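(* Let $s\in(0,1)$, $N>2s$, $0<q<1$, and let $\Omega\subset\mathbb{R}^N$ be a bounded domain with boundary of class $C^{1,1}$. For $\lambda>0$, $\mu\ge 0$ and $1<r\le\frac{N+2s}{N-2s}$ consider the problem $$(P_\lambda^\mu)\qquad (-\Delta)^s u=\lambda(u^q-1)+\mu u^r\ \text{ in }\Omega,\qquad u>0\ \text{ in }\Omega,\qquad u\equiv 0\ \text{ on }\mathbb{R}^N\setminus\Omega .$$ Let $\lambda_0=\inf\{\lambda>0:(P_\lambda^0)\text{ admits a weak solution}\}$ (which satisfies $\lambda_0\in(0,\infty)$). Then for $1<r\le\frac{N+2s}{N-2s}$ and for each $\lambda>\lambda_0$ there exists $\mu_\lambda>0$ such that $(P_\lambda^\mu)$ admits at least one positive (weak) solution for all $\mu\in(0,\mu_\lambda)$. If $1<r<\frac{N+2s}{N-2s}$, there exists a second (weak) solution, distinct from the first, to the problem $(P_\lambda^\mu)$ for $\lambda>\lambda_0$ and $\mu\in(0,\mu_\lambda)$.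
   Context: Notation: $C_{N,s}=\pi^{-N/2}2^{2s-1}\Gamma\left(\frac{N+2s}{2}\right)/\Gamma(1-s)$ and $(-\Delta)^s u(x)=2C_{N,s}\,\mathrm{P.V.}\int_{\mathbb{R}^N}\frac{u(x)-u(y)}{|x-y|^{N+2s}}\,dy$. Put $\Omega^c=\mathbb{R}^N\setminus\Omega$ and $Q=\mathbb{R}^N\times\mathbb{R}^N\setminus(\Omega^c\times\Omega^c)$. The space $X^s(\Omega)$ consists of all Lebesgue measurable $u:\mathbb{R}^N\to\mathbb{R}$ with $u|_\Omega\in L^2(\Omega)$ and $\int_Q\frac{|u(x)-u(y)|^2}{|x-y|^{N+2s}}\,dx\,dy<\infty$, and $X_0^s(\Omega)=\{u\in X^s(\Omega):u=0\text{ a.e. in }\Omega^c\}$. A weak solution of $(P_\lambda^\mu)$ (including the case $\mu=0$, where the term $\mu u^r$ is absent) is a function $u\in X_0^s(\Omega)$ with $u>0$ in $\Omega$ such that for all $\varphi\in C_c^\infty(\Omega)$ $$C_{N,s}\int_Q\frac{(u(x)-u(y))(\varphi(x)-\varphi(y))}{|x-y|^{N+2s}}\,dx\,dy=\lambda\int_\Omega(u^q-1)\varphi\,dx+\mu\int_\Omega u^r\varphi\,dx .$$ *)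

theory Defs
  imports "HOL-Analysis.Analysis"
begin

text \<open>
  Near each boundary point, \<open>\<Omega>\<close> is the set of points lying above the graph of a
  \<open>C\<^sup>1\<^sup>,\<^sup>1\<close> function in a rotated coordinate system. The last axis of that system is the
  unit vector \<open>e\<close>, and \<open>x - (x \<bullet> e) *\<^sub>R e\<close> is the orthogonal projection onto the
  hyperplane \<open>e\<^sup>\<bottom>\<close>. Only the values of \<open>\<gamma>\<close> on that hyperplane are used; a \<open>C\<^sup>1\<^sup>,\<^sup>1\<close>
  function there extends to the whole space by composing it with the projection.
\<close>

definition C11_function :: "('a::euclidean_space \<Rightarrow> real) \<Rightarrow> bool" where
  "C11_function \<gamma> \<longleftrightarrow>
     (\<exists>g L. (\<forall>y. GDERIV \<gamma> y :> g y) \<and> L-lipschitz_on UNIV g)"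

definition C11_boundary :: "'a::euclidean_space set \<Rightarrow> bool" where
  "C11_boundary \<Omega> \<longleftrightarrow>
     (\<forall>x0\<in>frontier \<Omega>. \<exists>\<rho>>0. \<exists>e \<gamma>. norm e = 1 \<and> C11_function \<gamma> \<and>
        \<Omega> \<inter> ball x0 \<rho> = {x \<in> ball x0 \<rho>. x \<bullet> e > \<gamma> (x - (x \<bullet> e) *\<^sub>R e)})"

primrec Ck_function :: "nat \<Rightarrow> ('a::euclidean_space \<Rightarrow> real) \<Rightarrow> bool" where
  "Ck_function 0 f \<longleftrightarrow> continuous_on UNIV f"
| "Ck_function (Suc k) f \<longleftrightarrow>
     (\<exists>g. (\<forall>x. GDERIV f x :> g x) \<and> (\<forall>b\<in>Basis. Ck_function k (\<lambda>x. g x \<bullet> b)))"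

text \<open>Elements of \<open>C\<^sub>c\<^sup>\<infinity>(\<Omega>)\<close> are regarded as functions on the whole space, extended by \<open>0\<close>.\<close>

definition test_function :: "'a::euclidean_space set \<Rightarrow> ('a \<Rightarrow> real) \<Rightarrow> bool" where
  "test_function \<Omega> \<phi> \<longleftrightarrow>
     (\<forall>k. Ck_function k \<phi>) \<and>
     compact (closure {x. \<phi> x \<noteq> 0}) \<and> closure {x. \<phi> x \<noteq> 0} \<subseteq> \<Omega>"

definition C_const :: "'a::euclidean_space itself \<Rightarrow> real \<Rightarrow> real" where
  "C_const _ s =
     pi powr (- real DIM('a) / 2) * 2 powr (2 * s - 1) *
       Gamma ((real DIM('a) + 2 * s) / 2) / Gamma (1 - s)"

definition Q_set :: "'a set \<Rightarrow> ('a \<times> 'a) set" where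
  "Q_set \<Omega> = UNIV - (- \<Omega>) \<times> (- \<Omega>)"

text \<open>
  In both integrals over \<open>Q_set \<Omega>\<close> below the integrand takes the value \<open>0\<close> on the diagonal,
  which is a null set.
\<close>

definition Xs :: "real \<Rightarrow> 'a::euclidean_space set \<Rightarrow> ('a \<Rightarrow> real) set" where
  "Xs s \<Omega> = {u. u \<in> borel_measurable lebesgue \<and>
     set_integrable lebesgue \<Omega> (\<lambda>x. (u x)\<^sup>2) \<and>
     set_integrable lebesgue (Q_set \<Omega>)
       (\<lambda>(x, y). \<bar>u x - u y\<bar>\<^sup>2 / norm (x - y) powr (real DIM('a) + 2 * s))}"

definition Xs0 :: "real \<Rightarrow> 'a::euclidean_space set \<Rightarrow> ('a \<Rightarrow> real) set" where
  "Xs0 s \<Omega> = {u \<in> Xs s \<Omega>. AE x in lebesgue. x \<notin> \<Omega> \<longrightarrow> u x = 0}"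

definition energy_form ::
  "real \<Rightarrow> 'a::euclidean_space set \<Rightarrow> ('a \<Rightarrow> real) \<Rightarrow> ('a \<Rightarrow> real) \<Rightarrow> real" where
  "energy_form s \<Omega> u \<phi> = C_const TYPE('a) s *
     set_lebesgue_integral lebesgue (Q_set \<Omega>)
       (\<lambda>(x, y). (u x - u y) * (\<phi> x - \<phi> y) / norm (x - y) powr (real DIM('a) + 2 * s))"

text \<open>
  For \<open>u\<close> in \<open>Xs0 s \<Omega>\<close>, \<open>\<Omega>\<close> bounded, \<open>0 < q < 1\<close> and \<open>1 < r \<le> (N + 2s) / (N - 2s)\<close>, all
  the integrals below converge absolutely, by the Cauchy-Schwarz inequality and the fractional
  Sobolev embedding, so the convention that a divergent integral equals \<open>0\<close> plays no role.
\<close>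

definition weak_solution ::
  "real \<Rightarrow> real \<Rightarrow> real \<Rightarrow> 'a::euclidean_space set \<Rightarrow> real \<Rightarrow> real \<Rightarrow> ('a \<Rightarrow> real) \<Rightarrow> bool" where
  "weak_solution s q r \<Omega> lam \<mu> u \<longleftrightarrow>
     u \<in> Xs0 s \<Omega> \<and> (\<forall>x\<in>\<Omega>. u x > 0) \<and>
     (\<forall>\<phi>. test_function \<Omega> \<phi> \<longrightarrow>
        energy_form s \<Omega> u \<phi> =
          lam * (LINT x:\<Omega>|lebesgue. (u x powr q - 1) * \<phi> x)
          + \<mu> * (LINT x:\<Omega>|lebesgue. u x powr r * \<phi> x))"

definition weak_solution_0 ::
  "real \<Rightarrow> real \<Rightarrow> 'a::euclidean_space set \<Rightarrow> real \<Rightarrow> ('a \<Rightarrow> real) \<Rightarrow> bool" where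
  "weak_solution_0 s q \<Omega> lam u \<longleftrightarrow>
     u \<in> Xs0 s \<Omega> \<and> (\<forall>x\<in>\<Omega>. u x > 0) \<and>
     (\<forall>\<phi>. test_function \<Omega> \<phi> \<longrightarrow>
        energy_form s \<Omega> u \<phi> = lam * (LINT x:\<Omega>|lebesgue. (u x powr q - 1) * \<phi> x))"

lemma weak_solution_mu_0: "weak_solution s q r \<Omega> lam 0 u \<longleftrightarrow> weak_solution_0 s q \<Omega> lam u"
  by (simp add: weak_solution_def weak_solution_0_def)

text \<open>The infimum is taken in the extended reals, where the empty set has infimum \<open>\<infinity>\<close>.\<close>

definition lambda0 :: "real \<Rightarrow> real \<Rightarrow> 'a::euclidean_space set \<Rightarrow> ereal" where
  "lambda0 s q \<Omega> = Inf {ereal lam | lam. lam > 0 \<and> (\<exists>u. weak_solution_0 s q \<Omega> lam u)}"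

end

theory Submission
  imports Defs "HOL-Complex_Analysis.Great_Picard"
begin

text \<open>
  Up to the constant in the energy, weak solutions are the critical points of a functional on the
  Hilbert space of functions of finite energy vanishing outside \<open>\<Omega>\<close>. The nonlinearity \<open>u\<^sup>q - 1\<close> is
  negative for small \<open>u\<close>, so positivity has to come from a positive subsolution \<open>w\<close> of the problem
  with \<open>\<mu> = 0\<close>. Replacing \<open>u\<^sup>q\<close> by \<open>max(u, w)\<^sup>q\<close> and truncating \<open>u\<^sup>r\<close> gives a coercive functional; by
  comparison, for small \<open>\<mu>\<close> its minimizer lies above \<open>w\<close> and below the truncation level, so it is a
  solution, with energy bounded independently of \<open>\<mu>\<close>. If \<open>r\<close> is subcritical, the functional with
  \<open>u\<^sup>r\<close> not truncated is minimized over those functions of the Nehari set whose energy is at least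
  a fixed large number; for small \<open>\<mu>\<close> the minimum is attained away from the boundary of this set and
  is a critical point, and its larger energy separates it from the first solution.

  For \<open>\<lambda> > \<lambda>\<^sub>0\<close> the subsolution is \<open>(\<lambda> / \<lambda>\<^sub>1) u\<^sub>1\<close>, where \<open>u\<^sub>1\<close> is a solution with \<open>\<mu> = 0\<close> for some
  \<open>\<lambda>\<^sub>1 < \<lambda>\<close>. To use it, the equation for \<open>u\<^sub>1\<close> must be tested with arbitrary functions of finite energy.
  These are weak limits of test functions: the exterior ball condition yields a Hardy
  inequality, which bounds the energy of cutoffs near the boundary, and mollification does not
  increase the energy. Testing with the solution itself and \<open>t\<^sup>q - 1 \<le> t\<close> give \<open>\<lambda>\<^sub>0 > 0\<close> by the
  Poincare inequality. An explicit subsolution, built from paraboloids over the interior balls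
  of a fixed radius, gives \<open>\<lambda>\<^sub>0 < \<infinity>\<close>.
\<close>

section \<open>The kernel\<close>

text \<open>Weak solutions come with no regularity and no bound in the supremum norm, so every
  estimate has to come from testing with functions of finite energy. Since these functions vanish
  outside \<open>\<Omega>\<close>, the energy dominates a zero-order term: the mass that the kernel
  sends from a point of \<open>\<Omega>\<close> into the complement. With a lower bound
  \<open>c\<close> of this mass, a constant \<open>K\<close> with
  \<open>\<lambda> K^q + \<mu> K^r \<le> c K\<close> acts as a supersolution, and this
  \<open>K\<close> is the truncation level. The truncated power is bounded, so the critical exponent
  is treated like the others. Both reaction terms have convex primitives, also after truncation.
  Subgradient inequalities therefore replace derivatives of functionals: a minimizer satisfies its
  equation by convexity alone, and on the Nehari set a perturbed function is moved back to the set
  by the intermediate value theorem instead of using a Lagrange multiplier. Weak convergence is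
  replaced by bounded energy together with convergence almost everywhere. The energy bound of the
  first solutions is fixed before \<open>\<mu>\<close>, so it can serve as a lower bound for the
  energy of the second.\<close>

definition kern :: "real \<Rightarrow> 'a::euclidean_space \<Rightarrow> real" where
  "kern s h = norm h powr (- (real DIM('a) + 2 * s))"

lemma kern_nonneg [simp]: "0 \<le> kern s h"
  by (simp add: kern_def)

lemma kern_minus [simp]: "kern s (- h) = kern s h"
  by (simp add: kern_def)

lemma borel_measurable_kern [measurable]: "kern s \<in> borel_measurable borel"
  unfolding kern_def[abs_def] by measurable

text \<open>In \<open>powr\<close>, \<open>0 powr a = 0\<close>; the kernel therefore vanishes at
  the origin instead of being infinite there, and the diagonal has to be excluded by
  \<open>h \<noteq> 0\<close>.\<close>

lemma kern_mono:
  fixes h :: "'a::euclidean_space"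
  assumes "0 \<le> s" "h \<noteq> 0" "norm h \<le> r"
  shows "r powr (- (real DIM('a) + 2 * s)) \<le> kern s h"
  unfolding kern_def using assms by (intro powr_mono2') auto

lemma emeasure_lborel_ball:
  fixes c :: "'a::euclidean_space"
  assumes "0 \<le> r"
  shows "emeasure lborel (ball c r) = ennreal (unit_ball_vol DIM('a) * r ^ DIM('a))"
  using emeasure_ball[OF assms, of c] by simp

text \<open>On the shell the power is at most \<open>2 powr \<bar>a\<bar>\<close> times
  \<open>\<rho> powr a\<close>, whatever the sign of \<open>a\<close>, and the shell lies in the
  ball of radius \<open>2 * \<rho>\<close>.\<close>

lemma powr_shell_bound:
  fixes a \<rho> :: real
  assumes "0 < \<rho>"
  shows "(\<integral>\<^sup>+h. ennreal (norm (h::'a::euclidean_space) powr a) * indicator {h. \<rho> \<le> norm h \<and> norm h < 2 * \<rho>} h \<partial>lborel)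
     \<le> ennreal (2 powr \<bar>a\<bar> * unit_ball_vol DIM('a) * 2 ^ DIM('a) * \<rho> powr (a + DIM('a)))"
proof -
  have pt: "norm h powr a \<le> 2 powr \<bar>a\<bar> * \<rho> powr a" if "\<rho> \<le> norm h" "norm h < 2 * \<rho>" for h :: 'a
  proof (cases "0 \<le> a")
    case True
    have "norm h powr a \<le> (2 * \<rho>) powr a" using that assms True by (intro powr_mono2) auto
    then show ?thesis using True assms by (simp add: powr_mult)
  next
    case False
    have "norm h powr a \<le> \<rho> powr a" using that assms False by (intro powr_mono2') auto
    also have "\<dots> \<le> 2 powr \<bar>a\<bar> * \<rho> powr a"
      using ge_one_powr_ge_zero[of 2 "\<bar>a\<bar>"] mult_right_mono[of 1 "2 powr \<bar>a\<bar>" "\<rho> powr a"] by simp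
    finally show ?thesis .
  qed
  have "(\<integral>\<^sup>+h. ennreal (norm (h::'a) powr a) * indicator {h. \<rho> \<le> norm h \<and> norm h < 2 * \<rho>} h \<partial>lborel)
    \<le> (\<integral>\<^sup>+h. ennreal (2 powr \<bar>a\<bar> * \<rho> powr a) * indicator (ball (0::'a) (2 * \<rho>)) h \<partial>lborel)"
    by (intro nn_integral_mono) (auto simp: indicator_def pt intro!: ennreal_leI)
  also have "\<dots> = ennreal (2 powr \<bar>a\<bar> * \<rho> powr a) * emeasure lborel (ball (0::'a) (2 * \<rho>))"
    by (subst nn_integral_cmult_indicator) auto
  also have "\<dots> = ennreal (2 powr \<bar>a\<bar> * unit_ball_vol DIM('a) * 2 ^ DIM('a) * \<rho> powr (a + DIM('a)))"
    using assms by (subst emeasure_lborel_ball)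
      (auto simp: ennreal_mult[symmetric] powr_add powr_realpow power_mult_distrib mult_ac)
  finally show ?thesis .
qed

text \<open>Shells with radii in geometric progression give a geometric series of ratio
  \<open>c powr b\<close>. The tail of the kernel uses \<open>c = 2\<close> with
  \<open>b < 0\<close>; the singularity at the origin, tamed by \<open>(norm h)\<^sup>2\<close>,
  uses \<open>c = 1/2\<close> with \<open>b > 0\<close>.\<close>

lemma powr_shell_sum:
  fixes a b c \<eta> :: real and A :: "'a::euclidean_space set"
  assumes "0 < \<eta>" "0 < c" and b: "b = a + DIM('a)" and "c powr b < 1"
    and A: "A \<subseteq> (\<Union>k. {h. \<eta> * c ^ k \<le> norm h \<and> norm h < 2 * (\<eta> * c ^ k)})"
  shows "(\<integral>\<^sup>+h. ennreal (norm h powr a) * indicator A h \<partial>lborel)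
     \<le> ennreal (2 powr \<bar>a\<bar> * unit_ball_vol DIM('a) * 2 ^ DIM('a) / (1 - c powr b) * \<eta> powr b)"
proof -
  let ?S = "\<lambda>k. {h::'a. \<eta> * c ^ k \<le> norm h \<and> norm h < 2 * (\<eta> * c ^ k)}"
  let ?C = "2 powr \<bar>a\<bar> * unit_ball_vol DIM('a) * 2 ^ DIM('a)"
  have C0: "0 \<le> ?C" by simp
  have "(\<integral>\<^sup>+h. ennreal (norm h powr a) * indicator A h \<partial>lborel)
     \<le> (\<integral>\<^sup>+h. (\<Sum>k. ennreal (norm h powr a) * indicator (?S k) h) \<partial>lborel)"
  proof (intro nn_integral_mono)
    fix h :: 'a
    show "ennreal (norm h powr a) * indicator A h \<le> (\<Sum>k. ennreal (norm h powr a) * indicator (?S k) h)"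
    proof (cases "h \<in> A")
      case True
      then obtain k where k: "h \<in> ?S k" using A by blast
      have "ennreal (norm h powr a) * indicator A h = ennreal (norm h powr a) * indicator (?S k) h"
        using True k by simp
      also have "\<dots> = (\<Sum>j\<in>{k}. ennreal (norm h powr a) * indicator (?S j) h)"
        by (simp del: sum_mult_indicator)
      also have "\<dots> \<le> (\<Sum>k. ennreal (norm h powr a) * indicator (?S k) h)"
        by (rule sum_le_suminf) auto
      finally show ?thesis .
    qed simp
  qed
  also have "\<dots> = (\<Sum>k. (\<integral>\<^sup>+h. ennreal (norm h powr a) * indicator (?S k) h \<partial>lborel))"
    by (rule nn_integral_suminf) measurable
  also have "\<dots> \<le> (\<Sum>k. ennreal (?C * (\<eta> powr b * (c powr b) ^ k)))"
  proof (intro suminf_le)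
    fix k
    have "(\<eta> * c ^ k) powr b = \<eta> powr b * (c powr b) ^ k"
      using assms(1,2) by (simp add: powr_mult powr_realpow[symmetric] powr_powr mult.commute)
    then show "(\<integral>\<^sup>+h. ennreal (norm h powr a) * indicator (?S k) h \<partial>lborel) \<le> ennreal (?C * (\<eta> powr b * (c powr b) ^ k))"
      using powr_shell_bound[where 'a='a, of "\<eta> * c ^ k" a] assms(1,2) b by simp
  qed auto
  also have "\<dots> = ennreal (\<Sum>k. ?C * (\<eta> powr b * (c powr b) ^ k))"
    using assms(4) C0 by (intro suminf_ennreal2 summable_mult summable_geometric) auto
  also have "(\<Sum>k. ?C * (\<eta> powr b * (c powr b) ^ k)) = ?C * (\<eta> powr b * (1 / (1 - c powr b)))"
    using assms(4) by (subst suminf_mult, (auto intro!: summable_mult summable_geometric)[1],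
      subst suminf_mult, (auto intro!: summable_geometric)[1], subst suminf_geometric) auto
  finally show ?thesis by (simp add: mult_ac)
qed

lemma kern_tail:
  assumes "0 < s"
  shows "\<exists>T>0. \<forall>\<eta>>0.
    (\<integral>\<^sup>+h. ennreal (kern s (h::'a::euclidean_space)) * indicator {h. \<eta> \<le> norm h} h \<partial>lborel) \<le> ennreal (T * \<eta> powr (- 2 * s))"
proof -
  let ?a = "- (real DIM('a) + 2 * s)"
  let ?T = "2 powr \<bar>?a\<bar> * unit_ball_vol DIM('a) * 2 ^ DIM('a) / (1 - 2 powr (- 2 * s))"
  have lt: "2 powr (- 2 * s) < 1" using assms by (simp add: powr_less_one)
  have T: "0 < ?T" using lt by simp
  have "(\<integral>\<^sup>+h. ennreal (kern s (h::'a)) * indicator {h. \<eta> \<le> norm h} h \<partial>lborel) \<le> ennreal (?T * \<eta> powr (- 2 * s))"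
    if \<eta>: "0 < \<eta>" for \<eta>
    unfolding kern_def
  proof (rule powr_shell_sum)
    show "{h::'a. \<eta> \<le> norm h} \<subseteq> (\<Union>k. {h. \<eta> * 2 ^ k \<le> norm h \<and> norm h < 2 * (\<eta> * 2 ^ k)})"
    proof
      fix h :: 'a assume "h \<in> {h. \<eta> \<le> norm h}"
      then have h: "1 \<le> norm h / \<eta>" using \<eta> by simp
      define k where "k = nat \<lfloor>log 2 (norm h / \<eta>)\<rfloor>"
      have l0: "0 \<le> log 2 (norm h / \<eta>)" using h by simp
      have k1: "real k \<le> log 2 (norm h / \<eta>)" "log 2 (norm h / \<eta>) < real k + 1"
        using l0 unfolding k_def by linarith+
      have "2 powr real k \<le> norm h / \<eta>" using k1(1) h by (simp add: powr_le_iff)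
      moreover have "norm h / \<eta> < 2 powr (real k + 1)" using k1(2) h by (simp add: less_powr_iff)
      ultimately have "\<eta> * 2 ^ k \<le> norm h" "norm h < 2 * (\<eta> * 2 ^ k)"
        using \<eta> by (simp_all add: powr_realpow powr_add field_simps)
      then show "h \<in> (\<Union>k. {h. \<eta> * 2 ^ k \<le> norm h \<and> norm h < 2 * (\<eta> * 2 ^ k)})" by blast
    qed
  qed (use \<eta> lt in auto)
  with T show ?thesis by blast
qed

lemma kern_near:
  assumes "s < 1"
  shows "\<exists>T>0. \<forall>\<eta>>0.
    (\<integral>\<^sup>+h. ennreal ((norm h)\<^sup>2 * kern s (h::'a::euclidean_space)) * indicator {h. norm h < \<eta>} h \<partial>lborel) \<le> ennreal (T * \<eta> powr (2 - 2 * s))"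
proof -
  let ?a = "2 - (real DIM('a) + 2 * s)"
  let ?b = "2 - 2 * s"
  let ?T' = "2 powr \<bar>?a\<bar> * unit_ball_vol DIM('a) * 2 ^ DIM('a) / (1 - (1/2) powr ?b)"
  let ?T = "?T' * (1 / 2) powr ?b"
  have lt: "(1/2::real) powr ?b < 1" using assms powr_less_mono2[of ?b "1/2" 1] by simp
  have T: "0 < ?T" using lt by simp
  have "(\<integral>\<^sup>+h. ennreal ((norm h)\<^sup>2 * kern s (h::'a)) * indicator {h. norm h < \<eta>} h \<partial>lborel) \<le> ennreal (?T * \<eta> powr ?b)"
    if \<eta>: "0 < \<eta>" for \<eta>
  proof -
  have *: "(norm h)\<^sup>2 * kern s h = norm h powr ?a" for h :: 'a
    by (cases "h = 0") (simp_all add: kern_def powr_diff powr_minus divide_simps powr_add)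
  have "(\<integral>\<^sup>+h. ennreal ((norm h)\<^sup>2 * kern s (h::'a)) * indicator {h. norm h < \<eta>} h \<partial>lborel)
     = (\<integral>\<^sup>+h. ennreal (norm (h::'a) powr ?a) * indicator {h. 0 < norm h \<and> norm h < \<eta>} h \<partial>lborel)"
    unfolding * by (intro nn_integral_cong) (auto simp: indicator_def)
  also have "\<dots> \<le> ennreal (?T' * (\<eta> / 2) powr ?b)"
  proof (rule powr_shell_sum)
    show "{h::'a. 0 < norm h \<and> norm h < \<eta>} \<subseteq> (\<Union>k. {h. \<eta> / 2 * (1/2) ^ k \<le> norm h \<and> norm h < 2 * (\<eta> / 2 * (1/2) ^ k)})"
    proof
      fix h :: 'a assume "h \<in> {h. 0 < norm h \<and> norm h < \<eta>}"
      then have h: "1 < \<eta> / norm h" "0 < norm h" by simp_all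
      define q where "q = \<eta> / norm h"
      have q: "1 < q" using h by (simp add: q_def)
      have l0: "0 < log 2 q" using q by simp
      \<comment> \<open>The shells are closed on the inside and open on the outside, so
        \<open>2 ^ k < q\<close> and \<open>q \<le> 2 ^ (k + 1)\<close> are required; hence a
        ceiling here, and a floor for the tail.\<close>
      define k where "k = nat (\<lceil>log 2 q\<rceil> - 1)"
      have k1: "real k < log 2 q" "log 2 q \<le> real k + 1"
        using l0 unfolding k_def by linarith+
      have "2 powr real k < q" using k1(1) q by (simp add: powr_less_iff)
      moreover have "q \<le> 2 powr (real k + 1)" using k1(2) q by (simp add: le_powr_iff)
      ultimately have "\<eta> / 2 * (1/2) ^ k \<le> norm h" "norm h < 2 * (\<eta> / 2 * (1/2) ^ k)"
        using \<eta> h(2) unfolding q_def by (simp_all add: powr_realpow powr_add field_simps power_one_over)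
      then show "h \<in> (\<Union>k. {h. \<eta> / 2 * (1/2) ^ k \<le> norm h \<and> norm h < 2 * (\<eta> / 2 * (1/2) ^ k)})" by blast
    qed
  qed (use \<eta> lt in auto)
  also have "?T' * (\<eta> / 2) powr ?b = ?T * \<eta> powr ?b"
    using \<eta> powr_mult[of \<eta> "1/2" ?b] by simp
  finally show ?thesis .
  qed
  with T show ?thesis by blast
qed

section \<open>Mass that the kernel sends out of a set\<close>

lemma kern_integral_lower:
  fixes x :: "'a::euclidean_space"
  assumes "0 \<le> s" and A: "A \<in> sets borel" and r: "\<And>y. y \<in> A \<Longrightarrow> norm (x - y) \<le> r"
  shows "ennreal (r powr (- (real DIM('a) + 2 * s))) * emeasure lborel A
     \<le> (\<integral>\<^sup>+y. ennreal (kern s (x - y)) * indicator A y \<partial>lborel)"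
proof -
  have "ennreal (r powr (- (real DIM('a) + 2 * s))) * emeasure lborel A
     = (\<integral>\<^sup>+y. ennreal (r powr (- (real DIM('a) + 2 * s))) * indicator A y \<partial>lborel)"
    using A by (subst nn_integral_cmult_indicator) auto
  also have "\<dots> \<le> (\<integral>\<^sup>+y. ennreal (kern s (x - y)) * indicator A y \<partial>lborel)"
  proof (rule nn_integral_mono_AE)
    show "AE y in lborel. ennreal (r powr (- (real DIM('a) + 2 * s))) * indicator A y
        \<le> ennreal (kern s (x - y)) * indicator A y"
      using AE_lborel_singleton[of x]
    proof eventually_elim
      case (elim y)
      then show ?case
        using kern_mono[of s "x - y" r] r[of y] assms(1) by (auto simp: indicator_def intro!: ennreal_leI)
    qed
  qed
  finally show ?thesis .
qed

lemma kern_compl_bounded: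
  fixes \<Omega> :: "'a::euclidean_space set"
  assumes "0 \<le> s" "bounded \<Omega>" "open \<Omega>"
  shows "\<exists>c>0. \<forall>x\<in>\<Omega>. ennreal c \<le> (\<integral>\<^sup>+y. ennreal (kern s (x - y)) * indicator (- \<Omega>) y \<partial>lborel)"
proof -
  obtain \<rho> where \<rho>: "0 < \<rho>" "\<Omega> \<subseteq> ball 0 \<rho>"
    using bounded_subset_ballD[OF assms(2)] by blast
  let ?p = "- (real DIM('a) + 2 * s)"
  let ?V = "unit_ball_vol (real DIM('a))"
  let ?A = "ball 0 (2 * \<rho>) - ball 0 \<rho> :: 'a set"
  let ?m = "?V * (2 * \<rho>) ^ DIM('a) - ?V * \<rho> ^ DIM('a)"
  have V: "0 < ?V" by simp
  have "(2::real) ^ DIM('a) > 1" by (rule one_less_power) auto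
  then have m: "0 < ?m" using \<rho>(1) V by (simp add: power_mult_distrib)
  have eA: "emeasure lborel ?A = ennreal ?m"
  proof (subst emeasure_Diff)
    show "emeasure lborel (ball (0::'a) (2 * \<rho>)) - emeasure lborel (ball (0::'a) \<rho>) = ennreal ?m"
      using \<rho>(1) V by (subst (1 2) emeasure_lborel_ball) (auto simp: ennreal_minus)
  qed (use \<rho> in \<open>auto simp: emeasure_lborel_ball\<close>)
  show ?thesis
  proof (intro exI[of _ "(3 * \<rho>) powr ?p * ?m"] conjI ballI)
    show "0 < (3 * \<rho>) powr ?p * ?m" using m \<rho>(1) by simp
    fix x assume x: "x \<in> \<Omega>"
    have "ennreal ((3 * \<rho>) powr ?p * ?m) = ennreal ((3 * \<rho>) powr ?p) * emeasure lborel ?A"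
      unfolding eA using m by (subst ennreal_mult) auto
    also have "\<dots> \<le> (\<integral>\<^sup>+y. ennreal (kern s (x - y)) * indicator ?A y \<partial>lborel)"
    proof (rule kern_integral_lower[OF assms(1)])
      fix y assume "y \<in> ?A"
      then show "norm (x - y) \<le> 3 * \<rho>"
        using x \<rho>(2) norm_triangle_ineq4[of x y] by (auto simp: subset_iff)
    qed auto
    also have "\<dots> \<le> (\<integral>\<^sup>+y. ennreal (kern s (x - y)) * indicator (- \<Omega>) y \<partial>lborel)"
      using \<rho>(2) by (intro nn_integral_mono) (auto simp: indicator_def)
    finally show "ennreal ((3 * \<rho>) powr ?p * ?m) \<le> (\<integral>\<^sup>+y. ennreal (kern s (x - y)) * indicator (- \<Omega>) y \<partial>lborel)" .
  qed
qed

text \<open>A ball of twice the measure of \<open>E\<close> has at least measure \<open>e\<close>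
  left outside \<open>E\<close>. Its radius is proportional to \<open>e powr (1 / N)\<close>, so the
  kernel is at least a multiple of \<open>e powr (- (N + 2 * s) / N)\<close> on it. This
  isoperimetric estimate is the source of the Sobolev bound.\<close>

lemma kern_compl_measure:
  assumes "0 \<le> s"
  shows "\<exists>c>0. \<forall>E e x. E \<in> sets borel \<longrightarrow> emeasure lborel E = ennreal e \<longrightarrow> 0 < e \<longrightarrow>
    ennreal (c * e powr (- (2 * s / DIM('a))))
      \<le> (\<integral>\<^sup>+y. ennreal (kern s (x - y)) * indicator (- E) (y::'a::euclidean_space) \<partial>lborel)"
proof -
  let ?N = "real DIM('a)" 
  let ?V = "unit_ball_vol ?N"
  let ?c = "(2 / ?V) powr (- (1 + 2 * s / ?N))"
  have V: "0 < ?V" by simp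
  then have V0 [simp]: "?V \<noteq> 0" by (metis less_irrefl)
  then have c: "0 < ?c" by simp
  have "ennreal (?c * e powr (- (2 * s / ?N)))
      \<le> (\<integral>\<^sup>+y. ennreal (kern s (x - y)) * indicator (- E) y \<partial>lborel)"
    if E: "E \<in> sets borel" "emeasure lborel E = ennreal e" "0 < e" for E :: "'a set" and e x
  proof -
  define r where "r = (2 * e / ?V) powr (1 / ?N)"
  have r: "0 < r" using E V by (simp add: r_def)
  have rN: "r ^ DIM('a) = 2 * e / ?V"
    using E V by (simp add: r_def powr_realpow[symmetric] powr_powr)
  let ?A = "ball x r - E"
  have "ennreal e = ennreal (2 * e) - ennreal e" using E by (simp add: ennreal_minus)
  also have "\<dots> = emeasure lborel (ball x r) - emeasure lborel E"
    using r rN V E by (subst emeasure_lborel_ball) auto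
  also have "\<dots> \<le> emeasure lborel ?A"
  proof -
    have "emeasure lborel (ball x r) \<le> emeasure lborel (?A \<union> E)" using E by (intro emeasure_mono) auto
    also have "\<dots> \<le> emeasure lborel ?A + emeasure lborel E" using E by (intro emeasure_subadditive) auto
    finally show ?thesis using E by (simp add: ennreal_minus_le_iff add.commute)
  qed
  finally have eA: "ennreal e \<le> emeasure lborel ?A" .
  have rp: "r powr (- (?N + 2 * s)) * e = ?c * e powr (- (2 * s / ?N))"
  proof -
    have "r powr (- (?N + 2 * s)) = (2 * e / ?V) powr (- (1 + 2 * s / ?N))"
      unfolding r_def powr_powr by (rule arg_cong[where f="\<lambda>a. _ powr a"]) (simp add: field_simps)
    also have "\<dots> = ?c * e powr (- (1 + 2 * s / ?N))"
      using E V powr_mult[of "2 / ?V" e] by simp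
    also have "e powr (- (1 + 2 * s / ?N)) = e powr (- (2 * s / ?N) - 1)"
      by (rule arg_cong[where f="\<lambda>a. e powr a"]) simp
    also have "\<dots> = e powr (- (2 * s / ?N)) / e"
      using E by (subst powr_diff) simp
    finally have "r powr (- (?N + 2 * s)) = ?c * (e powr (- (2 * s / ?N)) / e)" .
    then show ?thesis using E by (simp del: minus_add_distrib)
  qed
  have "ennreal (?c * e powr (- (2 * s / ?N))) = ennreal (r powr (- (?N + 2 * s))) * ennreal e"
    unfolding rp[symmetric] using E by (subst ennreal_mult) auto
  also have "\<dots> \<le> ennreal (r powr (- (?N + 2 * s))) * emeasure lborel ?A"
    using eA by (intro mult_left_mono) auto
  also have "\<dots> \<le> (\<integral>\<^sup>+y. ennreal (kern s (x - y)) * indicator ?A y \<partial>lborel)"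
    using E by (intro kern_integral_lower[OF assms]) (auto simp: dist_norm)
  also have "\<dots> \<le> (\<integral>\<^sup>+y. ennreal (kern s (x - y)) * indicator (- E) y \<partial>lborel)"
    by (intro nn_integral_mono) (auto simp: indicator_def)
  finally show ?thesis .
  qed
  with c show ?thesis by blast
qed

section \<open>The energy space\<close>

text \<open>With the kernel as a density, the Gagliardo form is the \<open>L^2\<close> inner product
  of the differences \<open>dq u\<close> and \<open>dq v\<close>, so Fatou, Tonelli and dominated
  convergence apply directly. The whole product space can replace \<open>Q_set \<Omega>\<close>,
  because functions that vanish outside \<open>\<Omega>\<close> contribute nothing on the
  rest.\<close>

definition kap :: "real \<Rightarrow> ('a::euclidean_space \<times> 'a) measure" where
  "kap s = density (lborel \<Otimes>\<^sub>M lborel) (\<lambda>z. ennreal (kern s (fst z - snd z)))"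

lemma sets_kap: "sets (kap s) = sets (lborel \<Otimes>\<^sub>M lborel)"
  by (simp add: kap_def)

lemma space_kap [simp]: "space (kap s) = UNIV"
  by (simp add: kap_def space_pair_measure)

lemma nn_integral_kap:
  assumes [measurable]: "f \<in> borel_measurable (lborel \<Otimes>\<^sub>M lborel)"
  shows "(\<integral>\<^sup>+z. f z \<partial>kap s) = (\<integral>\<^sup>+x. \<integral>\<^sup>+y. ennreal (kern s (x - y)) * f (x, y) \<partial>lborel \<partial>lborel)"
  unfolding kap_def by (subst nn_integral_density) (auto simp: lborel.nn_integral_fst[symmetric])

lemma nn_integral_kap':
  assumes [measurable]: "f \<in> borel_measurable (lborel \<Otimes>\<^sub>M lborel)"
  shows "(\<integral>\<^sup>+z. f z \<partial>kap s) = (\<integral>\<^sup>+y. \<integral>\<^sup>+x. ennreal (kern s (x - y)) * f (x, y) \<partial>lborel \<partial>lborel)"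
  unfolding kap_def by (subst nn_integral_density) (auto simp: lborel_pair.nn_integral_snd[symmetric])

lemma AE_pairI:
  assumes "AE x in lborel. P x"
  shows "AE z in lborel \<Otimes>\<^sub>M lborel. P (fst z) \<and> P (snd z)"
proof -
  obtain N where N': "{x \<in> space lborel. \<not> P x} \<subseteq> N" "emeasure lborel N = 0" "N \<in> sets lborel"
    by (rule AE_E[OF assms])
  then have N: "N \<in> null_sets lborel" "{x. \<not> P x} \<subseteq> N" by auto
  have "AE z in lborel \<Otimes>\<^sub>M lborel. fst z \<notin> N \<and> snd z \<notin> N"
  proof -
    have [measurable]: "N \<in> sets lborel" using N by auto
    have 1: "AE x in lborel. x \<notin> N" using N by (intro AE_not_in)
    have "AE x in lborel. AE y in lborel. fst (x, y) \<notin> N \<and> snd (x, y) \<notin> N"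
      using 1 by eventually_elim (use 1 in simp)
    then show ?thesis
      by (intro lborel_pair.AE_pair_measure) (measurable)
  qed
  then show "AE z in lborel \<Otimes>\<^sub>M lborel. P (fst z) \<and> P (snd z)"
    by eventually_elim (use N in auto)
qed

lemma AE_kapI:
  assumes "AE x in lborel. P x"
  shows "AE z in kap s. P (fst z) \<and> P (snd z)"
  unfolding kap_def using AE_pairI[OF assms] by (subst AE_density) auto

definition dq :: "('a::euclidean_space \<Rightarrow> real) \<Rightarrow> 'a \<times> 'a \<Rightarrow> real" where
  "dq u z = u (fst z) - u (snd z)"

lemma dq_simps:
  "dq (\<lambda>x. u x + v x) z = dq u z + dq v z"
  "dq (\<lambda>x. u x - v x) z = dq u z - dq v z"
  "dq (\<lambda>x. c * u x) z = c * dq u z"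
  "dq (\<lambda>x. - u x) z = - dq u z"
  by (simp_all add: dq_def algebra_simps)

lemma borel_measurable_dq [measurable (raw)]:
  assumes [measurable]: "u \<in> borel_measurable borel"
  shows "dq u \<in> borel_measurable (lborel \<Otimes>\<^sub>M lborel)"
  unfolding dq_def[abs_def] by measurable

lemma measurable_kap: "measurable (kap s) M = measurable (lborel \<Otimes>\<^sub>M lborel) M"
  by (rule measurable_cong_sets[OF sets_kap refl])

lemma borel_measurable_dq_kap [measurable (raw)]:
  "u \<in> borel_measurable borel \<Longrightarrow> dq u \<in> borel_measurable (kap s)"
  unfolding measurable_kap by (rule borel_measurable_dq)

text \<open>Borel functions that vanish everywhere outside \<open>\<Omega>\<close>, in contrast to
  the Lebesgue functions of \<open>Xs0\<close> that vanish there almost everywhere; this keeps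
  completions of product measures out of the analysis. Square integrability is not demanded, as it
  follows from the Poincare inequality on bounded open sets.\<close>

definition Hs :: "real \<Rightarrow> 'a::euclidean_space set \<Rightarrow> ('a \<Rightarrow> real) set" where
  "Hs s \<Omega> = {u \<in> borel_measurable borel. (\<forall>x. x \<notin> \<Omega> \<longrightarrow> u x = 0) \<and> integrable (kap s) (\<lambda>z. (dq u z)\<^sup>2)}"

definition form :: "real \<Rightarrow> ('a::euclidean_space \<Rightarrow> real) \<Rightarrow> ('a \<Rightarrow> real) \<Rightarrow> real" where
  "form s u v = (\<integral>z. dq u z * dq v z \<partial>kap s)"

lemma HsD:
  assumes "u \<in> Hs s \<Omega>"
  shows Hs_measurable: "u \<in> borel_measurable borel"
    and Hs_outside: "\<And>x. x \<notin> \<Omega> \<Longrightarrow> u x = 0"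
    and Hs_integrable: "integrable (kap s) (\<lambda>z. (dq u z)\<^sup>2)"
  using assms by (auto simp: Hs_def)

lemma HsI_nn:
  assumes [measurable]: "u \<in> borel_measurable borel" and "\<And>x. x \<notin> \<Omega> \<Longrightarrow> u x = 0"
    and "(\<integral>\<^sup>+z. ennreal ((dq u z)\<^sup>2) \<partial>kap s) < \<infinity>"
  shows "u \<in> Hs s \<Omega>"
  using assms by (auto simp: Hs_def integrable_iff_bounded)

lemma form_self: "form s u u = (\<integral>z. (dq u z)\<^sup>2 \<partial>kap s)"
  by (simp add: form_def power2_eq_square)

lemma form_nonneg [simp]: "0 \<le> form s u u"
  by (simp add: form_self)

lemma nn_integral_form:
  assumes "u \<in> Hs s \<Omega>"
  shows "(\<integral>\<^sup>+z. ennreal ((dq u z)\<^sup>2) \<partial>kap s) = ennreal (form s u u)"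
  unfolding form_self using HsD(3)[OF assms] by (intro nn_integral_eq_integral) auto

lemma form_le_nn:
  assumes "u \<in> Hs s \<Omega>" "(\<integral>\<^sup>+z. ennreal ((dq u z)\<^sup>2) \<partial>kap s) \<le> ennreal B" "0 \<le> B"
  shows "form s u u \<le> B"
  using assms by (simp add: nn_integral_form[OF assms(1)])

lemma Hs_integrable_mult:
  assumes "u \<in> Hs s \<Omega>" "v \<in> Hs s \<Omega>'"
  shows "integrable (kap s) (\<lambda>z. dq u z * dq v z)"
proof (rule Bochner_Integration.integrable_bound)
  show "integrable (kap s) (\<lambda>z. (dq u z)\<^sup>2 + (dq v z)\<^sup>2)"
    using HsD(3)[OF assms(1)] HsD(3)[OF assms(2)] by auto
  show "(\<lambda>z. dq u z * dq v z) \<in> borel_measurable (kap s)"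
    using HsD(1)[OF assms(1)] HsD(1)[OF assms(2)] by measurable
  show "AE z in kap s. norm (dq u z * dq v z) \<le> norm ((dq u z)\<^sup>2 + (dq v z)\<^sup>2)"
  proof (intro AE_I2)
    fix z
    have "2 * \<bar>dq u z\<bar> * \<bar>dq v z\<bar> \<le> \<bar>dq u z\<bar>\<^sup>2 + \<bar>dq v z\<bar>\<^sup>2" by (rule sum_squares_bound)
    moreover have "0 \<le> \<bar>dq u z\<bar> * \<bar>dq v z\<bar>" by simp
    ultimately have "\<bar>dq u z\<bar> * \<bar>dq v z\<bar> \<le> (dq u z)\<^sup>2 + (dq v z)\<^sup>2"
      unfolding power2_abs mult.assoc by linarith
    then show "norm (dq u z * dq v z) \<le> norm ((dq u z)\<^sup>2 + (dq v z)\<^sup>2)"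
      by (simp add: abs_mult)
  qed
qed

lemma Hs_add:
  assumes u: "u \<in> Hs s \<Omega>" and v: "v \<in> Hs s \<Omega>"
  shows "(\<lambda>x. u x + v x) \<in> Hs s \<Omega>"
proof -
  have [measurable]: "u \<in> borel_measurable borel" "v \<in> borel_measurable borel"
    using HsD(1)[OF u] HsD(1)[OF v] by auto
  have "integrable (kap s) (\<lambda>z. (dq u z)\<^sup>2 + 2 * (dq u z * dq v z) + (dq v z)\<^sup>2)"
    using Hs_integrable_mult[OF u v] HsD(3)[OF u] HsD(3)[OF v] by auto
  then have "integrable (kap s) (\<lambda>z. (dq (\<lambda>x. u x + v x) z)\<^sup>2)"
    by (simp add: dq_simps power2_sum mult.assoc add_ac)
  then show ?thesis using HsD[OF u] HsD[OF v] by (auto simp: Hs_def)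
qed

lemma Hs_cmult:
  assumes u: "u \<in> Hs s \<Omega>"
  shows "(\<lambda>x. c * u x) \<in> Hs s \<Omega>"
proof -
  have "integrable (kap s) (\<lambda>z. c\<^sup>2 * (dq u z)\<^sup>2)"
    using HsD(3)[OF u] by auto
  then show ?thesis using HsD[OF u] by (auto simp: Hs_def dq_simps power_mult_distrib)
qed

lemma Hs_diff:
  assumes u: "u \<in> Hs s \<Omega>" and v: "v \<in> Hs s \<Omega>"
  shows "(\<lambda>x. u x - v x) \<in> Hs s \<Omega>"
  using Hs_add[OF u Hs_cmult[OF v, of "-1"]] by simp

lemma Hs_lipschitz:
  assumes u: "u \<in> Hs s \<Omega>" and [measurable]: "g \<in> borel_measurable borel" and "g 0 = 0"
    and lip: "\<And>a b. \<bar>g a - g b\<bar> \<le> L * \<bar>a - b\<bar>"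
  shows "(\<lambda>x. g (u x)) \<in> Hs s \<Omega>"
proof -
  have [measurable]: "u \<in> borel_measurable borel" using HsD(1)[OF u] .
  have "integrable (kap s) (\<lambda>z. (dq (\<lambda>x. g (u x)) z)\<^sup>2)"
  proof (rule Bochner_Integration.integrable_bound)
    show "integrable (kap s) (\<lambda>z. L\<^sup>2 * (dq u z)\<^sup>2)" using HsD(3)[OF u] by auto
    show "AE z in kap s. norm ((dq (\<lambda>x. g (u x)) z)\<^sup>2) \<le> norm (L\<^sup>2 * (dq u z)\<^sup>2)"
    proof (intro AE_I2)
      fix z
      have "\<bar>dq (\<lambda>x. g (u x)) z\<bar>\<^sup>2 \<le> (L * \<bar>dq u z\<bar>)\<^sup>2"
        unfolding dq_def by (intro power_mono lip) auto
      then show "norm ((dq (\<lambda>x. g (u x)) z)\<^sup>2) \<le> norm (L\<^sup>2 * (dq u z)\<^sup>2)"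
        by (simp add: power_mult_distrib)
    qed
  qed measurable
  then show ?thesis using HsD[OF u] \<open>g 0 = 0\<close> by (auto simp: Hs_def)
qed

lemma Hs_pos_part: "u \<in> Hs s \<Omega> \<Longrightarrow> (\<lambda>x. max 0 (u x)) \<in> Hs s \<Omega>"
  by (rule Hs_lipschitz[where g="max 0" and L=1]) auto

lemma form_diff:
  assumes "u \<in> Hs s \<Omega>" "v \<in> Hs s \<Omega>" "w \<in> Hs s \<Omega>"
  shows "form s (\<lambda>x. u x - v x) w = form s u w - form s v w"
  using Hs_integrable_mult[OF assms(1,3)] Hs_integrable_mult[OF assms(2,3)]
  by (simp add: form_def dq_simps left_diff_distrib)

lemma form_cmult: "form s (\<lambda>x. c * u x) w = c * form s u w"
  by (simp add: form_def dq_simps mult.assoc)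

lemma form_cmult_right: "form s w (\<lambda>x. c * u x) = c * form s w u"
  by (simp add: form_def dq_simps mult.left_commute)

lemma form_add_scaled:
  assumes "u \<in> Hs s \<Omega>" "v \<in> Hs s \<Omega>"
  shows "form s (\<lambda>x. u x + t * v x) (\<lambda>x. u x + t * v x)
     = form s u u + 2 * t * form s u v + t\<^sup>2 * form s v v"
proof -
  note I = Hs_integrable_mult[OF assms(1,1)] Hs_integrable_mult[OF assms] Hs_integrable_mult[OF assms(2,2)]
  have "form s (\<lambda>x. u x + t * v x) (\<lambda>x. u x + t * v x)
     = (\<integral>z. dq u z * dq u z + 2 * t * (dq u z * dq v z) + t\<^sup>2 * (dq v z * dq v z) \<partial>kap s)"
    unfolding form_def by (intro Bochner_Integration.integral_cong refl) (simp add: dq_simps power2_eq_square algebra_simps)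
  also have "\<dots> = form s u u + 2 * t * form s u v + t\<^sup>2 * form s v v"
    unfolding form_def using I by simp
  finally show ?thesis .
qed

text \<open>For \<open>y\<close> outside \<open>\<Omega>\<close> the integrand of the form is
  \<open>u x * v x\<close>, so restricting the double integral to such \<open>y\<close> leaves
  \<open>u x * v x\<close> times the mass of the kernel on the complement. A constant weight gives
  the Poincare inequality, a power of the distance to the boundary gives the Hardy
  inequality.\<close>

lemma form_ge_weighted:
  fixes u :: "'a::euclidean_space \<Rightarrow> real"
  assumes u: "u \<in> Hs s \<Omega>" and v: "v \<in> Hs s \<Omega>" and [measurable]: "\<omega> \<in> borel_measurable borel" "\<Omega> \<in> sets borel"
    and \<omega>: "\<And>x. x \<in> \<Omega> \<Longrightarrow> ennreal (\<omega> x) \<le> (\<integral>\<^sup>+y. ennreal (kern s (x - y)) * indicator (- \<Omega>) y \<partial>lborel)"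
    and pos: "\<And>x y. 0 \<le> (u x - u y) * (v x - v y)" and ne: "- \<Omega> \<noteq> {}"
  shows "(\<integral>\<^sup>+x. ennreal (\<omega> x * (u x * v x)) \<partial>lborel) \<le> ennreal (form s u v)"
proof -
  have [measurable]: "u \<in> borel_measurable borel" "v \<in> borel_measurable borel" using HsD(1)[OF u] HsD(1)[OF v] by auto
  obtain y0 where "y0 \<notin> \<Omega>" using ne by blast
  then have uv: "0 \<le> u x * v x" for x
    using pos[of x y0] Hs_outside[OF u] Hs_outside[OF v] by simp
  have "(\<integral>\<^sup>+x. ennreal (\<omega> x * (u x * v x)) \<partial>lborel)
      \<le> (\<integral>\<^sup>+x. ennreal (u x * v x) * (\<integral>\<^sup>+y. ennreal (kern s (x - y)) * indicator (- \<Omega>) y \<partial>lborel) \<partial>lborel)"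
  proof (intro nn_integral_mono)
    fix x :: 'a
    show "ennreal (\<omega> x * (u x * v x)) \<le> ennreal (u x * v x) * (\<integral>\<^sup>+y. ennreal (kern s (x - y)) * indicator (- \<Omega>) y \<partial>lborel)"
    proof (cases "x \<in> \<Omega>")
      case True
      have "ennreal (\<omega> x * (u x * v x)) = ennreal (u x * v x) * ennreal (\<omega> x)"
        using uv[of x] by (simp add: ennreal_mult'' mult.commute)
      then show ?thesis using mult_left_mono[OF \<omega>[OF True]] by simp
    next
      case False
      then show ?thesis using Hs_outside[OF u] by simp
    qed
  qed
  also have "\<dots> = (\<integral>\<^sup>+x. \<integral>\<^sup>+y. ennreal (kern s (x - y)) * (ennreal (u x * v x) * indicator (- \<Omega>) y) \<partial>lborel \<partial>lborel)"
    by (subst nn_integral_cmult[symmetric]) (auto intro!: nn_integral_cong simp: mult_ac)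
  also have "\<dots> \<le> (\<integral>\<^sup>+x. \<integral>\<^sup>+y. ennreal (kern s (x - y)) * ennreal (dq u (x, y) * dq v (x, y)) \<partial>lborel \<partial>lborel)"
    using Hs_outside[OF u] Hs_outside[OF v]
    by (intro nn_integral_mono mult_left_mono) (auto simp: dq_def indicator_def)
  also have "\<dots> = (\<integral>\<^sup>+z. ennreal (dq u z * dq v z) \<partial>kap s)"
    by (subst nn_integral_kap) auto
  also have "\<dots> = ennreal (form s u v)"
    unfolding form_def using pos by (intro nn_integral_eq_integral Hs_integrable_mult[OF u v]) (auto simp: dq_def)
  finally show ?thesis .
qed

section \<open>Convergence along sequences of bounded energy\<close>

text \<open>Dominated convergence in which the domination may fail by a small multiple of functions
  \<open>Z n\<close> with bounded integrals: \<open>\<bar>D n\<bar>\<close> is at most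
  \<open>\<tau> * Z n\<close> plus \<open>min \<bar>D n\<bar> Y\<close>. The integral of the former
  is small with \<open>\<tau>\<close>, and the latter has the integrable majorant
  \<open>Y\<close>.\<close>

lemma tight_integral_tendsto_0:
  fixes D Z :: "nat \<Rightarrow> 'b \<Rightarrow> real"
  assumes D [measurable]: "\<And>n. D n \<in> borel_measurable M" and lim: "AE x in M. (\<lambda>n. D n x) \<longlonglongrightarrow> 0"
    and Z: "\<And>n. integrable M (Z n)" "\<And>n x. 0 \<le> Z n x" "\<And>n. (\<integral>x. Z n x \<partial>M) \<le> B"
    and bnd: "\<And>\<tau>. 0 < \<tau> \<Longrightarrow> \<exists>Y. integrable M Y \<and> (\<forall>n x. \<bar>D n x\<bar> \<le> \<tau> * Z n x + Y x)"
  shows "(\<lambda>n. \<integral>x. \<bar>D n x\<bar> \<partial>M) \<longlonglongrightarrow> 0" and "integrable M (D n)"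
proof -
  have intD: "integrable M (D n)" for n
  proof -
    obtain Y where Y: "integrable M Y" "\<And>n x. \<bar>D n x\<bar> \<le> 1 * Z n x + Y x"
      using bnd[of 1] by auto
    show ?thesis
    proof (rule Bochner_Integration.integrable_bound)
      show "integrable M (\<lambda>x. Z n x + Y x)" using Z Y by auto
      show "AE x in M. norm (D n x) \<le> norm (Z n x + Y x)"
      proof (intro AE_I2)
        fix x
        show "norm (D n x) \<le> norm (Z n x + Y x)"
          using Y(2)[of n x] unfolding real_norm_def by linarith
      qed
    qed simp
  qed
  then show "integrable M (D n)" .
  have "0 \<le> (\<integral>x. Z 0 x \<partial>M)" using Z(2) by (intro integral_nonneg_AE) auto
  then have B: "0 \<le> B" using Z(3)[of 0] by linarith
  show "(\<lambda>n. \<integral>x. \<bar>D n x\<bar> \<partial>M) \<longlonglongrightarrow> 0"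
  proof (rule LIMSEQ_I)
    fix e :: real assume e: "0 < e"
    define \<tau> where "\<tau> = e / (2 * (B + 1))"
    have \<tau>: "0 < \<tau>" "\<tau> * B < e / 2" using e B by (auto simp: \<tau>_def field_simps)
    obtain Y' where Y': "integrable M Y'" "\<And>n x. \<bar>D n x\<bar> \<le> \<tau> * Z n x + Y' x"
      using bnd[OF \<tau>(1)] by auto
    define Y where "Y x = max 0 (Y' x)" for x
    have Y: "integrable M Y" "\<And>x. 0 \<le> Y x"
      using Y'(1) by (auto simp: Y_def[abs_def])
    have Y2: "\<bar>D n x\<bar> \<le> \<tau> * Z n x + Y x" for n x
      using Y'(2)[of n x] unfolding Y_def by linarith
    have [measurable]: "Y \<in> borel_measurable M" using Y(1) by auto
    have "(\<lambda>n. \<integral>x. min \<bar>D n x\<bar> (Y x) \<partial>M) \<longlonglongrightarrow> (\<integral>x. 0 \<partial>M)"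
    proof (rule integral_dominated_convergence[where w=Y])
      show "AE x in M. (\<lambda>n. min \<bar>D n x\<bar> (Y x)) \<longlonglongrightarrow> 0"
        using lim
      proof eventually_elim
        case (elim x)
        then have "(\<lambda>n. min \<bar>D n x\<bar> (Y x)) \<longlonglongrightarrow> min \<bar>0\<bar> (Y x)"
          by (intro tendsto_min tendsto_rabs tendsto_const)
        then show ?case using Y(2)[of x] by simp
      qed
      show "AE x in M. norm (min \<bar>D n x\<bar> (Y x)) \<le> Y x" for n
        using Y(2) by (intro AE_I2) auto
    qed (use Y in auto)
    then have "\<forall>\<^sub>F n in sequentially. (\<integral>x. min \<bar>D n x\<bar> (Y x) \<partial>M) < e / 2"
      using e by (intro order_tendstoD(2)) auto
    then obtain N where N: "\<And>n. N \<le> n \<Longrightarrow> (\<integral>x. min \<bar>D n x\<bar> (Y x) \<partial>M) < e / 2"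
      by (auto simp: eventually_sequentially)
    have "norm ((\<integral>x. \<bar>D n x\<bar> \<partial>M) - 0) < e" if "N \<le> n" for n
    proof -
      have i: "integrable M (\<lambda>x. min \<bar>D n x\<bar> (Y x))"
        using intD Y(1) by auto
      have "(\<integral>x. \<bar>D n x\<bar> \<partial>M) \<le> (\<integral>x. \<tau> * Z n x + min \<bar>D n x\<bar> (Y x) \<partial>M)"
      proof (intro integral_mono)
        show "integrable M (\<lambda>x. \<bar>D n x\<bar>)" using intD by auto
        show "integrable M (\<lambda>x. \<tau> * Z n x + min \<bar>D n x\<bar> (Y x))" using Z i by auto
        fix x
        have "0 \<le> \<tau> * Z n x" using \<tau> Z(2)[of n x] by simp
        then show "\<bar>D n x\<bar> \<le> \<tau> * Z n x + min \<bar>D n x\<bar> (Y x)"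
          using Y2[of n x] by (simp add: min_def)
      qed
      also have "\<dots> = \<tau> * (\<integral>x. Z n x \<partial>M) + (\<integral>x. min \<bar>D n x\<bar> (Y x) \<partial>M)"
        using Z i by simp
      also have "\<dots> < \<tau> * B + e / 2"
        using mult_left_mono[OF Z(3)[of n], of \<tau>] \<tau> N[OF that] by linarith
      finally show ?thesis using \<tau> by simp
    qed
    then show "\<exists>N. \<forall>n\<ge>N. norm ((\<integral>x. \<bar>D n x\<bar> \<partial>M) - 0) < e" by blast
  qed
qed

lemma tight_integral_tendsto:
  fixes f Z :: "nat \<Rightarrow> 'b \<Rightarrow> real"
  assumes f: "\<And>n. f n \<in> borel_measurable M" and g: "integrable M g" 
    and lim: "AE x in M. (\<lambda>n. f n x) \<longlonglongrightarrow> g x"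
    and Z: "\<And>n. integrable M (Z n)" "\<And>n x. 0 \<le> Z n x" "\<And>n. (\<integral>x. Z n x \<partial>M) \<le> B"
    and bnd: "\<And>\<tau>. 0 < \<tau> \<Longrightarrow> \<exists>Y. integrable M Y \<and> (\<forall>n x. \<bar>f n x - g x\<bar> \<le> \<tau> * Z n x + Y x)"
  shows "(\<lambda>n. \<integral>x. f n x \<partial>M) \<longlonglongrightarrow> (\<integral>x. g x \<partial>M)" and "integrable M (f n)"
proof -
  have 0: "AE x in M. (\<lambda>n. f n x - g x) \<longlonglongrightarrow> 0"
    using lim by eventually_elim (simp add: LIM_zero)
  have m: "(\<lambda>x. f n x - g x) \<in> borel_measurable M" for n using f g by auto
  have t: "(\<lambda>n. \<integral>x. \<bar>f n x - g x\<bar> \<partial>M) \<longlonglongrightarrow> 0"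
    by (rule tight_integral_tendsto_0(1)[OF m 0 Z bnd])
  have i: "integrable M (\<lambda>x. f n x - g x)" for n
    by (rule tight_integral_tendsto_0(2)[OF m 0 Z bnd])
  have j: "integrable M (f n)" for n
    using Bochner_Integration.integrable_add[OF i[of n] g] by simp
  then show "integrable M (f n)" .
  have "(\<lambda>n. (\<integral>x. f n x \<partial>M) - (\<integral>x. g x \<partial>M)) \<longlonglongrightarrow> 0"
  proof (rule Lim_null_comparison[OF _ t])
    show "\<forall>\<^sub>F n in sequentially. norm ((\<integral>x. f n x \<partial>M) - (\<integral>x. g x \<partial>M)) \<le> (\<integral>x. \<bar>f n x - g x\<bar> \<partial>M)"
      using j g integral_norm_bound[of M "\<lambda>x. f _ x - g x"] by (intro always_eventually) simp
  qed
  then show "(\<lambda>n. \<integral>x. f n x \<partial>M) \<longlonglongrightarrow> (\<integral>x. g x \<partial>M)" by (simp add: LIM_zero_iff)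
qed

text \<open>Fatou's lemma for the squared differences: the energy is lower semicontinuous under
  convergence almost everywhere.\<close>

lemma Hs_limit:
  assumes u: "\<And>n. u n \<in> Hs s \<Omega>" and B: "\<And>n. form s (u n) (u n) \<le> B"
    and lim: "AE x in lborel. (\<lambda>n. u n x) \<longlonglongrightarrow> v x"
    and v: "v \<in> borel_measurable borel" "\<And>x. x \<notin> \<Omega> \<Longrightarrow> v x = 0"
  shows "v \<in> Hs s \<Omega>" "form s v v \<le> B"
proof -
  have [measurable]: "u n \<in> borel_measurable borel" for n using HsD(1)[OF u] .
  note [measurable] = v(1)
  have B0: "0 \<le> B" using B[of 0] form_nonneg[of s "u 0"] by linarith
  have "AE z in kap s. (\<lambda>n. ennreal ((dq (u n) z)\<^sup>2)) \<longlonglongrightarrow> ennreal ((dq v z)\<^sup>2)"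
    using AE_kapI[OF lim]
    by eventually_elim (auto simp: dq_def intro!: tendsto_ennrealI tendsto_power tendsto_diff)
  then have "AE z in kap s. ennreal ((dq v z)\<^sup>2) = liminf (\<lambda>n. ennreal ((dq (u n) z)\<^sup>2))"
    by eventually_elim (rule lim_imp_Liminf[OF sequentially_bot, symmetric])
  then have "(\<integral>\<^sup>+z. ennreal ((dq v z)\<^sup>2) \<partial>kap s) = (\<integral>\<^sup>+z. liminf (\<lambda>n. ennreal ((dq (u n) z)\<^sup>2)) \<partial>kap s)"
    by (intro nn_integral_cong_AE) auto
  also have "\<dots> \<le> liminf (\<lambda>n. \<integral>\<^sup>+z. ennreal ((dq (u n) z)\<^sup>2) \<partial>kap s)"
    by (rule nn_integral_liminf) measurable
  also have "\<dots> \<le> ennreal B"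
    using B u by (intro Liminf_le) (auto simp: nn_integral_form[OF u] intro!: always_eventually ennreal_leI)
  finally have *: "(\<integral>\<^sup>+z. ennreal ((dq v z)\<^sup>2) \<partial>kap s) \<le> ennreal B" .
  show v': "v \<in> Hs s \<Omega>"
    using * by (intro HsI_nn v) (auto intro: le_less_trans)
  show "form s v v \<le> B" by (rule form_le_nn[OF v' * B0])
qed

lemma Hs_limit_le:
  assumes u: "\<And>n. u n \<in> Hs s \<Omega>" and L: "(\<lambda>n. form s (u n) (u n)) \<longlonglongrightarrow> L"
    and lim: "AE x in lborel. (\<lambda>n. u n x) \<longlonglongrightarrow> v x"
    and v: "v \<in> borel_measurable borel" "\<And>x. x \<notin> \<Omega> \<Longrightarrow> v x = 0"
  shows "form s v v \<le> L"
proof (rule field_le_epsilon)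
  fix e :: real assume "0 < e"
  then have "\<forall>\<^sub>F n in sequentially. form s (u n) (u n) < L + e"
    using L by (intro order_tendstoD(2)[OF L]) auto
  then obtain N where N: "\<And>n. N \<le> n \<Longrightarrow> form s (u n) (u n) < L + e"
    by (auto simp: eventually_sequentially)
  show "form s v v \<le> L + e"
  proof (rule Hs_limit(2)[of "\<lambda>n. u (n + N)"])
    show "AE x in lborel. (\<lambda>n. u (n + N) x) \<longlonglongrightarrow> v x"
      using lim by eventually_elim (rule LIMSEQ_ignore_initial_segment)
    show "form s (u (n + N)) (u (n + N)) \<le> L + e" for n using N[of "n + N"] by simp
  qed (use u v in auto)
qed

lemma form_diff_bound:
  assumes u: "u \<in> Hs s \<Omega>" and v: "v \<in> Hs s \<Omega>"
  shows "form s (\<lambda>x. u x - v x) (\<lambda>x. u x - v x) \<le> 2 * form s u u + 2 * form s v v"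
proof -
  have "form s (\<lambda>x. u x - v x) (\<lambda>x. u x - v x) + form s (\<lambda>x. u x + v x) (\<lambda>x. u x + v x)
    = 2 * form s u u + 2 * form s v v"
    using form_add_scaled[OF u v, of 1] form_add_scaled[OF u v, of "-1"] by simp
  then show ?thesis using form_nonneg[of s "\<lambda>x. u x + v x"] by linarith
qed

text \<open>Young's inequality splits the product of \<open>dq w\<close> with the difference of
  \<open>u n\<close> and \<open>v\<close> into a small multiple of a square with bounded integral
  and a fixed multiple of \<open>(dq w)\<^sup>2\<close>. Bounded energy and convergence almost
  everywhere thus do the work of weak convergence.\<close>

lemma form_tendsto:
  assumes u: "\<And>n. u n \<in> Hs s \<Omega>" and B: "\<And>n. form s (u n) (u n) \<le> B"
    and lim: "AE x in lborel. (\<lambda>n. u n x) \<longlonglongrightarrow> v x" and v: "v \<in> Hs s \<Omega>" and w: "w \<in> Hs s \<Omega>"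
  shows "(\<lambda>n. form s w (u n)) \<longlonglongrightarrow> form s w v"
  unfolding form_def
proof (rule tight_integral_tendsto(1)[where Z="\<lambda>n z. (dq (\<lambda>x. u n x - v x) z)\<^sup>2"])
  show "(\<lambda>z. dq w z * dq (u n) z) \<in> borel_measurable (kap s)" for n
    using Hs_integrable_mult[OF w u] by auto
  show "integrable (kap s) (\<lambda>z. dq w z * dq v z)" by (rule Hs_integrable_mult[OF w v])
  show "AE z in kap s. (\<lambda>n. dq w z * dq (u n) z) \<longlonglongrightarrow> dq w z * dq v z"
    using AE_kapI[OF lim] by eventually_elim (auto simp: dq_def intro!: tendsto_intros)
  show "integrable (kap s) (\<lambda>z. (dq (\<lambda>x. u n x - v x) z)\<^sup>2)" for n
    using HsD(3)[OF Hs_diff[OF u v]] .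
  show "(\<integral>z. (dq (\<lambda>x. u n x - v x) z)\<^sup>2 \<partial>kap s) \<le> 2 * B + 2 * form s v v" for n
    using form_diff_bound[OF u[of n] v] B[of n] by (simp add: form_self)
  fix \<tau> :: real assume \<tau>: "0 < \<tau>"
  show "\<exists>Y. integrable (kap s) Y \<and>
      (\<forall>n z. \<bar>dq w z * dq (u n) z - dq w z * dq v z\<bar> \<le> \<tau> * (dq (\<lambda>x. u n x - v x) z)\<^sup>2 + Y z)"
  proof (intro exI conjI allI)
    show "integrable (kap s) (\<lambda>z. 1 / (4 * \<tau>) * (dq w z)\<^sup>2)" using HsD(3)[OF w] by auto
    fix n z
    define a where "a = dq (\<lambda>x. u n x - v x) z"
    define b where "b = dq w z"
    have "0 \<le> (2 * \<tau> * \<bar>a\<bar> - \<bar>b\<bar>)\<^sup>2 / (4 * \<tau>)" using \<tau> by simp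
    also have "\<dots> = \<tau> * a\<^sup>2 + 1 / (4 * \<tau>) * b\<^sup>2 - \<bar>b\<bar> * \<bar>a\<bar>"
      using \<tau> by (simp add: power2_eq_square field_simps)
    finally have "\<bar>b * a\<bar> \<le> \<tau> * a\<^sup>2 + 1 / (4 * \<tau>) * b\<^sup>2" by (simp add: abs_mult)
    then show "\<bar>dq w z * dq (u n) z - dq w z * dq v z\<bar> \<le> \<tau> * (dq (\<lambda>x. u n x - v x) z)\<^sup>2 + 1 / (4 * \<tau>) * (dq w z)\<^sup>2"
      by (simp add: a_def b_def dq_simps right_diff_distrib)
  qed
qed simp

section \<open>Convergence of integrals with subcritical growth\<close>

text \<open>Let \<open>M powr (a - p) = \<tau>\<close>. Up to \<open>M\<close> the power is at most
  \<open>M powr a\<close>; beyond \<open>M\<close> the factor \<open>t powr (a - p)\<close> is at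
  most \<open>\<tau>\<close>.\<close>

lemma powr_young:
  fixes t a p \<tau> :: real
  assumes "0 \<le> a" "a < p" "0 < \<tau>" "0 \<le> t"
  shows "t powr a \<le> \<tau> * t powr p + (\<tau> powr (1 / (a - p))) powr a"
proof -
  define M where "M = \<tau> powr (1 / (a - p))"
  have M: "0 < M" "M powr (a - p) = \<tau>" using assms by (auto simp: M_def powr_powr)
  show ?thesis
  proof (cases "t \<le> M")
    case True
    then have "t powr a \<le> M powr a" using assms by (intro powr_mono2) auto
    also have "\<dots> \<le> \<tau> * t powr p + M powr a" using assms by simp
    finally show ?thesis by (simp add: M_def)
  next
    case False
    then have "t powr (a - p) \<le> M powr (a - p)" using assms M by (intro powr_mono2') auto
    then have "t powr (a - p) * t powr p \<le> \<tau> * t powr p" using M by (intro mult_right_mono) auto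
    then have "t powr a \<le> \<tau> * t powr p" using False M by (simp add: powr_add[symmetric])
    then show ?thesis by (rule order_trans) simp
  qed
qed

text \<open>Because \<open>a < p\<close>, the growth \<open>\<bar>u n\<bar> powr a\<close> is at
  most a small multiple of \<open>\<bar>u n\<bar> powr p\<close>, whose integrals are bounded, plus
  a constant on a set of finite measure. This is the kind of domination that
  \<open>tight_integral_tendsto\<close> asks for.\<close>

lemma subcritical_integral_tendsto:
  fixes u \<phi> :: "nat \<Rightarrow> 'a::euclidean_space \<Rightarrow> real"
  assumes \<phi>: "\<And>n. \<phi> n \<in> borel_measurable lborel" and \<psi>: "\<psi> \<in> borel_measurable lborel"
    and lim: "AE x in lborel. (\<lambda>n. \<phi> n x) \<longlonglongrightarrow> \<psi> x"
    and \<Omega>: "\<Omega> \<in> sets borel" "emeasure lborel \<Omega> < \<infinity>"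
    and u: "\<And>n x. x \<notin> \<Omega> \<Longrightarrow> u n x = 0" "\<And>x. x \<notin> \<Omega> \<Longrightarrow> v x = 0"
    and p: "0 \<le> a" "a < p" "0 \<le> A" and h: "integrable lborel h"
    and i: "\<And>n. integrable lborel (\<lambda>x. \<bar>u n x\<bar> powr p)" "\<And>n. (\<integral>x. \<bar>u n x\<bar> powr p \<partial>lborel) \<le> B"
      "integrable lborel (\<lambda>x. \<bar>v x\<bar> powr p)"
    and b: "\<And>n x. \<bar>\<phi> n x\<bar> \<le> A * \<bar>u n x\<bar> powr a + h x" "\<And>x. \<bar>\<psi> x\<bar> \<le> A * \<bar>v x\<bar> powr a + h x"
  shows "(\<lambda>n. \<integral>x. \<phi> n x \<partial>lborel) \<longlonglongrightarrow> (\<integral>x. \<psi> x \<partial>lborel)"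
    and "integrable lborel \<psi>" and "integrable lborel (\<phi> n)"
proof -
  have ind: "integrable lborel (\<lambda>x. c * indicator \<Omega> x)" for c :: real
    using \<Omega> by auto
  have y: "\<bar>w x\<bar> powr a \<le> \<tau> * \<bar>w x\<bar> powr p + (\<tau> powr (1 / (a - p))) powr a * indicator \<Omega> x"
    if "0 < \<tau>" "\<And>x. x \<notin> \<Omega> \<Longrightarrow> w x = 0" for \<tau> x and w :: "'a \<Rightarrow> real"
    using powr_young[OF p(1,2) that(1), of "\<bar>w x\<bar>"] that(2)[of x] p that(1) by (cases "x \<in> \<Omega>") auto
  have int\<psi>: "integrable lborel \<psi>"
  proof (rule Bochner_Integration.integrable_bound[OF _ \<psi>])
    show "integrable lborel (\<lambda>x. A * (1 * \<bar>v x\<bar> powr p + (1 powr (1 / (a - p))) powr a * indicator \<Omega> x) + h x)"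
      using i(3) h ind[of 1] by auto
    show "AE x in lborel. norm (\<psi> x) \<le> norm (A * (1 * \<bar>v x\<bar> powr p + (1 powr (1 / (a - p))) powr a * indicator \<Omega> x) + h x)"
    proof (intro AE_I2)
      fix x
      have "A * \<bar>v x\<bar> powr a \<le> A * (1 * \<bar>v x\<bar> powr p + (1 powr (1 / (a - p))) powr a * indicator \<Omega> x)"
        using y[of 1 v x] u(2) p(3) by (intro mult_left_mono) auto
      then show "norm (\<psi> x) \<le> norm (A * (1 * \<bar>v x\<bar> powr p + (1 powr (1 / (a - p))) powr a * indicator \<Omega> x) + h x)"
        using b(2)[of x] by (simp only: real_norm_def)
    qed
  qed
  then show "integrable lborel \<psi>" .
  have tight: "\<exists>Y. integrable lborel Y \<and> (\<forall>n x. \<bar>\<phi> n x - \<psi> x\<bar> \<le> \<tau> * (A * (\<bar>u n x\<bar> powr p + \<bar>v x\<bar> powr p)) + Y x)"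
    if \<tau>: "0 < \<tau>" for \<tau>
  proof (intro exI conjI allI)
    let ?c = "(\<tau> powr (1 / (a - p))) powr a"
    show "integrable lborel (\<lambda>x. 2 * A * ?c * indicator \<Omega> x + 2 * h x)"
      using ind[of "2 * A * ?c"] h by auto
    fix n x
    have "A * \<bar>v x\<bar> powr a \<le> A * (\<tau> * \<bar>v x\<bar> powr p + ?c * indicator \<Omega> x)"
      using y[of \<tau> v x] u(2) p(3) \<tau> by (intro mult_left_mono) auto
    moreover have "A * \<bar>u n x\<bar> powr a \<le> A * (\<tau> * \<bar>u n x\<bar> powr p + ?c * indicator \<Omega> x)"
      using y[of \<tau> "u n" x] u(1) p(3) \<tau> by (intro mult_left_mono) auto
    ultimately have "\<bar>\<phi> n x - \<psi> x\<bar> \<le> A * (\<tau> * \<bar>v x\<bar> powr p + ?c * indicator \<Omega> x)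
        + A * (\<tau> * \<bar>u n x\<bar> powr p + ?c * indicator \<Omega> x) + 2 * h x"
      using b(1)[of n x] b(2)[of x] by linarith
    then show "\<bar>\<phi> n x - \<psi> x\<bar> \<le> \<tau> * (A * (\<bar>u n x\<bar> powr p + \<bar>v x\<bar> powr p)) + (2 * A * ?c * indicator \<Omega> x + 2 * h x)"
      by (simp add: algebra_simps)
  qed
  let ?B = "A * (B + (\<integral>x. \<bar>v x\<bar> powr p \<partial>lborel))"
  have Z: "integrable lborel (\<lambda>x. A * (\<bar>u n x\<bar> powr p + \<bar>v x\<bar> powr p))"
    "(\<integral>x. A * (\<bar>u n x\<bar> powr p + \<bar>v x\<bar> powr p) \<partial>lborel) \<le> ?B" for n
    using i p(3) by (auto intro!: mult_left_mono)
  show "(\<lambda>n. \<integral>x. \<phi> n x \<partial>lborel) \<longlonglongrightarrow> (\<integral>x. \<psi> x \<partial>lborel)"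
    by (rule tight_integral_tendsto(1)[OF \<phi> int\<psi> lim Z(1) _ Z(2) tight]) (use p in auto)
  show "integrable lborel (\<phi> n)"
    by (rule tight_integral_tendsto(2)[OF \<phi> int\<psi> lim Z(1) _ Z(2) tight]) (use p in auto)
qed

lemma AE_convergent_of_summable_L1:
  fixes u :: "nat \<Rightarrow> 'b \<Rightarrow> real"
  assumes i: "\<And>n. integrable M (\<lambda>x. u (Suc n) x - u n x)"
    and sm: "summable (\<lambda>n. \<integral>x. \<bar>u (Suc n) x - u n x\<bar> \<partial>M)"
  shows "AE x in M. convergent (\<lambda>n. u n x)"
proof -
  let ?d = "\<lambda>n x. \<bar>u (Suc n) x - u n x\<bar>"
  have m [measurable]: "?d n \<in> borel_measurable M" for n using i by auto
  have "(\<integral>\<^sup>+x. (\<Sum>n. ennreal (?d n x)) \<partial>M) = (\<Sum>n. \<integral>\<^sup>+x. ennreal (?d n x) \<partial>M)"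
    by (rule nn_integral_suminf) measurable
  also have "\<dots> = (\<Sum>n. ennreal (\<integral>x. ?d n x \<partial>M))"
    using i by (intro suminf_cong nn_integral_eq_integral) auto
  also have "\<dots> < \<infinity>" using sm by (subst suminf_ennreal2) auto
  finally have "AE x in M. (\<Sum>n. ennreal (?d n x)) \<noteq> \<infinity>"
    by (intro nn_integral_PInf_AE) auto
  then show ?thesis
  proof eventually_elim
    case (elim x)
    then have "summable (\<lambda>n. ?d n x)"
      by (intro summable_suminf_not_top) auto
    then have "summable (\<lambda>n. u (Suc n) x - u n x)" by (rule summable_rabs_cancel)
    then have "convergent (\<lambda>n. (\<Sum>k<n. u (Suc k) x - u k x))"
      by (simp add: summable_iff_convergent)
    then have "convergent (\<lambda>n. u n x - u 0 x)" by (subst (asm) sum_lessThan_telescope)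
    then obtain l where "(\<lambda>n. u n x - u 0 x) \<longlonglongrightarrow> l" by (auto simp: convergent_def)
    then have "(\<lambda>n. (u n x - u 0 x) + u 0 x) \<longlonglongrightarrow> l + u 0 x" by (intro tendsto_intros)
    then show ?case by (auto simp: convergent_def)
  qed
qed

section \<open>Bounded domains: Poincare, compactness and Sobolev bounds\<close>

locale fractional_domain =
  fixes s :: real and \<Omega> :: "'a::euclidean_space set"
  assumes s: "0 < s" "s < 1" and dim: "2 * s < real DIM('a)"
    and dom: "open \<Omega>" "bounded \<Omega>" "\<Omega> \<noteq> {}"
begin

abbreviation "H \<equiv> Hs s \<Omega>"
abbreviation "F \<equiv> form s"

lemma sets_dom [measurable]: "\<Omega> \<in> sets borel"
  using dom by auto

lemma finite_dom: "emeasure lborel \<Omega> < \<infinity>"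
  using dom by (intro emeasure_bounded_finite)

lemma compl_dom: "- \<Omega> \<noteq> {}"
proof
  assume "- \<Omega> = {}"
  then have "\<Omega> = UNIV" by auto
  then show False using dom(2) not_bounded_UNIV[where 'a='a] by simp
qed

lemma integrable_indicator_dom: "integrable lborel (indicator \<Omega> :: 'a \<Rightarrow> real)"
  using finite_dom by auto

lemma integral_pos:
  fixes f :: "'a \<Rightarrow> real"
  assumes f: "integrable lborel f" "\<And>x. 0 \<le> f x" and pos: "\<And>x. x \<in> \<Omega> \<Longrightarrow> 0 < f x"
  shows "0 < (\<integral>x. f x \<partial>lborel)"
proof (rule ccontr)
  assume "\<not> 0 < (\<integral>x. f x \<partial>lborel)"
  moreover have "0 \<le> (\<integral>x. f x \<partial>lborel)" using f(2) by (intro integral_nonneg_AE) auto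
  ultimately have "(\<integral>x. f x \<partial>lborel) = 0" by linarith
  then have "AE x in lborel. f x = 0" using integral_nonneg_eq_0_iff_AE[OF f(1)] f(2) by simp
  then have ae: "AE x in lborel. x \<notin> \<Omega>" by eventually_elim (use pos in force)
  obtain x0 \<rho> where b: "0 < \<rho>" "ball x0 \<rho> \<subseteq> \<Omega>" using dom(1,3) open_contains_ball by blast
  have "AE x in lborel. x \<notin> ball x0 \<rho>" using ae by eventually_elim (use b in blast)
  then have "emeasure lborel (ball x0 \<rho>) = 0" by (subst (asm) AE_iff_measurable[of "ball x0 \<rho>"]) auto
  moreover have "0 < unit_ball_vol (real DIM('a))" by simp
  ultimately show False using b(1) by (subst (asm) emeasure_lborel_ball) auto
qed

text \<open>The sign condition holds for \<open>v = u\<close>, which gives the Poincare inequality,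
  and for \<open>v = max 0 (u - K)\<close>, which is the test function that bounds the first
  solution from above.\<close>

lemma form_lower:
  shows "\<exists>c>0. \<forall>u\<in>H. \<forall>v\<in>H. (\<forall>x y. 0 \<le> (u x - u y) * (v x - v y)) \<longrightarrow>
    integrable lborel (\<lambda>x. u x * v x) \<and> c * (\<integral>x. u x * v x \<partial>lborel) \<le> F u v"
proof -
  obtain c where c: "0 < c"
    "\<forall>x\<in>\<Omega>. ennreal c \<le> (\<integral>\<^sup>+y. ennreal (kern s (x - y)) * indicator (- \<Omega>) y \<partial>lborel)"
    using kern_compl_bounded[OF less_imp_le[OF s(1)] dom(2,1)] by blast
  show ?thesis
  proof (intro exI[of _ c] conjI ballI impI c(1))
    fix u v assume u: "u \<in> H" and v: "v \<in> H" and pos': "\<forall>x y. 0 \<le> (u x - u y) * (v x - v y)"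
    then have pos: "\<And>x y. 0 \<le> (u x - u y) * (v x - v y)" by blast
    have [measurable]: "u \<in> borel_measurable borel" "v \<in> borel_measurable borel"
      using HsD(1)[OF u] HsD(1)[OF v] by auto
    obtain y0 where "y0 \<notin> \<Omega>" using compl_dom by blast
    then have uv: "0 \<le> u x * v x" for x
      using pos[of x y0] Hs_outside[OF u] Hs_outside[OF v] by simp
    have le: "(\<integral>\<^sup>+x. ennreal (c * (u x * v x)) \<partial>lborel) \<le> ennreal (F u v)"
      by (rule form_ge_weighted[OF u v _ _ c(2)[rule_format] pos compl_dom]) auto
    have "integrable lborel (\<lambda>x. c * (u x * v x))"
      using le_less_trans[OF le] uv c(1) by (intro integrableI_nonneg) auto
    then have i: "integrable lborel (\<lambda>x. u x * v x)" using c(1) by simp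
    have F0: "0 \<le> F u v" unfolding form_def using pos by (intro integral_nonneg_AE) (auto simp: dq_def)
    have "(\<integral>\<^sup>+x. ennreal (c * (u x * v x)) \<partial>lborel) = ennreal (\<integral>x. c * (u x * v x) \<partial>lborel)"
      using i uv c(1) by (intro nn_integral_eq_integral) auto
    with le F0 have "(\<integral>x. c * (u x * v x) \<partial>lborel) \<le> F u v" by simp
    then show "integrable lborel (\<lambda>x. u x * v x)" "c * (\<integral>x. u x * v x \<partial>lborel) \<le> F u v"
      using i by simp_all
  qed
qed

lemma poincare:
  shows "\<exists>c>0. \<forall>u\<in>H. c * (\<integral>x. (u x)\<^sup>2 \<partial>lborel) \<le> F u u"
proof -
  obtain c where c: "0 < c" "\<forall>u\<in>H. \<forall>v\<in>H. (\<forall>x y. 0 \<le> (u x - u y) * (v x - v y)) \<longrightarrow>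
    integrable lborel (\<lambda>x. u x * v x) \<and> c * (\<integral>x. u x * v x \<partial>lborel) \<le> F u v"
    using form_lower by blast
  show ?thesis using c by (intro exI[of _ c]) (auto simp: power2_eq_square)
qed

lemma Hs_L2: 
  assumes "u \<in> H" shows "integrable lborel (\<lambda>x. (u x)\<^sup>2)"
proof -
  obtain c where c: "0 < c" "\<forall>u\<in>H. \<forall>v\<in>H. (\<forall>x y. 0 \<le> (u x - u y) * (v x - v y)) \<longrightarrow>
    integrable lborel (\<lambda>x. u x * v x) \<and> c * (\<integral>x. u x * v x \<partial>lborel) \<le> F u v"
    using form_lower by blast
  show ?thesis using c(2)[rule_format, OF assms assms] by (simp add: power2_eq_square)
qed

lemma Hs_zero_of_form:
  assumes "u \<in> H" "F u u \<le> 0" shows "AE x in lborel. u x = 0"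
proof -
  obtain c where c: "0 < c" "\<forall>u\<in>H. c * (\<integral>x. (u x)\<^sup>2 \<partial>lborel) \<le> F u u"
    using poincare by blast
  have "c * (\<integral>x. (u x)\<^sup>2 \<partial>lborel) \<le> 0" using c(2)[rule_format, OF assms(1)] assms(2) by linarith
  then have "(\<integral>x. (u x)\<^sup>2 \<partial>lborel) \<le> 0" using c(1) by (simp add: mult_le_0_iff)
  moreover have "0 \<le> (\<integral>x. (u x)\<^sup>2 \<partial>lborel)" by (intro integral_nonneg_AE) auto
  ultimately have "(\<integral>x. (u x)\<^sup>2 \<partial>lborel) = 0" by linarith
  then show ?thesis
    using integral_nonneg_eq_0_iff_AE[OF Hs_L2[OF assms(1)]] by auto
qed

lemma integrable_of_square:
  fixes u :: "'a \<Rightarrow> real"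
  assumes [measurable]: "u \<in> borel_measurable borel" and "\<And>x. x \<notin> \<Omega> \<Longrightarrow> u x = 0"
    and "integrable lborel (\<lambda>x. (u x)\<^sup>2)"
  shows "integrable lborel u"
proof (rule Bochner_Integration.integrable_bound)
  show "integrable lborel (\<lambda>x. indicator \<Omega> x + (u x)\<^sup>2)"
    using assms(3) integrable_indicator_dom by auto
  show "AE x in lborel. norm (u x) \<le> norm (indicator \<Omega> x + (u x)\<^sup>2)"
  proof (intro AE_I2)
    fix x
    have "0 \<le> (\<bar>u x\<bar> - 1)\<^sup>2" by simp
    then have "2 * \<bar>u x\<bar> \<le> 1 + (u x)\<^sup>2" by (simp add: power2_eq_square algebra_simps)
    then show "norm (u x) \<le> norm (indicator \<Omega> x + (u x)\<^sup>2)"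
      using assms(2)[of x] by (cases "x \<in> \<Omega>") auto
  qed
qed simp

lemma Hs_L1: "u \<in> H \<Longrightarrow> integrable lborel u"
  using integrable_of_square HsD(1,2) Hs_L2 by blast

lemma Hs_mult_L1:
  assumes "u \<in> H" "v \<in> H" shows "integrable lborel (\<lambda>x. u x * v x)"
proof -
  have "integrable lborel (\<lambda>x. (u x + v x)\<^sup>2 - (u x)\<^sup>2 - (v x)\<^sup>2)"
    using Hs_L2[OF Hs_add[OF assms]] Hs_L2[OF assms(1)] Hs_L2[OF assms(2)] by auto
  then have "integrable lborel (\<lambda>x. 2 * (u x * v x))" by (simp add: power2_sum mult_ac)
  then show ?thesis by simp
qed

section \<open>Compactness from averages over small balls\<close>

text \<open>On a ball of radius \<open>\<delta>\<close> the squared distance of \<open>v x\<close>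
  from the mean value is at most the mean of \<open>(v x - v y)\<^sup>2\<close>, and
  \<open>norm (x - y) \<le> 2 * \<delta>\<close> turns this into
  \<open>\<delta> powr (2 * s)\<close> times a part of the energy. So at each scale finitely many
  linear functionals control the \<open>L^2\<close> norm up to a small multiple of the
  energy.\<close>

lemma average_bound:
  shows "\<exists>K>0. \<forall>\<delta> S v. 0 < \<delta> \<longrightarrow> finite S \<longrightarrow> \<Omega> \<subseteq> (\<Union>c\<in>S. ball c \<delta>) \<longrightarrow> v \<in> H \<longrightarrow>
    (\<integral>x. (v x)\<^sup>2 \<partial>lborel) \<le> K * \<delta> powr (2 * s) * F v v
      + 2 * measure lborel \<Omega> * (\<Sum>c\<in>S. ((\<integral>x. indicator (ball c \<delta>) x * v x \<partial>lborel) / measure lborel (ball c \<delta>))\<^sup>2)"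
proof -
  let ?N = "real DIM('a)"
  define K where "K = 2 * 2 powr (?N + 2 * s) / unit_ball_vol ?N"
  have V0: "0 < unit_ball_vol ?N" by simp
  have "0 < K" using V0 unfolding K_def by (intro divide_pos_pos) auto
  moreover have "(\<integral>x. (v x)\<^sup>2 \<partial>lborel) \<le> K * \<delta> powr (2 * s) * F v v
      + 2 * measure lborel \<Omega> * (\<Sum>c\<in>S. ((\<integral>x. indicator (ball c \<delta>) x * v x \<partial>lborel) / measure lborel (ball c \<delta>))\<^sup>2)"
    if \<delta>: "0 < \<delta>" and S: "finite S" "\<Omega> \<subseteq> (\<Union>c\<in>S. ball c \<delta>)" and v: "v \<in> H" for \<delta> S v
  proof -
    have [measurable]: "v \<in> borel_measurable borel" using HsD(1)[OF v] .
    let ?av = "\<lambda>c. (\<integral>x. indicator (ball c \<delta>) x * v x \<partial>lborel) / measure lborel (ball c \<delta>)"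
    let ?\<Sigma> = "\<Sum>c\<in>S. (?av c)\<^sup>2"
    define V where "V = unit_ball_vol ?N * \<delta> ^ DIM('a)"
    have V: "0 < V" using V0 \<delta> by (simp add: V_def)
    have mV: "measure lborel (ball c \<delta>) = V" for c :: 'a
      unfolding measure_def emeasure_lborel_ball[OF less_imp_le[OF \<delta>]] using V by (simp add: V_def)
    have ib: "integrable lborel (\<lambda>x. indicator (ball c \<delta>) x :: real)" for c :: 'a
      using emeasure_lborel_ball_finite[of c \<delta>] by (auto simp: integrable_indicator_iff)
    have k: "K * \<delta> powr (2 * s) = 2 * ((2 * \<delta>) powr (?N + 2 * s) / V)"
    proof -
      have "(2 * \<delta>) powr (?N + 2 * s) = 2 powr (?N + 2 * s) * (\<delta> ^ DIM('a) * \<delta> powr (2 * s))"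
        using \<delta> by (simp add: powr_mult powr_add powr_realpow)
      then show ?thesis using \<delta> by (simp add: K_def V_def)
    qed
    have pt: "ennreal ((v x)\<^sup>2) \<le> ennreal (2 * ?\<Sigma>) * indicator \<Omega> x
        + (\<integral>\<^sup>+y. ennreal (K * \<delta> powr (2 * s)) * (ennreal (kern s (x - y)) * ennreal ((dq v (x, y))\<^sup>2)) \<partial>lborel)" for x
    proof (cases "x \<in> \<Omega>")
      case True
      then obtain c where c: "c \<in> S" "x \<in> ball c \<delta>" using S by auto
      let ?B = "\<lambda>y. indicator (ball c \<delta>) y :: real"
      have i1: "integrable lborel (\<lambda>y. ?B y * v y)"
        using integrable_mult_indicator[OF _ Hs_L1[OF v], of "ball c \<delta>"] by simp
      have i2: "integrable lborel (\<lambda>y. ?B y * (v y)\<^sup>2)"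
        using integrable_mult_indicator[OF _ Hs_L2[OF v], of "ball c \<delta>"] by simp
      define a where "a = ?av c"
      have iv: "(\<integral>y. ?B y * v y \<partial>lborel) = a * V" using V by (simp add: a_def mV)
      have iB: "(\<integral>y. ?B y \<partial>lborel) = V" using mV[of c] by simp
      define q where "q = (\<integral>y. ?B y * (v x - v y)\<^sup>2 \<partial>lborel)"
      have iq: "integrable lborel (\<lambda>y. ?B y * (v x - v y)\<^sup>2)"
      proof -
        have "integrable lborel (\<lambda>y. (v x)\<^sup>2 * ?B y - 2 * v x * (?B y * v y) + ?B y * (v y)\<^sup>2)"
          using i1 i2 ib by auto
        then show ?thesis by (simp add: power2_diff algebra_simps)
      qed
      \<comment> \<open>Up to the factor \<open>V\<close>, the variance of \<open>v\<close> on the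
        ball is the mean square deviation from \<open>v x\<close> minus
        \<open>(v x - a)\<^sup>2\<close>. That it is nonnegative is the required case of Jensen's
        inequality.\<close>
      have "0 \<le> (\<integral>y. ?B y * (v y - a)\<^sup>2 \<partial>lborel)" by (intro integral_nonneg_AE) auto
      also have "(\<lambda>y. ?B y * (v y - a)\<^sup>2) = (\<lambda>y. ?B y * (v x - v y)\<^sup>2 - (v x - a)\<^sup>2 * ?B y + 2 * (v x - a) * (?B y * v y - a * ?B y))"
        by (auto simp: fun_eq_iff power2_eq_square algebra_simps)
      also have "(\<integral>y. ?B y * (v x - v y)\<^sup>2 - (v x - a)\<^sup>2 * ?B y + 2 * (v x - a) * (?B y * v y - a * ?B y) \<partial>lborel)
          = q - (v x - a)\<^sup>2 * V + 2 * (v x - a) * (a * V - a * V)"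
        using iq i1 ib unfolding q_def by (simp add: iv iB mV)
      finally have "(v x - a)\<^sup>2 * V \<le> q" by simp
      then have "(v x - a)\<^sup>2 \<le> q / V" using V by (simp add: field_simps)
      moreover have "(v x)\<^sup>2 \<le> 2 * a\<^sup>2 + 2 * (v x - a)\<^sup>2"
        using zero_le_power2[of "v x - 2 * a"] by (simp add: power2_eq_square algebra_simps)
      moreover have "a\<^sup>2 \<le> ?\<Sigma>" unfolding a_def using S c by (intro member_le_sum[of c S "\<lambda>c. (?av c)\<^sup>2"]) auto
      ultimately have "(v x)\<^sup>2 \<le> 2 * ?\<Sigma> + 2 / V * q" by simp
      then have "ennreal ((v x)\<^sup>2) \<le> ennreal (2 * ?\<Sigma> + 2 / V * q)" by (rule ennreal_leI)
      also have "\<dots> = ennreal (2 * ?\<Sigma>) + ennreal (2 / V * q)"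
        using V unfolding q_def by (intro ennreal_plus) (auto intro!: mult_nonneg_nonneg integral_nonneg_AE sum_nonneg)
      also have "ennreal (2 / V * q) = (\<integral>\<^sup>+y. ennreal (2 / V * (?B y * (v x - v y)\<^sup>2)) \<partial>lborel)"
        using iq V unfolding q_def by (subst nn_integral_eq_integral) auto
      also have "\<dots> \<le> (\<integral>\<^sup>+y. ennreal (K * \<delta> powr (2 * s)) * (ennreal (kern s (x - y)) * ennreal ((dq v (x, y))\<^sup>2)) \<partial>lborel)"
      proof (intro nn_integral_mono)
        fix y
        have "2 / V * (?B y * (v x - v y)\<^sup>2) \<le> K * \<delta> powr (2 * s) * (kern s (x - y) * (v x - v y)\<^sup>2)"
        proof (cases "y \<in> ball c \<delta> \<and> x \<noteq> y")
          case True
          have "norm (x - y) \<le> 2 * \<delta>"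
            using True c(2) dist_triangle2[of x y c] by (simp add: dist_norm[symmetric] dist_commute)
          then have "(2 * \<delta>) powr (- (?N + 2 * s)) \<le> kern s (x - y)"
            using True s by (intro kern_mono) auto
          then have "(2 * \<delta>) powr (?N + 2 * s) * (2 * \<delta>) powr (- (?N + 2 * s)) \<le> (2 * \<delta>) powr (?N + 2 * s) * kern s (x - y)"
            by (intro mult_left_mono) auto
          then have "1 \<le> (2 * \<delta>) powr (?N + 2 * s) * kern s (x - y)"
            using \<delta> by (simp add: powr_add[symmetric])
          then have "2 / V * (v x - v y)\<^sup>2 * 1 \<le> 2 / V * (v x - v y)\<^sup>2 * ((2 * \<delta>) powr (?N + 2 * s) * kern s (x - y))"
            using V by (intro mult_left_mono) auto
          then show ?thesis using True unfolding k by (simp add: mult_ac)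
        next
          case False
          then show ?thesis using V k by (auto simp: indicator_def K_def)
        qed
        then show "ennreal (2 / V * (?B y * (v x - v y)\<^sup>2)) \<le> ennreal (K * \<delta> powr (2 * s)) * (ennreal (kern s (x - y)) * ennreal ((dq v (x, y))\<^sup>2))"
          using \<open>0 < K\<close> by (simp add: dq_def ennreal_mult[symmetric] ennreal_leI)
      qed
      finally show ?thesis using True by (simp add: add_mono)
    next
      case False
      then show ?thesis using Hs_outside[OF v] by simp
    qed
    define g where "g x = (\<integral>\<^sup>+y. ennreal (kern s (x - y)) * ennreal ((dq v (x, y))\<^sup>2) \<partial>lborel)" for x
    have [measurable]: "g \<in> borel_measurable lborel" unfolding g_def[abs_def] dq_def fst_conv snd_conv by measurable
    have cm: "(\<integral>\<^sup>+y. ennreal (K * \<delta> powr (2 * s)) * (ennreal (kern s (x - y)) * ennreal ((dq v (x, y))\<^sup>2)) \<partial>lborel)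
        = ennreal (K * \<delta> powr (2 * s)) * g x" for x
      unfolding g_def dq_def fst_conv snd_conv by (rule nn_integral_cmult) measurable
    have \<Sigma>0: "0 \<le> ?\<Sigma>" by (intro sum_nonneg) auto
    have m: "emeasure lborel \<Omega> = ennreal (measure lborel \<Omega>)"
      using finite_dom by (intro emeasure_eq_ennreal_measure) auto
    have "ennreal (\<integral>x. (v x)\<^sup>2 \<partial>lborel) = (\<integral>\<^sup>+x. ennreal ((v x)\<^sup>2) \<partial>lborel)"
      using Hs_L2[OF v] by (intro nn_integral_eq_integral[symmetric]) auto
    also have "\<dots> \<le> (\<integral>\<^sup>+x. ennreal (2 * ?\<Sigma>) * indicator \<Omega> x
        + (\<integral>\<^sup>+y. ennreal (K * \<delta> powr (2 * s)) * (ennreal (kern s (x - y)) * ennreal ((dq v (x, y))\<^sup>2)) \<partial>lborel) \<partial>lborel)"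
      by (intro nn_integral_mono pt)
    also have "\<dots> = (\<integral>\<^sup>+x. ennreal (2 * ?\<Sigma>) * indicator \<Omega> x + ennreal (K * \<delta> powr (2 * s)) * g x \<partial>lborel)"
      unfolding cm ..
    also have "\<dots> = (\<integral>\<^sup>+x. ennreal (2 * ?\<Sigma>) * indicator \<Omega> x \<partial>lborel)
        + (\<integral>\<^sup>+x. ennreal (K * \<delta> powr (2 * s)) * g x \<partial>lborel)"
      by (rule nn_integral_add) measurable
    also have "(\<integral>\<^sup>+x. ennreal (2 * ?\<Sigma>) * indicator \<Omega> x \<partial>lborel) = ennreal (2 * ?\<Sigma>) * emeasure lborel \<Omega>"
      by (rule nn_integral_cmult_indicator) simp
    also have "(\<integral>\<^sup>+x. ennreal (K * \<delta> powr (2 * s)) * g x \<partial>lborel) = ennreal (K * \<delta> powr (2 * s)) * (\<integral>\<^sup>+x. g x \<partial>lborel)"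
      by (rule nn_integral_cmult) measurable
    also have "(\<integral>\<^sup>+x. g x \<partial>lborel) = ennreal (F v v)"
      unfolding g_def nn_integral_form[OF v, symmetric]
      by (rule nn_integral_kap[where f="\<lambda>z. ennreal ((dq v z)\<^sup>2)", symmetric]) measurable
    also have "ennreal (2 * ?\<Sigma>) * emeasure lborel \<Omega> + ennreal (K * \<delta> powr (2 * s)) * ennreal (F v v)
       = ennreal (K * \<delta> powr (2 * s) * F v v + 2 * measure lborel \<Omega> * ?\<Sigma>)"
      unfolding m using \<Sigma>0 \<open>0 < K\<close>
      by (subst ennreal_plus) (auto simp: ennreal_mult[symmetric] mult_ac add.commute)
    finally show ?thesis
      using \<Sigma>0 \<open>0 < K\<close> by (subst (asm) ennreal_le_iff) auto
  qed
  ultimately show ?thesis by blast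
qed

end

context fractional_domain begin

text \<open>A diagonal subsequence makes the averages over all balls of countably many finite covers
  converge; \<open>average_bound\<close> then makes it a Cauchy sequence in \<open>L^2\<close>. A
  further subsequence converges so fast that its increments are summable in \<open>L^1\<close>,
  which yields the limit almost everywhere.\<close>

lemma Hs_compact:
  fixes u :: "nat \<Rightarrow> 'a \<Rightarrow> real"
  assumes u: "\<And>n. u n \<in> H" and B: "\<And>n. F (u n) (u n) \<le> B"
  shows "\<exists>r v. strict_mono (r :: nat \<Rightarrow> nat) \<and> v \<in> H \<and> (AE x in lborel. (\<lambda>n. u (r n) x) \<longlonglongrightarrow> v x)"
proof -
  have B0: "0 \<le> B" using B[of 0] form_nonneg[of s "u 0"] by linarith
  have "\<exists>S. finite S \<and> \<Omega> \<subseteq> (\<Union>c\<in>S. ball c (1 / real (Suc m)))" for m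
  proof -
    have "compact (closure \<Omega>)" using dom by (simp add: compact_closure)
    then obtain S where "finite S" "closure \<Omega> \<subseteq> (\<Union>c\<in>S. ball c (1 / real (Suc m)))"
      unfolding compact_eq_totally_bounded using zero_less_divide_1_iff[of "real (Suc m)"] of_nat_0_less_iff zero_less_Suc by blast
    then show ?thesis using closure_subset[of \<Omega>] by blast
  qed
  then obtain S where S: "\<And>m. finite (S m)" "\<And>m. \<Omega> \<subseteq> (\<Union>c\<in>S m. ball c (1 / real (Suc m)))"
    by metis
  define I where "I = (SIGMA m:UNIV. S m)"
  have cI: "countable I" unfolding I_def using S(1) by (intro countable_SIGMA) (auto intro: countable_finite)
  define f where "f n p = (\<integral>x. indicator (ball (snd p) (1 / real (Suc (fst p)))) x * u n x \<partial>lborel)" for n p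
  obtain cP where cP: "0 < cP" "\<forall>u\<in>H. cP * (\<integral>x. (u x)\<^sup>2 \<partial>lborel) \<le> F u u"
    using poincare by blast
  have "norm (f n p) \<le> measure lborel \<Omega> + B / cP" for n p
  proof -
    have "norm (f n p) \<le> (\<integral>x. norm (indicator (ball (snd p) (1 / real (Suc (fst p)))) x * u n x) \<partial>lborel)"
      unfolding f_def by (rule integral_norm_bound)
    also have "\<dots> \<le> (\<integral>x. indicator \<Omega> x + (u n x)\<^sup>2 \<partial>lborel)"
    proof (intro integral_mono)
      show "integrable lborel (\<lambda>x. norm (indicator (ball (snd p) (1 / real (Suc (fst p)))) x * u n x))"
        using integrable_mult_indicator[OF _ Hs_L1[OF u[of n]], of "ball (snd p) (1 / real (Suc (fst p)))"]
        by (intro integrable_norm) simp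
      show "integrable lborel (\<lambda>x. indicator \<Omega> x + (u n x)\<^sup>2)"
        using Hs_L2[OF u[of n]] integrable_indicator_dom by auto
      fix x
      have "0 \<le> (\<bar>u n x\<bar> - 1)\<^sup>2" by simp
      then have "2 * \<bar>u n x\<bar> \<le> 1 + (u n x)\<^sup>2" by (simp add: power2_eq_square algebra_simps)
      then show "norm (indicator (ball (snd p) (1 / real (Suc (fst p)))) x * u n x) \<le> indicator \<Omega> x + (u n x)\<^sup>2"
        using Hs_outside[OF u[of n], of x] by (auto simp: indicator_def)
    qed
    also have "\<dots> = measure lborel \<Omega> + (\<integral>x. (u n x)\<^sup>2 \<partial>lborel)"
      using Hs_L2[OF u[of n]] integrable_indicator_dom by simp
    also have "(\<integral>x. (u n x)\<^sup>2 \<partial>lborel) \<le> B / cP"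
      using order_trans[OF cP(2)[rule_format, OF u[of n]] B[of n]] cP(1) by (simp add: field_simps)
    finally show ?thesis by simp
  qed
  then obtain k where k: "strict_mono (k :: nat \<Rightarrow> nat)" "\<And>p. p \<in> I \<Longrightarrow> \<exists>l. (\<lambda>n. f (k n) p) \<longlonglongrightarrow> l"
    using function_convergent_subsequence[OF cI, of f "measure lborel \<Omega> + B / cP"] by blast
  define w where "w n = u (k n)" for n
  have w: "w n \<in> H" "F (w n) (w n) \<le> B" for n using u B by (auto simp: w_def)
  obtain K where K: "0 < K" "\<forall>\<delta> S v. 0 < \<delta> \<longrightarrow> finite S \<longrightarrow> \<Omega> \<subseteq> (\<Union>c\<in>S. ball c \<delta>) \<longrightarrow> v \<in> H \<longrightarrow>
    (\<integral>x. (v x)\<^sup>2 \<partial>lborel) \<le> K * \<delta> powr (2 * s) * F v v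
      + 2 * measure lborel \<Omega> * (\<Sum>c\<in>S. ((\<integral>x. indicator (ball c \<delta>) x * v x \<partial>lborel) / measure lborel (ball c \<delta>))\<^sup>2)"
    using average_bound by blast
  have cauchy: "\<exists>N. \<forall>m\<ge>N. \<forall>n\<ge>N. (\<integral>x. (w n x - w m x)\<^sup>2 \<partial>lborel) < e" if e: "0 < e" for e
  proof -
    have "(\<lambda>m. K * (1 / real (Suc m)) powr (2 * s) * (4 * B)) \<longlonglongrightarrow> K * 0 powr (2 * s) * (4 * B)"
      using s LIMSEQ_inverse_real_of_nat
      by (intro tendsto_mult tendsto_const tendsto_powr2) (auto simp: inverse_eq_divide)
    then have "\<forall>\<^sub>F m in sequentially. K * (1 / real (Suc m)) powr (2 * s) * (4 * B) < e / 2"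
      using e by (intro order_tendstoD(2)) auto
    then obtain m0 where m0: "K * (1 / real (Suc m0)) powr (2 * s) * (4 * B) < e / 2"
      by (auto simp: eventually_sequentially)
    define \<delta> where "\<delta> = 1 / real (Suc m0)"
    have \<delta>: "0 < \<delta>" by (simp add: \<delta>_def)
    define a where "a c n = (\<integral>x. indicator (ball c \<delta>) x * w n x \<partial>lborel) / measure lborel (ball c \<delta>)" for c n
    have "\<exists>l. (\<lambda>n. a c n) \<longlonglongrightarrow> l" if "c \<in> S m0" for c
    proof -
      have "(m0, c) \<in> I" using that by (auto simp: I_def)
      then obtain l where "(\<lambda>n. f (k n) (m0, c)) \<longlonglongrightarrow> l" using k(2) by blast
      then have "(\<lambda>n. f (k n) (m0, c) / measure lborel (ball c \<delta>)) \<longlonglongrightarrow> l / measure lborel (ball c \<delta>)"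
        unfolding divide_inverse by (intro tendsto_mult tendsto_const)
      then show ?thesis unfolding a_def f_def w_def \<delta>_def by auto
    qed
    then obtain l where l: "\<And>c. c \<in> S m0 \<Longrightarrow> (\<lambda>n. a c n) \<longlonglongrightarrow> l c" by metis
    define E where "E n = (\<Sum>c\<in>S m0. (a c n - l c)\<^sup>2)" for n
    have "E \<longlonglongrightarrow> (\<Sum>c\<in>S m0. (l c - l c)\<^sup>2)"
      unfolding E_def using l by (intro tendsto_sum tendsto_power tendsto_diff tendsto_const)
    then have "(\<lambda>n. 4 * measure lborel \<Omega> * E n) \<longlonglongrightarrow> 4 * measure lborel \<Omega> * 0"
      by (intro tendsto_mult tendsto_const) simp
    then have "\<forall>\<^sub>F n in sequentially. 4 * measure lborel \<Omega> * E n < e / 4"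
      using e by (intro order_tendstoD(2)) auto
    then obtain N where N: "\<And>n. N \<le> n \<Longrightarrow> 4 * measure lborel \<Omega> * E n < e / 4"
      by (auto simp: eventually_sequentially)
    show ?thesis
    proof (intro exI[of _ N] allI impI)
      fix m n assume mn: "N \<le> m" "N \<le> n"
      let ?v = "\<lambda>x. w n x - w m x"
      have v: "?v \<in> H" using w by (intro Hs_diff)
      have av: "(\<integral>x. indicator (ball c \<delta>) x * ?v x \<partial>lborel) / measure lborel (ball c \<delta>) = a c n - a c m" for c
      proof -
        have "integrable lborel (\<lambda>x. indicator (ball c \<delta>) x * w i x)" for i
          using integrable_mult_indicator[OF _ Hs_L1[OF w(1)[of i]], of "ball c \<delta>"] by simp
        then show ?thesis by (simp add: a_def right_diff_distrib diff_divide_distrib)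
      qed
      have "(\<integral>x. (?v x)\<^sup>2 \<partial>lborel) \<le> K * \<delta> powr (2 * s) * F ?v ?v
        + 2 * measure lborel \<Omega> * (\<Sum>c\<in>S m0. (a c n - a c m)\<^sup>2)"
        using K(2)[rule_format, OF \<delta> S(1)[of m0] _ v] S(2)[of m0] unfolding av \<delta>_def[symmetric] by simp
      also have "(\<Sum>c\<in>S m0. (a c n - a c m)\<^sup>2) \<le> (\<Sum>c\<in>S m0. 2 * (a c n - l c)\<^sup>2 + 2 * (a c m - l c)\<^sup>2)"
      proof (intro sum_mono)
        fix c
        show "(a c n - a c m)\<^sup>2 \<le> 2 * (a c n - l c)\<^sup>2 + 2 * (a c m - l c)\<^sup>2"
          using zero_le_power2[of "(a c n - l c) + (a c m - l c)"]
          by (simp add: power2_eq_square algebra_simps)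
      qed
      also have "\<dots> = 2 * E n + 2 * E m" by (simp add: E_def sum.distrib sum_distrib_left)
      also have "F ?v ?v \<le> 4 * B" using form_diff_bound[OF w(1)[of n] w(1)[of m]] w(2)[of n] w(2)[of m] by linarith
      finally have "(\<integral>x. (?v x)\<^sup>2 \<partial>lborel) \<le> K * \<delta> powr (2 * s) * (4 * B) + 2 * measure lborel \<Omega> * (2 * E n + 2 * E m)"
        using K(1) by (simp add: mult_left_mono)
      then show "(\<integral>x. (?v x)\<^sup>2 \<partial>lborel) < e"
        using N[OF mn(1)] N[OF mn(2)] m0 unfolding \<delta>_def[symmetric] by (simp add: algebra_simps)
    qed
  qed
  \<comment> \<open>The \<open>L^1\<close> norm of an increment is bounded below by
    \<open>2 ^ (-i)\<close> times the measure of \<open>\<Omega>\<close> plus \<open>2 ^ i\<close>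
    times its squared \<open>L^2\<close> norm; with the rate \<open>(1/8) ^ i\<close> both terms are
    summable.\<close>
  have "\<exists>j. \<forall>i. (\<forall>m\<ge>j i. \<forall>n\<ge>j i. (\<integral>x. (w n x - w m x)\<^sup>2 \<partial>lborel) < (1/8) ^ i) \<and> j i < j (Suc i)"
  proof (rule dependent_nat_choice)
    show "\<exists>N. \<forall>m\<ge>N. \<forall>n\<ge>N. (\<integral>x. (w n x - w m x)\<^sup>2 \<partial>lborel) < (1/8) ^ 0" by (rule cauchy) simp
    fix N i
    obtain N' where N': "\<forall>m\<ge>N'. \<forall>n\<ge>N'. (\<integral>x. (w n x - w m x)\<^sup>2 \<partial>lborel) < (1/8) ^ Suc i"
      using cauchy[of "(1/8) ^ Suc i"] by auto
    show "\<exists>y. (\<forall>m\<ge>y. \<forall>n\<ge>y. (\<integral>x. (w n x - w m x)\<^sup>2 \<partial>lborel) < (1/8) ^ Suc i) \<and> N < y"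
      using N' by (intro exI[of _ "max N' (Suc N)"]) auto
  qed
  then obtain j where j: "\<And>i m n. j i \<le> m \<Longrightarrow> j i \<le> n \<Longrightarrow> (\<integral>x. (w n x - w m x)\<^sup>2 \<partial>lborel) < (1/8) ^ i" "\<And>i. j i < j (Suc i)"
    by blast
  have d: "integrable lborel (\<lambda>x. w (j (Suc i)) x - w (j i) x)" for i
    using Hs_L1[OF w(1)] by auto
  have sm: "summable (\<lambda>i. \<integral>x. \<bar>w (j (Suc i)) x - w (j i) x\<bar> \<partial>lborel)"
  proof (rule summable_comparison_test')
    show "summable (\<lambda>i. measure lborel \<Omega> * (1/2::real) ^ i + (1/4) ^ i)"
      by (intro summable_add summable_mult summable_geometric) auto
    fix i :: nat assume "0 \<le> i"
    let ?d = "\<lambda>x. w (j (Suc i)) x - w (j i) x"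
    have dH: "?d \<in> H" using w by (intro Hs_diff)
    have "(\<integral>x. \<bar>?d x\<bar> \<partial>lborel) \<le> (\<integral>x. (1/2) ^ i * indicator \<Omega> x + 2 ^ i * (?d x)\<^sup>2 \<partial>lborel)"
    proof (intro integral_mono)
      show "integrable lborel (\<lambda>x. \<bar>?d x\<bar>)" using d by auto
      show "integrable lborel (\<lambda>x. (1/2) ^ i * indicator \<Omega> x + 2 ^ i * (?d x)\<^sup>2)"
        using Hs_L2[OF dH] integrable_indicator_dom by auto
      fix x
      define t where "t = \<bar>?d x\<bar>"
      define \<tau> :: real where "\<tau> = 2 ^ i"
      have \<tau>: "0 < \<tau>" by (simp add: \<tau>_def)
      have "0 \<le> (\<tau> * t - 1)\<^sup>2 / \<tau>" using \<tau> by simp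
      also have "\<dots> = \<tau> * t\<^sup>2 + 1 / \<tau> - 2 * t" using \<tau> by (simp add: power2_eq_square field_simps)
      finally have "2 * t \<le> 1 / \<tau> + \<tau> * t\<^sup>2" by simp
      moreover have "0 \<le> t" by (simp add: t_def)
      ultimately have "t \<le> 1 / \<tau> + \<tau> * t\<^sup>2" by linarith
      then show "\<bar>?d x\<bar> \<le> (1/2) ^ i * indicator \<Omega> x + 2 ^ i * (?d x)\<^sup>2"
        using Hs_outside[OF dH, of x] by (cases "x \<in> \<Omega>") (auto simp: t_def \<tau>_def power_one_over)
    qed
    also have "\<dots> = (1/2) ^ i * measure lborel \<Omega> + 2 ^ i * (\<integral>x. (?d x)\<^sup>2 \<partial>lborel)"
      using Hs_L2[OF dH] integrable_indicator_dom by simp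
    also have "\<dots> \<le> (1/2) ^ i * measure lborel \<Omega> + 2 ^ i * (1/8) ^ i"
      using j(1)[of i "j i" "j (Suc i)"] j(2)[of i] by simp
    also have "2 ^ i * (1/8) ^ i = (1/4::real) ^ i" by (simp add: power_mult_distrib[symmetric])
    finally show "norm (\<integral>x. \<bar>?d x\<bar> \<partial>lborel) \<le> measure lborel \<Omega> * (1/2) ^ i + (1/4) ^ i"
      by (simp add: mult.commute integral_nonneg_AE)
  qed
  have [measurable]: "w n \<in> borel_measurable borel" for n using HsD(1)[OF w(1)] .
  define v where "v x = lim (\<lambda>i. w (j i) x)" for x
  have ae: "AE x in lborel. (\<lambda>i. w (j i) x) \<longlonglongrightarrow> v x"
    using AE_convergent_of_summable_L1[OF d sm]
    by eventually_elim (simp add: v_def convergent_LIMSEQ_iff)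
  have vm: "v \<in> borel_measurable borel"
    unfolding v_def[abs_def] by (intro borel_measurable_lim_metric) simp
  have v0: "v x = 0" if "x \<notin> \<Omega>" for x
    using Hs_outside[OF w(1) that] by (simp add: v_def)
  have "v \<in> H" by (rule Hs_limit(1)[OF w(1) w(2) ae vm v0])
  moreover have "strict_mono (\<lambda>i. k (j i))"
    using k(1) j(2) by (auto simp: strict_mono_Suc_iff strict_mono_less)
  ultimately show ?thesis using ae unfolding w_def by blast
qed

section \<open>Sobolev bounds below the critical exponent\<close>

text \<open>Truncation at dyadic levels. Let \<open>D k\<close> be the set where
  \<open>\<bar>u\<bar> > 2 ^ k\<close>. A point of \<open>D (Suc k)\<close> and a point outside
  \<open>D k\<close> have values that differ by at least \<open>2 ^ k\<close>, and
  \<open>kern_compl_measure\<close> bounds the kernel mass of such pairs from below. The energy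
  bound becomes a recursion for the measures of the \<open>D k\<close>, solved by decay at the rate
  of the critical exponent.\<close>

lemma weak_sobolev:
  assumes crit: "crit = 2 * real DIM('a) / (real DIM('a) - 2 * s)"
  shows "\<exists>K>0. \<forall>u\<in>H. F u u \<le> B \<longrightarrow> (\<forall>k::nat. emeasure lborel {x. 2 ^ k < \<bar>u x\<bar>} \<le> ennreal (K * 2 powr (- (real k * crit))))"
proof -
  let ?N = "real DIM('a)"
  define \<theta> where "\<theta> = 2 * s / ?N"
  have N: "0 < ?N" by simp
  have \<theta>: "0 < \<theta>" "\<theta> < 1" using s dim N by (auto simp: \<theta>_def)
  \<comment> \<open>By this identity, the factor \<open>4 ^ k\<close> of the squared differences
    restores exactly the decay that is lost when the induction hypothesis is raised to the power
    \<open>\<theta>\<close>.\<close>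
  have ct: "crit * \<theta> = crit - 2" using dim N unfolding crit by (simp add: \<theta>_def field_simps)
  obtain c where c: "0 < c" "\<forall>E e x. E \<in> sets borel \<longrightarrow> emeasure lborel E = ennreal e \<longrightarrow> 0 < e \<longrightarrow>
    ennreal (c * e powr (- (2 * s / DIM('a)))) \<le> (\<integral>\<^sup>+y. ennreal (kern s (x - y)) * indicator (- E) (y::'a) \<partial>lborel)"
    using kern_compl_measure[of s, where 'a='a] s by auto
  define Q where "Q = \<bar>B\<bar> * 2 powr crit / c"
  have Q: "0 \<le> Q" using c by (simp add: Q_def)
  \<comment> \<open>The induction step turns the constant \<open>K\<close> into
    \<open>Q * K powr \<theta>\<close> with \<open>\<theta> < 1\<close>, so a large \<open>K\<close>
    reproduces itself. The entries \<open>1\<close> and the measure of \<open>\<Omega>\<close> serve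
    positivity and the base case.\<close>
  define K where "K = max (max 1 (measure lborel \<Omega>)) (Q powr (1 / (1 - \<theta>)))"
  have K: "1 \<le> K" "measure lborel \<Omega> \<le> K" by (auto simp: K_def)
  have QK: "Q * K powr \<theta> \<le> K"
  proof -
    have "Q \<le> K powr (1 - \<theta>)"
    proof (cases "Q = 0")
      case False
      have "Q = (Q powr (1 / (1 - \<theta>))) powr (1 - \<theta>)" using Q False \<theta> by (simp add: powr_powr)
      also have "\<dots> \<le> K powr (1 - \<theta>)" using \<theta> by (intro powr_mono2) (auto simp: K_def)
      finally show ?thesis .
    qed simp
    then have "Q * K powr \<theta> \<le> K powr (1 - \<theta>) * K powr \<theta>" by (intro mult_right_mono) auto
    also have "\<dots> = K" using K by (simp add: powr_add[symmetric])
    finally show ?thesis .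
  qed
  have "emeasure lborel {x. 2 ^ k < \<bar>u x\<bar>} \<le> ennreal (K * 2 powr (- (real k * crit)))"
    if u: "u \<in> H" and uB: "F u u \<le> B" for u k
  proof -
    have [measurable]: "u \<in> borel_measurable borel" using HsD(1)[OF u] .
    define D where "D k = {x. 2 ^ k < \<bar>u x\<bar>}" for k :: nat
    have Dm [measurable]: "D k \<in> sets borel" for k unfolding D_def by measurable
    have D\<Omega>: "D k \<subseteq> \<Omega>" for k using Hs_outside[OF u] by (force simp: D_def)
    have Dfin: "emeasure lborel (D k) = ennreal (measure lborel (D k))" for k
      using emeasure_mono[OF D\<Omega>, of lborel k] finite_dom by (intro emeasure_eq_ennreal_measure) auto
    define d where "d k = measure lborel (D k)" for k
    have d0: "0 \<le> d k" for k by (simp add: d_def)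
    have dmono: "d (Suc k) \<le> d k" for k
    proof -
      have "D (Suc k) \<subseteq> D k" by (auto simp: D_def)
      then have "emeasure lborel (D (Suc k)) \<le> emeasure lborel (D k)" by (intro emeasure_mono) auto
      then show ?thesis using Dfin d0 by (simp add: d_def)
    qed
    have step: "d (Suc k) * (c * d k powr (- \<theta>) * 4 ^ k) \<le> B" if dk: "0 < d k" for k
    proof -
      have "ennreal (d (Suc k) * (c * d k powr (- \<theta>) * 4 ^ k)) = ennreal (c * d k powr (- \<theta>) * 4 ^ k) * emeasure lborel (D (Suc k))"
        using c d0 unfolding Dfin d_def by (subst ennreal_mult[symmetric]) (auto simp: mult_ac)
      also have "\<dots> = (\<integral>\<^sup>+x. ennreal (c * d k powr (- \<theta>) * 4 ^ k) * indicator (D (Suc k)) x \<partial>lborel)"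
        by (rule nn_integral_cmult_indicator[symmetric]) simp
      also have "\<dots> \<le> (\<integral>\<^sup>+x. \<integral>\<^sup>+y. ennreal (kern s (x - y)) * ennreal ((dq u (x, y))\<^sup>2) \<partial>lborel \<partial>lborel)"
      proof (intro nn_integral_mono)
        fix x
        show "ennreal (c * d k powr (- \<theta>) * 4 ^ k) * indicator (D (Suc k)) x
           \<le> (\<integral>\<^sup>+y. ennreal (kern s (x - y)) * ennreal ((dq u (x, y))\<^sup>2) \<partial>lborel)"
        proof (cases "x \<in> D (Suc k)")
          case True
          have "ennreal (c * d k powr (- \<theta>) * 4 ^ k) = ennreal (4 ^ k) * ennreal (c * d k powr (- \<theta>))"
            using c by (simp add: ennreal_mult[symmetric] mult.commute)
          also have "\<dots> \<le> ennreal (4 ^ k) * (\<integral>\<^sup>+y. ennreal (kern s (x - y)) * indicator (- D k) y \<partial>lborel)"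
            using c(2)[rule_format, OF Dm[of k] Dfin[of k]] dk by (intro mult_left_mono) (auto simp: d_def \<theta>_def)
          also have "\<dots> = (\<integral>\<^sup>+y. ennreal (4 ^ k) * (ennreal (kern s (x - y)) * indicator (- D k) y) \<partial>lborel)"
            by (rule nn_integral_cmult[symmetric]) measurable
          also have "\<dots> \<le> (\<integral>\<^sup>+y. ennreal (kern s (x - y)) * ennreal ((dq u (x, y))\<^sup>2) \<partial>lborel)"
          proof (intro nn_integral_mono)
            fix y
            have "(4::real) ^ k \<le> (dq u (x, y))\<^sup>2" if "y \<notin> D k"
            proof -
              have "2 ^ k \<le> \<bar>dq u (x, y)\<bar>" using True that unfolding D_def dq_def by auto
              then have "(2 ^ k)\<^sup>2 \<le> \<bar>dq u (x, y)\<bar>\<^sup>2" by (intro power_mono) auto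
              then show ?thesis by (simp add: power_mult[symmetric] mult.commute[of k] power_mult)
            qed
            then show "ennreal (4 ^ k) * (ennreal (kern s (x - y)) * indicator (- D k) y)
               \<le> ennreal (kern s (x - y)) * ennreal ((dq u (x, y))\<^sup>2)"
              by (cases "y \<in> D k") (auto simp: mult.commute[of "ennreal (4 ^ k)"] intro!: mult_left_mono ennreal_leI)
          qed
          finally show ?thesis using True by simp
        qed simp
      qed
      also have "\<dots> = ennreal (F u u)"
        unfolding nn_integral_form[OF u, symmetric]
        by (rule nn_integral_kap[where f="\<lambda>z. ennreal ((dq u z)\<^sup>2)", symmetric]) measurable
      finally have "d (Suc k) * (c * d k powr (- \<theta>) * 4 ^ k) \<le> F u u"
        by (subst (asm) ennreal_le_iff) auto
      then show ?thesis using uB by simp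
    qed
    have "d k \<le> K * 2 powr (- (real k * crit))"
    proof (induction k)
      case 0
      have "emeasure lborel (D 0) \<le> emeasure lborel \<Omega>" using D\<Omega> by (intro emeasure_mono) auto
      also have "\<dots> = ennreal (measure lborel \<Omega>)"
        using finite_dom by (intro emeasure_eq_ennreal_measure) auto
      finally have "d 0 \<le> measure lborel \<Omega>" unfolding Dfin d_def by simp
      then show ?case using K by simp
    next
      case (Suc k)
      show ?case
      proof (cases "d k = 0")
        case True
        then show ?thesis using dmono[of k] K by (intro order_trans[OF dmono[of k]]) simp
      next
        case False
        then have dk: "0 < d k" using d0[of k] by simp
        have "d (Suc k) * (c * d k powr (- \<theta>) * 4 ^ k) \<le> \<bar>B\<bar>" using step[OF dk] by linarith
        then have "d (Suc k) \<le> \<bar>B\<bar> / c * (d k powr \<theta> / 4 ^ k)"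
          using c dk by (simp add: powr_minus field_simps)
        also have "\<dots> \<le> \<bar>B\<bar> / c * ((K * 2 powr (- (real k * crit))) powr \<theta> / 4 ^ k)"
          using c dk \<theta> Suc.IH by (intro mult_left_mono divide_right_mono powr_mono2) auto
        also have "(K * 2 powr (- (real k * crit))) powr \<theta> = K powr \<theta> * 2 powr (- (real k * (crit * \<theta>)))"
          using K by (simp add: powr_mult powr_powr mult.assoc)
        also have "2 powr (- (real k * (crit * \<theta>))) / 4 ^ k = 2 powr (- (real k * crit))"
        proof -
          have "(4::real) ^ k = 2 powr (2 * real k)" by (simp add: powr_powr[symmetric] powr_realpow)
          then have "2 powr (- (real k * (crit * \<theta>))) / 4 ^ k = 2 powr (- (real k * (crit * \<theta>)) - 2 * real k)"
            by (simp add: powr_diff)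
          also have "- (real k * (crit * \<theta>)) - 2 * real k = - (real k * crit)"
            unfolding ct by (simp add: algebra_simps)
          finally show ?thesis .
        qed
        then have "\<bar>B\<bar> / c * (K powr \<theta> * 2 powr (- (real k * (crit * \<theta>))) / 4 ^ k) = (Q * K powr \<theta>) * 2 powr (- (real (Suc k) * crit))"
        proof -
          assume *: "2 powr (- (real k * (crit * \<theta>))) / 4 ^ k = 2 powr (- (real k * crit))"
          have "2 powr (- (real k * crit)) = 2 powr crit * 2 powr (- (real (Suc k) * crit))"
            by (simp add: powr_add[symmetric] algebra_simps)
          then show ?thesis
            unfolding times_divide_eq_right[symmetric] * Q_def by simp
        qed
        also have "\<dots> \<le> K * 2 powr (- (real (Suc k) * crit))" by (intro mult_right_mono QK) auto
        finally show ?thesis .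
      qed
    qed
    then show ?thesis using Dfin[of k] by (simp add: D_def d_def ennreal_leI)
  qed
  then show ?thesis using K(1) by (intro exI[of _ K]) auto
qed

text \<open>Where \<open>\<bar>u\<bar>\<close> lies between \<open>2 ^ k\<close> and
  \<open>2 ^ (k + 1)\<close>, its power is at most \<open>2 powr ((k + 1) * p)\<close>. With the
  decay of the level sets, the sum over \<open>k\<close> is a geometric series of ratio
  \<open>2 powr (p - crit) < 1\<close>; values up to \<open>1\<close> cost the measure of
  \<open>\<Omega>\<close>.\<close>

lemma sobolev_subcritical:
  assumes p: "0 < p" and pc: "p < 2 * real DIM('a) / (real DIM('a) - 2 * s)"
  shows "\<exists>S. \<forall>u\<in>H. F u u \<le> B \<longrightarrow> integrable lborel (\<lambda>x. \<bar>u x\<bar> powr p) \<and> (\<integral>x. \<bar>u x\<bar> powr p \<partial>lborel) \<le> S"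
proof -
  define crit where "crit = 2 * real DIM('a) / (real DIM('a) - 2 * s)"
  obtain K where K: "0 < K" "\<forall>u\<in>H. F u u \<le> B \<longrightarrow> (\<forall>k::nat. emeasure lborel {x. 2 ^ k < \<bar>u x\<bar>} \<le> ennreal (K * 2 powr (- (real k * crit))))"
    using weak_sobolev[OF crit_def, of B] by blast
  let ?r = "2 powr (p - crit)"
  have r: "?r < 1" using pc unfolding crit_def by (simp add: powr_less_one)
  let ?S = "measure lborel \<Omega> + 2 powr p * K * (1 / (1 - ?r))"
  have S0: "0 \<le> ?S" using K r by (intro add_nonneg_nonneg mult_nonneg_nonneg) auto
  have "integrable lborel (\<lambda>x. \<bar>u x\<bar> powr p) \<and> (\<integral>x. \<bar>u x\<bar> powr p \<partial>lborel) \<le> ?S" if u: "u \<in> H" and uB: "F u u \<le> B" for u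
  proof -
    have [measurable]: "u \<in> borel_measurable borel" using HsD(1)[OF u] .
    define D where "D k = {x. 2 ^ k < \<bar>u x\<bar>}" for k :: nat
    have Dm [measurable]: "D k \<in> sets borel" for k unfolding D_def by measurable
    let ?g = "\<lambda>k x. ennreal (2 powr (real (Suc k) * p)) * indicator (D k) x"
    have "(\<integral>\<^sup>+x. ennreal (\<bar>u x\<bar> powr p) \<partial>lborel) \<le> (\<integral>\<^sup>+x. indicator \<Omega> x + (\<Sum>k. ?g k x) \<partial>lborel)"
    proof (intro nn_integral_mono)
      fix x
      show "ennreal (\<bar>u x\<bar> powr p) \<le> indicator \<Omega> x + (\<Sum>k. ?g k x)"
      proof (cases "\<bar>u x\<bar> \<le> 1")
        case True
        have "\<bar>u x\<bar> powr p \<le> 1" using True p by (intro powr_le1) auto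
        then have "ennreal (\<bar>u x\<bar> powr p) \<le> indicator \<Omega> x"
          using Hs_outside[OF u, of x] by (cases "x \<in> \<Omega>") auto
        then show ?thesis by (rule order_trans) simp
      next
        case False
        define k where "k = nat (\<lceil>log 2 \<bar>u x\<bar>\<rceil> - 1)"
        have l0: "0 < log 2 \<bar>u x\<bar>" using False by simp
        have k1: "real k < log 2 \<bar>u x\<bar>" "log 2 \<bar>u x\<bar> \<le> real (Suc k)"
          using l0 unfolding k_def by linarith+
        have "2 powr real k < \<bar>u x\<bar>" using k1(1) False by (subst powr_less_iff) auto
        then have xD: "x \<in> D k" by (simp add: D_def powr_realpow)
        have "\<bar>u x\<bar> \<le> 2 powr real (Suc k)" using k1(2) False by (subst le_powr_iff) auto
        then have "\<bar>u x\<bar> powr p \<le> (2 powr real (Suc k)) powr p" using p by (intro powr_mono2) auto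
        then have "ennreal (\<bar>u x\<bar> powr p) \<le> ?g k x" using xD by (simp add: powr_powr ennreal_leI del: of_nat_Suc)
        also have "?g k x = (\<Sum>k\<in>{k}. ?g k x)" by (simp del: sum_mult_indicator)
        also have "\<dots> \<le> (\<Sum>k. ?g k x)" by (rule sum_le_suminf) auto
        finally show ?thesis by (rule order_trans) simp
      qed
    qed
    also have "\<dots> = emeasure lborel \<Omega> + (\<integral>\<^sup>+x. (\<Sum>k. ?g k x) \<partial>lborel)"
      by (subst nn_integral_add) auto
    finally have le0: "(\<integral>\<^sup>+x. ennreal (\<bar>u x\<bar> powr p) \<partial>lborel) \<le> emeasure lborel \<Omega> + (\<integral>\<^sup>+x. (\<Sum>k. ?g k x) \<partial>lborel)" .
    have "(\<integral>\<^sup>+x. (\<Sum>k. ?g k x) \<partial>lborel) = (\<Sum>k. \<integral>\<^sup>+x. ?g k x \<partial>lborel)"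
      by (rule nn_integral_suminf) measurable
    also have "\<dots> \<le> (\<Sum>k. ennreal (2 powr p * K * ?r ^ k))"
    proof (intro suminf_le)
      fix k
      have "(\<integral>\<^sup>+x. ?g k x \<partial>lborel) = ennreal (2 powr (real (Suc k) * p)) * emeasure lborel (D k)"
        by (rule nn_integral_cmult_indicator) simp
      also have "\<dots> \<le> ennreal (2 powr (real (Suc k) * p)) * ennreal (K * 2 powr (- (real k * crit)))"
        using K(2) u uB unfolding D_def by (intro mult_left_mono) auto
      also have "\<dots> = ennreal (2 powr p * K * ?r ^ k)"
      proof -
        have "2 powr (real (Suc k) * p) * (K * 2 powr (- (real k * crit))) = K * 2 powr (real (Suc k) * p + - (real k * crit))"
          by (simp only: powr_add mult_ac)
        also have "real (Suc k) * p + - (real k * crit) = p + (p - crit) * real k" by (simp add: algebra_simps)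
        also have "2 powr (p + (p - crit) * real k) = 2 powr p * ?r ^ k"
          by (simp add: powr_add powr_powr[symmetric] powr_realpow)
        finally show ?thesis using K by (simp add: ennreal_mult[symmetric] mult_ac)
      qed
      finally show "(\<integral>\<^sup>+x. ?g k x \<partial>lborel) \<le> ennreal (2 powr p * K * ?r ^ k)" .
    qed auto
    also have "\<dots> = ennreal (\<Sum>k. 2 powr p * K * ?r ^ k)"
      using r K by (intro suminf_ennreal2 summable_mult summable_geometric) auto
    also have "(\<Sum>k. 2 powr p * K * ?r ^ k) = 2 powr p * K * (1 / (1 - ?r))"
      using r by (subst suminf_mult, (auto intro!: summable_geometric)[1], subst suminf_geometric) auto
    finally have "(\<integral>\<^sup>+x. (\<Sum>k. ?g k x) \<partial>lborel) \<le> ennreal (2 powr p * K * (1 / (1 - ?r)))" .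
    note order_trans[OF le0 add_left_mono[OF this]]
    also have "emeasure lborel \<Omega> = ennreal (measure lborel \<Omega>)"
      using finite_dom by (intro emeasure_eq_ennreal_measure) auto
    also have "ennreal (measure lborel \<Omega>) + ennreal (2 powr p * K * (1 / (1 - ?r))) = ennreal ?S"
      using K r by (intro ennreal_plus[symmetric]) auto
    finally have le: "(\<integral>\<^sup>+x. ennreal (\<bar>u x\<bar> powr p) \<partial>lborel) \<le> ennreal ?S" .
    have i: "integrable lborel (\<lambda>x. \<bar>u x\<bar> powr p)"
      using le by (intro integrableI_nonneg) (auto intro: le_less_trans)
    moreover have "(\<integral>\<^sup>+x. ennreal (\<bar>u x\<bar> powr p) \<partial>lborel) = ennreal (\<integral>x. \<bar>u x\<bar> powr p \<partial>lborel)"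
      using i by (intro nn_integral_eq_integral) auto
    ultimately show ?thesis using le S0 by simp
  qed
  then show ?thesis by blast
qed

end

section \<open>The first solution\<close>

lemma powr_tangent:
  fixes x y p :: real
  assumes p: "1 \<le> p" and x: "0 \<le> x" and y: "0 \<le> y"
  shows "p * x powr (p - 1) * (y - x) \<le> y powr p - x powr p"
proof -
  consider "x = 0" | "y = 0" "0 < x" | "x = y" | "0 < x" "0 < y" "x < y" | "0 < x" "0 < y" "y < x"
    using x y by fastforce
  then show ?thesis
  proof cases
    case 2
    have "x powr (p - 1) * x = x powr p" using 2 by (simp add: powr_diff)
    then have "p * x powr (p - 1) * (y - x) = - p * x powr p" using 2 by (simp add: mult.assoc)
    also have "\<dots> \<le> - 1 * x powr p" using p by (intro mult_right_mono) auto
    finally show ?thesis using 2 by simp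
  next
    case 4
    have "\<exists>z. x < z \<and> z < y \<and> y powr p - x powr p = (y - x) * (p * z powr (p - 1))"
      using 4 by (intro MVT2) (auto intro!: derivative_eq_intros)
    then obtain z where z: "x < z" "y powr p - x powr p = (y - x) * (p * z powr (p - 1))" by blast
    have "x powr (p - 1) \<le> z powr (p - 1)" using z 4 p by (intro powr_mono2) auto
    then have "(y - x) * (p * x powr (p - 1)) \<le> (y - x) * (p * z powr (p - 1))"
      using 4 p by (intro mult_left_mono) auto
    then show ?thesis using z by (simp add: mult_ac)
  next
    case 5
    have "\<exists>z. y < z \<and> z < x \<and> x powr p - y powr p = (x - y) * (p * z powr (p - 1))"
      using 5 by (intro MVT2) (auto intro!: derivative_eq_intros)
    then obtain z where z: "y < z" "z < x" "x powr p - y powr p = (x - y) * (p * z powr (p - 1))" by blast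
    have "z powr (p - 1) \<le> x powr (p - 1)" using z 5 p by (intro powr_mono2) auto
    then have "(x - y) * (p * z powr (p - 1)) \<le> (x - y) * (p * x powr (p - 1))"
      using 5 p by (intro mult_left_mono) auto
    then show ?thesis using z by (simp add: algebra_simps)
  qed (use p in auto)
qed

definition prim :: "real \<Rightarrow> real \<Rightarrow> real" where
  "prim r t = max 0 t powr (r + 1) / (r + 1)"

text \<open>The subgradient inequality for the primitive of \<open>max 0 t powr r\<close>.
  Integrated inequalities of this kind take the place of derivatives of the functionals.\<close>

lemma prim_convex:
  assumes "0 \<le> r"
  shows "max 0 x powr r * (y - x) \<le> prim r y - prim r x"
proof -
  have "(r + 1) * max 0 x powr r * (max 0 y - max 0 x) \<le> max 0 y powr (r + 1) - max 0 x powr (r + 1)"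
    using powr_tangent[of "r + 1" "max 0 x" "max 0 y"] assms by simp
  then have "max 0 x powr r * (max 0 y - max 0 x) \<le> prim r y - prim r x"
    using assms by (simp add: prim_def diff_divide_distrib[symmetric] pos_le_divide_eq mult_ac)
  moreover have "max 0 x powr r * (y - x) \<le> max 0 x powr r * (max 0 y - max 0 x)"
    by (cases "0 \<le> x") (auto intro!: mult_left_mono)
  ultimately show ?thesis by linarith
qed

lemma continuous_prim: "0 \<le> r \<Longrightarrow> isCont (prim r) t"
  unfolding isCont_def prim_def[abs_def]
  by (intro tendsto_divide tendsto_powr2 tendsto_max tendsto_const tendsto_ident_at always_eventually) auto

text \<open>
  Primitives (in \<open>t\<close>, up to a constant) of the truncated powers \<open>(max t a)\<^sup>q\<close> and
  \<open>(min t\<^sub>+ K)\<^sup>r\<close>.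
\<close>

definition prim_below :: "real \<Rightarrow> real \<Rightarrow> real \<Rightarrow> real" where
  "prim_below q a t = prim q (max t a) + a powr q * (t - max t a)"

definition prim_above :: "real \<Rightarrow> real \<Rightarrow> real \<Rightarrow> real" where
  "prim_above r K t = prim r (min t K) + K powr r * (t - min t K)"

text \<open>The truncated power is still nondecreasing in \<open>t\<close>, so its primitive is
  convex. The increment is split into that of the clamped variable \<open>max t a\<close>, where
  \<open>prim_convex\<close> applies, and the remaining increment below \<open>a\<close>, where the
  primitive is affine.\<close>

lemma prim_below_convex:
  assumes "0 \<le> q" "0 \<le> a"
  shows "max x a powr q * (y - x) \<le> prim_below q a y - prim_below q a x"
proof -
  have "max x a powr q * (max y a - max x a) \<le> prim q (max y a) - prim q (max x a)"
    using prim_convex[OF assms(1), of "max x a" "max y a"] assms max_absorb2[of 0 "max x a"] by simp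
  moreover have "max x a powr q * (y - x - (max y a - max x a)) \<le> a powr q * (y - x - (max y a - max x a))"
  proof (cases "x \<le> a")
    case False
    have "a powr q \<le> x powr q" using assms False by (intro powr_mono2) auto
    then show ?thesis using False by (intro mult_right_mono_neg) (auto simp: max_def)
  qed (simp add: max_def)
  ultimately show ?thesis by (simp add: prim_below_def algebra_simps)
qed

lemma prim_above_convex:
  assumes "0 \<le> r" "0 \<le> K"
  shows "min (max 0 x) K powr r * (y - x) \<le> prim_above r K y - prim_above r K x"
proof -
  have e: "min (max 0 x) K = max 0 (min x K)" using assms by (auto simp: min_def max_def)
  have "max 0 (min x K) powr r * (min y K - min x K) \<le> prim r (min y K) - prim r (min x K)"
    using prim_convex[OF assms(1)] .
  moreover have "max 0 (min x K) powr r * (y - x - (min y K - min x K)) \<le> K powr r * (y - x - (min y K - min x K))"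
  proof (cases "x \<le> K")
    case True
    have "max 0 (min x K) powr r \<le> K powr r" using assms True by (intro powr_mono2) auto
    then show ?thesis using True by (intro mult_right_mono) (auto simp: min_def)
  qed (use assms in \<open>simp add: min_def max_def\<close>)
  ultimately show ?thesis unfolding e by (simp add: prim_above_def algebra_simps)
qed

lemma continuous_prim_below: "0 \<le> q \<Longrightarrow> isCont (prim_below q a) t"
  unfolding prim_below_def[abs_def]
  by (intro continuous_intros isCont_o2[OF _ continuous_prim]) auto

lemma continuous_prim_above: "0 \<le> r \<Longrightarrow> isCont (prim_above r K) t"
  unfolding prim_above_def[abs_def]
  by (intro continuous_intros isCont_o2[OF _ continuous_prim]) auto

lemma borel_measurable_prim [measurable]: "prim r \<in> borel_measurable borel"
  unfolding prim_def[abs_def] by measurable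

lemma powr_add_le:
  fixes x y p :: real
  assumes "0 \<le> x" "0 \<le> y" "0 \<le> p"
  shows "(x + y) powr p \<le> 2 powr p * (x powr p + y powr p)"
proof -
  have "(x + y) powr p \<le> (2 * max x y) powr p" using assms by (intro powr_mono2) auto
  also have "\<dots> = 2 powr p * max x y powr p" using assms by (simp add: powr_mult)
  also have "max x y powr p \<le> x powr p + y powr p" by (simp add: max_def)
  finally show ?thesis by simp
qed

lemma prim_below_bound:
  assumes q: "0 \<le> q" "q \<le> 1" and a: "0 \<le> a"
  shows "\<bar>prim_below q a t\<bar> \<le> 8 * \<bar>t\<bar> powr (q + 1) + 8 * a powr (q + 1)"
proof -
  let ?m = "\<bar>t\<bar> + a"
  have m1: "\<bar>prim q (max t a)\<bar> \<le> ?m powr (q + 1)"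
  proof -
    have "prim q (max t a) \<le> max 0 (max t a) powr (q + 1)"
      using mult_left_mono[of 1 "q + 1" "max 0 (max t a) powr (q + 1)"] q by (simp add: prim_def divide_le_eq)
    also have "\<dots> \<le> ?m powr (q + 1)" using q a by (intro powr_mono2) auto
    finally show ?thesis using q by (simp add: prim_def)
  qed
  have "\<bar>a powr q * (t - max t a)\<bar> = a powr q * \<bar>t - max t a\<bar>" by (simp add: abs_mult)
  also have "\<dots> \<le> ?m powr q * ?m"
    using a q by (intro mult_mono powr_mono2) auto
  also have "\<dots> = ?m powr (q + 1)"
    using a by (cases "?m = 0") (auto simp: powr_add)
  finally have "\<bar>prim_below q a t\<bar> \<le> 2 * ?m powr (q + 1)"
    using m1 unfolding prim_below_def by linarith
  also have "?m powr (q + 1) \<le> 2 powr (q + 1) * (\<bar>t\<bar> powr (q + 1) + a powr (q + 1))"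
    using a q by (intro powr_add_le) auto
  also have "2 powr (q + 1) \<le> (2::real) powr 2" using q by (intro powr_mono) auto
  then have "2 powr (q + 1) * (\<bar>t\<bar> powr (q + 1) + a powr (q + 1)) \<le> 4 * (\<bar>t\<bar> powr (q + 1) + a powr (q + 1))"
    by (intro mult_right_mono) auto
  finally show ?thesis by simp
qed

lemma prim_above_bound:
  assumes "0 \<le> r" "0 \<le> K"
  shows "\<bar>prim_above r K t\<bar> \<le> K powr r * \<bar>t\<bar>"
proof -
  have P0: "prim r 0 = 0" "prim_above r K 0 = 0" using assms by (auto simp: prim_def prim_above_def min_def)
  have lo: "0 \<le> prim_above r K t"
    using prim_above_convex[OF assms, of 0 t] assms P0 by (simp add: min_def)
  have "min (max 0 t) K powr r * (0 - t) \<le> - prim_above r K t"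
    using prim_above_convex[OF assms, of t 0] P0 by simp
  then have "prim_above r K t \<le> min (max 0 t) K powr r * t" by simp
  also have "\<dots> \<le> min (max 0 t) K powr r * \<bar>t\<bar>" by (intro mult_left_mono) auto
  also have "\<dots> \<le> K powr r * \<bar>t\<bar>"
    using assms by (intro mult_right_mono powr_mono2) auto
  finally show ?thesis using lo by simp
qed

lemma pos_part_mult_le:
  fixes x y :: real
  shows "(max 0 x - max 0 y) * (max 0 x - max 0 y) \<le> (x - y) * (max 0 x - max 0 y)"
  by (cases "0 \<le> x"; cases "0 \<le> y")
    (auto simp: max_def algebra_simps mult_nonneg_nonpos mult_nonpos_nonneg not_le)

section \<open>Continuity of integral functionals, direct method and comparison\<close>

context fractional_domain begin

lemma crit_gt_2: "2 < 2 * real DIM('a) / (real DIM('a) - 2 * s)"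
  using s dim by (simp add: field_simps)

lemma Hs_abs: "u \<in> H \<Longrightarrow> (\<lambda>x. \<bar>u x\<bar>) \<in> H"
  by (rule Hs_lipschitz[where L=1]) auto

text \<open>An exponent \<open>p\<close> strictly between \<open>a\<close> and the critical exponent
  has bounded integrals by the Sobolev bound and dominates the growth. The functional is therefore
  continuous along sequences of bounded energy that converge almost everywhere, without strong
  convergence.\<close>

lemma nemytskii:
  fixes g :: "'a \<Rightarrow> real \<Rightarrow> real"
  assumes a: "0 \<le> a" "a < 2 * real DIM('a) / (real DIM('a) - 2 * s)" and A: "0 \<le> A" and h: "integrable lborel h"
    and meas: "\<And>u. u \<in> borel_measurable borel \<Longrightarrow> (\<lambda>x. g x (u x)) \<in> borel_measurable borel"
    and cont: "\<And>x t. isCont (g x) t"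
    and bound: "\<And>x t. \<bar>g x t\<bar> \<le> A * \<bar>t\<bar> powr a + h x"
  shows nemytskii_integrable: "u \<in> H \<Longrightarrow> integrable lborel (\<lambda>x. g x (u x))"
    and nemytskii_tendsto: "(\<And>n. v n \<in> H) \<Longrightarrow> (\<And>n. F (v n) (v n) \<le> B) \<Longrightarrow> AE x in lborel. (\<lambda>n. v n x) \<longlonglongrightarrow> u x \<Longrightarrow> u \<in> H
      \<Longrightarrow> (\<lambda>n. \<integral>x. g x (v n x) \<partial>lborel) \<longlonglongrightarrow> (\<integral>x. g x (u x) \<partial>lborel)"
proof -
  obtain p where p: "max a 1 < p" "p < 2 * real DIM('a) / (real DIM('a) - 2 * s)"
    using dense[of "max a 1"] a(2) crit_gt_2 by force
  then have p': "0 < p" "a < p" by auto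
  have main: "(\<lambda>n. \<integral>x. g x (v n x) \<partial>lborel) \<longlonglongrightarrow> (\<integral>x. g x (u x) \<partial>lborel)" "integrable lborel (\<lambda>x. g x (u x))"
    if v: "\<And>n. v n \<in> H" and B: "\<And>n. F (v n) (v n) \<le> B" and lim: "AE x in lborel. (\<lambda>n. v n x) \<longlonglongrightarrow> u x" and u: "u \<in> H"
    for v u B
  proof -
    obtain S1 where S1: "\<forall>u\<in>H. F u u \<le> B \<longrightarrow> integrable lborel (\<lambda>x. \<bar>u x\<bar> powr p) \<and> (\<integral>x. \<bar>u x\<bar> powr p \<partial>lborel) \<le> S1"
      using sobolev_subcritical[OF p'(1) p(2)] by blast
    have uB: "F u u \<le> B" by (rule Hs_limit(2)[OF v B lim HsD(1,2)[OF u]])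
    have m: "(\<lambda>x. g x (v n x)) \<in> borel_measurable lborel" for n using meas[OF HsD(1)[OF v]] by simp
    have mu: "(\<lambda>x. g x (u x)) \<in> borel_measurable lborel" using meas[OF HsD(1)[OF u]] by simp
    have l: "AE x in lborel. (\<lambda>n. g x (v n x)) \<longlonglongrightarrow> g x (u x)"
      using lim by eventually_elim (rule isCont_tendsto_compose[OF cont])
    have i: "\<And>n. integrable lborel (\<lambda>x. \<bar>v n x\<bar> powr p)" "\<And>n. (\<integral>x. \<bar>v n x\<bar> powr p \<partial>lborel) \<le> S1"
      "integrable lborel (\<lambda>x. \<bar>u x\<bar> powr p)"
      using S1 v B u uB by auto
    have b: "\<And>n x. \<bar>g x (v n x)\<bar> \<le> A * \<bar>v n x\<bar> powr a + h x" "\<And>x. \<bar>g x (u x)\<bar> \<le> A * \<bar>u x\<bar> powr a + h x"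
      using bound by auto
    show "(\<lambda>n. \<integral>x. g x (v n x) \<partial>lborel) \<longlonglongrightarrow> (\<integral>x. g x (u x) \<partial>lborel)" "integrable lborel (\<lambda>x. g x (u x))"
      using subcritical_integral_tendsto(1,2)[OF m mu l sets_dom finite_dom _ _ a(1) p'(2) A h i b] Hs_outside[OF v] Hs_outside[OF u]
      by auto
  qed
  show "u \<in> H \<Longrightarrow> integrable lborel (\<lambda>x. g x (u x))"
    using main(2)[of "\<lambda>_. u" "F u u" u] by auto
  show "(\<And>n. v n \<in> H) \<Longrightarrow> (\<And>n. F (v n) (v n) \<le> B) \<Longrightarrow> AE x in lborel. (\<lambda>n. v n x) \<longlonglongrightarrow> u x \<Longrightarrow> u \<in> H
      \<Longrightarrow> (\<lambda>n. \<integral>x. g x (v n x) \<partial>lborel) \<longlonglongrightarrow> (\<integral>x. g x (u x) \<partial>lborel)"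
    by (rule main(1))
qed

lemma Hs_powr_integrable:
  assumes "0 \<le> a" "a < 2 * real DIM('a) / (real DIM('a) - 2 * s)" "u \<in> H"
  shows "integrable lborel (\<lambda>x. \<bar>u x\<bar> powr a)"
proof (cases "a = 0")
  case True
  have "(\<lambda>x. \<bar>u x\<bar> powr a) = indicator {x. u x \<noteq> 0}" by (auto simp: True indicator_def)
  moreover have "{x. u x \<noteq> 0} \<in> sets borel" using HsD(1)[OF assms(3)] by measurable
  moreover have "emeasure lborel {x. u x \<noteq> 0} \<le> emeasure lborel \<Omega>"
    using Hs_outside[OF assms(3)] by (intro emeasure_mono) auto
  ultimately show ?thesis using finite_dom by (auto simp: integrable_indicator_iff intro: le_less_trans)
next
  case False
  show ?thesis
    by (rule nemytskii_integrable[where g="\<lambda>_ t. \<bar>t\<bar> powr a" and A=1 and h="\<lambda>_. 0", OF assms(1,2) _ _ _ _ _ assms(3)])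
      (use False assms(1) in \<open>auto simp: isCont_def intro!: tendsto_powr2 tendsto_rabs\<close>)
qed

text \<open>A power below \<open>2\<close> is at most a small multiple of the square plus a constant
  on \<open>\<Omega>\<close>, and the square is controlled by the energy through the Poincare
  inequality.\<close>

lemma power_growth:
  assumes a: "0 \<le> a" "a < 2" and \<tau>: "0 < \<tau>"
  shows "\<exists>C. \<forall>u\<in>H. (\<integral>x. \<bar>u x\<bar> powr a \<partial>lborel) \<le> \<tau> * F u u + C"
proof -
  obtain cP where cP: "0 < cP" "\<forall>u\<in>H. cP * (\<integral>x. (u x)\<^sup>2 \<partial>lborel) \<le> F u u"
    using poincare by blast
  define \<sigma> where "\<sigma> = \<tau> * cP"
  have \<sigma>: "0 < \<sigma>" using \<tau> cP by (simp add: \<sigma>_def)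
  define c where "c = (\<sigma> powr (1 / (a - 2))) powr a"
  have "(\<integral>x. \<bar>u x\<bar> powr a \<partial>lborel) \<le> \<tau> * F u u + c * measure lborel \<Omega>" if u: "u \<in> H" for u
  proof -
    have "(\<integral>x. \<bar>u x\<bar> powr a \<partial>lborel) \<le> (\<integral>x. \<sigma> * (u x)\<^sup>2 + c * indicator \<Omega> x \<partial>lborel)"
    proof (intro integral_mono)
      show "integrable lborel (\<lambda>x. \<bar>u x\<bar> powr a)" using Hs_powr_integrable[OF a(1) _ u] a crit_gt_2 by auto
      show "integrable lborel (\<lambda>x. \<sigma> * (u x)\<^sup>2 + c * indicator \<Omega> x)"
        using Hs_L2[OF u] integrable_indicator_dom by auto
      fix x
      show "\<bar>u x\<bar> powr a \<le> \<sigma> * (u x)\<^sup>2 + c * indicator \<Omega> x"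
        using powr_young[OF a \<sigma>, of "\<bar>u x\<bar>"] Hs_outside[OF u, of x]
        by (cases "x \<in> \<Omega>") (auto simp: c_def)
    qed
    also have "\<dots> = \<sigma> * (\<integral>x. (u x)\<^sup>2 \<partial>lborel) + c * measure lborel \<Omega>"
      using Hs_L2[OF u] integrable_indicator_dom by simp
    also have "\<sigma> * (\<integral>x. (u x)\<^sup>2 \<partial>lborel) \<le> \<tau> * F u u"
      using mult_left_mono[OF cP(2)[rule_format, OF u], of \<tau>] \<tau> by (simp add: \<sigma>_def mult.assoc)
    finally show ?thesis by simp
  qed
  then show ?thesis by blast
qed

text \<open>The direct method: \<open>grow\<close> bounds the functional from below by a quarter of
  the energy minus \<open>C\<close>, so a minimizing sequence has bounded energy; along a convergent
  subsequence \<open>\<Phi>\<close> is continuous and the energy lower semicontinuous.\<close>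

lemma exists_minimizer:
  assumes grow: "\<forall>u\<in>H. \<Phi> u \<le> F u u / 4 + C"
    and cont: "\<And>v u B. (\<And>n. v n \<in> H) \<Longrightarrow> (\<And>n. F (v n) (v n) \<le> B) \<Longrightarrow> AE x in lborel. (\<lambda>n. v n x) \<longlonglongrightarrow> u x \<Longrightarrow> u \<in> H
      \<Longrightarrow> (\<lambda>n. \<Phi> (v n)) \<longlonglongrightarrow> \<Phi> u"
  shows "\<exists>u\<in>H. \<forall>v\<in>H. F u u / 2 - \<Phi> u \<le> F v v / 2 - \<Phi> v"
proof -
  define J where "J u = F u u / 2 - \<Phi> u" for u
  have lb: "F u u / 4 - C \<le> J u" if "u \<in> H" for u using grow that by (force simp: J_def)
  have "(\<lambda>_. 0) \<in> H" by (auto simp: Hs_def dq_def)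
  then have ne: "J ` H \<noteq> {}" by blast
  have bb: "bdd_below (J ` H)"
  proof (rule bdd_belowI2)
    fix u assume "u \<in> H"
    then show "- C \<le> J u" using lb[of u] form_nonneg[of s u] by linarith
  qed
  define m where "m = Inf (J ` H)"
  have "\<exists>u\<in>H. J u < m + 1 / real (Suc n)" for n
    using cInf_lessD[OF ne, of "m + 1 / real (Suc n)"] by (auto simp: m_def)
  then obtain v where v: "\<And>n. v n \<in> H" "\<And>n. J (v n) < m + 1 / real (Suc n)" by metis
  have mJ: "m \<le> J u" if "u \<in> H" for u unfolding m_def using bb that by (intro cInf_lower) auto
  have B: "F (v n) (v n) \<le> 4 * (m + 1 + C)" for n
  proof -
    have "J (v n) < m + 1" using v(2)[of n] by (rule less_le_trans) simp
    then have "F (v n) (v n) / 4 - C < m + 1" using lb[OF v(1)[of n]] by (rule le_less_trans[rotated])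
    then show ?thesis by (simp add: field_simps)
  qed
  obtain r u where r: "strict_mono (r :: nat \<Rightarrow> nat)" "u \<in> H" "AE x in lborel. (\<lambda>n. v (r n) x) \<longlonglongrightarrow> u x"
    using Hs_compact[of v, OF v(1) B] by (elim exE conjE) (rule that)
  have Jm: "(\<lambda>n. J (v n)) \<longlonglongrightarrow> m"
  proof (rule tendsto_sandwich[of "\<lambda>_. m" _ _ "\<lambda>n. m + 1 / real (Suc n)"])
    show "(\<lambda>n. m + 1 / real (Suc n)) \<longlonglongrightarrow> m"
      using tendsto_add[OF tendsto_const LIMSEQ_inverse_real_of_nat, of m] by (simp add: inverse_eq_divide)
    show "(\<lambda>_. m) \<longlonglongrightarrow> m" by simp
    show "\<forall>\<^sub>F n in sequentially. m \<le> J (v n)" using mJ v(1) by simp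
    show "\<forall>\<^sub>F n in sequentially. J (v n) \<le> m + 1 / real (Suc n)" using v(2) by (intro always_eventually allI less_imp_le)
  qed
  have \<Phi>: "(\<lambda>n. \<Phi> (v (r n))) \<longlonglongrightarrow> \<Phi> u" by (rule cont[of "\<lambda>n. v (r n)", OF v(1) B r(3) r(2)])
  have "(\<lambda>n. 2 * (J (v (r n)) + \<Phi> (v (r n)))) \<longlonglongrightarrow> 2 * (m + \<Phi> u)"
    using LIMSEQ_subseq_LIMSEQ[OF Jm r(1)] \<Phi> by (intro tendsto_intros) (auto simp: o_def)
  then have "(\<lambda>n. F (v (r n)) (v (r n))) \<longlonglongrightarrow> 2 * (m + \<Phi> u)" by (simp add: J_def)
  then have "F u u \<le> 2 * (m + \<Phi> u)" by (rule Hs_limit_le[of "\<lambda>n. v (r n)", OF v(1) _ r(3) HsD(1,2)[OF r(2)]])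
  then have "J u \<le> m" by (simp add: J_def)
  then show ?thesis using r(2) mJ order_trans unfolding J_def by blast
qed

text \<open>The hypothesis \<open>conv\<close> says that \<open>l\<close> is a subgradient of
  \<open>\<Phi>\<close> in the direction \<open>\<phi>\<close>. Minimality then makes
  \<open>t * (F u \<phi> - l) + t\<^sup>2 / 2 * F \<phi> \<phi>\<close> nonnegative for
  \<open>t\<close> of both signs, so the linear coefficient is \<open>0\<close>.\<close>

lemma minimizer_equation:
  assumes u: "u \<in> H" and \<phi>: "\<phi> \<in> H" and min: "\<forall>v\<in>H. F u u / 2 - \<Phi> u \<le> F v v / 2 - \<Phi> v"
    and conv: "\<And>t. t * l \<le> \<Phi> (\<lambda>x. u x + t * \<phi> x) - \<Phi> u"
  shows "F u \<phi> = l"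
proof -
  define d where "d = F u \<phi> - l"
  have *: "0 \<le> t * d + t\<^sup>2 / 2 * F \<phi> \<phi>" for t
  proof -
    have "F u u / 2 - \<Phi> u \<le> F (\<lambda>x. u x + t * \<phi> x) (\<lambda>x. u x + t * \<phi> x) / 2 - \<Phi> (\<lambda>x. u x + t * \<phi> x)"
      using min Hs_add[OF u Hs_cmult[OF \<phi>]] by blast
    also have "\<dots> \<le> F u u / 2 + t * F u \<phi> + t\<^sup>2 / 2 * F \<phi> \<phi> - \<Phi> u - t * l"
      using conv[of t] form_add_scaled[OF u \<phi>, of t] by (simp add: add_divide_distrib)
    finally show ?thesis by (simp add: d_def algebra_simps)
  qed
  have "d = 0"
  proof (rule ccontr)
    assume "d \<noteq> 0"
    \<comment> \<open>Adding \<open>1\<close> to \<open>F \<phi> \<phi>\<close> makes the quadratic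
      coefficient positive, so that the minimizing value \<open>t = - d / a\<close> exists even if
      \<open>\<phi>\<close> has energy \<open>0\<close>.\<close>
    define a where "a = F \<phi> \<phi> + 1"
    have a: "0 < a" "F \<phi> \<phi> \<le> a" using form_nonneg[of s \<phi>] unfolding a_def by linarith+
    define t where "t = - d / a"
    have "t * d + t\<^sup>2 / 2 * F \<phi> \<phi> \<le> t * d + t\<^sup>2 / 2 * a"
      using a by (intro add_left_mono mult_left_mono) auto
    also have "\<dots> = - (d\<^sup>2 / (2 * a))"
      using a by (simp add: t_def power2_eq_square field_simps)
    also have "\<dots> < 0" using a \<open>d \<noteq> 0\<close> by simp
    finally show False using *[of t] by linarith
  qed
  then show ?thesis by (simp add: d_def)
qed

text \<open>The positive part \<open>p\<close> of \<open>w - u\<close> satisfies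
  \<open>F p p \<le> F w p - F u p\<close>, as taking positive parts can only lower the product of
  differences. The hypothesis then leaves \<open>p\<close> with energy \<open>0\<close>.\<close>

lemma comparison:
  assumes w: "w \<in> H" and u: "u \<in> H" and le: "F w (\<lambda>x. max 0 (w x - u x)) \<le> F u (\<lambda>x. max 0 (w x - u x))"
  shows "AE x in lborel. w x \<le> u x"
proof -
  let ?z = "\<lambda>x. w x - u x"
  let ?p = "\<lambda>x. max 0 (w x - u x)"
  have z: "?z \<in> H" by (rule Hs_diff[OF w u])
  have p: "?p \<in> H" by (rule Hs_pos_part[OF z])
  have "F ?p ?p \<le> F ?z ?p"
    unfolding form_def
  proof (intro integral_mono Hs_integrable_mult[OF p p] Hs_integrable_mult[OF z p])
    fix a
    show "dq ?p a * dq ?p a \<le> dq ?z a * dq ?p a"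
      unfolding dq_def by (rule pos_part_mult_le)
  qed
  also have "\<dots> = F w ?p - F u ?p" by (rule form_diff[OF w u p])
  finally have "AE x in lborel. ?p x = 0" using le by (intro Hs_zero_of_form[OF p]) simp
  then show ?thesis by eventually_elim (simp add: max_def split: if_splits)
qed

end

lemma powr_le_1_plus:
  fixes t q :: real
  assumes "0 \<le> t" "0 \<le> q" "q \<le> 1"
  shows "t powr q \<le> 1 + t"
proof (cases "t \<le> 1")
  case True
  then have "t powr q \<le> 1" using assms by (intro powr_le1) auto
  then show ?thesis using assms by linarith
next
  case False
  then have "t powr q \<le> t powr 1" using assms by (intro powr_mono) auto
  then show ?thesis using False by simp
qed

section \<open>Subsolutions and the truncated problem\<close>

context fractional_domain begin

definition weak_sub :: "real \<Rightarrow> real \<Rightarrow> ('a \<Rightarrow> real) \<Rightarrow> bool" where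
  "weak_sub q lam w \<longleftrightarrow> w \<in> H \<and> (\<forall>x\<in>\<Omega>. 0 < w x) \<and>
     (\<forall>\<phi>\<in>H. (\<forall>x. 0 \<le> \<phi> x) \<longrightarrow> F w \<phi> \<le> lam * (\<integral>x. (w x powr q - 1) * \<phi> x \<partial>lborel))"

text \<open>The normalizing constant is not part of \<open>F\<close>, so \<open>lam\<close> and
  \<open>\<mu>\<close> stand for the original parameters divided by \<open>C_const\<close>.
  Positivity is left to a separate comparison with a subsolution.\<close>

definition solves :: "real \<Rightarrow> real \<Rightarrow> real \<Rightarrow> real \<Rightarrow> ('a \<Rightarrow> real) \<Rightarrow> bool" where
  "solves q r lam \<mu> u \<longleftrightarrow> u \<in> H \<and>
     (\<forall>\<phi>\<in>H. F u \<phi> = lam * (\<integral>x. (u x powr q - 1) * \<phi> x \<partial>lborel) + \<mu> * (\<integral>x. u x powr r * \<phi> x \<partial>lborel))"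

lemma weak_subD:
  assumes "weak_sub q lam w"
  shows "w \<in> H" "\<And>x. x \<in> \<Omega> \<Longrightarrow> 0 < w x" "\<And>x. 0 \<le> w x"
    "\<And>\<phi>. \<phi> \<in> H \<Longrightarrow> (\<And>x. 0 \<le> \<phi> x) \<Longrightarrow> F w \<phi> \<le> lam * (\<integral>x. (w x powr q - 1) * \<phi> x \<partial>lborel)"
proof -
  show w: "w \<in> H" "\<And>x. x \<in> \<Omega> \<Longrightarrow> 0 < w x"
    "\<And>\<phi>. \<phi> \<in> H \<Longrightarrow> (\<And>x. 0 \<le> \<phi> x) \<Longrightarrow> F w \<phi> \<le> lam * (\<integral>x. (w x powr q - 1) * \<phi> x \<partial>lborel)"
    using assms by (auto simp: weak_sub_def)
  show "0 \<le> w x" for x using w(2)[of x] Hs_outside[OF w(1), of x] by (cases "x \<in> \<Omega>") auto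
qed

lemma integrable_sublinear:
  assumes q: "0 \<le> q" "q \<le> 1" and u: "u \<in> H" and w: "w \<in> H" "\<And>x. 0 \<le> w x" and \<phi>: "\<phi> \<in> H"
  shows "integrable lborel (\<lambda>x. max (u x) (w x) powr q * \<phi> x)"
proof (rule Bochner_Integration.integrable_bound)
  have [measurable]: "u \<in> borel_measurable borel" "w \<in> borel_measurable borel" "\<phi> \<in> borel_measurable borel"
    using HsD(1) u w \<phi> by blast+
  show "(\<lambda>x. max (u x) (w x) powr q * \<phi> x) \<in> borel_measurable lborel" by measurable
  show "integrable lborel (\<lambda>x. \<bar>\<phi> x\<bar> + \<bar>u x\<bar> * \<bar>\<phi> x\<bar> + \<bar>w x\<bar> * \<bar>\<phi> x\<bar>)"
    using Hs_L1[OF \<phi>] Hs_mult_L1[OF Hs_abs[OF u] Hs_abs[OF \<phi>]] Hs_mult_L1[OF Hs_abs[OF w(1)] Hs_abs[OF \<phi>]]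
    by (intro Bochner_Integration.integrable_add integrable_abs)
  show "AE x in lborel. norm (max (u x) (w x) powr q * \<phi> x) \<le> norm (\<bar>\<phi> x\<bar> + \<bar>u x\<bar> * \<bar>\<phi> x\<bar> + \<bar>w x\<bar> * \<bar>\<phi> x\<bar>)"
  proof (intro AE_I2)
    fix x
    have "max (u x) (w x) powr q \<le> 1 + max (u x) (w x)"
      using w(2)[of x] q by (intro powr_le_1_plus) auto
    also have "\<dots> \<le> 1 + \<bar>u x\<bar> + \<bar>w x\<bar>" by (auto simp: max_def)
    finally have "max (u x) (w x) powr q * \<bar>\<phi> x\<bar> \<le> (1 + \<bar>u x\<bar> + \<bar>w x\<bar>) * \<bar>\<phi> x\<bar>"
      by (intro mult_right_mono) auto
    then show "norm (max (u x) (w x) powr q * \<phi> x) \<le> norm (\<bar>\<phi> x\<bar> + \<bar>u x\<bar> * \<bar>\<phi> x\<bar> + \<bar>w x\<bar> * \<bar>\<phi> x\<bar>)"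
      by (simp add: abs_mult distrib_right)
  qed
qed

lemma integrable_powr_weight:
  assumes q: "0 \<le> q" "q \<le> 1" and w: "w \<in> H" "\<And>x. 0 \<le> w x" and \<phi>: "\<phi> \<in> H"
  shows "integrable lborel (\<lambda>x. w x powr q * \<phi> x)"
  using integrable_sublinear[OF q w(1) w \<phi>] by simp

lemma integrable_capped:
  assumes r: "0 \<le> r" and K: "0 \<le> K" and u: "u \<in> H" and \<phi>: "\<phi> \<in> H"
  shows "integrable lborel (\<lambda>x. min (max 0 (u x)) K powr r * \<phi> x)"
proof (rule Bochner_Integration.integrable_bound)
  have [measurable]: "u \<in> borel_measurable borel" "\<phi> \<in> borel_measurable borel"
    using HsD(1) u \<phi> by blast+
  show "(\<lambda>x. min (max 0 (u x)) K powr r * \<phi> x) \<in> borel_measurable lborel" by measurable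
  show "integrable lborel (\<lambda>x. K powr r * \<phi> x)" using Hs_L1[OF \<phi>] by auto
  show "AE x in lborel. norm (min (max 0 (u x)) K powr r * \<phi> x) \<le> norm (K powr r * \<phi> x)"
    using r K by (intro AE_I2) (auto simp: abs_mult intro!: mult_right_mono powr_mono2)
qed

text \<open>Truncating at a function \<open>w\<close> of finite energy costs only the integrable
  term \<open>w powr (q + 1)\<close>, and \<open>q + 1 < 2\<close> makes the functional grow more
  slowly than any multiple of the energy.\<close>

lemma sublinear_primitive:
  assumes q: "0 \<le> q" "q < 1" and w: "w \<in> H" "\<And>x. 0 \<le> w x"
  shows sublinear_primitive_integrable: "u \<in> H \<Longrightarrow> integrable lborel (\<lambda>x. prim_below q (w x) (u x))"
    and sublinear_primitive_tendsto: "(\<And>n. v n \<in> H) \<Longrightarrow> (\<And>n. F (v n) (v n) \<le> B) \<Longrightarrow> AE x in lborel. (\<lambda>n. v n x) \<longlonglongrightarrow> u x \<Longrightarrow> u \<in> H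
      \<Longrightarrow> (\<lambda>n. \<integral>x. prim_below q (w x) (v n x) \<partial>lborel) \<longlonglongrightarrow> (\<integral>x. prim_below q (w x) (u x) \<partial>lborel)"
    and sublinear_primitive_growth: "0 < \<tau> \<Longrightarrow> \<exists>C. \<forall>u\<in>H. \<bar>\<integral>x. prim_below q (w x) (u x) \<partial>lborel\<bar> \<le> \<tau> * F u u + C"
    and sublinear_primitive_convex: "u \<in> H \<Longrightarrow> \<phi> \<in> H \<Longrightarrow> t * (\<integral>x. max (u x) (w x) powr q * \<phi> x \<partial>lborel)
      \<le> (\<integral>x. prim_below q (w x) (u x + t * \<phi> x) \<partial>lborel) - (\<integral>x. prim_below q (w x) (u x) \<partial>lborel)"
proof -
  have [measurable]: "w \<in> borel_measurable borel" using HsD(1)[OF w(1)] .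
  have q1: "0 \<le> q + 1" "q + 1 < 2 * real DIM('a) / (real DIM('a) - 2 * s)" using q crit_gt_2 by linarith+
  have iw: "integrable lborel (\<lambda>x. 8 * w x powr (q + 1))"
    using Hs_powr_integrable[OF q1 w(1)] w(2) by simp
  have m: "(\<lambda>x. prim_below q (w x) (u x)) \<in> borel_measurable borel" if [measurable]: "u \<in> borel_measurable borel" for u
    unfolding prim_below_def by measurable
  have c: "isCont (prim_below q (w x)) t" for x t by (rule continuous_prim_below[OF q(1)])
  have b: "\<bar>prim_below q (w x) t\<bar> \<le> 8 * \<bar>t\<bar> powr (q + 1) + 8 * w x powr (q + 1)" for x t
    using q w(2) by (intro prim_below_bound) auto
  show i: "u \<in> H \<Longrightarrow> integrable lborel (\<lambda>x. prim_below q (w x) (u x))" for u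
    by (rule nemytskii_integrable[where g="\<lambda>x. prim_below q (w x)", OF q1 _ iw m c b]) auto
  show "(\<And>n. v n \<in> H) \<Longrightarrow> (\<And>n. F (v n) (v n) \<le> B) \<Longrightarrow> AE x in lborel. (\<lambda>n. v n x) \<longlonglongrightarrow> u x \<Longrightarrow> u \<in> H
      \<Longrightarrow> (\<lambda>n. \<integral>x. prim_below q (w x) (v n x) \<partial>lborel) \<longlonglongrightarrow> (\<integral>x. prim_below q (w x) (u x) \<partial>lborel)"
    by (rule nemytskii_tendsto[where g="\<lambda>x. prim_below q (w x)", OF q1 _ iw m c b]) auto
  show "\<exists>C. \<forall>u\<in>H. \<bar>\<integral>x. prim_below q (w x) (u x) \<partial>lborel\<bar> \<le> \<tau> * F u u + C" if \<tau>: "0 < \<tau>"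
  proof -
    obtain C where C: "\<forall>u\<in>H. (\<integral>x. \<bar>u x\<bar> powr (q + 1) \<partial>lborel) \<le> \<tau> / 8 * F u u + C"
      using power_growth[of "q + 1" "\<tau> / 8"] q \<tau> by auto
    have "\<bar>\<integral>x. prim_below q (w x) (u x) \<partial>lborel\<bar> \<le> \<tau> * F u u + (8 * C + (\<integral>x. 8 * w x powr (q + 1) \<partial>lborel))" if u: "u \<in> H" for u
    proof -
      have iu: "integrable lborel (\<lambda>x. \<bar>u x\<bar> powr (q + 1))" by (rule Hs_powr_integrable[OF q1 u])
      have "\<bar>\<integral>x. prim_below q (w x) (u x) \<partial>lborel\<bar> \<le> (\<integral>x. \<bar>prim_below q (w x) (u x)\<bar> \<partial>lborel)"
        using integral_norm_bound[of lborel "\<lambda>x. prim_below q (w x) (u x)"] by simp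
      also have "\<dots> \<le> (\<integral>x. 8 * \<bar>u x\<bar> powr (q + 1) + 8 * w x powr (q + 1) \<partial>lborel)"
      proof (intro integral_mono b)
        show "integrable lborel (\<lambda>x. \<bar>prim_below q (w x) (u x)\<bar>)" using i[OF u] by (rule integrable_abs)
        show "integrable lborel (\<lambda>x. 8 * \<bar>u x\<bar> powr (q + 1) + 8 * w x powr (q + 1))"
          by (rule Bochner_Integration.integrable_add[OF integrable_mult_right[OF iu] iw])
      qed
      also have "\<dots> = 8 * (\<integral>x. \<bar>u x\<bar> powr (q + 1) \<partial>lborel) + (\<integral>x. 8 * w x powr (q + 1) \<partial>lborel)"
        by (subst Bochner_Integration.integral_add[OF integrable_mult_right[OF iu] iw]) (simp only: integral_mult_right_zero)
      also have "\<dots> \<le> 8 * (\<tau> / 8 * F u u + C) + (\<integral>x. 8 * w x powr (q + 1) \<partial>lborel)"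
        using C u by (intro add_right_mono mult_left_mono) auto
      finally show ?thesis by (simp add: algebra_simps)
    qed
    then show ?thesis by blast
  qed
  show "t * (\<integral>x. max (u x) (w x) powr q * \<phi> x \<partial>lborel)
      \<le> (\<integral>x. prim_below q (w x) (u x + t * \<phi> x) \<partial>lborel) - (\<integral>x. prim_below q (w x) (u x) \<partial>lborel)"
    if u: "u \<in> H" and \<phi>: "\<phi> \<in> H"
  proof -
    have ut: "(\<lambda>x. u x + t * \<phi> x) \<in> H" by (rule Hs_add[OF u Hs_cmult[OF \<phi>]])
    have j: "integrable lborel (\<lambda>x. max (u x) (w x) powr q * \<phi> x)"
      using q by (intro integrable_sublinear u w \<phi>) auto
    have "t * (\<integral>x. max (u x) (w x) powr q * \<phi> x \<partial>lborel) = (\<integral>x. t * (max (u x) (w x) powr q * \<phi> x) \<partial>lborel)"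
      by (rule integral_mult_right_zero[symmetric])
    also have "\<dots> \<le> (\<integral>x. prim_below q (w x) (u x + t * \<phi> x) - prim_below q (w x) (u x) \<partial>lborel)"
    proof (intro integral_mono integrable_mult_right j Bochner_Integration.integrable_diff i[OF ut] i[OF u])
      fix x
      show "t * (max (u x) (w x) powr q * \<phi> x) \<le> prim_below q (w x) (u x + t * \<phi> x) - prim_below q (w x) (u x)"
        using prim_below_convex[OF q(1) w(2), of "u x" x "u x + t * \<phi> x"] by (simp add: mult_ac)
    qed
    also have "\<dots> = (\<integral>x. prim_below q (w x) (u x + t * \<phi> x) \<partial>lborel) - (\<integral>x. prim_below q (w x) (u x) \<partial>lborel)"
      by (rule Bochner_Integration.integral_diff[OF i[OF ut] i[OF u]])
    finally show ?thesis .
  qed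
qed

lemma capped_primitive:
  assumes r: "0 \<le> r" and K: "0 \<le> K"
  shows capped_primitive_integrable: "u \<in> H \<Longrightarrow> integrable lborel (\<lambda>x. prim_above r K (u x))"
    and capped_primitive_tendsto: "(\<And>n. v n \<in> H) \<Longrightarrow> (\<And>n. F (v n) (v n) \<le> B) \<Longrightarrow> AE x in lborel. (\<lambda>n. v n x) \<longlonglongrightarrow> u x \<Longrightarrow> u \<in> H
      \<Longrightarrow> (\<lambda>n. \<integral>x. prim_above r K (v n x) \<partial>lborel) \<longlonglongrightarrow> (\<integral>x. prim_above r K (u x) \<partial>lborel)"
    and capped_primitive_growth: "0 < \<tau> \<Longrightarrow> \<exists>C. \<forall>u\<in>H. \<bar>\<integral>x. prim_above r K (u x) \<partial>lborel\<bar> \<le> \<tau> * F u u + C"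
    and capped_primitive_convex: "u \<in> H \<Longrightarrow> \<phi> \<in> H \<Longrightarrow> t * (\<integral>x. min (max 0 (u x)) K powr r * \<phi> x \<partial>lborel)
      \<le> (\<integral>x. prim_above r K (u x + t * \<phi> x) \<partial>lborel) - (\<integral>x. prim_above r K (u x) \<partial>lborel)"
proof -
  have q1: "0 \<le> (1::real)" "1 < 2 * real DIM('a) / (real DIM('a) - 2 * s)" using crit_gt_2 by linarith+
  have m: "(\<lambda>x. prim_above r K (u x)) \<in> borel_measurable borel" if [measurable]: "u \<in> borel_measurable borel" for u :: "'a \<Rightarrow> real"
    unfolding prim_above_def by measurable
  have c: "isCont (prim_above r K) t" for x t by (rule continuous_prim_above[OF r])
  have b: "\<bar>prim_above r K t\<bar> \<le> K powr r * \<bar>t\<bar> powr 1 + 0" for x :: 'a and t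
    using prim_above_bound[OF r K, of t] by simp
  have K0: "0 \<le> K powr r" by simp
  have i0: "integrable lborel (\<lambda>x::'a. 0::real)" by simp
  show i: "u \<in> H \<Longrightarrow> integrable lborel (\<lambda>x. prim_above r K (u x))" for u
    by (rule nemytskii_integrable[where g="\<lambda>x. prim_above r K", OF q1 K0 i0 m c b]) auto
  show "(\<And>n. v n \<in> H) \<Longrightarrow> (\<And>n. F (v n) (v n) \<le> B) \<Longrightarrow> AE x in lborel. (\<lambda>n. v n x) \<longlonglongrightarrow> u x \<Longrightarrow> u \<in> H
      \<Longrightarrow> (\<lambda>n. \<integral>x. prim_above r K (v n x) \<partial>lborel) \<longlonglongrightarrow> (\<integral>x. prim_above r K (u x) \<partial>lborel)"
    by (rule nemytskii_tendsto[where g="\<lambda>x. prim_above r K", OF q1 K0 i0 m c b]) auto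
  show "\<exists>C. \<forall>u\<in>H. \<bar>\<integral>x. prim_above r K (u x) \<partial>lborel\<bar> \<le> \<tau> * F u u + C" if \<tau>: "0 < \<tau>"
  proof -
    define k where "k = K powr r + 1"
    have k: "0 < k" using K0 unfolding k_def by linarith
    obtain C where C: "\<forall>u\<in>H. (\<integral>x. \<bar>u x\<bar> powr 1 \<partial>lborel) \<le> \<tau> / k * F u u + C"
      using power_growth[of 1 "\<tau> / k"] k \<tau> by auto
    have "\<bar>\<integral>x. prim_above r K (u x) \<partial>lborel\<bar> \<le> \<tau> * F u u + k * C" if u: "u \<in> H" for u
    proof -
      have iu: "integrable lborel (\<lambda>x. \<bar>u x\<bar> powr 1)" by (rule Hs_powr_integrable[OF q1 u])
      have "\<bar>\<integral>x. prim_above r K (u x) \<partial>lborel\<bar> \<le> (\<integral>x. \<bar>prim_above r K (u x)\<bar> \<partial>lborel)"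
        using integral_norm_bound[of lborel "\<lambda>x. prim_above r K (u x)"] by simp
      also have "\<dots> \<le> (\<integral>x. k * \<bar>u x\<bar> powr 1 \<partial>lborel)"
      proof (intro integral_mono integrable_mult_right iu)
        show "integrable lborel (\<lambda>x. \<bar>prim_above r K (u x)\<bar>)" using i[OF u] by (rule integrable_abs)
        fix x
        have "K powr r * \<bar>u x\<bar> powr 1 \<le> k * \<bar>u x\<bar> powr 1"
          by (intro mult_right_mono) (auto simp: k_def)
        then show "\<bar>prim_above r K (u x)\<bar> \<le> k * \<bar>u x\<bar> powr 1" using b[of "u x"] by linarith
      qed
      also have "\<dots> = k * (\<integral>x. \<bar>u x\<bar> powr 1 \<partial>lborel)" by (rule integral_mult_right_zero)
      also have "\<dots> \<le> k * (\<tau> / k * F u u + C)"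
        using C u k by (intro mult_left_mono) auto
      also have "\<dots> = \<tau> * F u u + k * C" using k by (simp add: field_simps)
      finally show ?thesis .
    qed
    then show ?thesis by blast
  qed
  show "t * (\<integral>x. min (max 0 (u x)) K powr r * \<phi> x \<partial>lborel)
      \<le> (\<integral>x. prim_above r K (u x + t * \<phi> x) \<partial>lborel) - (\<integral>x. prim_above r K (u x) \<partial>lborel)"
    if u: "u \<in> H" and \<phi>: "\<phi> \<in> H"
  proof -
    have ut: "(\<lambda>x. u x + t * \<phi> x) \<in> H" by (rule Hs_add[OF u Hs_cmult[OF \<phi>]])
    have j: "integrable lborel (\<lambda>x. min (max 0 (u x)) K powr r * \<phi> x)"
      by (rule integrable_capped[OF r K u \<phi>])
    have "t * (\<integral>x. min (max 0 (u x)) K powr r * \<phi> x \<partial>lborel) = (\<integral>x. t * (min (max 0 (u x)) K powr r * \<phi> x) \<partial>lborel)"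
      by (rule integral_mult_right_zero[symmetric])
    also have "\<dots> \<le> (\<integral>x. prim_above r K (u x + t * \<phi> x) - prim_above r K (u x) \<partial>lborel)"
    proof (intro integral_mono integrable_mult_right j Bochner_Integration.integrable_diff i[OF ut] i[OF u])
      fix x
      show "t * (min (max 0 (u x)) K powr r * \<phi> x) \<le> prim_above r K (u x + t * \<phi> x) - prim_above r K (u x)"
        using prim_above_convex[OF r K, of "u x" "u x + t * \<phi> x"] by (simp add: mult_ac)
    qed
    also have "\<dots> = (\<integral>x. prim_above r K (u x + t * \<phi> x) \<partial>lborel) - (\<integral>x. prim_above r K (u x) \<partial>lborel)"
      by (rule Bochner_Integration.integral_diff[OF i[OF ut] i[OF u]])
    finally show ?thesis .
  qed
qed

lemma integral_growth:
  assumes "0 < \<tau>"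
  shows "\<exists>C. \<forall>u\<in>H. \<bar>\<integral>x. u x \<partial>lborel\<bar> \<le> \<tau> * F u u + C"
proof -
  obtain C where C: "\<forall>u\<in>H. (\<integral>x. \<bar>u x\<bar> powr 1 \<partial>lborel) \<le> \<tau> * F u u + C"
    using power_growth[of 1 \<tau>] assms by auto
  have "\<bar>\<integral>x. u x \<partial>lborel\<bar> \<le> \<tau> * F u u + C" if "u \<in> H" for u
  proof -
    have "\<bar>\<integral>x. u x \<partial>lborel\<bar> \<le> (\<integral>x. \<bar>u x\<bar> \<partial>lborel)" using integral_norm_bound[of lborel u] by simp
    also have "\<dots> \<le> \<tau> * F u u + C" using C[rule_format, OF that] by simp
    finally show ?thesis .
  qed
  then show ?thesis by blast
qed

lemma integral_tendsto:
  assumes "\<And>n. v n \<in> H" "\<And>n. F (v n) (v n) \<le> B" "AE x in lborel. (\<lambda>n. v n x) \<longlonglongrightarrow> u x" "u \<in> H"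
  shows "(\<lambda>n. \<integral>x. v n x \<partial>lborel) \<longlonglongrightarrow> (\<integral>x. u x \<partial>lborel)"
  by (rule nemytskii_tendsto[where g="\<lambda>_ t. t" and a=1 and A=1 and h="\<lambda>_. 0", OF _ _ _ _ _ _ _ assms])
    (use crit_gt_2 in auto)

text \<open>The test function is the positive part of \<open>w - u\<close>. Where it is nonzero,
  \<open>max u w powr q\<close> equals \<open>w powr q\<close>, so \<open>u\<close> satisfies the
  reverse of the inequality for \<open>w\<close> with the same right-hand side, and the comparison
  does not involve the monotonicity of the reaction.\<close>

lemma subsolution_below:
  assumes w: "weak_sub q lam w" and q: "0 \<le> q" "q \<le> 1" and lam: "0 \<le> lam" and u: "u \<in> H"
    and g: "\<And>\<phi>. \<phi> \<in> H \<Longrightarrow> (\<And>x. 0 \<le> \<phi> x) \<Longrightarrow>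
      lam * ((\<integral>x. max (u x) (w x) powr q * \<phi> x \<partial>lborel) - (\<integral>x. \<phi> x \<partial>lborel)) \<le> F u \<phi>"
  shows "AE x in lborel. w x \<le> u x"
proof (rule comparison)
  show wH: "w \<in> H" and "u \<in> H" using weak_subD[OF w] u by auto
  let ?p = "\<lambda>x. max 0 (w x - u x)"
  have p: "?p \<in> H" by (rule Hs_pos_part[OF Hs_diff[OF wH u]])
  have i: "integrable lborel (\<lambda>x. w x powr q * ?p x)"
    by (rule integrable_powr_weight[OF q wH weak_subD(3)[OF w] p])
  have "F w ?p \<le> lam * (\<integral>x. (w x powr q - 1) * ?p x \<partial>lborel)"
    by (rule weak_subD(4)[OF w p]) simp
  also have "(\<integral>x. (w x powr q - 1) * ?p x \<partial>lborel) = (\<integral>x. w x powr q * ?p x \<partial>lborel) - (\<integral>x. ?p x \<partial>lborel)"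
    using i Hs_L1[OF p] by (simp add: left_diff_distrib)
  also have "(\<lambda>x. w x powr q * ?p x) = (\<lambda>x. max (u x) (w x) powr q * ?p x)"
    by (auto simp: fun_eq_iff max_def)
  also have "lam * ((\<integral>x. max (u x) (w x) powr q * ?p x \<partial>lborel) - (\<integral>x. ?p x \<partial>lborel)) \<le> F u ?p"
    by (rule g[OF p]) simp
  finally show "F w ?p \<le> F u ?p" .
qed

text \<open>Both truncations are removed from the minimizer: the lower one by comparison with
  \<open>w\<close>, the upper one by testing with the positive part of \<open>u - K\<close>. The
  size of \<open>K\<close> is tied to the constant \<open>c\<close> of the zero-order part of the
  energy.\<close>

lemma first_solution_bounded:
  assumes w: "weak_sub q lam w" and q: "0 < q" "q < 1" and lam: "0 < lam" and r: "0 < r" and mu: "0 \<le> \<mu>"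
    and c: "0 < c" "\<forall>u\<in>H. \<forall>v\<in>H. (\<forall>x y. 0 \<le> (u x - u y) * (v x - v y)) \<longrightarrow>
      integrable lborel (\<lambda>x. u x * v x) \<and> c * (\<integral>x. u x * v x \<partial>lborel) \<le> F u v"
    and K: "0 < K" "lam * K powr (q - 1) \<le> c / 2" "\<mu> * K powr (r - 1) \<le> c / 2"
  shows "\<exists>u. solves q r lam \<mu> u \<and> (AE x in lborel. w x \<le> u x) \<and> F u u \<le> c * K\<^sup>2 * measure lborel \<Omega>"
proof -
  note wH = weak_subD(1)[OF w] and w0 = weak_subD(3)[OF w]
  have q': "0 \<le> q" "q \<le> 1" and r': "0 \<le> r" and K': "0 \<le> K" using q r K by auto
  define \<Phi> where "\<Phi> u = lam * ((\<integral>x. prim_below q (w x) (u x) \<partial>lborel) - (\<integral>x. u x \<partial>lborel))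
      + \<mu> * (\<integral>x. prim_above r K (u x) \<partial>lborel)" for u
  \<comment> \<open>Three terms, each bounded by a twelfth of the energy up to a constant, exhaust
    the quarter that \<open>exists_minimizer\<close> allows. In the last one,
    \<open>\<mu> + 1\<close> avoids a division by \<open>0\<close>.\<close>
  obtain C1 where C1: "\<forall>u\<in>H. \<bar>\<integral>x. prim_below q (w x) (u x) \<partial>lborel\<bar> \<le> 1 / (12 * lam) * F u u + C1"
    using sublinear_primitive_growth[OF q'(1) q(2) wH w0, of "1 / (12 * lam)"] lam by auto
  obtain C2 where C2: "\<forall>u\<in>H. \<bar>\<integral>x. u x \<partial>lborel\<bar> \<le> 1 / (12 * lam) * F u u + C2"
    using integral_growth[of "1 / (12 * lam)"] lam by auto
  obtain C3 where C3: "\<forall>u\<in>H. \<bar>\<integral>x. prim_above r K (u x) \<partial>lborel\<bar> \<le> 1 / (12 * (\<mu> + 1)) * F u u + C3"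
    using capped_primitive_growth[OF r' K', of "1 / (12 * (\<mu> + 1))"] mu by auto
  have grow: "\<forall>u\<in>H. \<Phi> u \<le> F u u / 4 + (lam * (C1 + C2) + \<mu> * C3)"
  proof
    fix u assume u: "u \<in> H"
    have "lam * ((\<integral>x. prim_below q (w x) (u x) \<partial>lborel) - (\<integral>x. u x \<partial>lborel))
      \<le> lam * (1 / (12 * lam) * F u u + C1 + (1 / (12 * lam) * F u u + C2))"
      using C1[rule_format, OF u] C2[rule_format, OF u] lam by (intro mult_left_mono) linarith+
    also have "\<dots> = F u u / 6 + lam * (C1 + C2)" using lam by (simp add: field_simps)
    finally have 1: "lam * ((\<integral>x. prim_below q (w x) (u x) \<partial>lborel) - (\<integral>x. u x \<partial>lborel)) \<le> F u u / 6 + lam * (C1 + C2)" .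
    have "\<mu> * (\<integral>x. prim_above r K (u x) \<partial>lborel) \<le> \<mu> * (1 / (12 * (\<mu> + 1)) * F u u + C3)"
      using C3[rule_format, OF u] mu by (intro mult_left_mono) linarith+
    also have "\<dots> = (\<mu> / (\<mu> + 1)) * (F u u / 12) + \<mu> * C3" using mu by (simp add: field_simps)
    also have "(\<mu> / (\<mu> + 1)) * (F u u / 12) \<le> 1 * (F u u / 12)"
      using mu by (intro mult_right_mono) (auto simp: divide_le_eq)
    finally show "\<Phi> u \<le> F u u / 4 + (lam * (C1 + C2) + \<mu> * C3)" using 1 unfolding \<Phi>_def by simp
  qed
  have "\<exists>u\<in>H. \<forall>v\<in>H. F u u / 2 - \<Phi> u \<le> F v v / 2 - \<Phi> v"
  proof (rule exists_minimizer[OF grow])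
    fix v u B assume "\<And>n. v n \<in> H" "\<And>n. F (v n) (v n) \<le> B" "AE x in lborel. (\<lambda>n. v n x) \<longlonglongrightarrow> u x" "u \<in> H"
    note * = this
    show "(\<lambda>n. \<Phi> (v n)) \<longlonglongrightarrow> \<Phi> u"
      unfolding \<Phi>_def
      by (intro tendsto_add tendsto_mult tendsto_diff tendsto_const
          sublinear_primitive_tendsto[OF q'(1) q(2) wH w0 *] integral_tendsto[OF *] capped_primitive_tendsto[OF r' K' *])
  qed
  then obtain u where u: "u \<in> H" and min: "\<forall>v\<in>H. F u u / 2 - \<Phi> u \<le> F v v / 2 - \<Phi> v" by blast
  have isub: "integrable lborel (\<lambda>x. max (u x) (w x) powr q * \<phi> x)" if "\<phi> \<in> H" for \<phi>
    by (rule integrable_sublinear[OF q' u wH w0 that])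
  have icap: "integrable lborel (\<lambda>x. min (max 0 (u x)) K powr r * \<phi> x)" if "\<phi> \<in> H" for \<phi>
    by (rule integrable_capped[OF r' K' u that])
  have eq: "F u \<phi> = lam * ((\<integral>x. max (u x) (w x) powr q * \<phi> x \<partial>lborel) - (\<integral>x. \<phi> x \<partial>lborel))
      + \<mu> * (\<integral>x. min (max 0 (u x)) K powr r * \<phi> x \<partial>lborel)" (is "_ = ?l \<phi>") if \<phi>: "\<phi> \<in> H" for \<phi>
  proof (rule minimizer_equation[OF u \<phi> min])
    fix t
    have "lam * (t * (\<integral>x. max (u x) (w x) powr q * \<phi> x \<partial>lborel))
        \<le> lam * ((\<integral>x. prim_below q (w x) (u x + t * \<phi> x) \<partial>lborel) - (\<integral>x. prim_below q (w x) (u x) \<partial>lborel))"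
      using lam by (intro mult_left_mono sublinear_primitive_convex[OF q'(1) q(2) wH w0 u \<phi>]) auto
    moreover have "\<mu> * (t * (\<integral>x. min (max 0 (u x)) K powr r * \<phi> x \<partial>lborel))
        \<le> \<mu> * ((\<integral>x. prim_above r K (u x + t * \<phi> x) \<partial>lborel) - (\<integral>x. prim_above r K (u x) \<partial>lborel))"
      using mu by (intro mult_left_mono capped_primitive_convex[OF r' K' u \<phi>]) auto
    moreover have "(\<integral>x. u x + t * \<phi> x \<partial>lborel) = (\<integral>x. u x \<partial>lborel) + t * (\<integral>x. \<phi> x \<partial>lborel)"
      using Hs_L1[OF u] Hs_L1[OF \<phi>] by simp
    ultimately show "t * ?l \<phi> \<le> \<Phi> (\<lambda>x. u x + t * \<phi> x) - \<Phi> u"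
      unfolding \<Phi>_def by (simp add: algebra_simps)
  qed
  have cap0: "0 \<le> (\<integral>x. min (max 0 (u x)) K powr r * \<phi> x \<partial>lborel)" if "\<And>x. 0 \<le> \<phi> x" for \<phi>
    using that by (intro integral_nonneg_AE) auto
  have lower: "AE x in lborel. w x \<le> u x"
  proof (rule subsolution_below[OF w q' less_imp_le[OF lam] u])
    fix \<phi> assume \<phi>: "\<phi> \<in> H" "\<And>x. 0 \<le> \<phi> x"
    show "lam * ((\<integral>x. max (u x) (w x) powr q * \<phi> x \<partial>lborel) - (\<integral>x. \<phi> x \<partial>lborel)) \<le> F u \<phi>"
      using mult_nonneg_nonneg[OF mu cap0[OF \<phi>(2)]] unfolding eq[OF \<phi>(1)] by simp
  qed
  \<comment> \<open>From \<open>K\<close> on, the reaction without its term \<open>- lam\<close>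
    lies below \<open>c * t\<close>: the powers are each given half of \<open>c\<close>. This is the
    supersolution property of the level \<open>K\<close>.\<close>
  have Kb: "lam * t powr q + \<mu> * K powr r \<le> c * t" if "K \<le> t" for t
  proof -
    have "t powr (q - 1) \<le> K powr (q - 1)" using that K q by (intro powr_mono2') auto
    then have "lam * t powr (q - 1) \<le> c / 2" using lam K(2) by (smt (verit) mult_left_mono)
    then have "lam * t powr (q - 1) * t \<le> c / 2 * t" using that K by (intro mult_right_mono) auto
    moreover have "t powr (q - 1) * t = t powr q" using that K by (simp add: powr_diff)
    moreover have "\<mu> * K powr (r - 1) * K \<le> c / 2 * K" using K by (intro mult_right_mono) auto
    moreover have "K powr (r - 1) * K = K powr r" using K by (simp add: powr_diff)
    moreover have "c / 2 * K \<le> c / 2 * t" using that c by (intro mult_left_mono) auto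
    ultimately show ?thesis by (simp add: mult.assoc)
  qed
  have upper: "AE x in lborel. u x \<le> K"
  proof -
    let ?p = "\<lambda>x. max 0 (u x - K)"
    have p: "?p \<in> H" by (rule Hs_lipschitz[OF u, where g="\<lambda>t. max 0 (t - K)" and L=1]) (use K in auto)
    have "0 \<le> (u x - u y) * (?p x - ?p y)" for x y
      by (cases "u x \<le> u y") (auto intro!: mult_nonneg_nonneg mult_nonpos_nonpos)
    then have up: "integrable lborel (\<lambda>x. u x * ?p x)" "c * (\<integral>x. u x * ?p x \<partial>lborel) \<le> F u ?p"
      using c(2) u p by auto
    have "lam * (\<integral>x. max (u x) (w x) powr q * ?p x \<partial>lborel) + \<mu> * (\<integral>x. min (max 0 (u x)) K powr r * ?p x \<partial>lborel)
       = (\<integral>x. lam * (max (u x) (w x) powr q * ?p x) + \<mu> * (min (max 0 (u x)) K powr r * ?p x) \<partial>lborel)"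
      using isub[OF p] icap[OF p] by simp
    also have "\<dots> \<le> (\<integral>x. c * (u x * ?p x) \<partial>lborel)"
    proof (rule integral_mono_AE)
      show "integrable lborel (\<lambda>x. lam * (max (u x) (w x) powr q * ?p x) + \<mu> * (min (max 0 (u x)) K powr r * ?p x))"
        using isub[OF p] icap[OF p] by (intro Bochner_Integration.integrable_add integrable_mult_right)
      show "integrable lborel (\<lambda>x. c * (u x * ?p x))" using up(1) by (rule integrable_mult_right)
      show "AE x in lborel. lam * (max (u x) (w x) powr q * ?p x) + \<mu> * (min (max 0 (u x)) K powr r * ?p x) \<le> c * (u x * ?p x)"
        using lower
      proof eventually_elim
        case (elim x)
        show ?case
        proof (cases "u x \<le> K")
          case False
          then have "(lam * u x powr q + \<mu> * K powr r) * ?p x \<le> c * u x * ?p x"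
            by (intro mult_right_mono Kb) auto
          moreover have "max (u x) (w x) = u x" "min (max 0 (u x)) K = K" using elim False K by auto
          ultimately show ?thesis by (simp add: algebra_simps)
        qed simp
      qed
    qed
    also have "\<dots> = c * (\<integral>x. u x * ?p x \<partial>lborel)" by (rule integral_mult_right_zero)
    \<comment> \<open>After the powers have been compared with the energy, only the absorption term
      \<open>- lam\<close> is left in the equation, and it forces the positive part of
      \<open>u - K\<close> to vanish.\<close>
    finally have "lam * (\<integral>x. ?p x \<partial>lborel) \<le> 0"
      using up(2) unfolding eq[OF p] by (simp add: algebra_simps)
    then have "(\<integral>x. ?p x \<partial>lborel) \<le> 0" using lam by (simp add: mult_le_0_iff)
    moreover have "0 \<le> (\<integral>x. ?p x \<partial>lborel)" by (intro integral_nonneg_AE) auto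
    ultimately have "AE x in lborel. ?p x = 0"
      using integral_nonneg_eq_0_iff_AE[OF Hs_L1[OF p]] by auto
    then show ?thesis by eventually_elim (simp add: max_def split: if_splits)
  qed
  have trunc: "AE x in lborel. max (u x) (w x) = u x \<and> min (max 0 (u x)) K = u x \<and> 0 \<le> u x \<and> u x \<le> K"
    using lower upper
  proof eventually_elim
    case (elim x)
    then show ?case using w0[of x] by auto
  qed
  have [measurable]: "u \<in> borel_measurable borel" "w \<in> borel_measurable borel"
    using HsD(1)[OF u] HsD(1)[OF wH] by auto
  have "solves q r lam \<mu> u"
    unfolding solves_def
  proof (intro conjI ballI u)
    fix \<phi> assume \<phi>: "\<phi> \<in> H"
    have [measurable]: "\<phi> \<in> borel_measurable borel" using HsD(1)[OF \<phi>] .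
    have "(\<integral>x. max (u x) (w x) powr q * \<phi> x \<partial>lborel) - (\<integral>x. \<phi> x \<partial>lborel) = (\<integral>x. max (u x) (w x) powr q * \<phi> x - \<phi> x \<partial>lborel)"
      by (rule Bochner_Integration.integral_diff[symmetric, OF isub[OF \<phi>] Hs_L1[OF \<phi>]])
    also have "\<dots> = (\<integral>x. (u x powr q - 1) * \<phi> x \<partial>lborel)"
    proof (rule integral_cong_AE)
      show "AE x in lborel. max (u x) (w x) powr q * \<phi> x - \<phi> x = (u x powr q - 1) * \<phi> x"
        using trunc by eventually_elim (simp add: left_diff_distrib)
    qed measurable
    finally have 1: "(\<integral>x. max (u x) (w x) powr q * \<phi> x \<partial>lborel) - (\<integral>x. \<phi> x \<partial>lborel) = (\<integral>x. (u x powr q - 1) * \<phi> x \<partial>lborel)" .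
    have 2: "(\<integral>x. min (max 0 (u x)) K powr r * \<phi> x \<partial>lborel) = (\<integral>x. u x powr r * \<phi> x \<partial>lborel)"
    proof (rule integral_cong_AE)
      show "AE x in lborel. min (max 0 (u x)) K powr r * \<phi> x = u x powr r * \<phi> x"
        using trunc by eventually_elim simp
    qed measurable
    show "F u \<phi> = lam * (\<integral>x. (u x powr q - 1) * \<phi> x \<partial>lborel) + \<mu> * (\<integral>x. u x powr r * \<phi> x \<partial>lborel)"
      unfolding eq[OF \<phi>] 1 2 ..
  qed
  \<comment> \<open>Testing with \<open>u\<close> itself, which by now lies between \<open>0\<close>
    and \<open>K\<close>, gives a bound that involves neither \<open>\<mu>\<close> nor
    \<open>w\<close>.\<close>
  moreover have "F u u \<le> c * K\<^sup>2 * measure lborel \<Omega>"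
  proof -
    have "F u u = (\<integral>x. lam * (max (u x) (w x) powr q * u x - u x) + \<mu> * (min (max 0 (u x)) K powr r * u x) \<partial>lborel)"
      unfolding eq[OF u] using isub[OF u] icap[OF u] Hs_L1[OF u] by simp
    also have "\<dots> \<le> (\<integral>x. c * K\<^sup>2 * indicator \<Omega> x \<partial>lborel)"
    proof (rule integral_mono_AE)
      show "integrable lborel (\<lambda>x. lam * (max (u x) (w x) powr q * u x - u x) + \<mu> * (min (max 0 (u x)) K powr r * u x))"
        using isub[OF u] icap[OF u] Hs_L1[OF u]
        by (intro Bochner_Integration.integrable_add integrable_mult_right Bochner_Integration.integrable_diff)
      show "integrable lborel (\<lambda>x. c * K\<^sup>2 * indicator \<Omega> x)" using integrable_indicator_dom by (rule integrable_mult_right)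
      show "AE x in lborel. lam * (max (u x) (w x) powr q * u x - u x) + \<mu> * (min (max 0 (u x)) K powr r * u x) \<le> c * K\<^sup>2 * indicator \<Omega> x"
        using trunc
      proof eventually_elim
        case (elim x)
        show ?case
        proof (cases "x \<in> \<Omega>")
          case True
          have "lam * u x powr q + \<mu> * u x powr r \<le> lam * K powr q + \<mu> * K powr r"
            using elim q r lam mu by (intro add_mono mult_left_mono powr_mono2) auto
          also have "\<dots> \<le> c * K" by (rule Kb) simp
          finally have "(lam * u x powr q + \<mu> * u x powr r) * u x \<le> c * K * K"
            using elim c K lam mu by (intro mult_mono) auto
          moreover have "0 \<le> lam * u x" using elim lam by auto
          ultimately show ?thesis using True elim by (simp add: algebra_simps power2_eq_square)
        next
          case False
          then show ?thesis using Hs_outside[OF u] by simp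
        qed
      qed
    qed
    also have "\<dots> = c * K\<^sup>2 * measure lborel \<Omega>" by simp
    finally show ?thesis .
  qed
  ultimately show ?thesis using lower by blast
qed

text \<open>The level \<open>K\<close> solves \<open>lam * K powr (q - 1) = c / 2\<close> and
  depends neither on \<open>w\<close> nor on \<open>\<mu>\<close>. One threshold and one energy
  bound \<open>B\<close> therefore serve all subsolutions and all small \<open>\<mu>\<close>; the
  second solution will have to exceed this \<open>B\<close>.\<close>

lemma first_solution:
  assumes q: "0 < q" "q < 1" and lam: "0 < lam" and r: "0 < r"
  shows "\<exists>\<mu>0>0. \<exists>B. \<forall>w \<mu>. weak_sub q lam w \<longrightarrow> 0 \<le> \<mu> \<longrightarrow> \<mu> < \<mu>0 \<longrightarrow>
    (\<exists>u. solves q r lam \<mu> u \<and> (AE x in lborel. w x \<le> u x) \<and> F u u \<le> B)"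
proof -
  obtain c where c: "0 < c" "\<forall>u\<in>H. \<forall>v\<in>H. (\<forall>x y. 0 \<le> (u x - u y) * (v x - v y)) \<longrightarrow>
      integrable lborel (\<lambda>x. u x * v x) \<and> c * (\<integral>x. u x * v x \<partial>lborel) \<le> F u v"
    using form_lower by blast
  define K where "K = (c / (2 * lam)) powr (1 / (q - 1))"
  have K: "0 < K" using c lam by (simp add: K_def)
  have "K powr (q - 1) = c / (2 * lam)" using c lam q by (simp add: K_def powr_powr)
  then have K1: "lam * K powr (q - 1) \<le> c / 2" using lam by simp
  show ?thesis
  proof (rule exI[of _ "c / (2 * K powr (r - 1))"], rule conjI)
    show "0 < c / (2 * K powr (r - 1))" using c K by simp
    show "\<exists>B. \<forall>w \<mu>. weak_sub q lam w \<longrightarrow> 0 \<le> \<mu> \<longrightarrow> \<mu> < c / (2 * K powr (r - 1)) \<longrightarrow>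
      (\<exists>u. solves q r lam \<mu> u \<and> (AE x in lborel. w x \<le> u x) \<and> F u u \<le> B)"
    proof (intro exI[of _ "c * K\<^sup>2 * measure lborel \<Omega>"] allI impI)
    fix w \<mu> assume w: "weak_sub q lam w" and mu: "0 \<le> \<mu>" "\<mu> < c / (2 * K powr (r - 1))"
    have "\<mu> * K powr (r - 1) \<le> c / 2" using mu K by (simp add: field_simps)
    then show "\<exists>u. solves q r lam \<mu> u \<and> (AE x in lborel. w x \<le> u x) \<and> F u u \<le> c * K\<^sup>2 * measure lborel \<Omega>"
      by (intro first_solution_bounded[OF w q lam r mu(1) c K K1])
    qed
  qed
qed

end

section \<open>The second solution\<close>

locale superlinear_problem = fractional_domain s \<Omega> for s :: real and \<Omega> :: "'a::euclidean_space set" +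
  fixes q r lam :: real and w :: "'a \<Rightarrow> real"
  assumes q: "0 < q" "q < 1" and lam: "0 < lam"
    and r: "1 < r" "r + 1 < 2 * real DIM('a) / (real DIM('a) - 2 * s)"
    and w: "weak_sub q lam w"
begin

text \<open>\<open>G\<close> and \<open>P\<close> are convex and \<open>DG\<close>,
  \<open>DP\<close> are their directional derivatives; the link between them is used only as the
  subgradient inequalities \<open>G_convex\<close> and \<open>P_convex\<close>. The truncation from
  below at \<open>w\<close> is kept, while the superlinear power has no cap, so the locale asks for
  \<open>r + 1\<close> below the critical exponent.\<close>

definition G :: "('a \<Rightarrow> real) \<Rightarrow> real" where
  "G u = lam * ((\<integral>x. prim_below q (w x) (u x) \<partial>lborel) - (\<integral>x. u x \<partial>lborel))"

definition DG :: "('a \<Rightarrow> real) \<Rightarrow> ('a \<Rightarrow> real) \<Rightarrow> real" where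
  "DG u \<phi> = lam * ((\<integral>x. max (u x) (w x) powr q * \<phi> x \<partial>lborel) - (\<integral>x. \<phi> x \<partial>lborel))"

definition P :: "('a \<Rightarrow> real) \<Rightarrow> real" where
  "P u = (\<integral>x. prim r (u x) \<partial>lborel)"

definition DP :: "('a \<Rightarrow> real) \<Rightarrow> ('a \<Rightarrow> real) \<Rightarrow> real" where
  "DP u \<phi> = (\<integral>x. max 0 (u x) powr r * \<phi> x \<partial>lborel)"

lemmas wH = weak_subD(1)[OF w] and w_nonneg = weak_subD(3)[OF w]

lemma q': "0 \<le> q" "q \<le> 1" using q by auto

lemma Hs_ray: "v \<in> H \<Longrightarrow> (\<lambda>x. t * v x) \<in> H"
  by (rule Hs_cmult)

lemma form_ray: "F (\<lambda>x. t * v x) (\<lambda>x. t * v x) = t\<^sup>2 * F v v"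
  by (simp add: form_cmult form_cmult_right power2_eq_square)

lemma G_tendsto:
  assumes "\<And>n. v n \<in> H" "\<And>n. F (v n) (v n) \<le> B" "AE x in lborel. (\<lambda>n. v n x) \<longlonglongrightarrow> u x" "u \<in> H"
  shows "(\<lambda>n. G (v n)) \<longlonglongrightarrow> G u"
  unfolding G_def
  by (intro tendsto_mult tendsto_diff tendsto_const sublinear_primitive_tendsto[OF q'(1) q(2) wH w_nonneg assms]
      integral_tendsto[OF assms])

lemma G_growth:
  assumes "0 < \<tau>" shows "\<exists>C. \<forall>u\<in>H. \<bar>G u\<bar> \<le> \<tau> * F u u + C"
proof -
  have t: "0 < \<tau> / (2 * lam)" using assms lam by simp
  obtain C1 where C1: "\<forall>u\<in>H. \<bar>\<integral>x. prim_below q (w x) (u x) \<partial>lborel\<bar> \<le> \<tau> / (2 * lam) * F u u + C1"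
    using sublinear_primitive_growth[OF q'(1) q(2) wH w_nonneg t] by blast
  obtain C2 where C2: "\<forall>u\<in>H. \<bar>\<integral>x. u x \<partial>lborel\<bar> \<le> \<tau> / (2 * lam) * F u u + C2"
    using integral_growth[OF t] by blast
  have "\<bar>G u\<bar> \<le> \<tau> * F u u + lam * (C1 + C2)" if u: "u \<in> H" for u
  proof -
    have "\<bar>G u\<bar> = lam * \<bar>(\<integral>x. prim_below q (w x) (u x) \<partial>lborel) - (\<integral>x. u x \<partial>lborel)\<bar>"
      using lam by (simp add: G_def abs_mult)
    also have "\<dots> \<le> lam * ((\<tau> / (2 * lam) * F u u + C1) + (\<tau> / (2 * lam) * F u u + C2))"
      using C1[rule_format, OF u] C2[rule_format, OF u] lam by (intro mult_left_mono) linarith+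
    also have "\<dots> = \<tau> * F u u + lam * (C1 + C2)" using lam by (simp add: field_simps)
    finally show ?thesis .
  qed
  then show ?thesis by blast
qed

lemma G_convex:
  assumes u: "u \<in> H" and \<phi>: "\<phi> \<in> H"
  shows "t * DG u \<phi> \<le> G (\<lambda>x. u x + t * \<phi> x) - G u"
proof -
  have "lam * (t * (\<integral>x. max (u x) (w x) powr q * \<phi> x \<partial>lborel))
      \<le> lam * ((\<integral>x. prim_below q (w x) (u x + t * \<phi> x) \<partial>lborel) - (\<integral>x. prim_below q (w x) (u x) \<partial>lborel))"
    using lam by (intro mult_left_mono sublinear_primitive_convex[OF q'(1) q(2) wH w_nonneg u \<phi>]) auto
  moreover have "(\<integral>x. u x + t * \<phi> x \<partial>lborel) = (\<integral>x. u x \<partial>lborel) + t * (\<integral>x. \<phi> x \<partial>lborel)"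
    using Hs_L1[OF u] Hs_L1[OF \<phi>] by simp
  ultimately show ?thesis unfolding G_def DG_def by (simp add: algebra_simps)
qed

lemma DG_cmult: "DG u (\<lambda>x. t * \<phi> x) = t * DG u \<phi>"
proof -
  have "(\<lambda>x. max (u x) (w x) powr q * (t * \<phi> x)) = (\<lambda>x. t * (max (u x) (w x) powr q * \<phi> x))" by (simp add: mult_ac)
  then show ?thesis by (simp add: DG_def algebra_simps)
qed

lemma G_convex_ray:
  assumes v: "v \<in> H"
  shows "(t - t0) * DG (\<lambda>x. t0 * v x) v \<le> G (\<lambda>x. t * v x) - G (\<lambda>x. t0 * v x)"
proof -
  have "(\<lambda>x. t0 * v x + (t - t0) * v x) = (\<lambda>x. t * v x)" by (simp add: algebra_simps)
  then show ?thesis using G_convex[OF Hs_ray[OF v, of t0] v, of "t - t0"] by simp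
qed

text \<open>By convexity on the ray through \<open>u\<close>, the derivative at \<open>u\<close>
  lies between differences of the values of \<open>G\<close> at \<open>0\<close>, \<open>u\<close>
  and \<open>2 * u\<close>. The energy of \<open>2 * u\<close> is four times that of
  \<open>u\<close>, hence the fraction \<open>\<tau> / 5\<close>.\<close>

lemma DG_growth:
  assumes "0 < \<tau>" shows "\<exists>C. \<forall>u\<in>H. \<bar>DG u u\<bar> \<le> \<tau> * F u u + C"
proof -
  obtain C where C: "\<forall>u\<in>H. \<bar>G u\<bar> \<le> \<tau> / 5 * F u u + C"
    using G_growth[of "\<tau> / 5"] assms by auto
  have "\<bar>DG u u\<bar> \<le> \<tau> * F u u + 2 * C" if u: "u \<in> H" for u
  proof -
    have "DG u u \<le> G (\<lambda>x. 2 * u x) - G u" using G_convex_ray[OF u, of 2 1] by simp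
    moreover have "- DG u u \<le> G (\<lambda>x. 0 * u x) - G u" using G_convex_ray[OF u, of 0 1] by simp
    moreover have "\<bar>G (\<lambda>x. 2 * u x)\<bar> \<le> \<tau> / 5 * (4 * F u u) + C"
      using C[rule_format, OF Hs_ray[OF u, of 2]] unfolding form_ray by simp
    moreover have "\<bar>G (\<lambda>x. 0 * u x)\<bar> \<le> C"
      using C[rule_format, OF Hs_ray[OF u, of 0]] unfolding form_ray by simp
    moreover have "\<bar>G u\<bar> \<le> \<tau> / 5 * F u u + C" using C u by blast
    moreover have "0 \<le> \<tau> / 5 * F u u" using assms by simp
    ultimately show ?thesis by linarith
  qed
  then show ?thesis by blast
qed

text \<open>In the sum of the subgradient inequalities at \<open>t0\<close> and at \<open>t\<close>
  the values of \<open>G\<close> cancel.\<close>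

lemma DG_ray_mono:
  assumes v: "v \<in> H" and t: "t0 \<le> t"
  shows "DG (\<lambda>x. t0 * v x) v \<le> DG (\<lambda>x. t * v x) v"
proof (cases "t = t0")
  case False
  have "(t - t0) * DG (\<lambda>x. t0 * v x) v \<le> (t - t0) * DG (\<lambda>x. t * v x) v"
    using G_convex_ray[OF v, of t t0] G_convex_ray[OF v, of t0 t] by (simp add: algebra_simps)
  then show ?thesis using t False by simp
qed simp

lemma DG_tendsto:
  assumes "\<And>n. v n \<in> H" "\<And>n. F (v n) (v n) \<le> B" "AE x in lborel. (\<lambda>n. v n x) \<longlonglongrightarrow> u x" "u \<in> H"
  shows "(\<lambda>n. DG (v n) (v n)) \<longlonglongrightarrow> DG u u"
proof -
  have [measurable]: "w \<in> borel_measurable borel" using HsD(1)[OF wH] .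
  have q1: "0 \<le> q + 1" "q + 1 < 2 * real DIM('a) / (real DIM('a) - 2 * s)" using q crit_gt_2 by linarith+
  have iw: "integrable lborel (\<lambda>x. 4 * w x powr (q + 1))"
    using Hs_powr_integrable[OF q1 wH] w_nonneg by simp
  have b: "\<bar>max t (w x) powr q * t\<bar> \<le> 4 * \<bar>t\<bar> powr (q + 1) + 4 * w x powr (q + 1)" for x t
  proof -
    let ?m = "\<bar>t\<bar> + w x"
    have "\<bar>max t (w x) powr q * t\<bar> = max t (w x) powr q * \<bar>t\<bar>" by (simp add: abs_mult)
    also have "\<dots> \<le> ?m powr q * ?m"
      using w_nonneg[of x] q by (intro mult_mono powr_mono2) auto
    also have "\<dots> = ?m powr (q + 1)"
      using w_nonneg[of x] by (cases "?m = 0") (auto simp: powr_add)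
    also have "\<dots> \<le> 2 powr (q + 1) * (\<bar>t\<bar> powr (q + 1) + w x powr (q + 1))"
      using w_nonneg[of x] q by (intro powr_add_le) auto
    also have "2 powr (q + 1) \<le> (2::real) powr 2" using q by (intro powr_mono) auto
    then have "2 powr (q + 1) * (\<bar>t\<bar> powr (q + 1) + w x powr (q + 1)) \<le> 4 * (\<bar>t\<bar> powr (q + 1) + w x powr (q + 1))"
      by (intro mult_right_mono) auto
    finally show ?thesis by simp
  qed
  have c: "isCont (\<lambda>t. max t (w x) powr q * t) t" for x t
    unfolding isCont_def using w_nonneg[of x] q
    by (intro tendsto_mult tendsto_powr2 tendsto_max tendsto_const tendsto_ident_at always_eventually) (auto simp: max_def)
  have "(\<lambda>n. \<integral>x. max (v n x) (w x) powr q * v n x \<partial>lborel) \<longlonglongrightarrow> (\<integral>x. max (u x) (w x) powr q * u x \<partial>lborel)"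
    by (rule nemytskii_tendsto[where g="\<lambda>x t. max t (w x) powr q * t", OF q1 _ iw _ c b assms]) auto
  then show ?thesis unfolding DG_def
    by (intro tendsto_mult tendsto_diff tendsto_const integral_tendsto[OF assms])
qed

lemma r0: "0 \<le> r" "0 \<le> r + 1" using r by auto

lemma prim_bound: "\<bar>prim r t\<bar> \<le> 1 * \<bar>t\<bar> powr (r + 1) + 0"
proof -
  have "prim r t \<le> max 0 t powr (r + 1)"
    using mult_left_mono[of 1 "r + 1" "max 0 t powr (r + 1)"] r by (simp add: prim_def divide_le_eq)
  also have "\<dots> \<le> \<bar>t\<bar> powr (r + 1)" using r by (intro powr_mono2) auto
  finally show ?thesis using r by (simp add: prim_def)
qed

lemma P_integrable: "u \<in> H \<Longrightarrow> integrable lborel (\<lambda>x. prim r (u x))"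
  by (rule nemytskii_integrable[where g="\<lambda>_. prim r" and A=1 and h="\<lambda>_. 0", OF r0(2) r(2) _ _ _ continuous_prim[OF r0(1)] prim_bound]) auto

lemma P_tendsto:
  assumes "\<And>n. v n \<in> H" "\<And>n. F (v n) (v n) \<le> B" "AE x in lborel. (\<lambda>n. v n x) \<longlonglongrightarrow> u x" "u \<in> H"
  shows "(\<lambda>n. P (v n)) \<longlonglongrightarrow> P u"
  unfolding P_def
  by (rule nemytskii_tendsto[where g="\<lambda>_. prim r" and A=1 and h="\<lambda>_. 0", OF r0(2) r(2) _ _ _ continuous_prim[OF r0(1)] prim_bound assms]) auto

lemma P_nonneg: "0 \<le> P u"
  unfolding P_def using r by (intro integral_nonneg_AE) (auto simp: prim_def)

lemma P_ray:
  assumes "0 \<le> t" shows "P (\<lambda>x. t * v x) = t powr (r + 1) * P v"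
proof -
  have "prim r (t * v x) = t powr (r + 1) * prim r (v x)" for x
  proof -
    have "max 0 (t * v x) = t * max 0 (v x)" using assms by (simp add: max_mult_distrib_left)
    then show ?thesis using assms by (simp add: prim_def powr_mult)
  qed
  then show ?thesis by (simp add: P_def)
qed

lemma DP_integrable:
  assumes u: "u \<in> H" and \<phi>: "\<phi> \<in> H"
  shows "integrable lborel (\<lambda>x. \<bar>u x\<bar> powr r * \<bar>\<phi> x\<bar>)" "integrable lborel (\<lambda>x. max 0 (u x) powr r * \<phi> x)"
proof -
  have [measurable]: "u \<in> borel_measurable borel" "\<phi> \<in> borel_measurable borel"
    using HsD(1) u \<phi> by blast+
  have i: "integrable lborel (\<lambda>x. \<bar>u x\<bar> powr (r + 1) + \<bar>\<phi> x\<bar> powr (r + 1))"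
    using Hs_powr_integrable[OF r0(2) r(2)] u \<phi> by (intro Bochner_Integration.integrable_add) auto
  have b: "\<bar>u x\<bar> powr r * \<bar>\<phi> x\<bar> \<le> \<bar>u x\<bar> powr (r + 1) + \<bar>\<phi> x\<bar> powr (r + 1)" for x
  proof -
    let ?m = "max \<bar>u x\<bar> \<bar>\<phi> x\<bar>"
    have "\<bar>u x\<bar> powr r * \<bar>\<phi> x\<bar> \<le> ?m powr r * ?m" using r by (intro mult_mono powr_mono2) auto
    also have "\<dots> = ?m powr (r + 1)" by (cases "?m = 0") (auto simp: powr_add)
    also have "\<dots> \<le> \<bar>u x\<bar> powr (r + 1) + \<bar>\<phi> x\<bar> powr (r + 1)" by (simp add: max_def)
    finally show ?thesis .
  qed
  show 1: "integrable lborel (\<lambda>x. \<bar>u x\<bar> powr r * \<bar>\<phi> x\<bar>)"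
    by (rule Bochner_Integration.integrable_bound[OF i]) (use b in auto)
  show "integrable lborel (\<lambda>x. max 0 (u x) powr r * \<phi> x)"
  proof (rule Bochner_Integration.integrable_bound[OF 1])
    show "AE x in lborel. norm (max 0 (u x) powr r * \<phi> x) \<le> norm (\<bar>u x\<bar> powr r * \<bar>\<phi> x\<bar>)"
      using r by (intro AE_I2) (auto simp: abs_mult intro!: mult_right_mono powr_mono2)
  qed measurable
qed

lemma P_convex:
  assumes u: "u \<in> H" and \<phi>: "\<phi> \<in> H"
  shows "t * DP u \<phi> \<le> P (\<lambda>x. u x + t * \<phi> x) - P u"
proof -
  have ut: "(\<lambda>x. u x + t * \<phi> x) \<in> H" by (rule Hs_add[OF u Hs_cmult[OF \<phi>]])
  have "t * DP u \<phi> = (\<integral>x. t * (max 0 (u x) powr r * \<phi> x) \<partial>lborel)"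
    unfolding DP_def by (rule integral_mult_right_zero[symmetric])
  also have "\<dots> \<le> (\<integral>x. prim r (u x + t * \<phi> x) - prim r (u x) \<partial>lborel)"
  proof (intro integral_mono integrable_mult_right DP_integrable(2)[OF u \<phi>]
      Bochner_Integration.integrable_diff P_integrable[OF ut] P_integrable[OF u])
    fix x
    show "t * (max 0 (u x) powr r * \<phi> x) \<le> prim r (u x + t * \<phi> x) - prim r (u x)"
      using prim_convex[OF r0(1), of "u x" "u x + t * \<phi> x"] by (simp add: mult_ac)
  qed
  also have "\<dots> = P (\<lambda>x. u x + t * \<phi> x) - P u"
    unfolding P_def by (rule Bochner_Integration.integral_diff[OF P_integrable[OF ut] P_integrable[OF u]])
  finally show ?thesis .
qed

text \<open>Dominated convergence, with the integrands at \<open>2 * \<bar>u\<bar>\<close> as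
  majorants. It is needed for the limit of the first variation, which is taken at
  \<open>t n * v\<close> and not at \<open>v\<close>.\<close>

lemma derivatives_ray_tendsto:
  assumes u: "u \<in> H" and \<phi>: "\<phi> \<in> H" and t: "t \<longlonglongrightarrow> (1::real)" "\<And>n. 0 \<le> t n" "\<And>n. t n \<le> 2"
  shows "(\<lambda>n. DG (\<lambda>x. t n * u x) \<phi>) \<longlonglongrightarrow> DG u \<phi>" "(\<lambda>n. DP (\<lambda>x. t n * u x) \<phi>) \<longlonglongrightarrow> DP u \<phi>"
proof -
  have [measurable]: "u \<in> borel_measurable borel" "\<phi> \<in> borel_measurable borel" "w \<in> borel_measurable borel"
    using HsD(1) u \<phi> wH by blast+
  have u2: "(\<lambda>x. 2 * \<bar>u x\<bar>) \<in> H" by (intro Hs_ray Hs_abs u)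
  have tu: "(\<lambda>n. t n * u x) \<longlonglongrightarrow> u x" for x
    using tendsto_mult[OF t(1) tendsto_const, of "u x"] by simp
  have tb: "\<bar>t n * u x\<bar> \<le> 2 * \<bar>u x\<bar>" for n x
    using t(2,3)[of n] by (simp add: abs_mult mult_right_mono)
  have "(\<lambda>n. \<integral>x. max (t n * u x) (w x) powr q * \<phi> x \<partial>lborel) \<longlonglongrightarrow> (\<integral>x. max (u x) (w x) powr q * \<phi> x \<partial>lborel)"
  proof (rule integral_dominated_convergence[where w="\<lambda>x. max (2 * \<bar>u x\<bar>) (w x) powr q * \<bar>\<phi> x\<bar>"])
    show "integrable lborel (\<lambda>x. max (2 * \<bar>u x\<bar>) (w x) powr q * \<bar>\<phi> x\<bar>)"
      by (rule integrable_sublinear[OF q' u2 wH w_nonneg Hs_abs[OF \<phi>]])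
    show "AE x in lborel. (\<lambda>n. max (t n * u x) (w x) powr q * \<phi> x) \<longlonglongrightarrow> max (u x) (w x) powr q * \<phi> x"
      using w_nonneg q by (intro AE_I2 tendsto_mult tendsto_powr2 tendsto_max tu tendsto_const always_eventually) (auto simp: le_max_iff_disj)
    show "AE x in lborel. norm (max (t n * u x) (w x) powr q * \<phi> x) \<le> max (2 * \<bar>u x\<bar>) (w x) powr q * \<bar>\<phi> x\<bar>" for n
    proof (intro AE_I2)
      fix x
      have "max (t n * u x) (w x) powr q \<le> max (2 * \<bar>u x\<bar>) (w x) powr q"
        using w_nonneg[of x] q tb[of n x] by (intro powr_mono2) (auto simp: max_def)
      then show "norm (max (t n * u x) (w x) powr q * \<phi> x) \<le> max (2 * \<bar>u x\<bar>) (w x) powr q * \<bar>\<phi> x\<bar>"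
        by (simp add: abs_mult mult_right_mono)
    qed
  qed measurable
  then show "(\<lambda>n. DG (\<lambda>x. t n * u x) \<phi>) \<longlonglongrightarrow> DG u \<phi>"
    unfolding DG_def by (intro tendsto_mult tendsto_diff tendsto_const)
  show "(\<lambda>n. DP (\<lambda>x. t n * u x) \<phi>) \<longlonglongrightarrow> DP u \<phi>"
    unfolding DP_def
  proof (rule integral_dominated_convergence[where w="\<lambda>x. \<bar>2 * \<bar>u x\<bar>\<bar> powr r * \<bar>\<phi> x\<bar>"])
    show "integrable lborel (\<lambda>x. \<bar>2 * \<bar>u x\<bar>\<bar> powr r * \<bar>\<phi> x\<bar>)" by (rule DP_integrable(1)[OF u2 \<phi>])
    show "AE x in lborel. (\<lambda>n. max 0 (t n * u x) powr r * \<phi> x) \<longlonglongrightarrow> max 0 (u x) powr r * \<phi> x"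
      using r by (intro AE_I2 tendsto_mult tendsto_powr2 tendsto_max tu tendsto_const always_eventually) auto
    show "AE x in lborel. norm (max 0 (t n * u x) powr r * \<phi> x) \<le> \<bar>2 * \<bar>u x\<bar>\<bar> powr r * \<bar>\<phi> x\<bar>" for n
    proof (intro AE_I2)
      fix x
      have "max 0 (t n * u x) powr r \<le> \<bar>2 * \<bar>u x\<bar>\<bar> powr r"
        using r tb[of n x] by (intro powr_mono2) auto
      then show "norm (max 0 (t n * u x) powr r * \<phi> x) \<le> \<bar>2 * \<bar>u x\<bar>\<bar> powr r * \<bar>\<phi> x\<bar>"
        by (simp add: abs_mult mult_right_mono)
    qed
  qed measurable
qed

end

lemma bernoulli_powr:
  fixes r t :: real
  assumes "1 < r" "0 \<le> t"
  shows "r * (t - 1) \<le> t powr r - 1"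
  using powr_tangent[of r 1 t] assms by simp

section \<open>The Nehari set and its fibres\<close>

context superlinear_problem begin

text \<open>
  \<open>N \<mu> u = 0\<close> is the Nehari identity \<open>J'(u) u = 0\<close>; the factor \<open>r + 1\<close> appears because
  \<open>DP u u = (r + 1) * P u\<close>.
\<close>

definition N :: "real \<Rightarrow> ('a \<Rightarrow> real) \<Rightarrow> real" where
  "N \<mu> u = F u u - DG u u - \<mu> * ((r + 1) * P u)"

definition J :: "real \<Rightarrow> ('a \<Rightarrow> real) \<Rightarrow> real" where
  "J \<mu> u = F u u / 2 - G u - \<mu> * P u"

text \<open>The share of the energy that the concave part may take at high energy. It is small
  enough in terms of \<open>r\<close> for the fibre estimates:
  \<open>4 * \<kappa> = (r - 1) / r\<close>, and \<open>r * (1 - \<kappa>) > 1\<close>.\<close>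

definition \<kappa> :: real where "\<kappa> = (r - 1) / (4 * r)"

lemma \<kappa>: "0 < \<kappa>" "\<kappa> < 1 / 4"
  using r by (auto simp: \<kappa>_def field_simps)

lemma DG_ray: "DG (\<lambda>x. t * v x) (\<lambda>x. t * v x) = t * DG (\<lambda>x. t * v x) v"
  by (rule DG_cmult)

lemma N_ray:
  assumes "0 \<le> t"
  shows "N \<mu> (\<lambda>x. t * v x) = t\<^sup>2 * F v v - t * DG (\<lambda>x. t * v x) v - t powr (r + 1) * (\<mu> * ((r + 1) * P v))"
  unfolding N_def form_ray DG_ray P_ray[OF assms] by (simp add: algebra_simps)

lemma N_tendsto:
  assumes "\<And>n. v n \<in> H" "\<And>n. F (v n) (v n) \<le> B" "AE x in lborel. (\<lambda>n. v n x) \<longlonglongrightarrow> u x" "u \<in> H"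
    and "(\<lambda>n. F (v n) (v n)) \<longlonglongrightarrow> F u u"
  shows "(\<lambda>n. N \<mu> (v n)) \<longlonglongrightarrow> N \<mu> u"
  unfolding N_def using DG_tendsto[OF assms(1-4)] P_tendsto[OF assms(1-4)] assms(5)
  by (intro tendsto_diff tendsto_mult tendsto_const)

lemma N_continuous_ray:
  assumes v: "v \<in> H"
  shows "continuous_on UNIV (\<lambda>t. N \<mu> (\<lambda>x. t * v x))"
proof (rule continuous_on_sequentiallyI)
  fix t :: "nat \<Rightarrow> real" and a assume t: "t \<longlonglongrightarrow> a"
  have "(\<lambda>n. (t n)\<^sup>2 * F v v) \<longlonglongrightarrow> a\<^sup>2 * F v v" using t by (intro tendsto_intros)
  then have 1: "(\<lambda>n. F (\<lambda>x. t n * v x) (\<lambda>x. t n * v x)) \<longlonglongrightarrow> F (\<lambda>x. a * v x) (\<lambda>x. a * v x)"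
    unfolding form_ray .
  then obtain B where B: "\<And>n. \<bar>F (\<lambda>x. t n * v x) (\<lambda>x. t n * v x)\<bar> \<le> B"
    using convergent_imp_Bseq[of "\<lambda>n. F (\<lambda>x. t n * v x) (\<lambda>x. t n * v x)"] unfolding Bseq_def convergent_def by auto
  show "(\<lambda>n. N \<mu> (\<lambda>x. t n * v x)) \<longlonglongrightarrow> N \<mu> (\<lambda>x. a * v x)"
  proof (rule N_tendsto[OF _ _ _ _ 1])
    show "F (\<lambda>x. t n * v x) (\<lambda>x. t n * v x) \<le> B" for n using B[of n] by linarith
    show "AE x in lborel. (\<lambda>n. t n * v x) \<longlonglongrightarrow> a * v x" using t by (intro AE_I2 tendsto_intros)
  qed (use v Hs_ray in auto)
qed

text \<open>The fibre map \<open>t \<mapsto> J(t v)\<close> has its global maximum on \<open>t \<ge> 0\<close> at \<open>t = 1\<close> when \<open>v\<close> satisfies the Nehari identity.\<close>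

lemma J_fibre_max:
  assumes v: "v \<in> H" and N: "N \<mu> v = 0" and D: "DG v v \<le> \<kappa> * F v v" and t: "0 \<le> t"
  shows "J \<mu> (\<lambda>x. t * v x) \<le> J \<mu> v"
proof -
  let ?E = "F v v" and ?p = "DG v v"
  \<comment> \<open>With the Nehari identity and the convexity of \<open>G\<close>, the increase of
    \<open>J\<close> from \<open>v\<close> to \<open>t * v\<close> is at most
    \<open>?p * C - ?E * A\<close>. What remains is to bound \<open>C\<close> by a multiple of
    \<open>A\<close>.\<close>
  define X where "X = (t powr (r + 1) - 1) / (r + 1)"
  define A where "A = X - (t\<^sup>2 - 1) / 2"
  define C where "C = X - (t - 1)"
  have C0: "0 \<le> C"
    using powr_tangent[of "r + 1" 1 t] r t unfolding C_def X_def by (simp add: pos_le_divide_eq mult.commute)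
  \<comment> \<open>Bernoulli's inequality for the exponent \<open>r\<close>, multiplied by
    \<open>t\<close>: the expression obtained is exactly
    \<open>2 * r * A - (r - 1) * C\<close>.\<close>
  have key: "(r - 1) * C \<le> 2 * r * A"
  proof -
    have "0 \<le> t * (t powr r - 1 - r * (t - 1))" using bernoulli_powr[OF r(1) t] t by simp
    also have "\<dots> = t powr (r + 1) - r * t\<^sup>2 + (r - 1) * t"
      using t by (cases "t = 0") (auto simp: powr_add power2_eq_square algebra_simps)
    also have "t powr (r + 1) = (r + 1) * X + 1" using r by (simp add: X_def)
    finally show ?thesis unfolding A_def C_def by (simp add: algebra_simps add_divide_distrib diff_divide_distrib)
  qed
  have pC: "?p * C \<le> ?E * A / 2"
  proof -
    have "?p * C \<le> \<kappa> * ?E * C" using D C0 by (intro mult_right_mono)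
    also have "\<dots> = ?E * ((r - 1) * C) / (4 * r)" by (simp add: \<kappa>_def)
    also have "\<dots> \<le> ?E * (2 * r * A) / (4 * r)" using key r by (intro divide_right_mono mult_left_mono) auto
    also have "\<dots> = ?E * A / 2" using r by simp
    finally show ?thesis .
  qed
  have A0: "0 \<le> A" 
  proof -
    have "0 \<le> (r - 1) * C" using r C0 by simp
    then have "0 \<le> 2 * r * A" using key by linarith
    then show ?thesis using r by (simp add: zero_le_mult_iff)
  qed
  have "(t - 1) * ?p \<le> G (\<lambda>x. t * v x) - G v" using G_convex_ray[OF v, of t 1] by simp
  moreover have "\<mu> * P (\<lambda>x. t * v x) - \<mu> * P v = X * (?E - ?p)"
  proof -
    have "?E - ?p = \<mu> * ((r + 1) * P v)" using N by (simp add: N_def)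
    then show ?thesis unfolding P_ray[OF t] X_def using r by (simp add: field_simps)
  qed
  moreover have "0 \<le> ?E * A" using A0 by simp
  ultimately show ?thesis using pC unfolding J_def form_ray A_def C_def
    by (simp add: algebra_simps add_divide_distrib diff_divide_distrib)
qed

text \<open>Beyond \<open>t = 1\<close> the superlinear term outgrows the quadratic one, and the
  concave part is too small to compensate. Together with \<open>N_ray_pos\<close> this shows that
  \<open>N\<close> changes sign at \<open>t = 1\<close>, a property that survives small
  perturbations of \<open>v\<close>.\<close>

lemma N_ray_neg:
  assumes v: "v \<in> H" and N: "N \<mu> v = 0" and D: "DG v v \<le> \<kappa> * F v v" and E: "0 < F v v" and t: "1 < t"
  shows "N \<mu> (\<lambda>x. t * v x) < 0"
proof -
  let ?E = "F v v" and ?p = "DG v v"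
  have m: "\<mu> * ((r + 1) * P v) = ?E - ?p" using N by (simp add: N_def)
  have y: "0 < t powr r - 1" using r t by (simp add: gr_one_powr)
  have "?p \<le> DG (\<lambda>x. t * v x) v" using DG_ray_mono[OF v, of 1 t] t by simp
  then have "t * ?p \<le> t * DG (\<lambda>x. t * v x) v" using t by (intro mult_left_mono) auto
  moreover have tp: "t powr (r + 1) = t * t powr r" using t by (simp add: powr_add)
  ultimately have "N \<mu> (\<lambda>x. t * v x) \<le> t * (?p * (t powr r - 1) - ?E * (t powr r - t))"
    using t unfolding N_ray[OF order.strict_implies_order[OF less_trans[OF zero_less_one t]]] m tp by (simp add: power2_eq_square algebra_simps)
  also have "\<dots> < 0"
  proof (intro mult_pos_neg)
    have "t - 1 \<le> (t powr r - 1) / r" using bernoulli_powr[OF r(1), of t] r t by (simp add: field_simps)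
    then have "(r - 1) / r * (t powr r - 1) \<le> t powr r - t" using r by (simp add: field_simps)
    moreover have "4 * \<kappa> = (r - 1) / r" using r by (simp add: \<kappa>_def field_simps)
    ultimately have "4 * \<kappa> * (t powr r - 1) \<le> t powr r - t" by simp
    moreover have "\<kappa> * (t powr r - 1) < 4 * \<kappa> * (t powr r - 1)" using \<kappa>(1) y by simp
    ultimately have "\<kappa> * (t powr r - 1) < t powr r - t" by linarith
    then have "?E * (\<kappa> * (t powr r - 1)) < ?E * (t powr r - t)" using E by (intro mult_strict_left_mono)
    moreover have "?p * (t powr r - 1) \<le> \<kappa> * ?E * (t powr r - 1)" using D y by (intro mult_right_mono) auto
    ultimately show "?p * (t powr r - 1) - ?E * (t powr r - t) < 0" by (simp add: mult_ac)
  qed (use t in simp)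
  finally show ?thesis .
qed

text \<open>The condition \<open>t2\<close> keeps \<open>t\<close> close to \<open>1\<close>;
  farther down the ray the energy may be so small that the concave part decides the sign of
  \<open>N\<close>.\<close>

lemma N_ray_pos:
  assumes v: "v \<in> H" and N: "N \<mu> v = 0" and D: "DG v v \<le> \<kappa> * F v v" and E: "0 < F v v"
    and t: "0 < t" "t < 1" and t2: "1 < r * t powr (r - 1) * (1 - \<kappa>)"
  shows "0 < N \<mu> (\<lambda>x. t * v x)"
proof -
  let ?E = "F v v" and ?p = "DG v v"
  define y where "y = 1 - t powr r"
  have m: "\<mu> * ((r + 1) * P v) = ?E - ?p" using N by (simp add: N_def)
  have y: "0 < y" using powr_less_mono2[of r t 1] r t by (simp add: y_def)
  have "DG (\<lambda>x. t * v x) v \<le> ?p" using DG_ray_mono[OF v, of t 1] t by simp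
  then have "t * DG (\<lambda>x. t * v x) v \<le> t * ?p" using t by (intro mult_left_mono) auto
  moreover have tp: "t powr (r + 1) = t * t powr r" using t by (simp add: powr_add)
  ultimately have "t * (?E * (y - (1 - t)) - ?p * y) \<le> N \<mu> (\<lambda>x. t * v x)"
    using t unfolding N_ray[OF less_imp_le[OF t(1)]] m tp y_def by (simp add: power2_eq_square algebra_simps)
  moreover have "0 < t * (?E * (y - (1 - t)) - ?p * y)"
  proof (intro mult_pos_pos t)
    have tan: "r * t powr (r - 1) * (1 - t) \<le> y" using powr_tangent[of r t 1] r t by (simp add: y_def)
    have "(1 - t) * 1 < (1 - t) * (r * t powr (r - 1) * (1 - \<kappa>))" using t t2 by (intro mult_strict_left_mono) auto
    also have "\<dots> = (r * t powr (r - 1) * (1 - t)) * (1 - \<kappa>)" by simp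
    also have "\<dots> \<le> y * (1 - \<kappa>)" using tan \<kappa> by (intro mult_right_mono) auto
    finally have "\<kappa> * y < y - (1 - t)" by (simp add: algebra_simps)
    then have "?E * (\<kappa> * y) < ?E * (y - (1 - t))" using E by (intro mult_strict_left_mono)
    moreover have "?p * y \<le> \<kappa> * ?E * y" using D y by (intro mult_right_mono) auto
    ultimately show "0 < ?E * (y - (1 - t)) - ?p * y" by (simp add: mult_ac)
  qed
  ultimately show ?thesis by linarith
qed

text \<open>A positive superlinear term makes \<open>N\<close> negative far out on the ray through
  \<open>w\<close>, and this is how the Nehari set is seen to be nonempty.\<close>

lemma P_subsolution_pos: "0 < P w"
proof (rule ccontr)
  assume "\<not> 0 < P w"
  then have "P w = 0" using P_nonneg[of w] by linarith
  then have "AE x in lborel. prim r (w x) = 0"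
    using integral_nonneg_eq_0_iff_AE[OF P_integrable[OF wH]] r unfolding P_def by (auto simp: prim_def)
  then have "AE x in lborel. x \<notin> \<Omega>"
  proof eventually_elim
    case (elim x)
    then show ?case using weak_subD(2)[OF w, of x] r by (auto simp: prim_def max_def split: if_splits)
  qed
  then have "\<Omega> \<in> null_sets lborel" by (subst AE_iff_null_sets) auto
  then have "negligible \<Omega>" by (simp add: negligible_iff_null_sets null_sets_completionI)
  then show False using open_not_negligible[OF dom(1,3)] by simp
qed

text \<open>On the sphere of energy \<open>\<rho>\<close> the value of \<open>N\<close> is at least
  \<open>(1 - \<kappa>) * \<rho> - 1\<close>, hence at least \<open>1\<close>. The Nehari set does
  not meet this sphere, so a minimizer of energy at least \<open>\<rho>\<close> cannot sit on the
  boundary of the admissible range.\<close>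

lemma N_pos_on_sphere:
  assumes u: "u \<in> H" "F u u = \<rho>" and large: "\<forall>u\<in>H. \<rho> \<le> F u u \<longrightarrow> \<bar>DG u u\<bar> \<le> \<kappa> * F u u"
    and rho: "2 \<le> (1 - \<kappa>) * \<rho>" and small: "\<forall>u\<in>H. F u u \<le> \<rho> \<longrightarrow> \<mu> * ((r + 1) * P u) \<le> 1"
  shows "0 < N \<mu> u"
proof -
  have "DG u u \<le> \<kappa> * \<rho>" using large u by fastforce
  moreover have "\<mu> * ((r + 1) * P u) \<le> 1" using small u by simp
  moreover have "\<rho> - \<kappa> * \<rho> \<ge> 2" using rho by (simp add: algebra_simps)
  ultimately show ?thesis unfolding N_def using u(2) by linarith
qed

text \<open>Between the sphere of energy \<open>\<rho>\<close>, where \<open>N > 0\<close>, and a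
  point of the same ray farther out with \<open>N \<le> 0\<close>, the intermediate value theorem
  gives a Nehari point. It is applied to the ray through \<open>w\<close>, and to bring a limit with
  \<open>N \<le> 0\<close> back to the Nehari set.\<close>

lemma nehari_ray:
  assumes v: "v \<in> H" and E: "0 < F v v" and \<rho>: "0 < \<rho>"
    and large: "\<forall>u\<in>H. \<rho> \<le> F u u \<longrightarrow> \<bar>DG u u\<bar> \<le> \<kappa> * F u u"
    and rho: "2 \<le> (1 - \<kappa>) * \<rho>" and small: "\<forall>u\<in>H. F u u \<le> \<rho> \<longrightarrow> \<mu> * ((r + 1) * P u) \<le> 1"
    and t: "\<rho> \<le> t\<^sup>2 * F v v" "0 < t" "N \<mu> (\<lambda>x. t * v x) \<le> 0"
  shows "\<exists>t1. 0 < t1 \<and> t1 \<le> t \<and> N \<mu> (\<lambda>x. t1 * v x) = 0 \<and> \<rho> \<le> t1\<^sup>2 * F v v"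
proof -
  define t0 where "t0 = sqrt (\<rho> / F v v)"
  have t0: "0 < t0" "t0\<^sup>2 * F v v = \<rho>" using \<rho> E by (auto simp: t0_def)
  have "t0\<^sup>2 \<le> t\<^sup>2" using t(1) E unfolding t0(2)[symmetric] by simp
  then have t0t: "t0 \<le> t" by (rule power2_le_imp_le) (use t(2) in simp)
  have pos: "0 < N \<mu> (\<lambda>x. t0 * v x)"
    by (rule N_pos_on_sphere[OF Hs_ray[OF v] _ large rho small]) (simp add: form_ray t0)
  have "\<exists>t1\<ge>t0. t1 \<le> t \<and> N \<mu> (\<lambda>x. t1 * v x) = 0"
    by (rule IVT2'[where f="\<lambda>t. N \<mu> (\<lambda>x. t * v x)", OF t(3) less_imp_le[OF pos] t0t
          continuous_on_subset[OF N_continuous_ray[OF v] subset_UNIV]])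
  then obtain t1 where t1: "t0 \<le> t1" "t1 \<le> t" "N \<mu> (\<lambda>x. t1 * v x) = 0" by blast
  have "t0\<^sup>2 * F v v \<le> t1\<^sup>2 * F v v" using t0 t1 E by (intro mult_right_mono power_mono) auto
  then show ?thesis using t0 t1 by (intro exI[of _ t1]) auto
qed

text \<open>The energy may drop in the limit \<open>u\<close> of a minimizing sequence, which leaves
  only \<open>N u \<le> 0\<close>. Some factor \<open>t \<le> 1\<close> restores the constraint. As
  \<open>J\<close> is maximal on each fibre at its Nehari point, multiplying the sequence by
  \<open>t\<close> does not increase \<open>J\<close>, and in the limit \<open>t * u\<close> is
  minimal.\<close>

lemma nehari_minimizer:
  assumes mu: "0 < \<mu>" and \<rho>: "0 < \<rho>"
    and large: "\<forall>u\<in>H. \<rho> \<le> F u u \<longrightarrow> \<bar>DG u u\<bar> \<le> \<kappa> * F u u"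
    and rho: "2 \<le> (1 - \<kappa>) * \<rho>" and small: "\<forall>u\<in>H. F u u \<le> \<rho> \<longrightarrow> \<mu> * ((r + 1) * P u) \<le> 1"
  shows "\<exists>v\<in>H. \<rho> < F v v \<and> N \<mu> v = 0 \<and> (\<forall>u\<in>H. \<rho> \<le> F u u \<longrightarrow> N \<mu> u = 0 \<longrightarrow> J \<mu> v \<le> J \<mu> u)"
proof -
  define M where "M = {v \<in> H. \<rho> \<le> F v v \<and> N \<mu> v = 0}"
  note ray = nehari_ray[OF _ _ \<rho> large rho small]
  have D: "\<bar>DG v v\<bar> \<le> \<kappa> * F v v" if "v \<in> M" for v using large that by (auto simp: M_def)
  have ne: "M \<noteq> {}"
  proof -
    define b where "b = \<mu> * ((r + 1) * P w)"
    have b: "0 < b" using P_subsolution_pos mu r by (simp add: b_def)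
    have Ew: "0 < F w w"
    proof (rule ccontr)
      assume "\<not> 0 < F w w"
      then have "AE x in lborel. w x = 0" using wH by (intro Hs_zero_of_form) auto
      then have "AE x in lborel. prim r (w x) = 0" by eventually_elim (simp add: prim_def)
      then have "P w = (\<integral>x. 0 \<partial>(lborel :: 'a measure))" unfolding P_def
        using P_integrable[OF wH] by (intro integral_cong_AE) auto
      then show False using P_subsolution_pos by simp
    qed
    \<comment> \<open>Large enough for \<open>Y * w\<close> to have energy at least
      \<open>\<rho>\<close>, and for its superlinear term to exceed \<open>1 + \<kappa>\<close>
      times the energy, an upper bound for the other two terms of \<open>N\<close>.\<close>
    define Y where "Y = max (sqrt (\<rho> / F w w)) (((1 + \<kappa>) * F w w / b) powr (1 / (r - 1)))"
    have Y1: "\<rho> \<le> Y\<^sup>2 * F w w"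
    proof -
      have "(sqrt (\<rho> / F w w))\<^sup>2 \<le> Y\<^sup>2" using \<rho> Ew unfolding Y_def by (intro power_mono) auto
      then show ?thesis using \<rho> Ew by (simp add: field_simps)
    qed
    have Y0: "0 < Y" using \<rho> Ew by (simp add: Y_def less_max_iff_disj)
    have Y2: "(1 + \<kappa>) * F w w \<le> b * Y powr (r - 1)"
    proof -
      have "(1 + \<kappa>) * F w w / b = (((1 + \<kappa>) * F w w / b) powr (1 / (r - 1))) powr (r - 1)"
        using \<kappa> Ew b r by (simp add: powr_powr)
      also have "\<dots> \<le> Y powr (r - 1)" using r by (intro powr_mono2) (auto simp: Y_def)
      finally show ?thesis using b by (simp add: field_simps)
    qed
    have "N \<mu> (\<lambda>x. Y * w x) \<le> 0"
    proof -
      have "\<bar>DG (\<lambda>x. Y * w x) (\<lambda>x. Y * w x)\<bar> \<le> \<kappa> * (Y\<^sup>2 * F w w)"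
        using large[rule_format, OF Hs_ray[OF wH, of Y]] Y1 unfolding form_ray by simp
      then have "N \<mu> (\<lambda>x. Y * w x) \<le> Y\<^sup>2 * F w w + \<kappa> * (Y\<^sup>2 * F w w) - Y powr (r + 1) * b"
        unfolding N_def form_ray P_ray[OF less_imp_le[OF Y0]] b_def by (simp add: algebra_simps)
      also have "Y powr (r + 1) = Y\<^sup>2 * Y powr (r - 1)"
      proof -
        have "Y powr (r + 1) = Y powr (2 + (r - 1))" by (rule arg_cong[where f="\<lambda>a. Y powr a"]) simp
        also have "\<dots> = Y powr 2 * Y powr (r - 1)" by (rule powr_add)
        finally show ?thesis using Y0 by simp
      qed
      also have "Y\<^sup>2 * F w w + \<kappa> * (Y\<^sup>2 * F w w) - Y\<^sup>2 * Y powr (r - 1) * b = Y\<^sup>2 * ((1 + \<kappa>) * F w w - b * Y powr (r - 1))"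
        by (simp add: algebra_simps)
      also have "\<dots> \<le> 0" using Y2 by (intro mult_nonneg_nonpos) auto
      finally show ?thesis .
    qed
    then obtain t1 where "0 < t1" "N \<mu> (\<lambda>x. t1 * w x) = 0" "\<rho> \<le> t1\<^sup>2 * F w w"
      using ray[OF wH Ew Y1 Y0] by blast
    then have "(\<lambda>x. t1 * w x) \<in> M" using Hs_ray[OF wH] by (auto simp: M_def form_ray)
    then show ?thesis by blast
  qed
  \<comment> \<open>This is \<open>1 / 2 - 1 / (r + 1)\<close>: the fraction of the energy that
    remains in \<open>J\<close> once \<open>P\<close> is eliminated by the Nehari identity. It makes
    \<open>J\<close> coercive on the Nehari set, although \<open>J\<close> is unbounded below on
    \<open>H\<close>.\<close>
  define \<theta> where "\<theta> = (r - 1) / (2 * (r + 1))"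
  have \<theta>: "0 < \<theta>" "\<theta> \<le> 1 / 2" using r by (auto simp: \<theta>_def field_simps)
  obtain C1 where C1: "\<forall>u\<in>H. \<bar>G u\<bar> \<le> \<theta> / 4 * F u u + C1" using G_growth[of "\<theta> / 4"] \<theta> by auto
  obtain C2 where C2: "\<forall>u\<in>H. \<bar>DG u u\<bar> \<le> \<theta> / 4 * F u u + C2" using DG_growth[of "\<theta> / 4"] \<theta> by auto
  have coer: "\<theta> / 2 * F v v - (C1 + \<bar>C2\<bar>) \<le> J \<mu> v" if v: "v \<in> M" for v
  proof -
    have vH: "v \<in> H" using v by (simp add: M_def)
    have "\<mu> * P v = (F v v - DG v v) / (r + 1)"
      using v r by (simp add: M_def N_def field_simps)
    then have "J \<mu> v = F v v / 2 - G v - F v v / (r + 1) + DG v v / (r + 1)"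
      unfolding J_def by (simp add: diff_divide_distrib)
    also have "F v v / 2 - G v - F v v / (r + 1) + DG v v / (r + 1) = \<theta> * F v v - G v + DG v v / (r + 1)"
      using r by (simp add: \<theta>_def field_simps)
    finally have 1: "J \<mu> v = \<theta> * F v v - G v + DG v v / (r + 1)" .
    have "\<bar>DG v v / (r + 1)\<bar> \<le> \<bar>DG v v\<bar>" using r mult_left_mono[of 1 "r + 1" "\<bar>DG v v\<bar>"] by (simp add: abs_divide divide_le_eq)
    also have "\<dots> \<le> \<theta> / 4 * F v v + \<bar>C2\<bar>" using C2[rule_format, OF vH] by linarith
    finally have 2: "- (\<theta> / 4 * F v v + \<bar>C2\<bar>) \<le> DG v v / (r + 1)" by linarith
    have 3: "G v \<le> \<theta> / 4 * F v v + C1" using C1[rule_format, OF vH] by linarith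
    have "\<theta> * F v v = \<theta> / 2 * F v v + \<theta> / 4 * F v v + \<theta> / 4 * F v v" by simp
    then show ?thesis using 1 2 3 by linarith
  qed
  have bb: "bdd_below (J \<mu> ` M)"
  proof (rule bdd_belowI2)
    fix v assume v: "v \<in> M"
    have "0 \<le> \<theta> / 2 * F v v" using \<theta> by simp
    then show "- (C1 + \<bar>C2\<bar>) \<le> J \<mu> v" using coer[OF v] by linarith
  qed
  define m where "m = Inf (J \<mu> ` M)"
  have mJ: "m \<le> J \<mu> u" if "u \<in> M" for u unfolding m_def using bb that by (intro cInf_lower) auto
  have "\<exists>u\<in>M. J \<mu> u < m + 1 / real (Suc n)" for n
    using cInf_lessD[of "J \<mu> ` M" "m + 1 / real (Suc n)"] ne by (auto simp: m_def)
  then obtain v where v: "\<And>n. v n \<in> M" "\<And>n. J \<mu> (v n) < m + 1 / real (Suc n)" by metis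
  have vH: "v n \<in> H" and vN: "N \<mu> (v n) = 0" and v\<rho>: "\<rho> \<le> F (v n) (v n)" for n using v(1)[of n] by (auto simp: M_def)
  define B where "B = 2 * (m + 1 + (C1 + \<bar>C2\<bar>)) / \<theta>"
  have B: "F (v n) (v n) \<le> B" for n
  proof -
    have "J \<mu> (v n) < m + 1" using v(2)[of n] by (rule less_le_trans) simp
    then have "\<theta> / 2 * F (v n) (v n) \<le> m + 1 + (C1 + \<bar>C2\<bar>)" using coer[OF v(1)[of n]] by simp
    then show ?thesis using \<theta> by (simp add: B_def field_simps)
  qed
  obtain k u where k: "strict_mono (k :: nat \<Rightarrow> nat)" "u \<in> H" "AE x in lborel. (\<lambda>n. v (k n) x) \<longlonglongrightarrow> u x"
    using Hs_compact[of v, OF vH B] by (elim exE conjE) (rule that)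
  have Jm: "(\<lambda>n. J \<mu> (v n)) \<longlonglongrightarrow> m"
  proof (rule tendsto_sandwich[of "\<lambda>_. m" _ _ "\<lambda>n. m + 1 / real (Suc n)"])
    show "(\<lambda>n. m + 1 / real (Suc n)) \<longlonglongrightarrow> m"
      using tendsto_add[OF tendsto_const LIMSEQ_inverse_real_of_nat, of m] by (simp add: inverse_eq_divide)
    show "(\<lambda>_. m) \<longlonglongrightarrow> m" by simp
    show "\<forall>\<^sub>F n in sequentially. m \<le> J \<mu> (v n)" using mJ v(1) by simp
    show "\<forall>\<^sub>F n in sequentially. J \<mu> (v n) \<le> m + 1 / real (Suc n)" using v(2) by (intro always_eventually allI less_imp_le)
  qed
  then have Jk: "(\<lambda>n. J \<mu> (v (k n))) \<longlonglongrightarrow> m" using LIMSEQ_subseq_LIMSEQ[OF Jm k(1)] by (simp add: o_def)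
  have Gk: "(\<lambda>n. G (v (k n))) \<longlonglongrightarrow> G u" by (rule G_tendsto[of "\<lambda>n. v (k n)", OF vH B k(3,2)])
  have Pk: "(\<lambda>n. P (v (k n))) \<longlonglongrightarrow> P u" by (rule P_tendsto[of "\<lambda>n. v (k n)", OF vH B k(3,2)])
  have Dk: "(\<lambda>n. DG (v (k n)) (v (k n))) \<longlonglongrightarrow> DG u u" by (rule DG_tendsto[of "\<lambda>n. v (k n)", OF vH B k(3,2)])
  \<comment> \<open>By the Nehari identity, the energy is a sum of terms that are continuous along
    the sequence. So the energies converge, though possibly to more than the energy of the
    limit.\<close>
  define L where "L = DG u u + \<mu> * ((r + 1) * P u)"
  have "(\<lambda>n. DG (v (k n)) (v (k n)) + \<mu> * ((r + 1) * P (v (k n)))) \<longlonglongrightarrow> L"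
    unfolding L_def by (intro tendsto_add tendsto_mult tendsto_const Dk Pk)
  moreover have "DG (v (k n)) (v (k n)) + \<mu> * ((r + 1) * P (v (k n))) = F (v (k n)) (v (k n))" for n
    using vN[of "k n"] by (simp add: N_def)
  ultimately have FL: "(\<lambda>n. F (v (k n)) (v (k n))) \<longlonglongrightarrow> L" by simp
  have uL: "F u u \<le> L" by (rule Hs_limit_le[of "\<lambda>n. v (k n)", OF vH FL k(3) HsD(1,2)[OF k(2)]])
  \<comment> \<open>Along the sequence the superlinear term is at least \<open>2\<close>, whereas
    \<open>small\<close> bounds it by \<open>1\<close> at energies up to \<open>\<rho>\<close>.
    Since it is continuous, the limit keeps an energy above \<open>\<rho>\<close>.\<close>
  have "2 \<le> \<mu> * ((r + 1) * P u)"
  proof (rule LIMSEQ_le_const)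
    show "(\<lambda>n. \<mu> * ((r + 1) * P (v (k n)))) \<longlonglongrightarrow> \<mu> * ((r + 1) * P u)" by (intro tendsto_mult tendsto_const Pk)
    have "2 \<le> \<mu> * ((r + 1) * P (v n))" for n
    proof -
      have "(1 - \<kappa>) * \<rho> \<le> (1 - \<kappa>) * F (v n) (v n)" using v\<rho> \<kappa> by (intro mult_left_mono) auto
      moreover have "\<mu> * ((r + 1) * P (v n)) = F (v n) (v n) - DG (v n) (v n)" using vN[of n] by (simp add: N_def)
      moreover have "DG (v n) (v n) \<le> \<kappa> * F (v n) (v n)" using D[OF v(1)[of n]] by linarith
      ultimately show ?thesis using rho by (simp add: algebra_simps)
    qed
    then show "\<exists>N. \<forall>n\<ge>N. 2 \<le> \<mu> * ((r + 1) * P (v (k n)))" by blast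
  qed
  then have u\<rho>: "\<rho> < F u u" using small[rule_format, OF k(2)] by (meson not_le order.trans one_le_numeral order.antisym numeral_le_one_iff semiring_norm(69))
  have "N \<mu> (\<lambda>x. 1 * u x) \<le> 0" using uL by (simp add: N_def L_def)
  moreover have "0 < F u u" using u\<rho> \<rho> by linarith
  ultimately obtain t where t: "0 < t" "t \<le> 1" "N \<mu> (\<lambda>x. t * u x) = 0" "\<rho> \<le> t\<^sup>2 * F u u"
    using ray[OF k(2), of 1] u\<rho> by auto
  let ?v = "\<lambda>x. t * u x"
  have vM: "?v \<in> M" using t Hs_ray[OF k(2)] by (simp add: M_def form_ray)
  have "J \<mu> ?v \<le> m"
  proof -
    have tH: "(\<lambda>x. t * v (k n) x) \<in> H" for n by (rule Hs_ray[OF vH])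
    have tB: "F (\<lambda>x. t * v (k n) x) (\<lambda>x. t * v (k n) x) \<le> t\<^sup>2 * B" for n
      unfolding form_ray using B by (intro mult_left_mono) auto
    have tl: "AE x in lborel. (\<lambda>n. t * v (k n) x) \<longlonglongrightarrow> t * u x"
      using k(3) by eventually_elim (intro tendsto_mult tendsto_const)
    have "(\<lambda>n. t\<^sup>2 * F (v (k n)) (v (k n)) / 2 - G (\<lambda>x. t * v (k n) x) - \<mu> * P (\<lambda>x. t * v (k n) x))
        \<longlonglongrightarrow> t\<^sup>2 * L / 2 - G ?v - \<mu> * P ?v"
      by (intro tendsto_diff tendsto_divide tendsto_mult tendsto_const FL
          G_tendsto[of "\<lambda>n x. t * v (k n) x", OF tH tB tl Hs_ray[OF k(2)]] P_tendsto[of "\<lambda>n x. t * v (k n) x", OF tH tB tl Hs_ray[OF k(2)]]) auto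
    then have "(\<lambda>n. J \<mu> (\<lambda>x. t * v (k n) x)) \<longlonglongrightarrow> t\<^sup>2 * L / 2 - G ?v - \<mu> * P ?v"
      by (simp add: J_def form_ray)
    moreover have "J \<mu> (\<lambda>x. t * v (k n) x) \<le> J \<mu> (v (k n))" for n
    proof (rule J_fibre_max[OF vH vN])
      show "DG (v (k n)) (v (k n)) \<le> \<kappa> * F (v (k n)) (v (k n))" using D[OF v(1)[of "k n"]] by linarith
    qed (use t in simp)
    ultimately have "t\<^sup>2 * L / 2 - G ?v - \<mu> * P ?v \<le> m" using Jk by (intro LIMSEQ_le[of _ _ _ m]) auto
    moreover have "J \<mu> ?v \<le> t\<^sup>2 * L / 2 - G ?v - \<mu> * P ?v"
      unfolding J_def form_ray using uL by (simp add: mult_left_mono)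
    ultimately show ?thesis by linarith
  qed
  moreover have "\<rho> < F ?v ?v"
  proof (rule ccontr)
    assume "\<not> \<rho> < F ?v ?v"
    then have "F ?v ?v = \<rho>" using vM by (simp add: M_def)
    then have "0 < N \<mu> ?v"
      using vM by (intro N_pos_on_sphere[OF _ _ large rho small]) (auto simp: M_def)
    then show False using t by simp
  qed
  ultimately show ?thesis using vM mJ by (intro bexI[of _ ?v]) (force simp: M_def)+
qed

text \<open>The function \<open>v + \<sigma> * \<phi>\<close> is rescaled by a factor
  \<open>t\<close> to the Nehari set. Then
  \<open>J (t v) \<le> J v \<le> J (t (v + \<sigma> \<phi>))\<close>, the first by maximality on the
  fibre and the second by minimality, so \<open>J\<close> is compared at two functions that differ
  by \<open>t \<sigma> \<phi>\<close>. Division by \<open>t \<sigma>\<close> and the limits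
  \<open>\<sigma> \<rightarrow> 0\<close>, \<open>t \<rightarrow> 1\<close> give the inequality;
  \<open>- \<phi>\<close> will give the reverse.\<close>

lemma nehari_critical:
  assumes mu: "0 < \<mu>" and \<rho>: "0 < \<rho>"
    and large: "\<forall>u\<in>H. \<rho> \<le> F u u \<longrightarrow> \<bar>DG u u\<bar> \<le> \<kappa> * F u u"
    and v: "v \<in> H" "\<rho> < F v v" "N \<mu> v = 0"
    and min: "\<forall>u\<in>H. \<rho> \<le> F u u \<longrightarrow> N \<mu> u = 0 \<longrightarrow> J \<mu> v \<le> J \<mu> u" and \<phi>: "\<phi> \<in> H"
  shows "DG v \<phi> + \<mu> * DP v \<phi> \<le> F v \<phi>"
proof -
  let ?E = "F v v"
  have E: "0 < ?E" using v(2) \<rho> by linarith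
  have Dv: "DG v v \<le> \<kappa> * ?E" using large v by force
  \<comment> \<open>For small \<open>\<sigma>\<close> the signs of \<open>N\<close> at the factors
    \<open>1 - \<delta>\<close> and \<open>1 + \<delta>\<close> persist, so a Nehari point lies in
    between; the energy at the factor \<open>1 - \<delta>\<close> already exceeds
    \<open>\<rho>\<close>.\<close>
  have step: "\<exists>t\<in>{1 - \<delta>..1 + \<delta>}. \<exists>\<sigma>\<in>{0<..e}. (\<lambda>x. t * (v x + \<sigma> * \<phi> x)) \<in> H \<and>
      \<rho> \<le> F (\<lambda>x. t * (v x + \<sigma> * \<phi> x)) (\<lambda>x. t * (v x + \<sigma> * \<phi> x)) \<and> N \<mu> (\<lambda>x. t * (v x + \<sigma> * \<phi> x)) = 0"
    if \<delta>: "0 < \<delta>" "\<delta> < 1" and lo: "0 < N \<mu> (\<lambda>x. (1 - \<delta>) * v x)" and hi: "N \<mu> (\<lambda>x. (1 + \<delta>) * v x) < 0"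
      and big: "\<rho> < (1 - \<delta>)\<^sup>2 * ?E" and e: "0 < e" for \<delta> e
  proof -
    define \<sigma> where "\<sigma> n = 1 / real (Suc n)" for n
    have \<sigma>0: "\<sigma> \<longlonglongrightarrow> 0" unfolding \<sigma>_def using LIMSEQ_inverse_real_of_nat by (simp add: inverse_eq_divide)
    have vs: "(\<lambda>x. v x + \<sigma> n * \<phi> x) \<in> H" for n by (intro Hs_add Hs_cmult v \<phi>)
    have Fs: "(\<lambda>n. F (\<lambda>x. v x + \<sigma> n * \<phi> x) (\<lambda>x. v x + \<sigma> n * \<phi> x)) \<longlonglongrightarrow> ?E"
    proof -
      have "(\<lambda>n. ?E + 2 * \<sigma> n * F v \<phi> + (\<sigma> n)\<^sup>2 * F \<phi> \<phi>) \<longlonglongrightarrow> ?E + 2 * 0 * F v \<phi> + 0\<^sup>2 * F \<phi> \<phi>"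
        by (intro tendsto_intros \<sigma>0)
      then show ?thesis using form_add_scaled[OF v(1) \<phi>] by simp
    qed
    have Fc: "(\<lambda>n. F (\<lambda>x. c * (v x + \<sigma> n * \<phi> x)) (\<lambda>x. c * (v x + \<sigma> n * \<phi> x))) \<longlonglongrightarrow> c\<^sup>2 * ?E" for c
    proof -
      have "F (\<lambda>x. c * (v x + \<sigma> n * \<phi> x)) (\<lambda>x. c * (v x + \<sigma> n * \<phi> x)) = c\<^sup>2 * F (\<lambda>x. v x + \<sigma> n * \<phi> x) (\<lambda>x. v x + \<sigma> n * \<phi> x)" for n
        by (rule form_ray[of c "\<lambda>x. v x + \<sigma> n * \<phi> x"])
      then show ?thesis using tendsto_mult[OF tendsto_const Fs, of "c\<^sup>2"] by simp
    qed
    have Nc: "(\<lambda>n. N \<mu> (\<lambda>x. c * (v x + \<sigma> n * \<phi> x))) \<longlonglongrightarrow> N \<mu> (\<lambda>x. c * v x)" for c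
    proof -
      obtain B where B: "\<And>n. \<bar>F (\<lambda>x. c * (v x + \<sigma> n * \<phi> x)) (\<lambda>x. c * (v x + \<sigma> n * \<phi> x))\<bar> \<le> B"
        using convergent_imp_Bseq[of "\<lambda>n. F (\<lambda>x. c * (v x + \<sigma> n * \<phi> x)) (\<lambda>x. c * (v x + \<sigma> n * \<phi> x))"] Fc
        unfolding Bseq_def convergent_def by auto
      show ?thesis
      proof (rule N_tendsto[of "\<lambda>n x. c * (v x + \<sigma> n * \<phi> x)"])
        show "(\<lambda>x. c * (v x + \<sigma> n * \<phi> x)) \<in> H" for n by (rule Hs_cmult[OF vs])
        show "F (\<lambda>x. c * (v x + \<sigma> n * \<phi> x)) (\<lambda>x. c * (v x + \<sigma> n * \<phi> x)) \<le> B" for n using B[of n] by linarith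
        show "AE x in lborel. (\<lambda>n. c * (v x + \<sigma> n * \<phi> x)) \<longlonglongrightarrow> c * v x"
        proof (intro AE_I2)
          fix x
          have "(\<lambda>n. c * (v x + \<sigma> n * \<phi> x)) \<longlonglongrightarrow> c * (v x + 0 * \<phi> x)" by (intro tendsto_intros \<sigma>0)
          then show "(\<lambda>n. c * (v x + \<sigma> n * \<phi> x)) \<longlonglongrightarrow> c * v x" by simp
        qed
        show "(\<lambda>x. c * v x) \<in> H" by (rule Hs_cmult[OF v(1)])
        show "(\<lambda>n. F (\<lambda>x. c * (v x + \<sigma> n * \<phi> x)) (\<lambda>x. c * (v x + \<sigma> n * \<phi> x))) \<longlonglongrightarrow> F (\<lambda>x. c * v x) (\<lambda>x. c * v x)"
          unfolding form_ray by (intro tendsto_mult tendsto_const Fs)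
      qed
    qed
    have "\<forall>\<^sub>F n in sequentially. 0 < N \<mu> (\<lambda>x. (1 - \<delta>) * (v x + \<sigma> n * \<phi> x)) \<and> N \<mu> (\<lambda>x. (1 + \<delta>) * (v x + \<sigma> n * \<phi> x)) < 0
        \<and> \<rho> < F (\<lambda>x. (1 - \<delta>) * (v x + \<sigma> n * \<phi> x)) (\<lambda>x. (1 - \<delta>) * (v x + \<sigma> n * \<phi> x)) \<and> \<sigma> n < e"
      by (intro eventually_conj order_tendstoD(1)[OF Nc lo] order_tendstoD(2)[OF Nc hi]
          order_tendstoD(1)[OF Fc big] order_tendstoD(2)[OF \<sigma>0 e])
    then obtain n where n: "0 < N \<mu> (\<lambda>x. (1 - \<delta>) * (v x + \<sigma> n * \<phi> x))" "N \<mu> (\<lambda>x. (1 + \<delta>) * (v x + \<sigma> n * \<phi> x)) < 0"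
      "\<rho> < F (\<lambda>x. (1 - \<delta>) * (v x + \<sigma> n * \<phi> x)) (\<lambda>x. (1 - \<delta>) * (v x + \<sigma> n * \<phi> x))" "\<sigma> n < e"
      using eventually_happens'[OF sequentially_bot] by blast
    let ?z = "\<lambda>x. v x + \<sigma> n * \<phi> x"
    have "\<exists>t\<ge>1 - \<delta>. t \<le> 1 + \<delta> \<and> N \<mu> (\<lambda>x. t * ?z x) = 0"
      by (rule IVT2'[where f="\<lambda>t. N \<mu> (\<lambda>x. t * (v x + \<sigma> n * \<phi> x))", OF less_imp_le[OF n(2)] less_imp_le[OF n(1)] _
          continuous_on_subset[OF N_continuous_ray[OF vs[of n]] subset_UNIV]]) (use \<delta> in simp)
    then obtain t where t: "1 - \<delta> \<le> t" "t \<le> 1 + \<delta>" "N \<mu> (\<lambda>x. t * ?z x) = 0" by blast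
    have "(1 - \<delta>)\<^sup>2 * F ?z ?z \<le> t\<^sup>2 * F ?z ?z" using t \<delta> by (intro mult_right_mono power_mono) auto
    then have "\<rho> \<le> F (\<lambda>x. t * ?z x) (\<lambda>x. t * ?z x)" using n(3) form_ray[of "1 - \<delta>" ?z] form_ray[of t ?z] by linarith
    then show ?thesis using t n(4) Hs_cmult[OF vs[of n]] by (intro bexI[of _ t] bexI[of _ "\<sigma> n"]) (auto simp: \<sigma>_def)
  qed
  \<comment> \<open>The first condition is the one of \<open>N_ray_pos\<close> at
    \<open>t = 1 - \<delta>\<close>, the second keeps the energy above \<open>\<rho>\<close>, and
    \<open>\<delta> < 1 / 2\<close> keeps all factors positive and below \<open>2\<close>.\<close>
  have "\<forall>\<^sub>F \<delta> in at_right 0. 1 < r * (1 - \<delta>) powr (r - 1) * (1 - \<kappa>) \<and> \<rho> < (1 - \<delta>)\<^sup>2 * ?E \<and> \<delta> < 1 / 2"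
  proof (intro eventually_conj)
    have "((\<lambda>\<delta>. r * (1 - \<delta>) powr (r - 1) * (1 - \<kappa>)) \<longlongrightarrow> r * (1 - 0) powr (r - 1) * (1 - \<kappa>)) (at_right 0)"
      by (intro tendsto_intros) auto
    moreover have "1 < r * (1 - 0) powr (r - 1) * (1 - \<kappa>)"
    proof -
      have "r * (1 - \<kappa>) = r - (r - 1) / 4" using r by (simp add: \<kappa>_def field_simps)
      moreover have "1 < r - (r - 1) / 4" using r(1) by (simp add: field_simps)
      ultimately show ?thesis by simp
    qed
    ultimately show "\<forall>\<^sub>F \<delta> in at_right 0. 1 < r * (1 - \<delta>) powr (r - 1) * (1 - \<kappa>)" by (rule order_tendstoD(1))
    have "((\<lambda>\<delta>. (1 - \<delta>)\<^sup>2 * ?E) \<longlongrightarrow> (1 - 0)\<^sup>2 * ?E) (at_right 0)" by (intro tendsto_intros)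
    then show "\<forall>\<^sub>F \<delta> in at_right 0. \<rho> < (1 - \<delta>)\<^sup>2 * ?E" using v(2) by (intro order_tendstoD(1)) auto
    show "\<forall>\<^sub>F \<delta> in at_right (0::real). \<delta> < 1 / 2" by (rule order_tendstoD(2)[OF tendsto_ident_at]) simp
  qed
  then obtain \<delta>0 where \<delta>0: "0 < \<delta>0" "\<And>\<delta>. 0 < \<delta> \<Longrightarrow> \<delta> < \<delta>0 \<Longrightarrow> 1 < r * (1 - \<delta>) powr (r - 1) * (1 - \<kappa>) \<and> \<rho> < (1 - \<delta>)\<^sup>2 * ?E \<and> \<delta> < 1 / 2"
    unfolding eventually_at_right_field by auto
  define \<delta> where "\<delta> n = \<delta>0 * (1 / real (Suc (Suc n)))" for n
  have \<delta>: "0 < \<delta> n" "\<delta> n < \<delta>0" for n using \<delta>0(1) by (auto simp: \<delta>_def divide_less_eq)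
  have \<delta>lim: "\<delta> \<longlonglongrightarrow> 0"
    using tendsto_mult[OF tendsto_const LIMSEQ_Suc[OF LIMSEQ_inverse_real_of_nat], of \<delta>0]
    by (simp add: \<delta>_def[abs_def] inverse_eq_divide)
  define Q where "Q n t \<sigma> \<longleftrightarrow> 1 - \<delta> n \<le> t \<and> t \<le> 1 + \<delta> n \<and> 0 < \<sigma> \<and> \<sigma> \<le> 1 / real (Suc n) \<and> (\<lambda>x. t * (v x + \<sigma> * \<phi> x)) \<in> H \<and>
      \<rho> \<le> F (\<lambda>x. t * (v x + \<sigma> * \<phi> x)) (\<lambda>x. t * (v x + \<sigma> * \<phi> x)) \<and> N \<mu> (\<lambda>x. t * (v x + \<sigma> * \<phi> x)) = 0" for n t \<sigma>
  have "\<exists>t \<sigma>. Q n t \<sigma>" for n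
  proof -
    have d: "0 < \<delta> n" "\<delta> n < 1" "1 < r * (1 - \<delta> n) powr (r - 1) * (1 - \<kappa>)" "\<rho> < (1 - \<delta> n)\<^sup>2 * ?E"
      using \<delta>0(2)[OF \<delta>, of n] \<delta>(1)[of n] by auto
    have "0 < N \<mu> (\<lambda>x. (1 - \<delta> n) * v x)" using d by (intro N_ray_pos[OF v(1,3) Dv E]) auto
    moreover have "N \<mu> (\<lambda>x. (1 + \<delta> n) * v x) < 0" using d by (intro N_ray_neg[OF v(1,3) Dv E]) auto
    ultimately show ?thesis using step[OF d(1,2) _ _ d(4), of "1 / real (Suc n)"] unfolding Q_def by fastforce
  qed
  then obtain t \<sigma> where Q: "\<And>n. Q n (t n) (\<sigma> n)" by metis
  have ts: "\<And>n. 1 - \<delta> n \<le> t n" "\<And>n. t n \<le> 1 + \<delta> n" "\<And>n. 0 < \<sigma> n" "\<And>n. \<sigma> n \<le> 1 / real (Suc n)"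
    "\<And>n. (\<lambda>x. t n * (v x + \<sigma> n * \<phi> x)) \<in> H"
    "\<And>n. \<rho> \<le> F (\<lambda>x. t n * (v x + \<sigma> n * \<phi> x)) (\<lambda>x. t n * (v x + \<sigma> n * \<phi> x))"
    "\<And>n. N \<mu> (\<lambda>x. t n * (v x + \<sigma> n * \<phi> x)) = 0"
    using Q unfolding Q_def by simp_all
  have t02: "0 < t n" "t n \<le> 2" for n using ts(1,2)[of n] \<delta>0(2)[OF \<delta>, of n] \<delta>(1)[of n] by auto
  have tl: "t \<longlonglongrightarrow> 1"
  proof (rule tendsto_sandwich)
    show "(\<lambda>n. 1 - \<delta> n) \<longlonglongrightarrow> 1" using tendsto_diff[OF tendsto_const \<delta>lim, of 1] by simp
    show "(\<lambda>n. 1 + \<delta> n) \<longlonglongrightarrow> 1" using tendsto_add[OF tendsto_const \<delta>lim, of 1] by simp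
  qed (use ts in auto)
  have \<sigma>l: "\<sigma> \<longlonglongrightarrow> 0"
  proof (rule tendsto_sandwich[of "\<lambda>_. 0" _ _ "\<lambda>n. 1 / real (Suc n)"])
    show "(\<lambda>n. 1 / real (Suc n)) \<longlonglongrightarrow> 0" using LIMSEQ_inverse_real_of_nat by (simp add: inverse_eq_divide)
    show "(\<lambda>n. 0) \<longlonglongrightarrow> (0::real)" by simp
    show "\<forall>\<^sub>F n in sequentially. 0 \<le> \<sigma> n" using ts(3) by (intro always_eventually allI less_imp_le)
    show "\<forall>\<^sub>F n in sequentially. \<sigma> n \<le> 1 / real (Suc n)" using ts(4) by (intro always_eventually allI)
  qed
  have ineq: "0 \<le> t n * F v \<phi> + t n * \<sigma> n / 2 * F \<phi> \<phi> - (DG (\<lambda>x. t n * v x) \<phi> + \<mu> * DP (\<lambda>x. t n * v x) \<phi>)" for n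
  proof -
    have eq: "(\<lambda>x. t n * (v x + \<sigma> n * \<phi> x)) = (\<lambda>x. t n * v x + (t n * \<sigma> n) * \<phi> x)"
      by (simp add: algebra_simps)
    have tv: "(\<lambda>x. t n * v x) \<in> H" by (rule Hs_ray[OF v(1)])
    have "J \<mu> (\<lambda>x. t n * v x) \<le> J \<mu> v" using t02[of n] by (intro J_fibre_max[OF v(1,3) Dv]) auto
    also have "\<dots> \<le> J \<mu> (\<lambda>x. t n * (v x + \<sigma> n * \<phi> x))" using min ts by blast
    finally have "J \<mu> (\<lambda>x. t n * v x) \<le> J \<mu> (\<lambda>x. t n * v x + (t n * \<sigma> n) * \<phi> x)" unfolding eq .
    moreover have "(t n * \<sigma> n) * DG (\<lambda>x. t n * v x) \<phi> \<le> G (\<lambda>x. t n * v x + (t n * \<sigma> n) * \<phi> x) - G (\<lambda>x. t n * v x)"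
      by (rule G_convex[OF tv \<phi>])
    moreover have "\<mu> * ((t n * \<sigma> n) * DP (\<lambda>x. t n * v x) \<phi>) \<le> \<mu> * (P (\<lambda>x. t n * v x + (t n * \<sigma> n) * \<phi> x) - P (\<lambda>x. t n * v x))"
      using mu by (intro mult_left_mono P_convex[OF tv \<phi>]) auto
    moreover have "F (\<lambda>x. t n * v x + (t n * \<sigma> n) * \<phi> x) (\<lambda>x. t n * v x + (t n * \<sigma> n) * \<phi> x)
      = F (\<lambda>x. t n * v x) (\<lambda>x. t n * v x) + 2 * (t n * \<sigma> n) * (t n * F v \<phi>) + (t n * \<sigma> n)\<^sup>2 * F \<phi> \<phi>"
      using form_add_scaled[OF tv \<phi>, of "t n * \<sigma> n"] by (simp add: form_cmult)
    ultimately have "0 \<le> (t n * \<sigma> n) * (t n * F v \<phi> + t n * \<sigma> n / 2 * F \<phi> \<phi> - (DG (\<lambda>x. t n * v x) \<phi> + \<mu> * DP (\<lambda>x. t n * v x) \<phi>))"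
      unfolding J_def by (simp add: algebra_simps power2_eq_square add_divide_distrib)
    moreover have "0 < t n * \<sigma> n" using t02[of n] ts(3)[of n] by simp
    ultimately show ?thesis by (simp add: zero_le_mult_iff)
  qed
  have "(\<lambda>n. t n * F v \<phi> + t n * \<sigma> n / 2 * F \<phi> \<phi> - (DG (\<lambda>x. t n * v x) \<phi> + \<mu> * DP (\<lambda>x. t n * v x) \<phi>))
     \<longlonglongrightarrow> 1 * F v \<phi> + 1 * 0 / 2 * F \<phi> \<phi> - (DG v \<phi> + \<mu> * DP v \<phi>)"
    using t02 less_imp_le
    by (intro tendsto_intros tl \<sigma>l derivatives_ray_tendsto[OF v(1) \<phi> tl]) auto
  then have "0 \<le> 1 * F v \<phi> + 1 * 0 / 2 * F \<phi> \<phi> - (DG v \<phi> + \<mu> * DP v \<phi>)"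
    by (rule LIMSEQ_le_const) (use ineq in auto)
  then show ?thesis by simp
qed

lemma large_solution:
  "\<exists>\<mu>0>0. \<forall>\<mu>. 0 < \<mu> \<longrightarrow> \<mu> < \<mu>0 \<longrightarrow> (\<exists>v. solves q r lam \<mu> v \<and> (AE x in lborel. w x \<le> v x) \<and> B < F v v)"
proof -
  obtain C where C: "\<forall>u\<in>H. \<bar>DG u u\<bar> \<le> \<kappa> / 2 * F u u + C" using DG_growth[of "\<kappa> / 2"] \<kappa> by auto
  \<comment> \<open>The entry \<open>B\<close> puts the second solution above the first in energy,
    \<open>4\<close> yields \<open>(1 - \<kappa>) * \<rho> \<ge> 2\<close>, and
    \<open>2 * C / \<kappa>\<close> allows the constant in the growth of \<open>DG\<close> to be
    absorbed.\<close>
  define \<rho> where "\<rho> = max (max B 4) (2 * C / \<kappa>)"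
  have \<rho>: "B \<le> \<rho>" "4 \<le> \<rho>" "2 * C / \<kappa> \<le> \<rho>" by (auto simp: \<rho>_def)
  have large: "\<forall>u\<in>H. \<rho> \<le> F u u \<longrightarrow> \<bar>DG u u\<bar> \<le> \<kappa> * F u u"
  proof (intro ballI impI)
    fix u assume u: "u \<in> H" "\<rho> \<le> F u u"
    have "2 * C / \<kappa> \<le> F u u" using u \<rho> by linarith
    then have "C \<le> \<kappa> / 2 * F u u" using \<kappa> by (simp add: field_simps)
    then show "\<bar>DG u u\<bar> \<le> \<kappa> * F u u" using C[rule_format, OF u(1)] by (simp add: field_simps)
  qed
  have rho: "2 \<le> (1 - \<kappa>) * \<rho>"
  proof -
    have "(1 / 2) * 4 \<le> (1 - \<kappa>) * \<rho>" using \<kappa> \<rho> by (intro mult_mono) auto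
    then show ?thesis by simp
  qed
  obtain S where S: "\<forall>u\<in>H. F u u \<le> \<rho> \<longrightarrow> integrable lborel (\<lambda>x. \<bar>u x\<bar> powr (r + 1)) \<and> (\<integral>x. \<bar>u x\<bar> powr (r + 1) \<partial>lborel) \<le> S"
    using sobolev_subcritical[of "r + 1" \<rho>] r by auto
  \<comment> \<open>Chosen after \<open>\<rho>\<close>: \<open>S\<close> bounds the integral of
    \<open>\<bar>u\<bar> powr (r + 1)\<close> at energies up to \<open>\<rho>\<close>, so the
    superlinear term is at most \<open>1\<close> there.\<close>
  define \<mu>0 where "\<mu>0 = 1 / ((r + 1) * (\<bar>S\<bar> + 1))"
  have S1: "0 < (r + 1) * (\<bar>S\<bar> + 1)" using r by (intro mult_pos_pos) auto
  show ?thesis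
  proof (intro exI[of _ \<mu>0] conjI allI impI)
    show "0 < \<mu>0" using S1 by (simp add: \<mu>0_def)
    fix \<mu> assume mu: "0 < \<mu>" "\<mu> < \<mu>0"
    have small: "\<forall>u\<in>H. F u u \<le> \<rho> \<longrightarrow> \<mu> * ((r + 1) * P u) \<le> 1"
    proof (intro ballI impI)
      fix u assume u: "u \<in> H" "F u u \<le> \<rho>"
      have "P u \<le> (\<integral>x. \<bar>u x\<bar> powr (r + 1) \<partial>lborel)"
        unfolding P_def using S u prim_bound by (intro integral_mono P_integrable) (auto intro: order_trans[OF abs_ge_self])
      also have "\<dots> \<le> \<bar>S\<bar> + 1" using S u by fastforce
      finally have "\<mu> * ((r + 1) * P u) \<le> \<mu>0 * ((r + 1) * (\<bar>S\<bar> + 1))"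
        using mu r P_nonneg[of u] by (intro mult_mono) auto
      also have "\<dots> = 1" using S1 unfolding \<mu>0_def by (metis less_irrefl nonzero_eq_divide_eq)
      finally show "\<mu> * ((r + 1) * P u) \<le> 1" .
    qed
    have \<rho>0: "0 < \<rho>" using \<rho> by linarith
    obtain v where v: "v \<in> H" "\<rho> < F v v" "N \<mu> v = 0" "\<forall>u\<in>H. \<rho> \<le> F u u \<longrightarrow> N \<mu> u = 0 \<longrightarrow> J \<mu> v \<le> J \<mu> u"
      using nehari_minimizer[OF mu(1) \<rho>0 large rho small] by blast
    have eq: "F v \<phi> = DG v \<phi> + \<mu> * DP v \<phi>" if \<phi>: "\<phi> \<in> H" for \<phi>
    proof (rule antisym)
      have m: "(\<lambda>x. - \<phi> x) \<in> H" using Hs_cmult[OF \<phi>, of "-1"] by simp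
      have "F v (\<lambda>x. - \<phi> x) = - F v \<phi>" "DP v (\<lambda>x. - \<phi> x) = - DP v \<phi>" "DG v (\<lambda>x. - \<phi> x) = - DG v \<phi>"
        using form_cmult_right[of s v "-1" \<phi>] DG_cmult[of v "-1" \<phi>] by (auto simp: DP_def)
      then show "F v \<phi> \<le> DG v \<phi> + \<mu> * DP v \<phi>"
        using nehari_critical[OF mu(1) \<rho>0 large v m] by simp
    qed (rule nehari_critical[OF mu(1) \<rho>0 large v \<phi>])
    have lower: "AE x in lborel. w x \<le> v x"
    proof (rule subsolution_below[OF w q' less_imp_le[OF lam] v(1)])
      fix \<phi> :: "'a \<Rightarrow> real" assume \<phi>: "\<phi> \<in> H" "\<And>x. 0 \<le> \<phi> x"
      have "0 \<le> DP v \<phi>" unfolding DP_def using \<phi> by (intro integral_nonneg_AE) auto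
      then show "lam * ((\<integral>x. max (v x) (w x) powr q * \<phi> x \<partial>lborel) - (\<integral>x. \<phi> x \<partial>lborel)) \<le> F v \<phi>"
        using mu unfolding eq[OF \<phi>(1)] DG_def by simp
    qed
    have [measurable]: "v \<in> borel_measurable borel" "w \<in> borel_measurable borel"
      using HsD(1) v(1) wH by blast+
    have "solves q r lam \<mu> v"
      unfolding solves_def
    proof (intro conjI ballI v)
      fix \<phi> :: "'a \<Rightarrow> real" assume \<phi>: "\<phi> \<in> H"
      have [measurable]: "\<phi> \<in> borel_measurable borel" using HsD(1)[OF \<phi>] .
      have i: "integrable lborel (\<lambda>x. max (v x) (w x) powr q * \<phi> x)"
        by (rule integrable_sublinear[OF q' v(1) wH w_nonneg \<phi>])
      have "(\<integral>x. max (v x) (w x) powr q * \<phi> x \<partial>lborel) - (\<integral>x. \<phi> x \<partial>lborel) = (\<integral>x. max (v x) (w x) powr q * \<phi> x - \<phi> x \<partial>lborel)"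
        by (rule Bochner_Integration.integral_diff[symmetric, OF i Hs_L1[OF \<phi>]])
      also have "\<dots> = (\<integral>x. (v x powr q - 1) * \<phi> x \<partial>lborel)"
      proof (rule integral_cong_AE)
        show "AE x in lborel. max (v x) (w x) powr q * \<phi> x - \<phi> x = (v x powr q - 1) * \<phi> x"
          using lower by eventually_elim (simp add: left_diff_distrib max_absorb1)
      qed measurable
      finally have 1: "DG v \<phi> = lam * (\<integral>x. (v x powr q - 1) * \<phi> x \<partial>lborel)" by (simp add: DG_def)
      have 2: "DP v \<phi> = (\<integral>x. v x powr r * \<phi> x \<partial>lborel)"
        unfolding DP_def
      proof (rule integral_cong_AE)
        show "AE x in lborel. max 0 (v x) powr r * \<phi> x = v x powr r * \<phi> x"
          using lower
        proof eventually_elim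
          case (elim x)
          then have "0 \<le> v x" using w_nonneg[of x] by linarith
          then show ?case by (simp add: max_absorb2)
        qed
      qed measurable
      show "F v \<phi> = lam * (\<integral>x. (v x powr q - 1) * \<phi> x \<partial>lborel) + \<mu> * (\<integral>x. v x powr r * \<phi> x \<partial>lborel)"
        unfolding eq[OF \<phi>] 1 2 ..
    qed
    then show "\<exists>v. solves q r lam \<mu> v \<and> (AE x in lborel. w x \<le> v x) \<and> B < F v v"
      using lower v(2) \<rho>(1) by (intro exI[of _ v]) auto
  qed
qed

end

lemma (in fractional_domain) second_solution:
  assumes "0 < q" "q < 1" "0 < lam" "1 < r" "r + 1 < 2 * real DIM('a) / (real DIM('a) - 2 * s)" "weak_sub q lam w"
  shows "\<exists>\<mu>0>0. \<forall>\<mu>. 0 < \<mu> \<longrightarrow> \<mu> < \<mu>0 \<longrightarrow> (\<exists>v. solves q r lam \<mu> v \<and> (AE x in lborel. w x \<le> v x) \<and> B < F v v)"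
proof -
  interpret superlinear_problem s \<Omega> q r lam w using assms by unfold_locales auto
  show ?thesis by (rule large_solution)
qed

section \<open>Interior and exterior balls\<close>

lemma lipschitz_gradient_taylor:
  fixes \<gamma> :: "'a::real_inner \<Rightarrow> real"
  assumes g: "\<And>y. GDERIV \<gamma> y :> g y" and L: "L-lipschitz_on UNIV g"
  shows "\<bar>\<gamma> y - \<gamma> x - g x \<bullet> (y - x)\<bar> \<le> L * (norm (y - x))\<^sup>2"
proof -
  let ?d = "y - x"
  have der: "((\<lambda>t. \<gamma> (x + t *\<^sub>R ?d)) has_real_derivative g (x + t *\<^sub>R ?d) \<bullet> ?d) (at t)" for t
  proof -
    have "((\<lambda>t. x + t *\<^sub>R ?d) has_derivative (\<lambda>t. t *\<^sub>R ?d)) (at t)"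
      by (auto intro!: derivative_eq_intros)
    moreover have "(\<gamma> has_derivative (\<lambda>h. h \<bullet> g (x + t *\<^sub>R ?d))) (at (x + t *\<^sub>R ?d))"
      using g unfolding gderiv_def .
    ultimately have "((\<lambda>t. \<gamma> (x + t *\<^sub>R ?d)) has_derivative (\<lambda>h. (h *\<^sub>R ?d) \<bullet> g (x + t *\<^sub>R ?d))) (at t)"
      by (rule has_derivative_compose)
    moreover have "(\<lambda>h. (h *\<^sub>R ?d) \<bullet> g (x + t *\<^sub>R ?d)) = (*) (g (x + t *\<^sub>R ?d) \<bullet> ?d)"
      by (auto simp: fun_eq_iff inner_commute)
    ultimately show ?thesis by (simp only: has_field_derivative_def)
  qed
  have "\<exists>z. 0 < z \<and> z < 1 \<and> \<gamma> (x + 1 *\<^sub>R ?d) - \<gamma> (x + 0 *\<^sub>R ?d) = (1 - 0) * (g (x + z *\<^sub>R ?d) \<bullet> ?d)"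
    by (rule MVT2[of 0 1 "\<lambda>t. \<gamma> (x + t *\<^sub>R ?d)"]) (use der in auto)
  then obtain z where z: "0 < z" "z < 1" "\<gamma> y - \<gamma> x = g (x + z *\<^sub>R ?d) \<bullet> ?d" by auto
  have L0: "0 \<le> L" using L by (rule lipschitz_on_nonneg)
  have "\<bar>\<gamma> y - \<gamma> x - g x \<bullet> ?d\<bar> = \<bar>(g (x + z *\<^sub>R ?d) - g x) \<bullet> ?d\<bar>"
    by (simp add: z inner_diff_left)
  also have "\<dots> \<le> norm (g (x + z *\<^sub>R ?d) - g x) * norm ?d" by (rule Cauchy_Schwarz_ineq2)
  also have "norm (g (x + z *\<^sub>R ?d) - g x) \<le> L * norm (z *\<^sub>R ?d)"
    using lipschitz_onD[OF L, of "x + z *\<^sub>R ?d" x] by (simp add: dist_norm)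
  also have "\<dots> \<le> L * norm ?d" using z L0 by (intro mult_left_mono) (auto simp: mult_left_le_one_le)
  finally show ?thesis by (simp add: power2_eq_square mult_right_mono mult.assoc)
qed

text \<open>In the chart, \<open>\<Omega>\<close> is the set where
  \<open>h x = x \<bullet> e - \<gamma> (pr x)\<close> is positive. At a boundary point
  \<open>b\<close>, \<open>h\<close> equals its linear part up to
  \<open>L * (norm (x - b))\<^sup>2\<close>, so a tangent ball of radius \<open>t\<close> with
  \<open>2 * t * L < 1\<close> stays on one side of the graph. Centres against the gradient give
  exterior balls, centres along it give interior balls.\<close>

lemma C11_boundary_local:
  fixes \<Omega> :: "'a::euclidean_space set"
  assumes C: "C11_boundary \<Omega>" and op: "open \<Omega>" and x0: "x0 \<in> frontier \<Omega>"
  shows "\<exists>\<delta>>0. \<exists>t0>0.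
    (\<forall>b\<in>frontier \<Omega> \<inter> ball x0 \<delta>. \<forall>t\<in>{0<..t0}. \<exists>a. dist a b = t \<and> ball a t \<inter> \<Omega> = {}) \<and>
    (\<forall>x\<in>\<Omega> \<inter> ball x0 \<delta>. \<exists>a. x \<in> ball a t0 \<and> ball a t0 \<subseteq> \<Omega>)"
proof -
  obtain \<rho> e \<gamma> where \<rho>: "0 < \<rho>" and e: "norm e = 1" and C11: "C11_function \<gamma>"
    and chart: "\<Omega> \<inter> ball x0 \<rho> = {x \<in> ball x0 \<rho>. x \<bullet> e > \<gamma> (x - (x \<bullet> e) *\<^sub>R e)}"
    using C x0 unfolding C11_boundary_def by blast
  obtain g L where g: "\<And>y. GDERIV \<gamma> y :> g y" and L: "L-lipschitz_on UNIV g"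
    using C11 unfolding C11_function_def by blast
  have L0: "0 \<le> L" using L by (rule lipschitz_on_nonneg)
  have ee: "e \<bullet> e = 1" using e by (simp add: norm_eq_1)
  define pr where "pr x = x - (x \<bullet> e) *\<^sub>R e" for x
  define h where "h x = x \<bullet> e - \<gamma> (pr x)" for x
  have pre: "pr x \<bullet> e = 0" for x by (simp add: pr_def inner_diff_left ee)
  have prd: "pr x - pr y = pr (x - y)" for x y by (simp add: pr_def inner_diff_left algebra_simps)
  have prn: "norm (pr x) \<le> norm x" for x
  proof -
    have "(norm (pr x))\<^sup>2 = (norm x)\<^sup>2 - (x \<bullet> e)\<^sup>2"
      unfolding power2_norm_eq_inner pr_def
      by (simp add: inner_diff_left inner_diff_right ee power2_eq_square inner_commute)
    then have "(norm (pr x))\<^sup>2 \<le> (norm x)\<^sup>2" by simp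
    then show ?thesis by (rule power2_le_imp_le) simp
  qed
  have \<gamma>c: "isCont \<gamma> y" for y
    using g[of y] has_derivative_continuous unfolding gderiv_def by blast
  have hc: "isCont h x" for x
    unfolding h_def pr_def by (intro continuous_intros isCont_o2[OF _ \<gamma>c])
  have in\<Omega>: "x \<in> \<Omega> \<longleftrightarrow> 0 < h x" if "x \<in> ball x0 \<rho>" for x
    using that arg_cong[OF chart, of "\<lambda>S. x \<in> S"] by (simp add: h_def pr_def)
  have fr: "h b = 0" if b: "b \<in> frontier \<Omega>" "b \<in> ball x0 \<rho>" for b
  proof (rule antisym)
    have "b \<notin> \<Omega>" using b op by (simp add: frontier_def interior_open)
    then show "h b \<le> 0" using in\<Omega>[OF b(2)] by simp
    show "0 \<le> h b"
    proof (rule ccontr)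
      assume "\<not> 0 \<le> h b"
      then have "\<forall>\<^sub>F x in at b. h x < 0" using hc[of b] by (intro order_tendstoD(2)) (auto simp: isCont_def)
      then obtain d where d: "0 < d" "\<And>x. x \<noteq> b \<Longrightarrow> dist x b < d \<Longrightarrow> h x < 0"
        unfolding eventually_at by auto
      have "b \<in> closure \<Omega>" using b by (simp add: frontier_def)
      moreover have "0 < min d (\<rho> - dist x0 b)" using d b by simp
      ultimately obtain x where x: "x \<in> \<Omega>" "dist x b < min d (\<rho> - dist x0 b)"
        using closure_approachable by blast
      have "x \<in> ball x0 \<rho>" using x(2) dist_triangle[of x0 x b] by (simp add: dist_commute)
      then have "0 < h x" using in\<Omega> x by blast
      moreover have "h x < 0 \<or> x = b" using d x by auto
      ultimately show False using \<open>\<not> 0 \<le> h b\<close> by auto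
    qed
  qed
  \<comment> \<open>\<open>nu b\<close> is the gradient of \<open>h\<close> at \<open>b\<close>. Its
    component along \<open>e\<close> is \<open>1\<close>, so its norm is at least
    \<open>1\<close>.\<close>
  define m where "m b = g (pr b) - (g (pr b) \<bullet> e) *\<^sub>R e" for b
  define nu where "nu b = e - m b" for b
  have me: "m b \<bullet> e = 0" for b by (simp add: m_def inner_diff_left ee)
  have nu1: "1 \<le> norm (nu b)" for b
  proof -
    have "(nu b) \<bullet> e = 1" by (simp add: nu_def inner_diff_left ee me)
    then show ?thesis using Cauchy_Schwarz_ineq2[of "nu b" e] e by simp
  qed
  have expand: "\<bar>h x - (x - b) \<bullet> nu b\<bar> \<le> L * (norm (x - b))\<^sup>2" if b: "h b = 0" for x b
  proof -
    have "g (pr b) \<bullet> (pr x - pr b) = m b \<bullet> (x - b)"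
      unfolding prd unfolding pr_def m_def by (simp add: inner_diff_left inner_diff_right inner_commute)
    then have "h x - (x - b) \<bullet> nu b = - (\<gamma> (pr x) - \<gamma> (pr b) - g (pr b) \<bullet> (pr x - pr b))"
      using b by (simp add: h_def nu_def inner_diff_left inner_diff_right inner_commute)
    then have "\<bar>h x - (x - b) \<bullet> nu b\<bar> \<le> L * (norm (pr x - pr b))\<^sup>2"
      using lipschitz_gradient_taylor[OF g L, of "pr x" "pr b"] by simp
    also have "\<dots> \<le> L * (norm (x - b))\<^sup>2" unfolding prd using L0 prn by (intro mult_left_mono power_mono) auto
    finally show ?thesis .
  qed
  \<comment> \<open>In a ball of radius \<open>t\<close> that touches the tangent plane at the
    origin, \<open>(norm z)\<^sup>2\<close> is less than \<open>2 * t\<close> times the linear term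
    \<open>z \<bullet> nu b\<close>. For \<open>2 * t * L < 1\<close> the linear term thus exceeds
    the quadratic error.\<close>
  have tangent: "L * (norm z)\<^sup>2 < z \<bullet> nu b" if t: "0 < t" "2 * t * L < 1" and z: "norm (z - (t / norm (nu b)) *\<^sub>R nu b) < t" for z t b
  proof -
    let ?n = "norm (nu b)"
    have n: "0 < ?n" using nu1[of b] by linarith
    have "(norm (z - (t / ?n) *\<^sub>R nu b))\<^sup>2 < t\<^sup>2" using z t by (intro power_strict_mono) auto
    also have "(norm (z - (t / ?n) *\<^sub>R nu b))\<^sup>2 = (norm z)\<^sup>2 - 2 * (t / ?n) * (z \<bullet> nu b) + t\<^sup>2"
    proof -
      have "nu b \<bullet> nu b = ?n * ?n" by (simp add: power2_norm_eq_inner[symmetric] power2_eq_square)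
      then show ?thesis using n
        unfolding power2_norm_eq_inner[of z] power2_norm_eq_inner[of "z - _"] inner_diff_left inner_diff_right
        by (simp add: inner_commute power2_eq_square)
    qed
    finally have "(norm z)\<^sup>2 < 2 * (t / ?n) * (z \<bullet> nu b)" by simp
    then have 1: "(norm z)\<^sup>2 * ?n < 2 * t * (z \<bullet> nu b)" using n by (simp add: field_simps)
    have "(norm z)\<^sup>2 * 1 \<le> (norm z)\<^sup>2 * ?n" using nu1 by (intro mult_left_mono) auto
    then have 2: "(norm z)\<^sup>2 < 2 * t * (z \<bullet> nu b)" using 1 by simp
    have "2 * t * (L * (norm z)\<^sup>2) = (2 * t * L) * (norm z)\<^sup>2" by simp
    also have "\<dots> \<le> 1 * (norm z)\<^sup>2" using t by (intro mult_right_mono) auto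
    finally have "2 * t * (L * (norm z)\<^sup>2) < 2 * t * (z \<bullet> nu b)" using 2 by simp
    then show ?thesis using t by simp
  qed
  \<comment> \<open>The bound \<open>\<rho> / 4\<close> keeps the tangent balls inside the chart,
    the other bound ensures \<open>2 * t * L < 1\<close> for all \<open>t\<close> up to
    \<open>t0\<close>.\<close>
  define t0 where "t0 = min (\<rho> / 4) (1 / (2 * (L + 1)))"
  have t0: "0 < t0" "t0 \<le> \<rho> / 4" using \<rho> L0 by (auto simp: t0_def)
  have tL: "2 * t * L < 1" if "0 < t" "t \<le> t0" for t
  proof -
    have "t \<le> 1 / (2 * (L + 1))" using that by (simp add: t0_def)
    then have "t * (2 * (L + 1)) \<le> 1" using L0 by (simp add: field_simps)
    then show ?thesis using that by (simp add: algebra_simps)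
  qed
  define M where "M = 1 + norm (g (pr x0)) + L * \<rho>"
  have M: "0 < M" unfolding M_def using L0 \<rho> by (intro add_pos_nonneg) auto
  have nuM: "norm (nu b) \<le> M" if "b \<in> ball x0 \<rho>" for b
  proof -
    have gn: "norm (m b) \<le> norm (g (pr b))"
      using prn[of "g (pr b)"] by (simp add: m_def pr_def)
    have "norm (g (pr b) - g (pr x0)) \<le> L * norm (pr b - pr x0)"
      using lipschitz_onD[OF L, of "pr b" "pr x0"] by (simp add: dist_norm)
    also have "\<dots> \<le> L * \<rho>"
      unfolding prd using prn[of "b - x0"] that L0 by (intro mult_left_mono) (auto simp: dist_norm norm_minus_commute)
    finally have "norm (g (pr b)) \<le> norm (g (pr x0)) + L * \<rho>"
      using norm_triangle_ineq2[of "g (pr b)" "g (pr x0)"] by linarith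
    then show ?thesis using gn norm_triangle_ineq4[of e "m b"] e unfolding nu_def M_def by linarith
  qed
  have x0h: "h x0 = 0" using fr[OF x0] \<rho> by simp
  \<comment> \<open>A point whose height \<open>h x\<close> over the graph is below
    \<open>\<eta>\<close> has its foot point in the chart, and it lies in the ball of radius
    \<open>t0\<close> tangent at the foot point, because \<open>M\<close> bounds
    \<open>norm (nu b)\<close>.\<close>
  define \<eta> where "\<eta> = min (\<rho> / 4) (2 * t0 / M)"
  have \<eta>: "0 < \<eta>" using \<rho> t0 M by (simp add: \<eta>_def)
  obtain \<delta>1 where \<delta>1: "0 < \<delta>1" "\<And>x. dist x x0 < \<delta>1 \<Longrightarrow> dist (h x) (h x0) < \<eta>"
    using hc[of x0] \<eta> unfolding continuous_at_eps_delta by blast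
  define \<delta> where "\<delta> = min \<delta>1 (\<rho> / 4)"
  have \<delta>: "0 < \<delta>" "\<delta> \<le> \<rho> / 4" using \<delta>1 \<rho> by (auto simp: \<delta>_def)
  show ?thesis
  proof (rule exI[of _ \<delta>], rule conjI[OF \<delta>(1)], rule exI[of _ t0], rule conjI[OF t0(1)],
      rule conjI; intro ballI)
    fix b t assume b: "b \<in> frontier \<Omega> \<inter> ball x0 \<delta>" and t: "t \<in> {0<..t0}"
    have b\<rho>: "b \<in> ball x0 \<rho>" using b \<delta> \<rho> by auto
    have hb: "h b = 0" using fr b b\<rho> by blast
    have n: "0 < norm (nu b)" using nu1[of b] by linarith
    let ?a = "b - (t / norm (nu b)) *\<^sub>R nu b"
    show "\<exists>a. dist a b = t \<and> ball a t \<inter> \<Omega> = {}"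
    proof (intro exI[of _ ?a] conjI)
      show db: "dist ?a b = t" using t n by (simp add: dist_norm)
      show "ball ?a t \<inter> \<Omega> = {}"
      proof (rule ccontr)
        assume "ball ?a t \<inter> \<Omega> \<noteq> {}"
        then obtain x where x: "dist ?a x < t" "x \<in> \<Omega>" by auto
        have "dist x0 x \<le> dist x0 b + (dist b ?a + dist ?a x)"
          using dist_triangle[of x0 x b] dist_triangle[of b x ?a] by linarith
        then have "x \<in> ball x0 \<rho>" using x(1) db b \<delta> t0 t by (simp add: dist_commute)
        then have hx: "0 < h x" using in\<Omega> x by blast
        have "norm (- (x - b) - (t / norm (nu b)) *\<^sub>R nu b) < t"
        proof -
          have "- (x - b) - (t / norm (nu b)) *\<^sub>R nu b = ?a - x" by simp
          then show ?thesis using x(1) by (simp only: dist_norm)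
        qed
        then have "L * (norm (- (x - b)))\<^sup>2 < - (x - b) \<bullet> nu b"
          using t tL by (intro tangent[of t]) auto
        then have "L * (norm (x - b))\<^sup>2 < - ((x - b) \<bullet> nu b)" by (simp only: norm_minus_cancel inner_minus_left)
        then show False using expand[OF hb, of x] hx by linarith
      qed
    qed
  next
    fix x assume x: "x \<in> \<Omega> \<inter> ball x0 \<delta>"
    have x\<rho>: "x \<in> ball x0 \<rho>" using x \<delta> \<rho> by auto
    have hx: "0 < h x" using in\<Omega>[OF x\<rho>] x by auto
    have hx2: "h x < \<rho> / 4" "h x < 2 * t0 / M"
      using \<delta>1(2)[of x] x x0h hx by (auto simp: \<delta>_def \<eta>_def dist_real_def dist_commute)
    \<comment> \<open>The foot point is taken along \<open>e\<close>, not along the normal. It need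
      not be the nearest boundary point, but \<open>nu b \<bullet> e = 1\<close> makes the distance
      of \<open>x\<close> from the centre of the ball explicit.\<close>
    define b where "b = x - h x *\<^sub>R e"
    have prb: "pr b = pr x" by (simp add: pr_def b_def inner_diff_left ee algebra_simps)
    have hb: "h b = 0" unfolding h_def prb by (simp add: b_def inner_diff_left ee h_def)
    have dxb: "dist x b = h x" using hx e by (simp add: b_def dist_norm)
    have bx0: "dist x0 b < \<rho> / 2" using dist_triangle[of x0 b x] dxb hx2 x \<delta> by simp
    then have b\<rho>: "b \<in> ball x0 \<rho>" using \<rho> by simp
    have n: "0 < norm (nu b)" using nu1[of b] by linarith
    let ?a = "b + (t0 / norm (nu b)) *\<^sub>R nu b"
    have da: "dist ?a b = t0" using t0 n by (simp add: dist_norm)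
    show "\<exists>a. x \<in> ball a t0 \<and> ball a t0 \<subseteq> \<Omega>"
    proof (intro exI[of _ ?a] conjI subsetI)
      have "h x * M < 2 * t0" using hx2(2) M by (simp add: field_simps)
      then have "h x * norm (nu b) < 2 * t0"
        using mult_left_mono[OF nuM[OF b\<rho>] less_imp_le[OF hx]] by linarith
      then have "h x * (h x * norm (nu b)) < h x * (2 * t0)" using hx by (intro mult_strict_left_mono)
      then have hn: "(h x)\<^sup>2 < 2 * (t0 / norm (nu b)) * h x" using n by (simp add: field_simps power2_eq_square)
      have ax: "?a - x = (t0 / norm (nu b)) *\<^sub>R nu b - h x *\<^sub>R e" by (simp add: b_def)
      have "(norm (?a - x))\<^sup>2 = t0\<^sup>2 - 2 * (t0 / norm (nu b)) * h x + (h x)\<^sup>2"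
      proof -
        have "nu b \<bullet> nu b = norm (nu b) * norm (nu b)" by (simp add: power2_norm_eq_inner[symmetric] power2_eq_square)
        moreover have "nu b \<bullet> e = 1" by (simp add: nu_def inner_diff_left ee me)
        ultimately show ?thesis using n
          unfolding ax power2_norm_eq_inner[of "_ - _"] inner_diff_left inner_diff_right
          by (simp add: inner_commute ee power2_eq_square)
      qed
      then have "(norm (?a - x))\<^sup>2 < t0\<^sup>2" using hn by linarith
      then have "norm (?a - x) < t0" by (rule power2_less_imp_less) (use t0 in simp)
      then show "x \<in> ball ?a t0" by (simp only: mem_ball dist_norm)
      fix y assume y: "y \<in> ball ?a t0"
      have "dist x0 y \<le> dist x0 b + (dist b ?a + dist ?a y)"
        using dist_triangle[of x0 y b] dist_triangle[of b y ?a] by linarith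
      moreover have "dist ?a y < t0" using y by (simp only: mem_ball)
      moreover have "dist b ?a = t0" using da by (simp only: dist_commute)
      ultimately have y\<rho>: "y \<in> ball x0 \<rho>" using bx0 t0 unfolding mem_ball by linarith
      have "norm ((y - b) - (t0 / norm (nu b)) *\<^sub>R nu b) < t0"
      proof -
        have "(y - b) - (t0 / norm (nu b)) *\<^sub>R nu b = - (?a - y)" by simp
        then show ?thesis using y by (simp only: mem_ball dist_norm norm_minus_cancel)
      qed
      then have "L * (norm (y - b))\<^sup>2 < (y - b) \<bullet> nu b" using t0 tL by (intro tangent[of t0]) auto
      then have "0 < h y" using expand[OF hb, of y] by linarith
      then show "y \<in> \<Omega>" using in\<Omega>[OF y\<rho>] by simp
    qed
  qed
qed

text \<open>The smaller ball is the image of the larger one under the homothety with centre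
  \<open>x\<close> and ratio \<open>t / r\<close>.\<close>

lemma smaller_ball:
  fixes a x :: "'a::real_normed_vector"
  assumes x: "x \<in> ball a r" and t: "0 < t" "t \<le> r"
  shows "\<exists>a'. x \<in> ball a' t \<and> ball a' t \<subseteq> ball a r"
proof -
  define a' where "a' = x + (t / r) *\<^sub>R (a - x)"
  have r: "0 < r" using t by linarith
  have d1: "dist a' x = (t / r) * dist a x" using t r by (simp add: a'_def dist_norm)
  have d2: "dist a a' = (1 - t / r) * dist a x"
  proof -
    have "a - a' = (1 - t / r) *\<^sub>R (a - x)" by (simp add: a'_def algebra_simps)
    then show ?thesis using t r by (simp add: dist_norm)
  qed
  have "(t / r) * dist a x < (t / r) * r" using x t r by (intro mult_strict_left_mono) auto
  then have "x \<in> ball a' t" using d1 r by simp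
  moreover have "(1 - t / r) * dist a x \<le> (1 - t / r) * r" using x t r by (intro mult_left_mono) auto
  then have "dist a a' + t \<le> r" using d2 r by (simp add: algebra_simps)
  have "ball a' t \<subseteq> ball a r"
  proof
    fix y assume "y \<in> ball a' t"
    then show "y \<in> ball a r"
      using dist_triangle[of a y a'] \<open>dist a a' + t \<le> r\<close> by simp
  qed
  ultimately show ?thesis by blast
qed

text \<open>Finitely many local radii suffice by compactness of the closure, and
  \<open>smaller_ball\<close> reduces them to the least one. Each \<open>x\<close> only has to lie
  in such a ball; being its centre would fail near the boundary.\<close>

lemma interior_ball_condition:
  fixes \<Omega> :: "'a::euclidean_space set"
  assumes C: "C11_boundary \<Omega>" and op: "open \<Omega>" and bd: "bounded \<Omega>"
  shows "\<exists>\<rho>>0. \<forall>x\<in>\<Omega>. \<exists>a. x \<in> ball a \<rho> \<and> ball a \<rho> \<subseteq> \<Omega>"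
proof -
  have "\<exists>\<delta> t. 0 < \<delta> \<and> 0 < t \<and> (\<forall>x\<in>\<Omega> \<inter> ball x0 \<delta>. \<exists>a. x \<in> ball a t \<and> ball a t \<subseteq> \<Omega>)" if "x0 \<in> closure \<Omega>" for x0
  proof (cases "x0 \<in> \<Omega>")
    case True
    then obtain d where d: "0 < d" "ball x0 d \<subseteq> \<Omega>" using op openE by blast
    have "ball x (d / 2) \<subseteq> \<Omega>" if "x \<in> ball x0 (d / 2)" for x
    proof
      fix y assume "y \<in> ball x (d / 2)"
      then have "dist x0 y < d" using that dist_triangle[of x0 y x] by simp
      then show "y \<in> \<Omega>" using d by auto
    qed
    then have "\<forall>x\<in>\<Omega> \<inter> ball x0 (d / 2). \<exists>a. x \<in> ball a (d / 2) \<and> ball a (d / 2) \<subseteq> \<Omega>"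
      using d(1) centre_in_ball[of _ "d / 2"] by (metis IntD2 half_gt_zero)
    then show ?thesis using d(1) half_gt_zero by blast
  next
    case False
    then have "x0 \<in> frontier \<Omega>" using that op by (simp add: frontier_def interior_open)
    then show ?thesis using C11_boundary_local[OF C op] by blast
  qed
  then obtain \<delta> t where dt: "\<And>x0. x0 \<in> closure \<Omega> \<Longrightarrow> 0 < \<delta> x0" "\<And>x0. x0 \<in> closure \<Omega> \<Longrightarrow> 0 < t x0"
    "\<And>x0 x. x0 \<in> closure \<Omega> \<Longrightarrow> x \<in> \<Omega> \<inter> ball x0 (\<delta> x0) \<Longrightarrow> \<exists>a. x \<in> ball a (t x0) \<and> ball a (t x0) \<subseteq> \<Omega>"
    by metis
  have "compact (closure \<Omega>)" using bd by (simp add: compact_closure)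
  then obtain K where K: "K \<subseteq> closure \<Omega>" "finite K" "closure \<Omega> \<subseteq> (\<Union>c\<in>K. ball c (\<delta> c))"
    by (rule compactE_image[of _ "closure \<Omega>" "\<lambda>c. ball c (\<delta> c)"]) (use dt in auto)
  define \<rho> where "\<rho> = Min (insert 1 (t ` K))"
  have \<rho>: "0 < \<rho>" "\<And>c. c \<in> K \<Longrightarrow> \<rho> \<le> t c" unfolding \<rho>_def using K dt by auto
  show ?thesis
  proof (intro exI[of _ \<rho>] conjI ballI \<rho>(1))
    fix x assume x: "x \<in> \<Omega>"
    then obtain c where c: "c \<in> K" "x \<in> ball c (\<delta> c)" using K closure_subset by blast
    then obtain a where a: "x \<in> ball a (t c)" "ball a (t c) \<subseteq> \<Omega>" using dt(3)[of c x] K x by blast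
    show "\<exists>a. x \<in> ball a \<rho> \<and> ball a \<rho> \<subseteq> \<Omega>" using smaller_ball[OF a(1) \<rho>(1) \<rho>(2)[OF c(1)]] a(2) by blast
  qed
qed

text \<open>All radii up to \<open>\<rho>\<close> are provided, since the Hardy inequality needs an
  exterior ball comparable in size to the distance of a given point from the boundary.\<close>

lemma exterior_ball_condition:
  fixes \<Omega> :: "'a::euclidean_space set"
  assumes C: "C11_boundary \<Omega>" and op: "open \<Omega>" and bd: "bounded \<Omega>"
  shows "\<exists>\<rho>>0. \<forall>b\<in>frontier \<Omega>. \<forall>t. 0 < t \<longrightarrow> t \<le> \<rho> \<longrightarrow> (\<exists>a. dist a b = t \<and> ball a t \<inter> \<Omega> = {})"
proof -
  have "\<exists>\<delta> t0. 0 < \<delta> \<and> 0 < t0 \<and> (\<forall>b\<in>frontier \<Omega> \<inter> ball x0 \<delta>. \<forall>t\<in>{0<..t0}. \<exists>a. dist a b = t \<and> ball a t \<inter> \<Omega> = {})"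
    if "x0 \<in> frontier \<Omega>" for x0
    using C11_boundary_local[OF C op that] by blast
  then obtain \<delta> t0 where dt: "\<And>x0. x0 \<in> frontier \<Omega> \<Longrightarrow> 0 < \<delta> x0" "\<And>x0. x0 \<in> frontier \<Omega> \<Longrightarrow> 0 < t0 x0"
    "\<And>x0. x0 \<in> frontier \<Omega> \<Longrightarrow> \<forall>b\<in>frontier \<Omega> \<inter> ball x0 (\<delta> x0). \<forall>t\<in>{0<..t0 x0}. \<exists>a. dist a b = t \<and> ball a t \<inter> \<Omega> = {}"
    by metis
  have "compact (frontier \<Omega>)" using bd by (rule compact_frontier_bounded)
  then obtain K where K: "K \<subseteq> frontier \<Omega>" "finite K" "frontier \<Omega> \<subseteq> (\<Union>c\<in>K. ball c (\<delta> c))"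
    by (rule compactE_image[of _ "frontier \<Omega>" "\<lambda>c. ball c (\<delta> c)"]) (use dt in auto)
  define \<rho> where "\<rho> = Min (insert 1 (t0 ` K))"
  have \<rho>: "0 < \<rho>" "\<And>c. c \<in> K \<Longrightarrow> \<rho> \<le> t0 c" unfolding \<rho>_def using K dt by auto
  show ?thesis
  proof (intro exI[of _ \<rho>] conjI ballI allI impI \<rho>(1))
    fix b t assume b: "b \<in> frontier \<Omega>" and t: "0 < t" "t \<le> \<rho>"
    obtain c where c: "c \<in> K" "b \<in> ball c (\<delta> c)" using K b by blast
    then show "\<exists>a. dist a b = t \<and> ball a t \<inter> \<Omega> = {}"
      using dt(3)[of c] K b t \<rho>(2)[OF c(1)] by (meson IntI greaterThanAtMost_iff order_trans subsetD)
  qed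
qed

section \<open>Smooth functions\<close>

lemma GDERIV_isCont: "GDERIV f x :> D \<Longrightarrow> isCont f x"
  unfolding gderiv_def by (rule has_derivative_continuous)

lemma GDERIV_unique:
  assumes "GDERIV f x :> D" "GDERIV f x :> D'"
  shows "D = D'"
proof -
  have "(\<lambda>h. h \<bullet> D) = (\<lambda>h. h \<bullet> D')"
    using assms unfolding gderiv_def by (rule has_derivative_unique)
  then have "(D - D') \<bullet> D = (D - D') \<bullet> D'" by meson
  then have "(D - D') \<bullet> (D - D') = 0" by (simp add: inner_diff_right)
  then show ?thesis by simp
qed

lemma bounded_gradient_lipschitz:
  fixes f :: "'a::real_inner \<Rightarrow> real"
  assumes g: "\<And>y. GDERIV f y :> g y" and C: "\<And>y. norm (g y) \<le> C"
  shows "\<bar>f y - f x\<bar> \<le> C * norm (y - x)"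
proof -
  have "norm (f y - f x) \<le> C * norm (y - x)"
  proof (rule differentiable_bound[of UNIV f "\<lambda>z h. h \<bullet> g z"])
    show "(f has_derivative (\<lambda>h. h \<bullet> g z)) (at z within UNIV)" for z
      using g[of z] by (simp add: gderiv_def)
    show "onorm (\<lambda>h. h \<bullet> g z) \<le> C" for z
    proof (rule onorm_bound)
      show "0 \<le> C" using C[of z] norm_ge_zero[of "g z"] by linarith
      fix h
      have "norm (h \<bullet> g z) \<le> norm h * norm (g z)" using Cauchy_Schwarz_ineq2[of h "g z"] by simp
      also have "\<dots> \<le> norm h * C" using C by (intro mult_left_mono) auto
      finally show "norm (h \<bullet> g z) \<le> C * norm h" by (simp add: mult.commute)
    qed
  qed auto
  then show ?thesis by simp
qed

lemma GDERIV_continuous_on: "(\<And>x. GDERIV f x :> g x) \<Longrightarrow> continuous_on UNIV f"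
  by (rule continuous_at_imp_continuous_on) (blast intro: GDERIV_isCont)

lemma Ck_continuous: "Ck_function k f \<Longrightarrow> continuous_on UNIV f"
  by (cases k) (auto intro: GDERIV_continuous_on)

lemma Ck_Suc_imp: "Ck_function (Suc k) f \<Longrightarrow> Ck_function k f"
proof (induction k arbitrary: f)
  case 0
  then show ?case using Ck_continuous[of "Suc 0" f] by simp
next
  case (Suc k)
  then show ?case by (auto simp del: Ck_function.simps(1))
qed

lemma Ck_const: "Ck_function k (\<lambda>_. c)"
proof (induction k arbitrary: c)
  case (Suc k)
  show ?case using Suc.IH GDERIV_const by (auto intro!: exI[of _ "\<lambda>_. 0"])
qed simp

lemma Ck_inner: "Ck_function k (\<lambda>x. x \<bullet> b)"
proof (cases k)
  case (Suc n)
  have "GDERIV (\<lambda>x. x \<bullet> b) x :> b" for x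
    unfolding gderiv_def by (auto intro!: derivative_eq_intros)
  then show ?thesis unfolding Suc using Ck_const by (auto intro!: exI[of _ "\<lambda>_. b"])
qed (simp add: continuous_intros)

lemma Ck_add:
  "Ck_function k f \<Longrightarrow> Ck_function k g \<Longrightarrow> Ck_function k (\<lambda>x. f x + g x)"
proof (induction k arbitrary: f g)
  case (Suc k)
  obtain df dg where "\<forall>x. GDERIV f x :> df x" "\<forall>b\<in>Basis. Ck_function k (\<lambda>x. df x \<bullet> b)"
    "\<forall>x. GDERIV g x :> dg x" "\<forall>b\<in>Basis. Ck_function k (\<lambda>x. dg x \<bullet> b)"
    using Suc.prems by auto
  then show ?case
    using Suc.IH by (auto intro!: exI[of _ "\<lambda>x. df x + dg x"] GDERIV_add simp: inner_add_left)
qed (simp add: continuous_on_add)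

lemma Ck_mult:
  "Ck_function k f \<Longrightarrow> Ck_function k g \<Longrightarrow> Ck_function k (\<lambda>x. f x * g x)"
proof (induction k arbitrary: f g)
  case (Suc k)
  obtain df dg where "\<forall>x. GDERIV f x :> df x" "\<forall>b\<in>Basis. Ck_function k (\<lambda>x. df x \<bullet> b)"
    "\<forall>x. GDERIV g x :> dg x" "\<forall>b\<in>Basis. Ck_function k (\<lambda>x. dg x \<bullet> b)"
    using Suc.prems by auto
  moreover have "Ck_function k f" "Ck_function k g" using Suc.prems Ck_Suc_imp by blast+
  ultimately show ?case
    using Suc.IH by (auto intro!: exI[of _ "\<lambda>x. f x *\<^sub>R dg x + g x *\<^sub>R df x"] GDERIV_mult Ck_add simp: inner_add_left)
qed (simp add: continuous_on_mult)

text \<open>The functions \<open>t powr (-m) * exp (-1 / t)\<close>, extended by \<open>0\<close>.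
  The derivative of \<open>flat m\<close> is a combination of \<open>flat (m + 1)\<close> and
  \<open>flat (m + 2)\<close>, so an induction over all \<open>m\<close> at once gives derivatives
  of every order.\<close>

definition flat :: "nat \<Rightarrow> real \<Rightarrow> real" where
  "flat m t = (if t \<le> 0 then 0 else inverse t ^ m * exp (- inverse t))"

lemma flat_tendsto_0: "(flat m \<longlongrightarrow> 0) (at_right 0)"
proof -
  have "((\<lambda>t::real. inverse t ^ m / exp (inverse t)) \<longlongrightarrow> 0) (at_right 0)"
    by (rule filterlim_compose[OF tendsto_power_div_exp_0 filterlim_inverse_at_top_right])
  moreover have "\<forall>\<^sub>F t::real in at_right 0. inverse t ^ m / exp (inverse t) = flat m t"
    unfolding eventually_at_right_field by (auto simp: flat_def exp_minus divide_inverse intro!: exI[of _ 1])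
  ultimately show ?thesis by (rule Lim_transform_eventually)
qed

lemma flat_deriv: "(flat m has_real_derivative flat (m + 2) t - real m * flat (m + 1) t) (at t)"
proof -
  consider "0 < t" | "t < 0" | "t = 0" by linarith
  then show ?thesis
  proof cases
    case 1
    have "((\<lambda>t. inverse t ^ m * exp (- inverse t)) has_real_derivative flat (m + 2) t - real m * flat (m + 1) t) (at t)"
    proof -
      have "((\<lambda>t. inverse t ^ m) has_real_derivative real m * (- (inverse t ^ Suc (Suc 0)) * inverse t ^ (m - Suc 0))) (at t)"
        using DERIV_power[OF DERIV_inverse[of t UNIV], of m] 1 by simp
      moreover have "real m * (- (inverse t ^ Suc (Suc 0)) * inverse t ^ (m - Suc 0)) = - real m * inverse t ^ (m + 1)"
        by (cases m) (auto simp: algebra_simps)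
      ultimately have a: "((\<lambda>t. inverse t ^ m) has_real_derivative - real m * inverse t ^ (m + 1)) (at t)" by (simp only:)
      have b: "((\<lambda>t. exp (- inverse t)) has_real_derivative exp (- inverse t) * inverse t ^ 2) (at t)"
        using 1 by (auto intro!: derivative_eq_intros simp: power2_eq_square)
      show ?thesis using DERIV_mult[OF a b] 1
        by (simp add: flat_def power_add power2_eq_square algebra_simps)
    qed
    then show ?thesis
      by (rule has_field_derivative_transform_within_open[where S="{0<..}"]) (use 1 in \<open>auto simp: flat_def\<close>)
  next
    case 2
    have "((\<lambda>t. 0) has_real_derivative flat (m + 2) t - real m * flat (m + 1) t) (at t)"
      using 2 by (auto simp: flat_def)
    then show ?thesis
      by (rule has_field_derivative_transform_within_open[where S="{..<0}"]) (use 2 in \<open>auto simp: flat_def\<close>)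
  next
    case 3
    \<comment> \<open>From the right, the difference quotient at \<open>0\<close> is
      \<open>flat (m + 1)\<close> itself, which tends to \<open>0\<close>.\<close>
    have "((\<lambda>h. (flat m h - flat m 0) / (h - 0)) \<longlongrightarrow> 0) (at 0)"
    proof (rule filterlim_split_at)
      have "\<forall>\<^sub>F h in at_left (0::real). 0 = (flat m h - flat m 0) / (h - 0)"
        unfolding eventually_at_left_field by (auto simp: flat_def intro!: exI[of _ "-1"])
      then show "((\<lambda>h. (flat m h - flat m 0) / (h - 0)) \<longlongrightarrow> 0) (at_left 0)"
        by (rule Lim_transform_eventually[OF tendsto_const])
      have "\<forall>\<^sub>F h in at_right (0::real). flat (m + 1) h = (flat m h - flat m 0) / (h - 0)"
        unfolding eventually_at_right_field by (auto simp: flat_def divide_inverse intro!: exI[of _ 1])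
      then show "((\<lambda>h. (flat m h - flat m 0) / (h - 0)) \<longlongrightarrow> 0) (at_right 0)"
        by (rule Lim_transform_eventually[OF flat_tendsto_0])
    qed
    then show ?thesis unfolding 3 has_field_derivative_iff by (simp add: flat_def)
  qed
qed

lemma Ck_flat: "Ck_function k (\<lambda>x::'a::euclidean_space. flat m (1 - x \<bullet> x))"
proof (induction k arbitrary: m)
  have q: "GDERIV (\<lambda>x. 1 - x \<bullet> x) x :> - 2 *\<^sub>R x" for x :: 'a
    unfolding gderiv_def by (auto intro!: derivative_eq_intros simp: inner_commute)
  have g: "GDERIV (\<lambda>x. flat m (1 - x \<bullet> x)) x :> (flat (m + 2) (1 - x \<bullet> x) - real m * flat (m + 1) (1 - x \<bullet> x)) *\<^sub>R (- 2 *\<^sub>R x)" for m and x :: 'a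
    by (rule GDERIV_DERIV_compose[OF q flat_deriv])
  {
    case 0
    then show ?case using GDERIV_continuous_on[OF g] by simp
  next
    case (Suc k)
    have "Ck_function k (\<lambda>x::'a. (flat (m + 2) (1 - x \<bullet> x) + (- real m) * flat (m + 1) (1 - x \<bullet> x)) * ((- 2) * (x \<bullet> b)))" for b
      by (intro Ck_mult Ck_add Ck_const Ck_inner Suc.IH)
    then have "\<forall>b\<in>Basis. Ck_function k (\<lambda>x::'a. ((flat (m + 2) (1 - x \<bullet> x) - real m * flat (m + 1) (1 - x \<bullet> x)) *\<^sub>R (- 2 *\<^sub>R x)) \<bullet> b)"
      by (simp only: inner_scaleR_left diff_conv_add_uminus mult_minus_left simp_thms ball_triv)
    then show ?case unfolding Ck_function.simps(2)
      by (intro exI[of _ "\<lambda>x. (flat (m + 2) (1 - x \<bullet> x) - real m * flat (m + 1) (1 - x \<bullet> x)) *\<^sub>R (- 2 *\<^sub>R x)"]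
          conjI allI g)
  }
qed

definition smooth_compact :: "('a::euclidean_space \<Rightarrow> real) \<Rightarrow> bool" where
  "smooth_compact \<rho> \<longleftrightarrow> (\<forall>k. Ck_function k \<rho>) \<and> (\<exists>R. \<forall>x. R \<le> norm x \<longrightarrow> \<rho> x = 0)"

text \<open>\<open>Ck_function\<close> asserts the existence of a gradient anew for every order
  \<open>k\<close>. By uniqueness these gradients agree, so one function \<open>G\<close> has
  components of all orders.\<close>

lemma smooth_compact_gradient:
  assumes "smooth_compact \<rho>"
  shows "\<exists>G. (\<forall>x. GDERIV \<rho> x :> G x) \<and> (\<forall>b\<in>Basis. smooth_compact (\<lambda>x. G x \<bullet> b))"
proof -
  have Ck: "\<And>k. Ck_function k \<rho>" using assms by (auto simp: smooth_compact_def)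
  obtain R where R: "\<And>x. R \<le> norm x \<Longrightarrow> \<rho> x = 0" using assms by (auto simp: smooth_compact_def)
  obtain G where G: "\<And>x. GDERIV \<rho> x :> G x" using Ck[of "Suc 0"] by auto
  have "Ck_function k (\<lambda>x. G x \<bullet> b)" if "b \<in> Basis" for k b
  proof -
    obtain g where g: "\<And>x. GDERIV \<rho> x :> g x" "\<forall>b\<in>Basis. Ck_function k (\<lambda>x. g x \<bullet> b)"
      using Ck[of "Suc k"] by auto
    have "g = G" using GDERIV_unique[OF g(1) G] by auto
    then show ?thesis using g that by auto
  qed
  moreover have "G x = 0" if x: "R + 1 \<le> norm x" for x
  proof -
    have "((\<lambda>_. 0) has_derivative (\<lambda>h. h \<bullet> 0)) (at x)" by simp
    then have "(\<rho> has_derivative (\<lambda>h. h \<bullet> 0)) (at x)"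
    proof (rule has_derivative_transform_within_open[where s="{y. R < norm y}"])
      show "open {y::'a. R < norm y}" by (intro open_Collect_less continuous_intros)
    qed (use x R in auto)
    then show ?thesis using GDERIV_unique[OF G] unfolding gderiv_def by blast
  qed
  ultimately show ?thesis using G unfolding smooth_compact_def by (metis inner_zero_left)
qed

lemma smooth_compact_bounded:
  assumes "smooth_compact \<rho>"
  shows "\<exists>C. \<forall>x. \<bar>\<rho> x\<bar> \<le> C"
proof -
  obtain R where R: "\<And>x. R \<le> norm x \<Longrightarrow> \<rho> x = 0" using assms by (auto simp: smooth_compact_def)
  have c: "continuous_on UNIV \<rho>" using assms Ck_continuous unfolding smooth_compact_def by blast
  have "compact (\<rho> ` cball 0 R)" by (intro compact_continuous_image continuous_on_subset[OF c]) auto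
  then have "bounded (\<rho> ` cball 0 R)" by (rule compact_imp_bounded)
  then obtain C where C: "\<forall>y\<in>\<rho> ` cball 0 R. norm y \<le> C" unfolding bounded_iff by blast
  have "\<bar>\<rho> x\<bar> \<le> max C 0" for x using R[of x] C by (cases "norm x \<le> R") (auto simp: le_max_iff_disj)
  then show ?thesis by blast
qed

lemma smooth_compact_lipschitz_gradient:
  assumes "smooth_compact \<rho>" and G: "\<And>x. GDERIV \<rho> x :> G x" "\<forall>b\<in>Basis. smooth_compact (\<lambda>x. G x \<bullet> b)"
  shows "\<exists>L. L-lipschitz_on UNIV G"
proof -
  have "\<exists>L\<ge>0. \<forall>x y. \<bar>G y \<bullet> b - G x \<bullet> b\<bar> \<le> L * norm (y - x)" if b: "b \<in> Basis" for b
  proof -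
    obtain D where D: "\<And>x. GDERIV (\<lambda>x. G x \<bullet> b) x :> D x" "\<forall>c\<in>Basis. smooth_compact (\<lambda>x. D x \<bullet> c)"
      using smooth_compact_gradient[of "\<lambda>x. G x \<bullet> b"] G b by blast
    have "\<exists>C. \<forall>x. \<bar>D x \<bullet> c\<bar> \<le> C" if "c \<in> Basis" for c
      using smooth_compact_bounded[of "\<lambda>x. D x \<bullet> c"] D that by blast
    then obtain C where C: "\<And>c x. c \<in> Basis \<Longrightarrow> \<bar>D x \<bullet> c\<bar> \<le> C c" by metis
    have n: "norm (D x) \<le> (\<Sum>c\<in>Basis. C c)" for x
      using norm_le_l1[of "D x"] sum_mono[of Basis "\<lambda>c. \<bar>D x \<bullet> c\<bar>" C] C by (force intro: order_trans)
    have "0 \<le> (\<Sum>c\<in>Basis. C c)" using n[of 0] norm_ge_zero[of "D 0"] by linarith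
    then show ?thesis using bounded_gradient_lipschitz[OF D(1) n] by blast
  qed
  then obtain L where L: "\<And>b. b \<in> Basis \<Longrightarrow> 0 \<le> L b" "\<And>b x y. b \<in> Basis \<Longrightarrow> \<bar>G y \<bullet> b - G x \<bullet> b\<bar> \<le> L b * norm (y - x)"
    by metis
  have "(\<Sum>b\<in>Basis. L b)-lipschitz_on UNIV G"
  proof (rule lipschitz_onI)
    show "0 \<le> (\<Sum>b\<in>Basis. L b)" using L by (intro sum_nonneg) auto
    fix x y
    have "dist (G x) (G y) \<le> (\<Sum>b\<in>Basis. \<bar>(G x - G y) \<bullet> b\<bar>)" unfolding dist_norm by (rule norm_le_l1)
    also have "\<dots> \<le> (\<Sum>b\<in>Basis. L b * norm (x - y))" using L by (intro sum_mono) (auto simp: inner_diff_left)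
    finally show "dist (G x) (G y) \<le> (\<Sum>b\<in>Basis. L b) * dist x y" by (simp add: sum_distrib_right dist_norm)
  qed
  then show ?thesis by blast
qed

section \<open>Convolution with smooth kernels of compact support\<close>

definition conv :: "('a::euclidean_space \<Rightarrow> real) \<Rightarrow> ('a \<Rightarrow> real) \<Rightarrow> 'a \<Rightarrow> real" where
  "conv v \<rho> x = (\<integral>y. v y * \<rho> (x - y) \<partial>lborel)"

lemma smooth_compact_measurable: "smooth_compact \<rho> \<Longrightarrow> \<rho> \<in> borel_measurable borel"
  using Ck_continuous unfolding smooth_compact_def by (blast intro: borel_measurable_continuous_onI)

lemma conv_integrable:
  assumes v: "integrable lborel v" and \<rho>: "smooth_compact \<rho>"
  shows "integrable lborel (\<lambda>y. v y * \<rho> (x - y))"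
proof -
  obtain C where C: "\<And>x. \<bar>\<rho> x\<bar> \<le> C" using smooth_compact_bounded[OF \<rho>] by blast
  have [measurable]: "\<rho> \<in> borel_measurable borel" by (rule smooth_compact_measurable[OF \<rho>])
  have [measurable]: "v \<in> borel_measurable borel" using v by auto
  show ?thesis
  proof (rule Bochner_Integration.integrable_bound)
    show "integrable lborel (\<lambda>y. C * \<bar>v y\<bar>)" using v by auto
    show "AE y in lborel. norm (v y * \<rho> (x - y)) \<le> norm (C * \<bar>v y\<bar>)"
    proof (intro AE_I2)
      fix y
      have "\<bar>v y\<bar> * \<bar>\<rho> (x - y)\<bar> \<le> \<bar>v y\<bar> * \<bar>C\<bar>"
        by (intro mult_left_mono order_trans[OF C abs_ge_self]) auto
      then show "norm (v y * \<rho> (x - y)) \<le> norm (C * \<bar>v y\<bar>)" by (simp add: abs_mult mult.commute)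
    qed
  qed measurable
qed

text \<open>The gradient of \<open>\<rho>\<close> is Lipschitz, so its Taylor remainder is at most
  \<open>L * (norm h)\<^sup>2\<close> uniformly in the point; integrated against
  \<open>\<bar>v\<bar>\<close> this differentiates under the integral sign.\<close>

lemma conv_gradient:
  assumes v: "integrable lborel v" and \<rho>: "smooth_compact \<rho>"
    and G: "\<And>x. GDERIV \<rho> x :> G x" "\<forall>b\<in>Basis. smooth_compact (\<lambda>x. G x \<bullet> b)"
  shows "GDERIV (conv v \<rho>) x :> (\<Sum>b\<in>Basis. conv v (\<lambda>x. G x \<bullet> b) x *\<^sub>R b)"
proof -
  obtain L where L: "L-lipschitz_on UNIV G" using smooth_compact_lipschitz_gradient[OF \<rho> G] by blast
  have L0: "0 \<le> L" using L by (rule lipschitz_on_nonneg)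
  define V where "V = (\<integral>y. \<bar>v y\<bar> \<partial>lborel)"
  have V0: "0 \<le> V" unfolding V_def by (intro integral_nonneg_AE) auto
  let ?D = "\<Sum>b\<in>Basis. conv v (\<lambda>x. G x \<bullet> b) x *\<^sub>R b"
  have iG: "integrable lborel (\<lambda>y. v y * (G (x - y) \<bullet> b))" if "b \<in> Basis" for b
    using conv_integrable[OF v, of "\<lambda>x. G x \<bullet> b"] G that by auto
  have hD: "h \<bullet> ?D = (\<integral>y. v y * (h \<bullet> G (x - y)) \<partial>lborel)" and iD: "integrable lborel (\<lambda>y. v y * (h \<bullet> G (x - y)))" for h
  proof -
    have e: "v y * (h \<bullet> G (x - y)) = (\<Sum>b\<in>Basis. (h \<bullet> b) * (v y * (G (x - y) \<bullet> b)))" for y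
      by (subst euclidean_inner) (simp add: sum_distrib_left mult_ac)
    show "integrable lborel (\<lambda>y. v y * (h \<bullet> G (x - y)))"
      unfolding e using iG by (intro Bochner_Integration.integrable_sum integrable_mult_right)
    show "h \<bullet> ?D = (\<integral>y. v y * (h \<bullet> G (x - y)) \<partial>lborel)"
      unfolding e using iG by (subst Bochner_Integration.integral_sum) (auto simp: inner_sum_right conv_def mult.commute)
  qed
  have rem: "\<bar>conv v \<rho> (x + h) - conv v \<rho> x - h \<bullet> ?D\<bar> \<le> L * V * (norm h)\<^sup>2" for h
  proof -
    have "conv v \<rho> (x + h) - conv v \<rho> x - h \<bullet> ?D
        = (\<integral>y. v y * \<rho> (x + h - y) - v y * \<rho> (x - y) - v y * (h \<bullet> G (x - y)) \<partial>lborel)"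
      unfolding conv_def[of v \<rho>] hD using conv_integrable[OF v \<rho>] iD by simp
    then have "\<bar>conv v \<rho> (x + h) - conv v \<rho> x - h \<bullet> ?D\<bar>
        \<le> (\<integral>y. \<bar>v y * \<rho> (x + h - y) - v y * \<rho> (x - y) - v y * (h \<bullet> G (x - y))\<bar> \<partial>lborel)"
      using integral_norm_bound[of lborel "\<lambda>y. v y * \<rho> (x + h - y) - v y * \<rho> (x - y) - v y * (h \<bullet> G (x - y))"] by simp
    also have "\<dots> \<le> (\<integral>y. L * (norm h)\<^sup>2 * \<bar>v y\<bar> \<partial>lborel)"
    proof (intro integral_mono)
      show "integrable lborel (\<lambda>y. \<bar>v y * \<rho> (x + h - y) - v y * \<rho> (x - y) - v y * (h \<bullet> G (x - y))\<bar>)"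
        using conv_integrable[OF v \<rho>] iD by (intro integrable_abs Bochner_Integration.integrable_diff)
      show "integrable lborel (\<lambda>y. L * (norm h)\<^sup>2 * \<bar>v y\<bar>)" using v by auto
      fix y
      have "\<bar>\<rho> (x + h - y) - \<rho> (x - y) - h \<bullet> G (x - y)\<bar> \<le> L * (norm h)\<^sup>2"
        using lipschitz_gradient_taylor[OF G(1) L, of "x + h - y" "x - y"] by (simp add: inner_commute)
      then have "\<bar>v y\<bar> * \<bar>\<rho> (x + h - y) - \<rho> (x - y) - h \<bullet> G (x - y)\<bar> \<le> \<bar>v y\<bar> * (L * (norm h)\<^sup>2)"
        by (intro mult_left_mono) auto
      then show "\<bar>v y * \<rho> (x + h - y) - v y * \<rho> (x - y) - v y * (h \<bullet> G (x - y))\<bar> \<le> L * (norm h)\<^sup>2 * \<bar>v y\<bar>"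
        by (simp add: abs_mult[symmetric] right_diff_distrib mult_ac)
    qed
    also have "\<dots> = L * V * (norm h)\<^sup>2" by (simp add: V_def)
    finally show ?thesis .
  qed
  show ?thesis
    unfolding gderiv_def has_derivative_at
  proof
    show "bounded_linear (\<lambda>h. h \<bullet> ?D)" by (rule bounded_linear_inner_left)
    have t: "((\<lambda>h::'a. L * V * norm h) \<longlongrightarrow> 0) (at 0)"
      using tendsto_mult[OF tendsto_const tendsto_norm_zero[OF tendsto_ident_at], of "L * V"] by simp
    show "(\<lambda>h. norm (conv v \<rho> (x + h) - conv v \<rho> x - h \<bullet> ?D) / norm h) \<midarrow>0\<rightarrow> 0"
    proof (rule Lim_null_comparison[OF _ t])
      have "norm (norm (conv v \<rho> (x + h) - conv v \<rho> x - h \<bullet> ?D) / norm h) \<le> L * V * norm h" for h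
        using rem[of h] L0 V0 by (cases "h = 0") (auto simp: divide_le_eq power2_eq_square mult.assoc)
      then show "\<forall>\<^sub>F h in at 0. norm (norm (conv v \<rho> (x + h) - conv v \<rho> x - h \<bullet> ?D) / norm h) \<le> L * V * norm h"
        by simp
    qed
  qed
qed

lemma Ck_conv:
  assumes v: "integrable lborel v"
  shows "smooth_compact \<rho> \<Longrightarrow> Ck_function k (conv v \<rho>)"
proof (induction k arbitrary: \<rho>)
  case 0
  obtain G where G: "\<And>x. GDERIV \<rho> x :> G x" "\<forall>b\<in>Basis. smooth_compact (\<lambda>x. G x \<bullet> b)"
    using smooth_compact_gradient[OF 0] by blast
  show ?case using GDERIV_continuous_on[OF conv_gradient[OF v 0 G]] by simp
next
  case (Suc k)
  obtain G where G: "\<And>x. GDERIV \<rho> x :> G x" "\<forall>b\<in>Basis. smooth_compact (\<lambda>x. G x \<bullet> b)"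
    using smooth_compact_gradient[OF Suc.prems] by blast
  have "Ck_function k (\<lambda>x. (\<Sum>b\<in>Basis. conv v (\<lambda>x. G x \<bullet> b) x *\<^sub>R b) \<bullet> c)" if c: "c \<in> Basis" for c
  proof -
    have "(\<lambda>x. (\<Sum>b\<in>Basis. conv v (\<lambda>x. G x \<bullet> b) x *\<^sub>R b) \<bullet> c) = conv v (\<lambda>x. G x \<bullet> c)"
      using c by (auto simp: fun_eq_iff inner_sum_left inner_Basis if_distrib cong: if_cong)
    then show ?thesis using Suc.IH G c by simp
  qed
  then show ?case using conv_gradient[OF v Suc.prems G] unfolding Ck_function.simps(2)
    by (intro exI[of _ "\<lambda>x. \<Sum>b\<in>Basis. conv v (\<lambda>x. G x \<bullet> b) x *\<^sub>R b"]) blast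
qed

lemma smooth_compact_scaled_flat:
  assumes "0 < \<tau>"
  shows "smooth_compact (\<lambda>x::'a::euclidean_space. flat 0 (1 - (x /\<^sub>R \<tau>) \<bullet> (x /\<^sub>R \<tau>)))"
proof -
  have sc: "Ck_function k f \<Longrightarrow> Ck_function k (\<lambda>x. f (c *\<^sub>R x))" for k c and f :: "'a \<Rightarrow> real"
  proof (induction k arbitrary: f)
    case 0
    then show ?case by (auto intro!: continuous_on_compose2[of UNIV f] continuous_intros)
  next
    case (Suc k)
    obtain g where g: "\<And>x. GDERIV f x :> g x" "\<forall>b\<in>Basis. Ck_function k (\<lambda>x. g x \<bullet> b)"
      using Suc.prems by auto
    have "GDERIV (\<lambda>x. f (c *\<^sub>R x)) x :> c *\<^sub>R g (c *\<^sub>R x)" for x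
    proof -
      have "((\<lambda>x. c *\<^sub>R x) has_derivative (\<lambda>h. c *\<^sub>R h)) (at x)" by (auto intro!: derivative_eq_intros)
      moreover have "(f has_derivative (\<lambda>h. h \<bullet> g (c *\<^sub>R x))) (at (c *\<^sub>R x))" using g(1) unfolding gderiv_def .
      ultimately have "((\<lambda>x. f (c *\<^sub>R x)) has_derivative (\<lambda>h. (c *\<^sub>R h) \<bullet> g (c *\<^sub>R x))) (at x)"
        by (rule has_derivative_compose)
      then show ?thesis by (simp add: gderiv_def)
    qed
    moreover have "Ck_function k (\<lambda>x. c * (g (c *\<^sub>R x) \<bullet> b))" if "b \<in> Basis" for b
      using Suc.IH[of "\<lambda>x. g x \<bullet> b"] g(2) that by (intro Ck_mult Ck_const) auto
    ultimately show ?case by (auto intro!: exI[of _ "\<lambda>x. c *\<^sub>R g (c *\<^sub>R x)"])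
  qed
  have "flat 0 (1 - (x /\<^sub>R \<tau>) \<bullet> (x /\<^sub>R \<tau>)) = 0" if "\<tau> \<le> norm x" for x :: 'a
  proof -
    have "1 \<le> norm (x /\<^sub>R \<tau>)" using that assms by (simp add: field_simps)
    then have "1 \<le> (norm (x /\<^sub>R \<tau>))\<^sup>2" by (rule one_le_power)
    then have "1 - (x /\<^sub>R \<tau>) \<bullet> (x /\<^sub>R \<tau>) \<le> 0" unfolding power2_norm_eq_inner by linarith
    then show ?thesis by (simp only: flat_def if_True)
  qed
  then show ?thesis unfolding smooth_compact_def using sc[OF Ck_flat, of _ 0 "inverse \<tau>"] by blast
qed

section \<open>Mollification\<close>

lemma distr_reflect: "distr lborel borel (\<lambda>h. x - h) = (lborel :: 'a::euclidean_space measure)"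
  using lborel_affine[of "-1" x] by (simp add: density_1)

lemma nn_integral_reflect:
  fixes x :: "'a::euclidean_space"
  assumes [measurable]: "f \<in> borel_measurable borel"
  shows "(\<integral>\<^sup>+h. f (x - h) \<partial>lborel) = (\<integral>\<^sup>+h. f h \<partial>lborel)"
proof -
  have "(\<integral>\<^sup>+h. f h \<partial>lborel) = (\<integral>\<^sup>+h. f h \<partial>distr lborel borel (\<lambda>h. x - h))" by (simp only: distr_reflect)
  also have "\<dots> = (\<integral>\<^sup>+h. f (x - h) \<partial>lborel)" by (rule nn_integral_distr) auto
  finally show ?thesis by simp
qed

lemma integral_reflect:
  fixes f :: "'a::euclidean_space \<Rightarrow> real"
  assumes [measurable]: "f \<in> borel_measurable borel"
  shows "(\<integral>h. f (x - h) \<partial>lborel) = (\<integral>h. f h \<partial>lborel)"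
proof -
  have "(\<integral>h. f h \<partial>lborel) = (\<integral>h. f h \<partial>distr lborel borel (\<lambda>h. x - h))" by (simp only: distr_reflect)
  also have "\<dots> = (\<integral>h. f (x - h) \<partial>lborel)" by (rule integral_distr) auto
  finally show ?thesis by simp
qed

lemma nn_integral_shift:
  fixes c :: "'a::euclidean_space"
  assumes [measurable]: "f \<in> borel_measurable borel"
  shows "(\<integral>\<^sup>+x. f (x - c) \<partial>lborel) = (\<integral>\<^sup>+x. f x \<partial>lborel)"
proof -
  have "(\<integral>\<^sup>+x. f x \<partial>lborel) = (\<integral>\<^sup>+x. f x \<partial>distr lborel borel ((+) (- c)))" by (simp only: lborel_distr_plus)
  also have "\<dots> = (\<integral>\<^sup>+x. f (- c + x) \<partial>lborel)" by (rule nn_integral_distr) auto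
  finally show ?thesis by simp
qed

text \<open>The variance under the probability density \<open>\<eta>\<close> is nonnegative. If the
  second moment is infinite, there is nothing to show.\<close>

lemma jensen_square:
  fixes \<eta> g :: "'b \<Rightarrow> real"
  assumes \<eta>: "integrable M \<eta>" "\<And>h. 0 \<le> \<eta> h" "(\<integral>h. \<eta> h \<partial>M) = 1" and g: "integrable M (\<lambda>h. \<eta> h * g h)"
    and gm [measurable]: "g \<in> borel_measurable M"
  shows "ennreal ((\<integral>h. \<eta> h * g h \<partial>M)\<^sup>2) \<le> (\<integral>\<^sup>+h. ennreal (\<eta> h * (g h)\<^sup>2) \<partial>M)"
proof (cases "(\<integral>\<^sup>+h. ennreal (\<eta> h * (g h)\<^sup>2) \<partial>M) < \<infinity>")
  case True
  have [measurable]: "\<eta> \<in> borel_measurable M" using \<eta> by auto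
  have i: "integrable M (\<lambda>h. \<eta> h * (g h)\<^sup>2)"
    using True \<eta>(2) by (intro integrableI_nonneg) auto
  define m where "m = (\<integral>h. \<eta> h * g h \<partial>M)"
  have "0 \<le> (\<integral>h. \<eta> h * (g h - m)\<^sup>2 \<partial>M)" using \<eta>(2) by (intro integral_nonneg_AE) auto
  also have "(\<lambda>h. \<eta> h * (g h - m)\<^sup>2) = (\<lambda>h. \<eta> h * (g h)\<^sup>2 - 2 * m * (\<eta> h * g h) + m\<^sup>2 * \<eta> h)"
    by (auto simp: fun_eq_iff power2_eq_square algebra_simps)
  also have "(\<integral>h. \<eta> h * (g h)\<^sup>2 - 2 * m * (\<eta> h * g h) + m\<^sup>2 * \<eta> h \<partial>M) = (\<integral>h. \<eta> h * (g h)\<^sup>2 \<partial>M) - 2 * m * m + m\<^sup>2"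
    using i g \<eta> by (simp add: m_def)
  finally have "m\<^sup>2 \<le> (\<integral>h. \<eta> h * (g h)\<^sup>2 \<partial>M)" by (simp add: power2_eq_square)
  then have "ennreal (m\<^sup>2) \<le> ennreal (\<integral>h. \<eta> h * (g h)\<^sup>2 \<partial>M)" by (rule ennreal_leI)
  also have "\<dots> = (\<integral>\<^sup>+h. ennreal (\<eta> h * (g h)\<^sup>2) \<partial>M)"
    using i \<eta>(2) by (intro nn_integral_eq_integral[symmetric]) auto
  finally show ?thesis by (simp add: m_def)
next
  case False
  then have "(\<integral>\<^sup>+h. ennreal (\<eta> h * (g h)\<^sup>2) \<partial>M) = \<infinity>" by (metis infinity_ennreal_def less_top)
  then show ?thesis by simp
qed

lemma flat0_bounds: "0 \<le> flat 0 t" "flat 0 t \<le> 1" "0 < t \<Longrightarrow> 0 < flat 0 t"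
  by (auto simp: flat_def)

lemma flat0_mono: "0 < a \<Longrightarrow> a \<le> t \<Longrightarrow> flat 0 a \<le> flat 0 t"
  by (auto simp: flat_def le_imp_inverse_le)

text \<open>The constant \<open>M\<close> is common to all \<open>\<tau>\<close>. The height bound
  \<open>M * \<tau> powr (-N)\<close> on a support of radius \<open>\<tau>\<close> is what allows
  the mollifier to be compared with the singular kernel in \<open>conv_L2_close\<close>.\<close>

lemma mollifier_exists:
  "\<exists>M>0. \<forall>\<tau>>0. \<exists>\<eta>::'a::euclidean_space \<Rightarrow> real. smooth_compact \<eta> \<and> integrable lborel \<eta> \<and> (\<forall>h. 0 \<le> \<eta> h) \<and>
     (\<integral>h. \<eta> h \<partial>lborel) = 1 \<and> (\<forall>h. \<tau> \<le> norm h \<longrightarrow> \<eta> h = 0) \<and> (\<forall>h. \<eta> h \<le> M * \<tau> powr (- real DIM('a)))"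
proof -
  let ?N = "DIM('a)"
  \<comment> \<open>A lower bound for the mass of the unscaled bump: on the ball of half the radius
    its argument \<open>1 - x \<bullet> x\<close> is at least \<open>3/4\<close>.\<close>
  define c where "c = flat 0 (3/4) * (unit_ball_vol (real ?N) * (1/2) ^ ?N)"
  have V0: "0 < unit_ball_vol (real ?N)" by simp
  have c: "0 < c" unfolding c_def using V0 flat0_bounds(3)[of "3/4"] by (intro mult_pos_pos) auto
  show ?thesis
  proof (rule exI[of _ "1 / c"], intro conjI allI impI)
    show "0 < 1 / c" using c by simp
    fix \<tau> :: real assume \<tau>: "0 < \<tau>"
    define \<beta> where "\<beta> x = flat 0 (1 - (x /\<^sub>R \<tau>) \<bullet> (x /\<^sub>R \<tau>))" for x :: 'a
    have sm: "smooth_compact \<beta>" unfolding \<beta>_def[abs_def] by (rule smooth_compact_scaled_flat[OF \<tau>])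
    have [measurable]: "\<beta> \<in> borel_measurable borel" by (rule smooth_compact_measurable[OF sm])
    have nz: "\<beta> x = 0" if "\<tau> \<le> norm x" for x
    proof -
      have "1 \<le> norm (x /\<^sub>R \<tau>)" using that \<tau> by (simp add: field_simps)
      then have "1 \<le> (norm (x /\<^sub>R \<tau>))\<^sup>2" by (rule one_le_power)
      then have "1 - (x /\<^sub>R \<tau>) \<bullet> (x /\<^sub>R \<tau>) \<le> 0" unfolding power2_norm_eq_inner by linarith
      then show ?thesis by (simp only: \<beta>_def flat_def if_True)
    qed
    have ib: "integrable lborel (indicator (ball (0::'a) r) :: 'a \<Rightarrow> real)" for r
      using emeasure_lborel_ball_finite[of "0::'a" r] by (auto simp: integrable_indicator_iff)
    have i: "integrable lborel \<beta>"
    proof (rule Bochner_Integration.integrable_bound[OF ib[of \<tau>]])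
      show "AE x in lborel. norm (\<beta> x) \<le> norm (indicator (ball 0 \<tau>) x :: real)"
        using nz flat0_bounds by (intro AE_I2) (auto simp: \<beta>_def indicator_def not_less)
    qed simp
    define I where "I = (\<integral>x. \<beta> x \<partial>lborel)"
    have low: "flat 0 (3/4) \<le> \<beta> x" if "x \<in> ball 0 (\<tau> / 2)" for x
    proof -
      have "norm (x /\<^sub>R \<tau>) \<le> 1 / 2" using that \<tau> by (simp add: field_simps)
      then have "(norm (x /\<^sub>R \<tau>))\<^sup>2 \<le> (1/2)\<^sup>2" by (intro power_mono) auto
      then have "3 / 4 \<le> 1 - (x /\<^sub>R \<tau>) \<bullet> (x /\<^sub>R \<tau>)" unfolding power2_norm_eq_inner by (simp add: power2_eq_square)
      then show ?thesis unfolding \<beta>_def by (intro flat0_mono) auto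
    qed
    have "(\<integral>x. flat 0 (3/4) * indicator (ball (0::'a) (\<tau> / 2)) x \<partial>lborel) \<le> I"
      unfolding I_def
    proof (intro integral_mono i)
      show "integrable lborel (\<lambda>x. flat 0 (3/4) * indicator (ball (0::'a) (\<tau> / 2)) x)" using ib by (rule integrable_mult_right)
      show "flat 0 (3/4) * indicator (ball 0 (\<tau> / 2)) x \<le> \<beta> x" for x
        using low[of x] flat0_bounds by (auto simp: \<beta>_def indicator_def)
    qed
    moreover have "measure lborel (ball (0::'a) (\<tau> / 2)) = unit_ball_vol (real ?N) * (\<tau> / 2) ^ ?N"
      using \<tau> V0 unfolding measure_def by (subst emeasure_lborel_ball) auto
    moreover have "(\<integral>x. flat 0 (3/4) * indicator (ball (0::'a) (\<tau> / 2)) x \<partial>lborel) = flat 0 (3/4) * measure lborel (ball (0::'a) (\<tau> / 2))"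
      by simp
    moreover have "c * \<tau> ^ ?N = flat 0 (3/4) * (unit_ball_vol (real ?N) * (\<tau> / 2) ^ ?N)"
      by (simp add: c_def power_divide)
    ultimately have I: "c * \<tau> ^ ?N \<le> I" by simp
    then have I0: "0 < I" using c \<tau> by (intro less_le_trans[OF _ I]) simp
    define \<eta> where "\<eta> x = (1 / I) * \<beta> x" for x
    show "\<exists>\<eta>::'a \<Rightarrow> real. smooth_compact \<eta> \<and> integrable lborel \<eta> \<and> (\<forall>h. 0 \<le> \<eta> h) \<and>
     (\<integral>h. \<eta> h \<partial>lborel) = 1 \<and> (\<forall>h. \<tau> \<le> norm h \<longrightarrow> \<eta> h = 0) \<and> (\<forall>h. \<eta> h \<le> 1 / c * \<tau> powr (- real ?N))"
    proof (intro exI[of _ \<eta>] conjI allI impI)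
      show "smooth_compact \<eta>"
      proof -
        have "Ck_function k \<eta>" for k
          unfolding \<eta>_def[abs_def] using sm by (intro Ck_mult Ck_const) (simp add: smooth_compact_def)
        moreover have "\<eta> x = 0" if "\<tau> \<le> norm x" for x using nz[OF that] by (simp add: \<eta>_def)
        ultimately show ?thesis unfolding smooth_compact_def by blast
      qed
      show "integrable lborel \<eta>" unfolding \<eta>_def[abs_def] using i by (rule integrable_mult_right)
      show "0 \<le> \<eta> h" for h using I0 flat0_bounds by (simp add: \<eta>_def \<beta>_def)
      show "(\<integral>h. \<eta> h \<partial>lborel) = 1" using I0 by (simp add: \<eta>_def I_def[symmetric])
      show "\<eta> h = 0" if "\<tau> \<le> norm h" for h using nz[OF that] by (simp add: \<eta>_def)
      fix h
      have "\<eta> h \<le> 1 / I" using I0 flat0_bounds by (simp add: \<eta>_def \<beta>_def divide_right_mono)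
      also have "\<dots> \<le> 1 / (c * \<tau> ^ ?N)" using I I0 c \<tau> by (intro divide_left_mono mult_pos_pos) auto
      also have "\<dots> = 1 / c * \<tau> powr (- real ?N)" using \<tau> by (simp add: powr_minus powr_realpow field_simps)
      finally show "\<eta> h \<le> 1 / c * \<tau> powr (- real ?N)" .
    qed
  qed
qed

section \<open>Hardy cutoffs and density of test functions\<close>

locale hardy_domain = fractional_domain s \<Omega> for s :: real and \<Omega> :: "'a::euclidean_space set" +
  assumes exterior: "\<exists>\<rho>>0. \<forall>b\<in>frontier \<Omega>. \<forall>t. 0 < t \<longrightarrow> t \<le> \<rho> \<longrightarrow> (\<exists>a. dist a b = t \<and> ball a t \<inter> \<Omega> = {})"
begin

definition dd :: "'a \<Rightarrow> real" where "dd x = infdist x (- \<Omega>)"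

lemma dd_nonneg [simp]: "0 \<le> dd x"
  by (simp add: dd_def infdist_nonneg)

lemma dd_lipschitz: "\<bar>dd x - dd y\<bar> \<le> norm (x - y)"
  using infdist_triangle_abs[of x "- \<Omega>" y] by (simp add: dd_def dist_norm)

lemma dd_outside: "x \<notin> \<Omega> \<Longrightarrow> dd x = 0"
  by (simp add: dd_def)

lemma dd_pos: "x \<in> \<Omega> \<Longrightarrow> 0 < dd x"
  using in_closed_iff_infdist_zero[of "- \<Omega>" x] dom compl_dom dd_nonneg[of x]
  unfolding dd_def by (auto simp: closed_Compl order.strict_iff_order)

lemma borel_measurable_dd [measurable]: "dd \<in> borel_measurable borel"
  unfolding dd_def[abs_def] by (intro borel_measurable_continuous_onI continuous_intros)

text \<open>At the boundary point nearest to \<open>x\<close> there is an exterior ball of radius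
  comparable to \<open>dd x\<close>, contained in the ball of radius \<open>3 * dd x\<close> around
  \<open>x\<close>. The kernel on it integrates to a multiple of
  \<open>dd x powr (-2 * s)\<close>.\<close>

lemma hardy_kernel:
  "\<exists>c>0. \<forall>x\<in>\<Omega>. ennreal (c * dd x powr (- 2 * s)) \<le> (\<integral>\<^sup>+y. ennreal (kern s (x - y)) * indicator (- \<Omega>) y \<partial>lborel)"
proof -
  let ?N = "real DIM('a)"
  let ?V = "unit_ball_vol ?N"
  have V0: "0 < ?V" by simp
  obtain \<rho> where \<rho>: "0 < \<rho>" "\<forall>b\<in>frontier \<Omega>. \<forall>t. 0 < t \<longrightarrow> t \<le> \<rho> \<longrightarrow> (\<exists>a. dist a b = t \<and> ball a t \<inter> \<Omega> = {})"
    using exterior by blast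
  obtain y0 where y0: "y0 \<notin> \<Omega>" using compl_dom by blast
  obtain D where D: "0 < D" "\<Omega> \<subseteq> ball y0 D" using bounded_subset_ballD[OF dom(2)] by blast
  have ddD: "dd x \<le> D" if "x \<in> \<Omega>" for x
  proof -
    have "dd x \<le> dist x y0" unfolding dd_def using y0 by (intro infdist_le) auto
    then show ?thesis using that D by (auto simp: dist_commute dest!: subsetD)
  qed
  \<comment> \<open>As \<open>dd\<close> is at most \<open>D\<close> on \<open>\<Omega>\<close>, the
    radius \<open>\<kappa> * dd x\<close> never exceeds the largest available radius
    \<open>\<rho>\<close>.\<close>
  define \<kappa> where "\<kappa> = min 1 (\<rho> / D)"
  have \<kappa>: "0 < \<kappa>" "\<kappa> \<le> 1" "\<kappa> * D \<le> \<rho>" using \<rho> D by (auto simp: \<kappa>_def min_def field_simps)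
  define c where "c = 3 powr (- (?N + 2 * s)) * (?V * \<kappa> ^ DIM('a))"
  have c: "0 < c" using \<kappa> V0 unfolding c_def by (intro mult_pos_pos) auto
  have "ennreal (c * dd x powr (- 2 * s)) \<le> (\<integral>\<^sup>+y. ennreal (kern s (x - y)) * indicator (- \<Omega>) y \<partial>lborel)" if x: "x \<in> \<Omega>" for x
  proof -
    let ?d = "dd x"
    have d: "0 < ?d" by (rule dd_pos[OF x])
    have "closed (- \<Omega>)" using dom by (simp add: closed_Compl)
    then obtain x0 where x0: "x0 \<in> - \<Omega>" "?d = dist x x0"
      using infdist_attains_inf[of "- \<Omega>" x] compl_dom unfolding dd_def by blast
    have "ball x ?d \<subseteq> \<Omega>"
    proof
      fix y assume "y \<in> ball x ?d"
      then show "y \<in> \<Omega>" using infdist_le[of y "- \<Omega>" x] unfolding dd_def by force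
    qed
    then have "closure (ball x ?d) \<subseteq> closure \<Omega>" by (rule closure_mono)
    moreover have "x0 \<in> closure (ball x ?d)" using d x0 by simp
    ultimately have fr: "x0 \<in> frontier \<Omega>" using x0 dom by (auto simp: frontier_def interior_open)
    define t where "t = \<kappa> * ?d"
    have t: "0 < t" "t \<le> ?d" "t \<le> \<rho>"
    proof -
      show "0 < t" "t \<le> ?d" using \<kappa> d by (auto simp: t_def mult_left_le_one_le)
      have "t \<le> \<kappa> * D" unfolding t_def using \<kappa> ddD[OF x] by (intro mult_left_mono) auto
      then show "t \<le> \<rho>" using \<kappa> by linarith
    qed
    obtain a where a: "dist a x0 = t" "ball a t \<inter> \<Omega> = {}" using \<rho>(2) fr t by blast
    have "c * ?d powr (- 2 * s) = (3 * ?d) powr (- (?N + 2 * s)) * (?V * t ^ DIM('a))"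
    proof -
      have "?d powr (- 2 * s) = ?d powr (- (?N + 2 * s) + ?N)" by simp
      also have "\<dots> = ?d powr (- (?N + 2 * s)) * ?d ^ DIM('a)"
        using d by (simp only: powr_add powr_realpow)
      finally show ?thesis using d unfolding c_def t_def by (simp add: powr_mult power_mult_distrib)
    qed
    then have "ennreal (c * ?d powr (- 2 * s)) = ennreal ((3 * ?d) powr (- (?N + 2 * s))) * emeasure lborel (ball a t)"
      using t V0 by (subst emeasure_lborel_ball) (auto simp: ennreal_mult[symmetric])
    also have "\<dots> \<le> (\<integral>\<^sup>+y. ennreal (kern s (x - y)) * indicator (ball a t) y \<partial>lborel)"
    proof (rule kern_integral_lower)
      fix y assume "y \<in> ball a t"
      then have "dist x y \<le> ?d + t + t"
        using dist_triangle[of x y x0] dist_triangle[of x0 y a] a x0 by (simp add: dist_commute)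
      then show "norm (x - y) \<le> 3 * ?d" using t by (simp add: dist_norm)
    qed (use s in auto)
    also have "\<dots> \<le> (\<integral>\<^sup>+y. ennreal (kern s (x - y)) * indicator (- \<Omega>) y \<partial>lborel)"
      using a by (intro nn_integral_mono) (auto simp: indicator_def)
    finally show ?thesis .
  qed
  then show ?thesis using c by blast
qed

definition chi :: "real \<Rightarrow> 'a \<Rightarrow> real" where
  "chi \<epsilon> x = min 1 (max 0 (dd x / \<epsilon> - 1))"

lemma chi_bounds: "0 \<le> chi \<epsilon> x" "chi \<epsilon> x \<le> 1"
  by (auto simp: chi_def)

lemma chi_lipschitz: "0 < \<epsilon> \<Longrightarrow> \<bar>chi \<epsilon> x - chi \<epsilon> y\<bar> \<le> norm (x - y) / \<epsilon>"
proof -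
  assume e: "0 < \<epsilon>"
  have "\<bar>chi \<epsilon> x - chi \<epsilon> y\<bar> \<le> \<bar>dd x / \<epsilon> - dd y / \<epsilon>\<bar>" unfolding chi_def by (auto simp: min_def max_def)
  also have "\<dots> = \<bar>dd x - dd y\<bar> / \<epsilon>" using e by (simp add: diff_divide_distrib[symmetric])
  also have "\<dots> \<le> norm (x - y) / \<epsilon>" using e dd_lipschitz by (intro divide_right_mono) auto
  finally show ?thesis .
qed

lemma borel_measurable_chi [measurable]: "chi \<epsilon> \<in> borel_measurable borel"
  unfolding chi_def[abs_def] by measurable

text \<open>The bound must be uniform in \<open>\<epsilon>\<close>. If
  \<open>dd y \<le> 4 * \<epsilon>\<close>, splitting at distance \<open>\<epsilon>\<close> between
  the Lipschitz bound and boundedness gives a multiple of \<open>\<epsilon> powr (-2 * s)\<close>.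
  Otherwise \<open>chi \<epsilon> y = 1\<close>, and only points at distance at least
  \<open>dd y / 4\<close> contribute.\<close>

lemma chi_kernel_bound:
  "\<exists>C>0. \<forall>\<epsilon>>0. \<forall>y\<in>\<Omega>. (\<integral>\<^sup>+x. ennreal (kern s (x - y)) * ennreal ((chi \<epsilon> x - chi \<epsilon> y)\<^sup>2) \<partial>lborel) \<le> ennreal (C * dd y powr (- 2 * s))"
proof -
  obtain T1 where T1: "0 < T1" "\<forall>\<eta>>0. (\<integral>\<^sup>+h. ennreal (kern s (h::'a)) * indicator {h. \<eta> \<le> norm h} h \<partial>lborel) \<le> ennreal (T1 * \<eta> powr (- 2 * s))"
    using kern_tail[OF s(1), where 'a='a] by blast
  obtain T2 where T2: "0 < T2" "\<forall>\<eta>>0. (\<integral>\<^sup>+h. ennreal ((norm h)\<^sup>2 * kern s (h::'a)) * indicator {h. norm h < \<eta>} h \<partial>lborel) \<le> ennreal (T2 * \<eta> powr (2 - 2 * s))"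
    using kern_near[OF s(2), where 'a='a] by blast
  define C where "C = (T1 + T2) * 4 powr (2 * s)"
  have C: "0 < C" using T1 T2 by (simp add: C_def)
  have "(\<integral>\<^sup>+x. ennreal (kern s (x - y)) * ennreal ((chi \<epsilon> x - chi \<epsilon> y)\<^sup>2) \<partial>lborel) \<le> ennreal (C * dd y powr (- 2 * s))"
    if e: "0 < \<epsilon>" and y: "y \<in> \<Omega>" for \<epsilon> y
  proof -
    let ?d = "dd y"
    have d: "0 < ?d" by (rule dd_pos[OF y])
    have sq1: "(chi \<epsilon> x - chi \<epsilon> y)\<^sup>2 \<le> 1" for x
    proof -
      have "\<bar>chi \<epsilon> x - chi \<epsilon> y\<bar> \<le> 1" using chi_bounds[of \<epsilon> x] chi_bounds[of \<epsilon> y] by linarith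
      then show ?thesis using abs_square_le_1 by blast
    qed
    have d4: "(?d / 4) powr (- 2 * s) = 4 powr (2 * s) * ?d powr (- 2 * s)"
    proof -
      have "(?d / 4) powr (- 2 * s) = ?d powr (- 2 * s) / 4 powr (- 2 * s)" by (rule powr_divide)
      also have "4 powr (- 2 * s) = inverse (4 powr (2 * s))" using powr_minus[of 4 "2 * s"] by simp
      finally show ?thesis by (simp only: divide_inverse inverse_inverse_eq mult.commute)
    qed
    show ?thesis
    proof (cases "?d \<le> 4 * \<epsilon>")
      case True
      have "(\<integral>\<^sup>+x. ennreal (kern s (x - y)) * ennreal ((chi \<epsilon> x - chi \<epsilon> y)\<^sup>2) \<partial>lborel)
        \<le> (\<integral>\<^sup>+x. ennreal (1 / \<epsilon>\<^sup>2) * (ennreal ((norm (x - y))\<^sup>2 * kern s (x - y)) * indicator {h. norm h < \<epsilon>} (x - y))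
            + ennreal (kern s (x - y)) * indicator {h. \<epsilon> \<le> norm h} (x - y) \<partial>lborel)"
      proof (intro nn_integral_mono)
        fix x
        show "ennreal (kern s (x - y)) * ennreal ((chi \<epsilon> x - chi \<epsilon> y)\<^sup>2)
          \<le> ennreal (1 / \<epsilon>\<^sup>2) * (ennreal ((norm (x - y))\<^sup>2 * kern s (x - y)) * indicator {h. norm h < \<epsilon>} (x - y))
            + ennreal (kern s (x - y)) * indicator {h. \<epsilon> \<le> norm h} (x - y)"
        proof (cases "norm (x - y) < \<epsilon>")
          case True
          have "\<bar>chi \<epsilon> x - chi \<epsilon> y\<bar>\<^sup>2 \<le> (norm (x - y) / \<epsilon>)\<^sup>2" using chi_lipschitz[OF e] by (intro power_mono) auto
          then have "kern s (x - y) * (chi \<epsilon> x - chi \<epsilon> y)\<^sup>2 \<le> kern s (x - y) * (norm (x - y) / \<epsilon>)\<^sup>2"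
            by (intro mult_left_mono) auto
          then have "kern s (x - y) * (chi \<epsilon> x - chi \<epsilon> y)\<^sup>2 \<le> 1 / \<epsilon>\<^sup>2 * ((norm (x - y))\<^sup>2 * kern s (x - y))"
            by (simp add: power_divide mult_ac)
          then show ?thesis using True e by (simp add: ennreal_mult[symmetric] ennreal_leI)
        next
          case False
          have "kern s (x - y) * (chi \<epsilon> x - chi \<epsilon> y)\<^sup>2 \<le> kern s (x - y) * 1" using sq1 by (intro mult_left_mono) auto
          then show ?thesis using False by (simp add: ennreal_mult[symmetric] ennreal_leI)
        qed
      qed
      also have "\<dots> = ennreal (1 / \<epsilon>\<^sup>2) * (\<integral>\<^sup>+x. ennreal ((norm (x - y))\<^sup>2 * kern s (x - y)) * indicator {h. norm h < \<epsilon>} (x - y) \<partial>lborel)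
            + (\<integral>\<^sup>+x. ennreal (kern s (x - y)) * indicator {h. \<epsilon> \<le> norm h} (x - y) \<partial>lborel)"
        by (subst nn_integral_add, measurable, subst nn_integral_cmult, measurable)
      also have "(\<integral>\<^sup>+x. ennreal ((norm (x - y))\<^sup>2 * kern s (x - y)) * indicator {h. norm h < \<epsilon>} (x - y) \<partial>lborel)
          = (\<integral>\<^sup>+h. ennreal ((norm h)\<^sup>2 * kern s (h::'a)) * indicator {h. norm h < \<epsilon>} h \<partial>lborel)"
        by (rule nn_integral_shift[where f="\<lambda>h. ennreal ((norm h)\<^sup>2 * kern s h) * indicator {h. norm h < \<epsilon>} h"]) measurable
      also have "(\<integral>\<^sup>+x. ennreal (kern s (x - y)) * indicator {h. \<epsilon> \<le> norm h} (x - y) \<partial>lborel)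
          = (\<integral>\<^sup>+h. ennreal (kern s (h::'a)) * indicator {h. \<epsilon> \<le> norm h} h \<partial>lborel)"
        by (rule nn_integral_shift[where f="\<lambda>h. ennreal (kern s h) * indicator {h. \<epsilon> \<le> norm h} h"]) measurable
      also have "ennreal (1 / \<epsilon>\<^sup>2) * (\<integral>\<^sup>+h. ennreal ((norm h)\<^sup>2 * kern s (h::'a)) * indicator {h. norm h < \<epsilon>} h \<partial>lborel)
          + (\<integral>\<^sup>+h. ennreal (kern s (h::'a)) * indicator {h. \<epsilon> \<le> norm h} h \<partial>lborel)
         \<le> ennreal (1 / \<epsilon>\<^sup>2) * ennreal (T2 * \<epsilon> powr (2 - 2 * s)) + ennreal (T1 * \<epsilon> powr (- 2 * s))"
        using T1(2) T2(2) e by (intro add_mono mult_left_mono) auto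
      also have "\<dots> = ennreal ((T1 + T2) * \<epsilon> powr (- 2 * s))"
      proof -
        have "\<epsilon> powr (2 - 2 * s) = \<epsilon> powr (2 + (- 2 * s))" by simp
        also have "\<dots> = \<epsilon>\<^sup>2 * \<epsilon> powr (- 2 * s)" unfolding powr_add using e by simp
        finally have "1 / \<epsilon>\<^sup>2 * (T2 * \<epsilon> powr (2 - 2 * s)) + T1 * \<epsilon> powr (- 2 * s) = (T1 + T2) * \<epsilon> powr (- 2 * s)"
          using e by (simp add: field_simps)
        moreover have "0 \<le> 1 / \<epsilon>\<^sup>2 * (T2 * \<epsilon> powr (2 - 2 * s))" "0 \<le> T1 * \<epsilon> powr (- 2 * s)" using T1 T2 by auto
        ultimately show ?thesis using T2 by (subst ennreal_mult[symmetric]) (auto simp flip: ennreal_plus)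
      qed
      also have "\<dots> \<le> ennreal ((T1 + T2) * (?d / 4) powr (- 2 * s))"
        using True d e s T1 T2 by (intro ennreal_leI mult_left_mono powr_mono2') auto
      finally show ?thesis unfolding d4 C_def by (simp add: mult.assoc)
    next
      case False
      have chiy: "chi \<epsilon> y = 1"
      proof -
        have "2 \<le> ?d / \<epsilon>" using False e by (simp add: field_simps)
        then show ?thesis by (simp add: chi_def)
      qed
      have far: "?d / 4 \<le> norm (x - y)" if "chi \<epsilon> x \<noteq> 1" for x
      proof -
        have "dd x / \<epsilon> - 1 < 1" using that by (auto simp: chi_def min_def max_def split: if_splits)
        then have "dd x < 2 * \<epsilon>" using e by (simp add: field_simps)
        then show ?thesis using False dd_lipschitz[of x y] d by linarith
      qed
      have "(\<integral>\<^sup>+x. ennreal (kern s (x - y)) * ennreal ((chi \<epsilon> x - chi \<epsilon> y)\<^sup>2) \<partial>lborel)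
        \<le> (\<integral>\<^sup>+x. ennreal (kern s (x - y)) * indicator {h. ?d / 4 \<le> norm h} (x - y) \<partial>lborel)"
      proof (intro nn_integral_mono mult_left_mono)
        fix x
        show "ennreal ((chi \<epsilon> x - chi \<epsilon> y)\<^sup>2) \<le> indicator {h. ?d / 4 \<le> norm h} (x - y)"
        proof (cases "chi \<epsilon> x = 1")
          case False
          then have "indicator {h. ?d / 4 \<le> norm h} (x - y) = (1 :: ennreal)" using far by (auto simp: indicator_def)
          then show ?thesis using sq1[of x] by (simp add: ennreal_le_1)
        qed (simp add: chiy)
      qed simp
      also have "\<dots> = (\<integral>\<^sup>+h. ennreal (kern s (h::'a)) * indicator {h. ?d / 4 \<le> norm h} h \<partial>lborel)"
        by (rule nn_integral_shift[where f="\<lambda>h. ennreal (kern s h) * indicator {h. ?d / 4 \<le> norm h} h"]) measurable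
      also have "\<dots> \<le> ennreal (T1 * (?d / 4) powr (- 2 * s))" using T1(2) d by (intro T1(2)[rule_format]) simp
      also have "\<dots> \<le> ennreal ((T1 + T2) * (?d / 4) powr (- 2 * s))"
        using T2 by (intro ennreal_leI mult_right_mono) auto
      finally show ?thesis unfolding d4 C_def by (simp add: mult.assoc)
    qed
  qed
  then show ?thesis using C by blast
qed

text \<open>By the product rule for differences, the energy of the cutoff function is controlled by
  that of \<open>u\<close> and by the integral of \<open>(u y)\<^sup>2\<close> against the energy
  density of \<open>chi\<close>. The latter is at most a multiple of
  \<open>dd y powr (-2 * s)\<close>, so the Hardy inequality applies.\<close>

lemma cutoff_bounded:
  "\<exists>C. \<forall>u\<in>H. \<forall>\<epsilon>>0. (\<lambda>x. chi \<epsilon> x * u x) \<in> H \<and> F (\<lambda>x. chi \<epsilon> x * u x) (\<lambda>x. chi \<epsilon> x * u x) \<le> C * F u u"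
proof -
  obtain c where c: "0 < c" "\<forall>x\<in>\<Omega>. ennreal (c * dd x powr (- 2 * s)) \<le> (\<integral>\<^sup>+y. ennreal (kern s (x - y)) * indicator (- \<Omega>) y \<partial>lborel)"
    using hardy_kernel by blast
  obtain C where C: "0 < C" "\<forall>\<epsilon>>0. \<forall>y\<in>\<Omega>. (\<integral>\<^sup>+x. ennreal (kern s (x - y)) * ennreal ((chi \<epsilon> x - chi \<epsilon> y)\<^sup>2) \<partial>lborel) \<le> ennreal (C * dd y powr (- 2 * s))"
    using chi_kernel_bound by blast
  have "(\<lambda>x. chi \<epsilon> x * u x) \<in> H \<and> F (\<lambda>x. chi \<epsilon> x * u x) (\<lambda>x. chi \<epsilon> x * u x) \<le> (2 + 2 * C / c) * F u u"
    if u: "u \<in> H" and e: "0 < \<epsilon>" for u \<epsilon>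
  proof -
    let ?w = "\<lambda>x. chi \<epsilon> x * u x"
    have [measurable]: "u \<in> borel_measurable borel" using HsD(1)[OF u] .
    have wm: "?w \<in> borel_measurable borel" by measurable
    have hardy: "(\<integral>\<^sup>+x. ennreal (c * dd x powr (- 2 * s) * (u x * u x)) \<partial>lborel) \<le> ennreal (F u u)"
      by (rule form_ge_weighted[OF u u _ _ c(2)[rule_format] _ compl_dom]) auto
    have pt: "(dq ?w z)\<^sup>2 \<le> 2 * (dq u z)\<^sup>2 + 2 * ((u (snd z))\<^sup>2 * (chi \<epsilon> (fst z) - chi \<epsilon> (snd z))\<^sup>2)" for z
    proof -
      define a where "a = chi \<epsilon> (fst z) * dq u z"
      define b where "b = u (snd z) * (chi \<epsilon> (fst z) - chi \<epsilon> (snd z))"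
      have "dq ?w z = a + b" by (simp add: a_def b_def dq_def algebra_simps)
      moreover have "(a + b)\<^sup>2 \<le> 2 * a\<^sup>2 + 2 * b\<^sup>2" using zero_le_power2[of "a - b"] by (simp add: power2_eq_square algebra_simps)
      moreover have "a\<^sup>2 \<le> (dq u z)\<^sup>2"
      proof -
        have "(chi \<epsilon> (fst z))\<^sup>2 \<le> 1" using chi_bounds by (intro power_le_one) auto
        then have "(chi \<epsilon> (fst z))\<^sup>2 * (dq u z)\<^sup>2 \<le> 1 * (dq u z)\<^sup>2" by (intro mult_right_mono) auto
        then show ?thesis by (simp add: a_def power_mult_distrib)
      qed
      ultimately show ?thesis by (simp add: b_def power_mult_distrib)
    qed
    have m1: "(\<lambda>z. ennreal ((dq u z)\<^sup>2)) \<in> borel_measurable (kap s)" by measurable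
    have m2: "(\<lambda>z. ennreal ((u (snd z))\<^sup>2 * (chi \<epsilon> (fst z) - chi \<epsilon> (snd z))\<^sup>2)) \<in> borel_measurable (kap s)"
      unfolding measurable_kap by measurable
    have "(\<integral>\<^sup>+z. ennreal ((dq ?w z)\<^sup>2) \<partial>kap s)
      \<le> (\<integral>\<^sup>+z. ennreal 2 * ennreal ((dq u z)\<^sup>2) + ennreal 2 * ennreal ((u (snd z))\<^sup>2 * (chi \<epsilon> (fst z) - chi \<epsilon> (snd z))\<^sup>2) \<partial>kap s)"
    proof (intro nn_integral_mono)
      fix z
      have "ennreal ((dq ?w z)\<^sup>2) \<le> ennreal (2 * (dq u z)\<^sup>2 + 2 * ((u (snd z))\<^sup>2 * (chi \<epsilon> (fst z) - chi \<epsilon> (snd z))\<^sup>2))"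
        by (intro ennreal_leI pt)
      also have "\<dots> = ennreal 2 * ennreal ((dq u z)\<^sup>2) + ennreal 2 * ennreal ((u (snd z))\<^sup>2 * (chi \<epsilon> (fst z) - chi \<epsilon> (snd z))\<^sup>2)"
        by (subst ennreal_plus) (auto simp: ennreal_mult)
      finally show "ennreal ((dq ?w z)\<^sup>2) \<le> ennreal 2 * ennreal ((dq u z)\<^sup>2) + ennreal 2 * ennreal ((u (snd z))\<^sup>2 * (chi \<epsilon> (fst z) - chi \<epsilon> (snd z))\<^sup>2)" .
    qed
    also have "\<dots> = ennreal 2 * ennreal (F u u) + ennreal 2 * (\<integral>\<^sup>+z. ennreal ((u (snd z))\<^sup>2 * (chi \<epsilon> (fst z) - chi \<epsilon> (snd z))\<^sup>2) \<partial>kap s)"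
      unfolding nn_integral_form[OF u, symmetric]
      using m1 m2 by (simp add: nn_integral_add nn_integral_cmult)
    also have "(\<integral>\<^sup>+z. ennreal ((u (snd z))\<^sup>2 * (chi \<epsilon> (fst z) - chi \<epsilon> (snd z))\<^sup>2) \<partial>kap s)
      = (\<integral>\<^sup>+y. \<integral>\<^sup>+x. ennreal (kern s (x - y)) * ennreal ((u y)\<^sup>2 * (chi \<epsilon> x - chi \<epsilon> y)\<^sup>2) \<partial>lborel \<partial>lborel)"
      by (subst nn_integral_kap') auto
    also have "\<dots> \<le> (\<integral>\<^sup>+y. ennreal (C / c) * ennreal (c * dd y powr (- 2 * s) * (u y * u y)) \<partial>lborel)"
    proof (intro nn_integral_mono)
      fix y
      show "(\<integral>\<^sup>+x. ennreal (kern s (x - y)) * ennreal ((u y)\<^sup>2 * (chi \<epsilon> x - chi \<epsilon> y)\<^sup>2) \<partial>lborel)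
         \<le> ennreal (C / c) * ennreal (c * dd y powr (- 2 * s) * (u y * u y))"
      proof (cases "y \<in> \<Omega>")
        case True
        have "(\<integral>\<^sup>+x. ennreal (kern s (x - y)) * ennreal ((u y)\<^sup>2 * (chi \<epsilon> x - chi \<epsilon> y)\<^sup>2) \<partial>lborel)
          = (\<integral>\<^sup>+x. ennreal ((u y)\<^sup>2) * (ennreal (kern s (x - y)) * ennreal ((chi \<epsilon> x - chi \<epsilon> y)\<^sup>2)) \<partial>lborel)"
          by (intro nn_integral_cong) (simp add: ennreal_mult mult_ac)
        also have "\<dots> = ennreal ((u y)\<^sup>2) * (\<integral>\<^sup>+x. ennreal (kern s (x - y)) * ennreal ((chi \<epsilon> x - chi \<epsilon> y)\<^sup>2) \<partial>lborel)"
          by (rule nn_integral_cmult) measurable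
        also have "\<dots> \<le> ennreal ((u y)\<^sup>2) * ennreal (C * dd y powr (- 2 * s))"
          using C(2) True e by (intro mult_left_mono) auto
        also have "\<dots> = ennreal ((u y)\<^sup>2 * (C * dd y powr (- 2 * s)))" using C by (intro ennreal_mult[symmetric]) auto
        also have "(u y)\<^sup>2 * (C * dd y powr (- 2 * s)) = C / c * (c * dd y powr (- 2 * s) * (u y * u y))"
          using c by (simp add: power2_eq_square)
        also have "ennreal \<dots> = ennreal (C / c) * ennreal (c * dd y powr (- 2 * s) * (u y * u y))"
          using c C by (intro ennreal_mult) auto
        finally show ?thesis .
      qed (simp add: Hs_outside[OF u])
    qed
    also have "\<dots> = ennreal (C / c) * (\<integral>\<^sup>+y. ennreal (c * dd y powr (- 2 * s) * (u y * u y)) \<partial>lborel)"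
      by (rule nn_integral_cmult) measurable
    also have "\<dots> \<le> ennreal (C / c) * ennreal (F u u)" using hardy by (intro mult_left_mono) auto
    finally have "(\<integral>\<^sup>+z. ennreal ((dq ?w z)\<^sup>2) \<partial>kap s) \<le> ennreal 2 * ennreal (F u u) + ennreal 2 * (ennreal (C / c) * ennreal (F u u))"
      by (simp add: mult_left_mono add_left_mono)
    also have "\<dots> = ennreal ((2 + 2 * C / c) * F u u)"
    proof -
      have "ennreal 2 * ennreal (F u u) + ennreal 2 * (ennreal (C / c) * ennreal (F u u)) = ennreal (2 * F u u) + ennreal (2 * (C / c * F u u))"
        using C c by (simp only: ennreal_mult[symmetric] form_nonneg zero_le_numeral less_imp_le divide_nonneg_nonneg mult_nonneg_nonneg)
      also have "\<dots> = ennreal (2 * F u u + 2 * (C / c * F u u))"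
        using C c by (intro ennreal_plus[symmetric] mult_nonneg_nonneg) auto
      finally show ?thesis by (simp add: algebra_simps)
    qed
    finally have le: "(\<integral>\<^sup>+z. ennreal ((dq ?w z)\<^sup>2) \<partial>kap s) \<le> ennreal ((2 + 2 * C / c) * F u u)" .
    have wH: "?w \<in> H"
      by (rule HsI_nn[OF wm]) (use Hs_outside[OF u] le in \<open>auto intro: le_less_trans\<close>)
    moreover have "0 \<le> (2 + 2 * C / c) * F u u" using C c by (intro mult_nonneg_nonneg) auto
    ultimately show ?thesis using form_le_nn[OF wH le] by simp
  qed
  then show ?thesis by blast
qed

end

section \<open>Energy and distance under mollification\<close>

lemma conv_reflect:
  fixes v :: "'a::euclidean_space \<Rightarrow> real"
  assumes v: "integrable lborel v" and \<eta>: "smooth_compact \<eta>"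
  shows "conv v \<eta> x = (\<integral>h. \<eta> h * v (x - h) \<partial>lborel)" and "integrable lborel (\<lambda>h. \<eta> h * v (x - h))"
proof -
  have [measurable]: "v \<in> borel_measurable borel" "\<eta> \<in> borel_measurable borel"
    using v smooth_compact_measurable[OF \<eta>] by auto
  have "conv v \<eta> x = (\<integral>h. v (x - h) * \<eta> (x - (x - h)) \<partial>lborel)"
    unfolding conv_def by (rule integral_reflect[symmetric]) measurable
  then show "conv v \<eta> x = (\<integral>h. \<eta> h * v (x - h) \<partial>lborel)" by (simp add: mult.commute)
  have "integrable (distr lborel borel (\<lambda>h. x - h)) (\<lambda>y. v y * \<eta> (x - y))"
    unfolding distr_reflect by (rule conv_integrable[OF v \<eta>])
  from integrable_distr[OF _ this] have "integrable lborel (\<lambda>h. v (x - h) * \<eta> (x - (x - h)))" by simp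
  then show "integrable lborel (\<lambda>h. \<eta> h * v (x - h))" by (simp add: mult.commute)
qed

lemma conv_measurable:
  assumes "integrable lborel v" "smooth_compact \<eta>" shows "conv v \<eta> \<in> borel_measurable borel"
  using Ck_continuous[OF Ck_conv[OF assms]] by (rule borel_measurable_continuous_onI)

text \<open>A mollification is an average of translates. The kernel depends on \<open>x - y\<close>
  only, so every translate has the energy of \<open>v\<close>, and Jensen's inequality with
  Tonelli's theorem passes this to the average.\<close>

lemma conv_form_le:
  fixes v :: "'a::euclidean_space \<Rightarrow> real"
  assumes v: "integrable lborel v" and \<eta>: "smooth_compact \<eta>" "integrable lborel \<eta>" "\<And>h. 0 \<le> \<eta> h" "(\<integral>h. \<eta> h \<partial>lborel) = 1"
  shows "(\<integral>\<^sup>+z. ennreal ((dq (conv v \<eta>) z)\<^sup>2) \<partial>kap s) \<le> (\<integral>\<^sup>+z. ennreal ((dq v z)\<^sup>2) \<partial>kap s)"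
proof -
  have [measurable]: "v \<in> borel_measurable borel" "\<eta> \<in> borel_measurable borel"
    using v smooth_compact_measurable[OF \<eta>(1)] by auto
  let ?D = "\<lambda>x y h. v (x - h) - v (y - h)"
  let ?I = "\<integral>\<^sup>+z. ennreal ((dq v z)\<^sup>2) \<partial>kap s"
  have pt: "ennreal ((dq (conv v \<eta>) z)\<^sup>2) \<le> (\<integral>\<^sup>+h. ennreal (\<eta> h * (?D (fst z) (snd z) h)\<^sup>2) \<partial>lborel)" for z
  proof -
    have i: "integrable lborel (\<lambda>h. \<eta> h * ?D (fst z) (snd z) h)"
      and e: "dq (conv v \<eta>) z = (\<integral>h. \<eta> h * ?D (fst z) (snd z) h \<partial>lborel)"
      unfolding dq_def conv_reflect(1)[OF v \<eta>(1)] right_diff_distrib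
      using conv_reflect(2)[OF v \<eta>(1)] by auto
    show ?thesis unfolding e by (rule jensen_square[OF \<eta>(2,3,4) i]) measurable
  qed
  have I: "(\<integral>\<^sup>+x. \<integral>\<^sup>+y. ennreal (kern s (x - y)) * ennreal ((?D x y h)\<^sup>2) \<partial>lborel \<partial>lborel) = ?I" for h
  proof -
    have "(\<integral>\<^sup>+y. ennreal (kern s (x - y)) * ennreal ((?D x y h)\<^sup>2) \<partial>lborel)
        = (\<integral>\<^sup>+y. ennreal (kern s (x - h - y)) * ennreal ((v (x - h) - v y)\<^sup>2) \<partial>lborel)" for x
      using nn_integral_shift[of "\<lambda>y. ennreal (kern s (x - h - y)) * ennreal ((v (x - h) - v y)\<^sup>2)" h] by simp
    then have "(\<integral>\<^sup>+x. \<integral>\<^sup>+y. ennreal (kern s (x - y)) * ennreal ((?D x y h)\<^sup>2) \<partial>lborel \<partial>lborel)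
       = (\<integral>\<^sup>+x. \<integral>\<^sup>+y. ennreal (kern s (x - h - y)) * ennreal ((v (x - h) - v y)\<^sup>2) \<partial>lborel \<partial>lborel)" by simp
    also have "\<dots> = (\<integral>\<^sup>+x. \<integral>\<^sup>+y. ennreal (kern s (x - y)) * ennreal ((v x - v y)\<^sup>2) \<partial>lborel \<partial>lborel)"
      by (rule nn_integral_shift[where f="\<lambda>x. \<integral>\<^sup>+y. ennreal (kern s (x - y)) * ennreal ((v x - v y)\<^sup>2) \<partial>lborel"]) measurable
    also have "\<dots> = ?I" by (subst nn_integral_kap) (simp_all add: dq_def)
    finally show ?thesis .
  qed
  have mD: "(\<lambda>z. \<integral>\<^sup>+h. ennreal (\<eta> h * (?D (fst z) (snd z) h)\<^sup>2) \<partial>lborel) \<in> borel_measurable (lborel \<Otimes>\<^sub>M lborel)"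
    by measurable
  have "(\<integral>\<^sup>+z. ennreal ((dq (conv v \<eta>) z)\<^sup>2) \<partial>kap s)
    \<le> (\<integral>\<^sup>+z. \<integral>\<^sup>+h. ennreal (\<eta> h * (?D (fst z) (snd z) h)\<^sup>2) \<partial>lborel \<partial>kap s)"
    by (intro nn_integral_mono pt)
  also have "\<dots> = (\<integral>\<^sup>+x. \<integral>\<^sup>+y. ennreal (kern s (x - y)) * (\<integral>\<^sup>+h. ennreal (\<eta> h * (?D x y h)\<^sup>2) \<partial>lborel) \<partial>lborel \<partial>lborel)"
    by (subst nn_integral_kap) (auto intro!: mD)
  also have "\<dots> = (\<integral>\<^sup>+x. \<integral>\<^sup>+y. \<integral>\<^sup>+h. ennreal (kern s (x - y)) * ennreal (\<eta> h * (?D x y h)\<^sup>2) \<partial>lborel \<partial>lborel \<partial>lborel)"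
    by (subst nn_integral_cmult[symmetric]) auto
  also have "\<dots> = (\<integral>\<^sup>+x. \<integral>\<^sup>+h. \<integral>\<^sup>+y. ennreal (kern s (x - y)) * ennreal (\<eta> h * (?D x y h)\<^sup>2) \<partial>lborel \<partial>lborel \<partial>lborel)"
  proof (rule nn_integral_cong)
    fix x
    show "(\<integral>\<^sup>+y. \<integral>\<^sup>+h. ennreal (kern s (x - y)) * ennreal (\<eta> h * (?D x y h)\<^sup>2) \<partial>lborel \<partial>lborel)
        = (\<integral>\<^sup>+h. \<integral>\<^sup>+y. ennreal (kern s (x - y)) * ennreal (\<eta> h * (?D x y h)\<^sup>2) \<partial>lborel \<partial>lborel)"
      by (rule lborel_pair.Fubini') measurable
  qed
  also have "\<dots> = (\<integral>\<^sup>+h. \<integral>\<^sup>+x. \<integral>\<^sup>+y. ennreal (kern s (x - y)) * ennreal (\<eta> h * (?D x y h)\<^sup>2) \<partial>lborel \<partial>lborel \<partial>lborel)"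
    by (rule lborel_pair.Fubini') measurable
  also have "\<dots> = (\<integral>\<^sup>+h. ennreal (\<eta> h) * ?I \<partial>lborel)"
  proof (intro nn_integral_cong)
    fix h
    have "(\<integral>\<^sup>+y. ennreal (kern s (x - y)) * ennreal (\<eta> h * (?D x y h)\<^sup>2) \<partial>lborel)
        = (\<integral>\<^sup>+y. ennreal (\<eta> h) * (ennreal (kern s (x - y)) * ennreal ((?D x y h)\<^sup>2)) \<partial>lborel)" for x
      using \<eta>(3) by (intro nn_integral_cong) (simp add: ennreal_mult mult_ac)
    also have "\<dots> x = ennreal (\<eta> h) * (\<integral>\<^sup>+y. ennreal (kern s (x - y)) * ennreal ((?D x y h)\<^sup>2) \<partial>lborel)" for x
      by (rule nn_integral_cmult) measurable
    finally have "(\<integral>\<^sup>+x. \<integral>\<^sup>+y. ennreal (kern s (x - y)) * ennreal (\<eta> h * (?D x y h)\<^sup>2) \<partial>lborel \<partial>lborel)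
        = (\<integral>\<^sup>+x. ennreal (\<eta> h) * (\<integral>\<^sup>+y. ennreal (kern s (x - y)) * ennreal ((?D x y h)\<^sup>2) \<partial>lborel) \<partial>lborel)" by simp
    also have "\<dots> = ennreal (\<eta> h) * (\<integral>\<^sup>+x. \<integral>\<^sup>+y. ennreal (kern s (x - y)) * ennreal ((?D x y h)\<^sup>2) \<partial>lborel \<partial>lborel)"
      by (rule nn_integral_cmult) measurable
    finally show "(\<integral>\<^sup>+x. \<integral>\<^sup>+y. ennreal (kern s (x - y)) * ennreal (\<eta> h * (?D x y h)\<^sup>2) \<partial>lborel \<partial>lborel) = ennreal (\<eta> h) * ?I"
      unfolding I .
  qed
  also have "\<dots> = ?I"
  proof -
    have "(\<integral>\<^sup>+h. ennreal (\<eta> h) \<partial>lborel) = 1"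
      using nn_integral_eq_integral[OF \<eta>(2)] \<eta>(3,4) by simp
    then show ?thesis by (simp add: nn_integral_multc)
  qed
  finally show ?thesis .
qed

text \<open>Away from the origin, \<open>\<eta> \<le> M * \<tau> powr (2 * s) * kern s\<close>, by
  the height and support of the mollifier. The squared deviation of the mean value from
  \<open>v x\<close> is thus bounded by the energy, with a factor tending to \<open>0\<close> with
  \<open>\<tau>\<close>.\<close>

lemma conv_L2_close:
  fixes v :: "'a::euclidean_space \<Rightarrow> real"
  assumes v: "integrable lborel v" and \<eta>: "smooth_compact \<eta>" "integrable lborel \<eta>" "\<And>h. 0 \<le> \<eta> h" "(\<integral>h. \<eta> h \<partial>lborel) = 1"
    and \<tau>: "0 < \<tau>" "\<And>h. \<tau> \<le> norm h \<Longrightarrow> \<eta> h = 0" "\<And>h. \<eta> h \<le> M * \<tau> powr (- real DIM('a))" and M: "0 \<le> M" and s: "0 \<le> s"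
  shows "(\<integral>\<^sup>+x. ennreal ((conv v \<eta> x - v x)\<^sup>2) \<partial>lborel) \<le> ennreal (M * \<tau> powr (2 * s)) * (\<integral>\<^sup>+z. ennreal ((dq v z)\<^sup>2) \<partial>kap s)"
proof -
  let ?K = "M * \<tau> powr (2 * s)"
  have [measurable]: "v \<in> borel_measurable borel" "\<eta> \<in> borel_measurable borel"
    using v smooth_compact_measurable[OF \<eta>(1)] by auto
  have ker: "\<eta> h \<le> ?K * kern s h" if "h \<noteq> 0" for h
  proof (cases "\<tau> \<le> norm h")
    case False
    have "\<tau> powr (- real DIM('a)) = \<tau> powr (2 * s + - (real DIM('a) + 2 * s))" by simp
    also have "\<dots> = \<tau> powr (2 * s) * \<tau> powr (- (real DIM('a) + 2 * s))" by (rule powr_add)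
    also have "\<dots> \<le> \<tau> powr (2 * s) * kern s h" using that s False by (intro mult_left_mono kern_mono) auto
    finally have "M * \<tau> powr (- real DIM('a)) \<le> M * (\<tau> powr (2 * s) * kern s h)" using M by (rule mult_left_mono)
    then show ?thesis using \<tau>(3)[of h] by (simp add: mult.assoc)
  qed (simp add: \<tau>(2) M)
  have "ennreal ((conv v \<eta> x - v x)\<^sup>2) \<le> ennreal ?K * (\<integral>\<^sup>+y. ennreal (kern s (x - y)) * ennreal ((v x - v y)\<^sup>2) \<partial>lborel)" for x
  proof -
    have i: "integrable lborel (\<lambda>h. \<eta> h * (v (x - h) - v x))"
      and e: "conv v \<eta> x - v x = (\<integral>h. \<eta> h * (v (x - h) - v x) \<partial>lborel)"
      unfolding conv_reflect(1)[OF v \<eta>(1)] right_diff_distrib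
      using conv_reflect(2)[OF v \<eta>(1)] \<eta> by auto
    have "ennreal ((conv v \<eta> x - v x)\<^sup>2) \<le> (\<integral>\<^sup>+h. ennreal (\<eta> h * (v (x - h) - v x)\<^sup>2) \<partial>lborel)"
      unfolding e by (rule jensen_square[OF \<eta>(2,3,4) i]) measurable
    also have "\<dots> \<le> (\<integral>\<^sup>+h. ennreal ?K * (ennreal (kern s h) * ennreal ((v x - v (x - h))\<^sup>2)) \<partial>lborel)"
    proof (intro nn_integral_mono)
      fix h
      have "\<eta> h * (v (x - h) - v x)\<^sup>2 \<le> ?K * kern s h * (v (x - h) - v x)\<^sup>2"
        using ker[of h] by (cases "h = 0") (auto intro: mult_right_mono)
      then have "ennreal (\<eta> h * (v (x - h) - v x)\<^sup>2) \<le> ennreal (?K * kern s h * (v (x - h) - v x)\<^sup>2)" by (rule ennreal_leI)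
      also have "\<dots> = ennreal ?K * (ennreal (kern s h) * ennreal ((v x - v (x - h))\<^sup>2))"
        using M by (simp add: ennreal_mult mult.assoc power2_commute[of "v x"])
      finally show "ennreal (\<eta> h * (v (x - h) - v x)\<^sup>2) \<le> ennreal ?K * (ennreal (kern s h) * ennreal ((v x - v (x - h))\<^sup>2))" .
    qed
    also have "\<dots> = ennreal ?K * (\<integral>\<^sup>+h. ennreal (kern s h) * ennreal ((v x - v (x - h))\<^sup>2) \<partial>lborel)"
      by (rule nn_integral_cmult) measurable
    also have "(\<integral>\<^sup>+h. ennreal (kern s h) * ennreal ((v x - v (x - h))\<^sup>2) \<partial>lborel)
       = (\<integral>\<^sup>+y. ennreal (kern s (x - y)) * ennreal ((v x - v y)\<^sup>2) \<partial>lborel)"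
      using nn_integral_reflect[of "\<lambda>y. ennreal (kern s (x - y)) * ennreal ((v x - v y)\<^sup>2)" x] by simp
    finally show ?thesis .
  qed
  then have "(\<integral>\<^sup>+x. ennreal ((conv v \<eta> x - v x)\<^sup>2) \<partial>lborel)
    \<le> (\<integral>\<^sup>+x. ennreal ?K * (\<integral>\<^sup>+y. ennreal (kern s (x - y)) * ennreal ((v x - v y)\<^sup>2) \<partial>lborel) \<partial>lborel)"
    by (intro nn_integral_mono)
  also have "\<dots> = ennreal ?K * (\<integral>\<^sup>+x. \<integral>\<^sup>+y. ennreal (kern s (x - y)) * ennreal ((v x - v y)\<^sup>2) \<partial>lborel \<partial>lborel)"
    by (rule nn_integral_cmult) measurable
  also have "(\<integral>\<^sup>+x. \<integral>\<^sup>+y. ennreal (kern s (x - y)) * ennreal ((v x - v y)\<^sup>2) \<partial>lborel \<partial>lborel) = (\<integral>\<^sup>+z. ennreal ((dq v z)\<^sup>2) \<partial>kap s)"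
    by (subst nn_integral_kap) (simp_all add: dq_def)
  finally show ?thesis .
qed

section \<open>Approximation by test functions\<close>

context hardy_domain begin

lemma mollify:
  "\<exists>M>0. \<forall>v\<in>H. \<forall>\<epsilon>>0. \<forall>\<tau>>0. \<tau> \<le> \<epsilon> / 2 \<longrightarrow> (\<forall>x. dd x < \<epsilon> \<longrightarrow> v x = 0) \<longrightarrow>
    (\<exists>w\<in>H. test_function \<Omega> w \<and> F w w \<le> F v v \<and> (\<integral>x. (w x - v x)\<^sup>2 \<partial>lborel) \<le> M * \<tau> powr (2 * s) * F v v)"
proof -
  obtain M where M: "0 < M" and ex: "\<forall>\<tau>>0. \<exists>\<eta>::'a \<Rightarrow> real. smooth_compact \<eta> \<and> integrable lborel \<eta> \<and> (\<forall>h. 0 \<le> \<eta> h) \<and>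
     (\<integral>h. \<eta> h \<partial>lborel) = 1 \<and> (\<forall>h. \<tau> \<le> norm h \<longrightarrow> \<eta> h = 0) \<and> (\<forall>h. \<eta> h \<le> M * \<tau> powr (- real DIM('a)))"
    using mollifier_exists[where 'a='a] by (elim exE conjE) (rule that)
  have "\<exists>w\<in>H. test_function \<Omega> w \<and> F w w \<le> F v v \<and> (\<integral>x. (w x - v x)\<^sup>2 \<partial>lborel) \<le> M * \<tau> powr (2 * s) * F v v"
    if v: "v \<in> H" and \<epsilon>: "0 < \<epsilon>" and \<tau>: "0 < \<tau>" "\<tau> \<le> \<epsilon> / 2" and van: "\<forall>x. dd x < \<epsilon> \<longrightarrow> v x = 0" for v \<epsilon> \<tau>
  proof -
    obtain \<eta> :: "'a \<Rightarrow> real" where \<eta>: "smooth_compact \<eta>" "integrable lborel \<eta>" "\<And>h. 0 \<le> \<eta> h" "(\<integral>h. \<eta> h \<partial>lborel) = 1"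
      "\<And>h. \<tau> \<le> norm h \<Longrightarrow> \<eta> h = 0" "\<And>h. \<eta> h \<le> M * \<tau> powr (- real DIM('a))"
      using ex[rule_format, OF \<tau>(1)] by blast
    let ?w = "conv v \<eta>"
    have vL: "integrable lborel v" by (rule Hs_L1[OF v])
    have wm [measurable]: "?w \<in> borel_measurable borel" by (rule conv_measurable[OF vL \<eta>(1)])
    \<comment> \<open>\<open>v\<close> vanishes up to distance \<open>\<epsilon>\<close> from the
      complement and mollification spreads its support by at most
      \<open>\<tau> \<le> \<epsilon> / 2\<close>, which leaves a compact support inside
      \<open>\<Omega>\<close>.\<close>
    have wz: "?w x = 0" if "dd x < \<epsilon> / 2" for x
    proof -
      have "\<eta> h * v (x - h) = 0" for h
      proof (cases "\<tau> \<le> norm h")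
        case False
        have "dd (x - h) < \<epsilon>" using dd_lipschitz[of "x - h" x] False \<tau> that by simp
        then show ?thesis using van by simp
      qed (simp add: \<eta>(5))
      then show ?thesis by (simp only: conv_reflect(1)[OF vL \<eta>(1)]) simp
    qed
    have le: "(\<integral>\<^sup>+z. ennreal ((dq ?w z)\<^sup>2) \<partial>kap s) \<le> ennreal (F v v)"
      unfolding nn_integral_form[OF v, symmetric] by (rule conv_form_le[OF vL \<eta>(1-4)])
    have wH: "?w \<in> H"
    proof (rule HsI_nn[OF wm])
      show "?w x = 0" if "x \<notin> \<Omega>" for x using wz[of x] dd_outside[OF that] \<epsilon> by simp
      show "(\<integral>\<^sup>+z. ennreal ((dq ?w z)\<^sup>2) \<partial>kap s) < \<infinity>" using le by (auto intro: le_less_trans)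
    qed
    have "test_function \<Omega> ?w"
    proof -
      have cl: "closure {x. ?w x \<noteq> 0} \<subseteq> {x. \<epsilon> / 2 \<le> dd x}"
      proof (rule closure_minimal)
        show "{x. ?w x \<noteq> 0} \<subseteq> {x. \<epsilon> / 2 \<le> dd x}" using wz not_less by blast
        show "closed {x. \<epsilon> / 2 \<le> dd x}"
          unfolding dd_def by (intro closed_Collect_le continuous_intros)
      qed
      also have "\<dots> \<subseteq> \<Omega>" using dd_outside \<epsilon> by force
      finally have sub: "closure {x. ?w x \<noteq> 0} \<subseteq> \<Omega>" .
      moreover have "compact (closure {x. ?w x \<noteq> 0})"
        using sub dom(2) bounded_subset by (auto simp: compact_eq_bounded_closed)
      ultimately show ?thesis unfolding test_function_def using Ck_conv[OF vL \<eta>(1)] by blast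
    qed
    moreover have "F ?w ?w \<le> F v v" by (rule form_le_nn[OF wH le form_nonneg])
    moreover have "(\<integral>x. (?w x - v x)\<^sup>2 \<partial>lborel) \<le> M * \<tau> powr (2 * s) * F v v"
    proof -
      have i: "integrable lborel (\<lambda>x. (?w x - v x)\<^sup>2)" by (rule Hs_L2[OF Hs_diff[OF wH v]])
      have "ennreal (\<integral>x. (?w x - v x)\<^sup>2 \<partial>lborel) = (\<integral>\<^sup>+x. ennreal ((?w x - v x)\<^sup>2) \<partial>lborel)"
        using i by (intro nn_integral_eq_integral[symmetric]) auto
      also have "\<dots> \<le> ennreal (M * \<tau> powr (2 * s)) * (\<integral>\<^sup>+z. ennreal ((dq v z)\<^sup>2) \<partial>kap s)"
        by (rule conv_L2_close[OF vL \<eta>(1-4) \<tau>(1) \<eta>(5,6)]) (use M s in auto)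
      also have "\<dots> = ennreal (M * \<tau> powr (2 * s) * F v v)"
        using M unfolding nn_integral_form[OF v] by (intro ennreal_mult[symmetric]) auto
      finally show ?thesis using M by (simp add: ennreal_le_iff)
    qed
    ultimately show ?thesis using wH by blast
  qed
  then show ?thesis using M by blast
qed

text \<open>Stated for functionals rather than as strong density: cutoffs are only known to have
  bounded energy and to converge pointwise, which is exactly what \<open>cont\<close> accepts.
  Functions vanishing near the complement are mollified, and a general one is reached through its
  cutoffs.\<close>

lemma density:
  assumes cont: "\<And>v u B. (\<And>n. v n \<in> H) \<Longrightarrow> (\<And>n. F (v n) (v n) \<le> B) \<Longrightarrow> AE x in lborel. (\<lambda>n. v n x) \<longlonglongrightarrow> u x \<Longrightarrow> u \<in> H
      \<Longrightarrow> (\<lambda>n. \<Psi> (v n)) \<longlonglongrightarrow> (\<Psi> u :: real)"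
    and test: "\<And>\<phi>. \<phi> \<in> H \<Longrightarrow> test_function \<Omega> \<phi> \<Longrightarrow> \<Psi> \<phi> = 0" and \<phi>: "\<phi> \<in> H"
  shows "\<Psi> \<phi> = 0"
proof -
  obtain M where M: "0 < M" and moll: "\<forall>v\<in>H. \<forall>\<epsilon>>0. \<forall>\<tau>>0. \<tau> \<le> \<epsilon> / 2 \<longrightarrow> (\<forall>x. dd x < \<epsilon> \<longrightarrow> v x = 0) \<longrightarrow>
    (\<exists>w\<in>H. test_function \<Omega> w \<and> F w w \<le> F v v \<and> (\<integral>x. (w x - v x)\<^sup>2 \<partial>lborel) \<le> M * \<tau> powr (2 * s) * F v v)"
    using mollify by blast
  obtain C where C: "\<forall>u\<in>H. \<forall>\<epsilon>>0. (\<lambda>x. chi \<epsilon> x * u x) \<in> H \<and> F (\<lambda>x. chi \<epsilon> x * u x) (\<lambda>x. chi \<epsilon> x * u x) \<le> C * F u u"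
    using cutoff_bounded by blast
  have inner: "\<Psi> v = 0" if v: "v \<in> H" and \<epsilon>: "0 < \<epsilon>" and van: "\<forall>x. dd x < \<epsilon> \<longrightarrow> v x = 0" for v \<epsilon>
  proof -
    define \<tau> where "\<tau> n = (\<epsilon> / 2) / real (Suc n)" for n
    have \<tau>: "0 < \<tau> n" "\<tau> n \<le> \<epsilon> / 2" for n using \<epsilon> by (auto simp: \<tau>_def field_simps)
    have \<tau>0: "\<tau> \<longlonglongrightarrow> 0"
      unfolding \<tau>_def[abs_def] by (rule real_tendsto_divide_at_top[OF tendsto_const filterlim_compose[OF filterlim_real_sequentially filterlim_Suc]])
    have "\<forall>n. \<exists>w. w \<in> H \<and> test_function \<Omega> w \<and> F w w \<le> F v v \<and> (\<integral>x. (w x - v x)\<^sup>2 \<partial>lborel) \<le> M * \<tau> n powr (2 * s) * F v v"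
    proof
      fix n
      show "\<exists>w. w \<in> H \<and> test_function \<Omega> w \<and> F w w \<le> F v v \<and> (\<integral>x. (w x - v x)\<^sup>2 \<partial>lborel) \<le> M * \<tau> n powr (2 * s) * F v v"
        using moll[rule_format, OF v \<epsilon> \<tau>(1)[of n] \<tau>(2)[of n]] van by blast
    qed
    then obtain w where w: "\<And>n. w n \<in> H" "\<And>n. test_function \<Omega> (w n)" "\<And>n. F (w n) (w n) \<le> F v v"
      "\<And>n. (\<integral>x. (w n x - v x)\<^sup>2 \<partial>lborel) \<le> M * \<tau> n powr (2 * s) * F v v"
      by metis
    have lim: "(\<lambda>n. M * \<tau> n powr (2 * s) * F v v) \<longlonglongrightarrow> 0"
    proof -
      have "(\<lambda>n. \<tau> n powr (2 * s)) \<longlonglongrightarrow> 0"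
        by (rule tendsto_zero_powrI[OF \<tau>0 tendsto_const]) (use s \<tau>(1) in \<open>auto intro!: always_eventually less_imp_le\<close>)
      then have "(\<lambda>n. M * \<tau> n powr (2 * s) * F v v) \<longlonglongrightarrow> M * 0 * F v v" by (intro tendsto_intros)
      then show ?thesis by simp
    qed
    have i: "integrable lborel (\<lambda>x. (w n x - v x)\<^sup>2)" for n by (rule Hs_L2[OF Hs_diff[OF w(1) v]])
    have L: "(\<lambda>n. \<integral>x. norm ((w n x - v x)\<^sup>2) \<partial>lborel) \<longlonglongrightarrow> 0"
      by (rule tendsto_sandwich[OF _ _ tendsto_const lim]) (use w(4) in \<open>auto intro!: always_eventually\<close>)
    obtain r :: "nat \<Rightarrow> nat" where r: "AE x in lborel. (\<lambda>n. (w (r n) x - v x)\<^sup>2) \<longlonglongrightarrow> 0"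
      using tendsto_L1_AE_subseq[of lborel "\<lambda>n x. (w n x - v x)\<^sup>2", OF i L] by blast
    have "AE x in lborel. (\<lambda>n. w (r n) x) \<longlonglongrightarrow> v x"
      using r
    proof eventually_elim
      case (elim x)
      then have "(\<lambda>n. sqrt ((w (r n) x - v x)\<^sup>2)) \<longlonglongrightarrow> sqrt 0" by (rule tendsto_real_sqrt)
      then have "(\<lambda>n. w (r n) x - v x) \<longlonglongrightarrow> 0" by (simp add: tendsto_rabs_zero_iff)
      then show ?case by (simp add: LIM_zero_iff)
    qed
    then have "(\<lambda>n. \<Psi> (w (r n))) \<longlonglongrightarrow> \<Psi> v"
      by (intro cont[of "\<lambda>n. w (r n)", OF w(1) w(3) _ v])
    moreover have "\<Psi> (w (r n)) = 0" for n using w by (intro test)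
    ultimately show ?thesis by (simp add: LIMSEQ_const_iff)
  qed
  define e where "e n = 1 / real (Suc n)" for n
  have e: "0 < e n" for n by (simp add: e_def)
  have cH: "(\<lambda>x. chi (e n) x * \<phi> x) \<in> H" "F (\<lambda>x. chi (e n) x * \<phi> x) (\<lambda>x. chi (e n) x * \<phi> x) \<le> C * F \<phi> \<phi>" for n
    using C \<phi> e by auto
  have lim: "(\<lambda>n. chi (e n) x * \<phi> x) \<longlonglongrightarrow> \<phi> x" for x
  proof (cases "x \<in> \<Omega>")
    case True
    have "\<forall>\<^sub>F n in sequentially. 2 / dd x \<le> real (Suc n)"
      using filterlim_compose[OF filterlim_real_sequentially filterlim_Suc] by (rule filterlim_at_top[THEN iffD1, rule_format])
    then have "\<forall>\<^sub>F n in sequentially. chi (e n) x * \<phi> x = \<phi> x"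
    proof eventually_elim
      case (elim n)
      then have "2 \<le> dd x / e n" using dd_pos[OF True] by (simp add: e_def field_simps)
      then show ?case by (simp add: chi_def)
    qed
    then show ?thesis by (rule tendsto_eventually)
  qed (simp add: Hs_outside[OF \<phi>])
  have "(\<lambda>n. \<Psi> (\<lambda>x. chi (e n) x * \<phi> x)) \<longlonglongrightarrow> \<Psi> \<phi>"
    by (rule cont[of "\<lambda>n x. chi (e n) x * \<phi> x", OF cH AE_I2[OF lim] \<phi>])
  moreover have "\<Psi> (\<lambda>x. chi (e n) x * \<phi> x) = 0" for n
  proof (rule inner[OF cH(1) e[of n]])
    show "\<forall>x. dd x < e n \<longrightarrow> chi (e n) x * \<phi> x = 0"
      using e[of n] by (auto simp: chi_def max_def field_simps)
  qed
  ultimately show ?thesis by (simp add: LIMSEQ_const_iff)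
qed

end

section \<open>An explicit subsolution\<close>

lemma integrable_of_nn_bound:
  fixes f :: "'b \<Rightarrow> real"
  assumes [measurable]: "f \<in> borel_measurable M" and f: "\<And>x. 0 \<le> f x" and B: "(\<integral>\<^sup>+x. ennreal (f x) \<partial>M) \<le> ennreal B" "0 \<le> B"
  shows "integrable M f" and "(\<integral>x. f x \<partial>M) \<le> B"
proof -
  show i: "integrable M f"
    using B f by (intro integrableI_nonneg) (auto intro: le_less_trans)
  have "ennreal (\<integral>x. f x \<partial>M) = (\<integral>\<^sup>+x. ennreal (f x) \<partial>M)" using i f by (intro nn_integral_eq_integral[symmetric]) auto
  also have "\<dots> \<le> ennreal B" by (rule B)
  finally show "(\<integral>x. f x \<partial>M) \<le> B" using B by (simp add: ennreal_le_iff)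
qed

text \<open>Removing a neighbourhood of the origin makes the kernel integrable. The fractional
  Laplacian is handled through these truncations with bounds uniform in the radius, so no principal
  value is needed.\<close>

definition kfar :: "real \<Rightarrow> real \<Rightarrow> 'a::euclidean_space \<Rightarrow> real" where
  "kfar s \<eta> h = kern s h * indicator {h. \<eta> \<le> norm h} h"

lemma kfar_nonneg [simp]: "0 \<le> kfar s \<eta> h"
  by (simp add: kfar_def)

lemma kfar_minus [simp]: "kfar s \<eta> (- h) = kfar s \<eta> h"
  by (simp add: kfar_def indicator_def)

lemma borel_measurable_kfar [measurable]: "kfar s \<eta> \<in> borel_measurable borel"
  unfolding kfar_def[abs_def] by measurable

lemma kfar_integrable:
  assumes "0 < s"
  shows "\<exists>T>0. \<forall>\<eta>>0. integrable lborel (kfar s \<eta> :: 'a::euclidean_space \<Rightarrow> real) \<and> (\<integral>h. kfar s \<eta> (h::'a) \<partial>lborel) \<le> T * \<eta> powr (- 2 * s)"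
proof -
  obtain T where T: "0 < T" "\<forall>\<eta>>0. (\<integral>\<^sup>+h. ennreal (kern s (h::'a)) * indicator {h. \<eta> \<le> norm h} h \<partial>lborel) \<le> ennreal (T * \<eta> powr (- 2 * s))"
    using kern_tail[OF assms, where 'a='a] by blast
  have "ennreal (kfar s \<eta> h) = ennreal (kern s (h::'a)) * indicator {h. \<eta> \<le> norm h} h" for \<eta> h
    by (simp add: kfar_def indicator_def)
  then have "(\<integral>\<^sup>+h. ennreal (kfar s \<eta> (h::'a)) \<partial>lborel) \<le> ennreal (T * \<eta> powr (- 2 * s))" if "0 < \<eta>" for \<eta>
    using T(2) that by simp
  then show ?thesis using T(1) by (intro exI[of _ T] conjI allI impI integrable_of_nn_bound) auto
qed

lemma knear_integrable:
  assumes "s < 1"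
  shows "\<exists>T>0. \<forall>\<eta>>0. integrable lborel (\<lambda>h::'a::euclidean_space. (norm h)\<^sup>2 * kern s h * indicator {h. norm h < \<eta>} h) \<and>
    (\<integral>h. (norm h)\<^sup>2 * kern s (h::'a) * indicator {h. norm h < \<eta>} h \<partial>lborel) \<le> T * \<eta> powr (2 - 2 * s)"
proof -
  obtain T where T: "0 < T" "\<forall>\<eta>>0. (\<integral>\<^sup>+h. ennreal ((norm h)\<^sup>2 * kern s (h::'a)) * indicator {h. norm h < \<eta>} h \<partial>lborel) \<le> ennreal (T * \<eta> powr (2 - 2 * s))"
    using kern_near[OF assms, where 'a='a] by blast
  have "ennreal ((norm h)\<^sup>2 * kern s h * indicator {h. norm h < \<eta>} h) = ennreal ((norm h)\<^sup>2 * kern s (h::'a)) * indicator {h. norm h < \<eta>} h" for \<eta> h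
    by (simp add: indicator_def)
  then have "(\<integral>\<^sup>+h. ennreal ((norm h)\<^sup>2 * kern s (h::'a) * indicator {h. norm h < \<eta>} h) \<partial>lborel) \<le> ennreal (T * \<eta> powr (2 - 2 * s))" if "0 < \<eta>" for \<eta>
    using T(2) that by simp
  then show ?thesis using T(1) by (intro exI[of _ T] conjI allI impI integrable_of_nn_bound) auto
qed

context fractional_domain begin

text \<open>At short range the Lipschitz bound leaves \<open>(norm h)\<^sup>2 * kern s h\<close>, at
  long range boundedness leaves the tail of the kernel, and both are integrable. Pairs with both
  points outside \<open>\<Omega>\<close> contribute nothing, so one variable always ranges over a
  set of finite measure.\<close>

lemma lipschitz_in_Hs:
  assumes lip: "\<And>x y. \<bar>f x - f y\<bar> \<le> L * norm (x - y)" and out: "\<And>x. x \<notin> \<Omega> \<Longrightarrow> f x = 0"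
  shows "f \<in> H"
proof -
  have L0: "0 \<le> L"
  proof -
    obtain b :: 'a where "b \<in> Basis" using nonempty_Basis by blast
    then show ?thesis using lip[of b 0] by (simp add: order_trans[OF abs_ge_zero])
  qed
  have cf: "continuous_on UNIV f"
  proof (rule lipschitz_on_continuous_on[of L])
    show "L-lipschitz_on UNIV f" using lip L0 by (intro lipschitz_onI) (auto simp: dist_norm)
  qed
  have fm [measurable]: "f \<in> borel_measurable borel" by (rule borel_measurable_continuous_onI[OF cf])
  obtain y0 where y0: "y0 \<notin> \<Omega>" using compl_dom by blast
  obtain r where r: "\<Omega> \<subseteq> ball y0 r" using bounded_subset_ballD[OF dom(2)] by blast
  define M where "M = L * r"
  have fM: "\<bar>f x\<bar> \<le> \<bar>M\<bar>" for x
  proof (cases "x \<in> \<Omega>")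
    case True
    have "\<bar>f x\<bar> \<le> L * norm (x - y0)" using lip[of x y0] out[OF y0] by simp
    also have "\<dots> \<le> L * r" using r True L0 by (intro mult_left_mono) (auto simp: dist_norm norm_minus_commute dest!: subsetD)
    finally show ?thesis by (simp add: M_def)
  qed (simp add: out)
  obtain T1 where T1: "\<forall>\<eta>>0. integrable lborel (kfar s \<eta> :: 'a \<Rightarrow> real) \<and> (\<integral>h. kfar s \<eta> (h::'a) \<partial>lborel) \<le> T1 * \<eta> powr (- 2 * s)"
    using kfar_integrable[OF s(1), where 'a='a] by blast
  obtain T2 where T2: "\<forall>\<eta>>0. integrable lborel (\<lambda>h::'a. (norm h)\<^sup>2 * kern s h * indicator {h. norm h < \<eta>} h) \<and>
    (\<integral>h. (norm h)\<^sup>2 * kern s (h::'a) * indicator {h. norm h < \<eta>} h \<partial>lborel) \<le> T2 * \<eta> powr (2 - 2 * s)"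
    using knear_integrable[OF s(2), where 'a='a] by blast
  define m :: "'a \<Rightarrow> real" where "m h = L\<^sup>2 * ((norm h)\<^sup>2 * kern s h * indicator {h. norm h < 1} h) + (2 * M)\<^sup>2 * kfar s 1 h" for h
  have m0: "0 \<le> m h" for h by (simp add: m_def)
  have mi: "integrable lborel m" unfolding m_def[abs_def] using T1 T2 by (intro Bochner_Integration.integrable_add integrable_mult_right) auto
  then have [measurable]: "m \<in> borel_measurable borel" by auto
  have mfin: "(\<integral>\<^sup>+h. ennreal (m h) \<partial>lborel) < \<infinity>" using nn_integral_eq_integral[OF mi] m0 by simp
  have pt: "kern s (x - y) * (f x - f y)\<^sup>2 \<le> indicator \<Omega> x * m (x - y) + indicator \<Omega> y * m (x - y)" for x y
  proof (cases "x \<in> \<Omega> \<or> y \<in> \<Omega>")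
    case True
    have "kern s (x - y) * (f x - f y)\<^sup>2 \<le> m (x - y)"
    proof (cases "norm (x - y) < 1")
      case True
      have "\<bar>f x - f y\<bar>\<^sup>2 \<le> (L * norm (x - y))\<^sup>2" by (rule power_mono[OF lip]) simp
      then have "kern s (x - y) * (f x - f y)\<^sup>2 \<le> kern s (x - y) * (L * norm (x - y))\<^sup>2" by (intro mult_left_mono) auto
      also have "\<dots> = m (x - y)" using True by (simp add: m_def kfar_def power_mult_distrib)
      finally show ?thesis .
    next
      case False
      have "\<bar>f x - f y\<bar>\<^sup>2 \<le> \<bar>2 * M\<bar>\<^sup>2" using fM[of x] fM[of y] by (intro power_mono) auto
      then have "kern s (x - y) * (f x - f y)\<^sup>2 \<le> kern s (x - y) * (2 * M)\<^sup>2" by (intro mult_left_mono) auto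
      also have "\<dots> = m (x - y)" using False by (simp add: m_def kfar_def)
      finally show ?thesis .
    qed
    then show ?thesis using True m0[of "x - y"] by (auto simp: indicator_def)
  next
    case False
    then show ?thesis using out by simp
  qed
  have side: "(\<integral>\<^sup>+x. \<integral>\<^sup>+y. indicator \<Omega> x * ennreal (m (x - y)) \<partial>lborel \<partial>lborel) < \<infinity>"
    "(\<integral>\<^sup>+y. \<integral>\<^sup>+x. indicator \<Omega> y * ennreal (m (x - y)) \<partial>lborel \<partial>lborel) < \<infinity>"
  proof -
    have "(\<integral>\<^sup>+y. indicator \<Omega> x * ennreal (m (x - y)) \<partial>lborel) = indicator \<Omega> x * (\<integral>\<^sup>+h. ennreal (m h) \<partial>lborel)" for x
      using nn_integral_reflect[of "\<lambda>h. ennreal (m h)" x] by (subst nn_integral_cmult) auto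
    moreover have "(\<integral>\<^sup>+x. indicator \<Omega> y * ennreal (m (x - y)) \<partial>lborel) = indicator \<Omega> y * (\<integral>\<^sup>+h. ennreal (m h) \<partial>lborel)" for y
      using nn_integral_shift[of "\<lambda>h. ennreal (m h)" y] by (subst nn_integral_cmult) auto
    moreover have "(\<integral>\<^sup>+x. indicator \<Omega> x * (\<integral>\<^sup>+h. ennreal (m h) \<partial>lborel) \<partial>lborel) < \<infinity>"
      using mfin finite_dom by (subst nn_integral_multc) (auto simp: ennreal_mult_less_top)
    ultimately show "(\<integral>\<^sup>+x. \<integral>\<^sup>+y. indicator \<Omega> x * ennreal (m (x - y)) \<partial>lborel \<partial>lborel) < \<infinity>"
      "(\<integral>\<^sup>+y. \<integral>\<^sup>+x. indicator \<Omega> y * ennreal (m (x - y)) \<partial>lborel \<partial>lborel) < \<infinity>"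
      by simp_all
  qed
  have "(\<integral>\<^sup>+z. ennreal ((dq f z)\<^sup>2) \<partial>kap s) = (\<integral>\<^sup>+x. \<integral>\<^sup>+y. ennreal (kern s (x - y)) * ennreal ((f x - f y)\<^sup>2) \<partial>lborel \<partial>lborel)"
    by (subst nn_integral_kap) (simp_all add: dq_def)
  also have "\<dots> \<le> (\<integral>\<^sup>+x. \<integral>\<^sup>+y. indicator \<Omega> x * ennreal (m (x - y)) + indicator \<Omega> y * ennreal (m (x - y)) \<partial>lborel \<partial>lborel)"
  proof (intro nn_integral_mono)
    fix x y
    have "ennreal (kern s (x - y)) * ennreal ((f x - f y)\<^sup>2) = ennreal (kern s (x - y) * (f x - f y)\<^sup>2)" by (simp add: ennreal_mult)
    also have "\<dots> \<le> ennreal (indicator \<Omega> x * m (x - y) + indicator \<Omega> y * m (x - y))" by (rule ennreal_leI[OF pt])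
    also have "\<dots> = indicator \<Omega> x * ennreal (m (x - y)) + indicator \<Omega> y * ennreal (m (x - y))"
      using m0 by (auto simp: indicator_def ennreal_plus)
    finally show "ennreal (kern s (x - y)) * ennreal ((f x - f y)\<^sup>2) \<le> indicator \<Omega> x * ennreal (m (x - y)) + indicator \<Omega> y * ennreal (m (x - y))" .
  qed
  also have "\<dots> = (\<integral>\<^sup>+x. (\<integral>\<^sup>+y. indicator \<Omega> x * ennreal (m (x - y)) \<partial>lborel) + (\<integral>\<^sup>+y. indicator \<Omega> y * ennreal (m (x - y)) \<partial>lborel) \<partial>lborel)"
    by (intro nn_integral_cong nn_integral_add) auto
  also have "\<dots> = (\<integral>\<^sup>+x. \<integral>\<^sup>+y. indicator \<Omega> x * ennreal (m (x - y)) \<partial>lborel \<partial>lborel) + (\<integral>\<^sup>+x. \<integral>\<^sup>+y. indicator \<Omega> y * ennreal (m (x - y)) \<partial>lborel \<partial>lborel)"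
    by (rule nn_integral_add) auto
  also have "(\<integral>\<^sup>+x. \<integral>\<^sup>+y. indicator \<Omega> y * ennreal (m (x - y)) \<partial>lborel \<partial>lborel) = (\<integral>\<^sup>+y. \<integral>\<^sup>+x. indicator \<Omega> y * ennreal (m (x - y)) \<partial>lborel \<partial>lborel)"
    by (rule lborel_pair.Fubini') auto
  finally have "(\<integral>\<^sup>+z. ennreal ((dq f z)\<^sup>2) \<partial>kap s) < \<infinity>" using side by (auto intro: le_less_trans)
  then show ?thesis using fm out by (intro HsI_nn)
qed

lemma test_function_in_Hs:
  assumes t: "test_function \<Omega> \<phi>" shows "\<phi> \<in> H"
proof -
  have Ck: "\<forall>k. Ck_function k \<phi>" and sub: "closure {x. \<phi> x \<noteq> 0} \<subseteq> \<Omega>" using t by (auto simp: test_function_def)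
  have out: "\<phi> x = 0" if "x \<notin> \<Omega>" for x using sub closure_subset[of "{x. \<phi> x \<noteq> 0}"] that by blast
  obtain r where r: "\<Omega> \<subseteq> ball 0 r" using bounded_subset_ballD[OF dom(2)] by blast
  have "\<phi> x = 0" if "r \<le> norm x" for x using out[of x] r that by (force simp: subset_iff)
  then have sc: "smooth_compact \<phi>" using Ck unfolding smooth_compact_def by blast
  obtain G where G: "\<And>x. GDERIV \<phi> x :> G x" "\<forall>b\<in>Basis. smooth_compact (\<lambda>x. G x \<bullet> b)"
    using smooth_compact_gradient[OF sc] by blast
  have "\<exists>C. \<forall>x. \<bar>G x \<bullet> c\<bar> \<le> C" if "c \<in> Basis" for c
    using smooth_compact_bounded[of "\<lambda>x. G x \<bullet> c"] G that by blast
  then obtain C where C: "\<And>c x. c \<in> Basis \<Longrightarrow> \<bar>G x \<bullet> c\<bar> \<le> C c" by metis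
  have n: "norm (G x) \<le> (\<Sum>c\<in>Basis. C c)" for x
    using norm_le_l1[of "G x"] sum_mono[of Basis "\<lambda>c. \<bar>G x \<bullet> c\<bar>" C] C by (force intro: order_trans)
  show ?thesis
  proof (rule lipschitz_in_Hs)
    show "\<bar>\<phi> x - \<phi> y\<bar> \<le> (\<Sum>c\<in>Basis. C c) * norm (x - y)" for x y
      by (rule bounded_gradient_lipschitz[OF G(1) n])
  qed (rule out)
qed

text \<open>
  The only second-order information used about \<open>w\<close> is that \<open>w + \<bar>\<cdot>\<bar>\<^sup>2\<close> is midpoint convex: the
  second difference at short range is then at most \<open>2\<bar>h\<bar>\<^sup>2\<close>, while the part of \<open>w\<close> at distance
  at least \<open>\<eta>\<close> from \<open>x\<close> contributes a fixed negative amount.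
\<close>

lemma fractional_laplacian_upper_bound:
  assumes wm [measurable]: "w \<in> borel_measurable borel" and w: "\<And>x. 0 \<le> w x" "\<And>x. w x \<le> R" "\<And>x. x \<notin> \<Omega> \<Longrightarrow> w x = 0"
    and semi: "\<And>x h. 2 * w x - w (x + h) - w (x - h) \<le> 2 * (norm h)\<^sup>2" and W: "0 < (\<integral>x. w x \<partial>lborel)"
  shows "\<exists>K m \<eta>. 0 < K \<and> 0 < m \<and> 0 < \<eta> \<and> (\<forall>x\<in>\<Omega>. \<forall>\<delta>>0. \<delta> \<le> \<eta> \<longrightarrow> (\<integral>y. kfar s \<delta> (x - y) * (w x - w y) \<partial>lborel) \<le> K * w x - m)"
proof -
  let ?N = "real DIM('a)"
  let ?W = "\<integral>x. w x \<partial>lborel"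
  have R0: "0 \<le> R" using w(1,2)[of 0] by linarith
  have wi: "integrable lborel w"
  proof (rule Bochner_Integration.integrable_bound)
    show "integrable lborel (\<lambda>x. R * indicator \<Omega> x)" using integrable_indicator_dom by auto
    show "AE x in lborel. norm (w x) \<le> norm (R * indicator \<Omega> x :: real)"
      using w R0 by (intro AE_I2) (auto simp: indicator_def)
  qed simp
  obtain T1 where T1: "0 < T1" "\<forall>\<eta>>0. integrable lborel (kfar s \<eta> :: 'a \<Rightarrow> real) \<and> (\<integral>h. kfar s \<eta> (h::'a) \<partial>lborel) \<le> T1 * \<eta> powr (- 2 * s)"
    using kfar_integrable[OF s(1), where 'a='a] by blast
  obtain T2 where T2: "\<forall>\<eta>>0. integrable lborel (\<lambda>h::'a. (norm h)\<^sup>2 * kern s h * indicator {h. norm h < \<eta>} h) \<and>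
    (\<integral>h. (norm h)\<^sup>2 * kern s (h::'a) * indicator {h. norm h < \<eta>} h \<partial>lborel) \<le> T2 * \<eta> powr (2 - 2 * s)"
    using knear_integrable[OF s(2), where 'a='a] by blast
  have T1i: "integrable lborel (kfar s \<eta> :: 'a \<Rightarrow> real)" and T1b: "(\<integral>h. kfar s \<eta> (h::'a) \<partial>lborel) \<le> T1 * \<eta> powr (- 2 * s)"
    and T2i: "integrable lborel (\<lambda>h::'a. (norm h)\<^sup>2 * kern s h * indicator {h. norm h < \<eta>} h)"
    and T2b: "(\<integral>h. (norm h)\<^sup>2 * kern s (h::'a) * indicator {h. norm h < \<eta>} h \<partial>lborel) \<le> T2 * \<eta> powr (2 - 2 * s)"
    if "0 < \<eta>" for \<eta>
    using T1(2)[rule_format, OF that] T2[rule_format, OF that] by auto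
  obtain r where r: "0 < r" "\<Omega> \<subseteq> ball 0 r" using bounded_subset_ballD[OF dom(2)] by blast
  define c where "c = (2 * r) powr (- (?N + 2 * s))"
  have c: "0 < c" using r by (simp add: c_def)
  have kc: "c \<le> kern s (x - y)" if "x \<in> \<Omega>" "y \<in> \<Omega>" "x \<noteq> y" for x y
    unfolding c_def
  proof (rule kern_mono)
    have "norm x < r" "norm y < r" using subsetD[OF r(2) that(1)] subsetD[OF r(2) that(2)] by auto
    then show "norm (x - y) \<le> 2 * r" using norm_triangle_ineq4[of x y] by linarith
  qed (use s that in auto)
  let ?V = "unit_ball_vol ?N"
  define e where "e n = 1 / real (Suc n)" for n
  have e: "0 < e n" for n by (simp add: e_def)
  have e0: "e \<longlonglongrightarrow> 0" unfolding e_def[abs_def]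
    by (rule real_tendsto_divide_at_top[OF tendsto_const filterlim_compose[OF filterlim_real_sequentially filterlim_Suc]])
  have "(\<lambda>n. T2 * e n powr (2 - 2 * s) + c * R * (?V * e n ^ DIM('a))) \<longlonglongrightarrow> T2 * 0 + c * R * (?V * 0 ^ DIM('a))"
  proof -
    have "(\<lambda>n. e n powr (2 - 2 * s)) \<longlonglongrightarrow> 0"
      by (rule tendsto_zero_powrI[OF e0 tendsto_const]) (use s e in \<open>auto intro!: always_eventually less_imp_le\<close>)
    then show ?thesis by (intro tendsto_intros e0)
  qed
  then have "(\<lambda>n. T2 * e n powr (2 - 2 * s) + c * R * (?V * e n ^ DIM('a))) \<longlonglongrightarrow> 0" by (simp add: power_0_left)
  moreover have "0 < c * ?W / 2" using c W by simp
  ultimately have "\<forall>\<^sub>F n in sequentially. T2 * e n powr (2 - 2 * s) + c * R * (?V * e n ^ DIM('a)) < c * ?W / 2"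
    by (rule order_tendstoD)
  then obtain n where n: "T2 * e n powr (2 - 2 * s) + c * R * (?V * e n ^ DIM('a)) < c * ?W / 2"
    using eventually_happens by fastforce
  \<comment> \<open>So small that the second-order error at short range and the part of
    \<open>w\<close> lost inside the ball of radius \<open>\<eta>\<close> together cost less than
    half of the far contribution \<open>c * ?W\<close>.\<close>
  define \<eta> where "\<eta> = e n"
  have \<eta>: "0 < \<eta>" "T2 * \<eta> powr (2 - 2 * s) + c * R * (?V * \<eta> ^ DIM('a)) < c * ?W / 2" using e n by (auto simp: \<eta>_def)
  define K where "K = T1 * \<eta> powr (- 2 * s)"
  have "(\<integral>y. kfar s \<delta> (x - y) * (w x - w y) \<partial>lborel) \<le> K * w x - c * ?W / 2" if x: "x \<in> \<Omega>" and \<delta>: "0 < \<delta>" "\<delta> \<le> \<eta>" for x \<delta>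
  proof -
    have kw: "integrable lborel (\<lambda>h. kfar s t h * g h)" if t: "0 < t" and [measurable]: "g \<in> borel_measurable borel" and g: "\<And>h. \<bar>g h\<bar> \<le> R'" for t R' and g :: "'a \<Rightarrow> real"
    proof (rule Bochner_Integration.integrable_bound)
      show "integrable lborel (\<lambda>h::'a. kfar s t h * R')" using T1i[OF t] by (intro integrable_mult_left)
      show "AE h in lborel. norm (kfar s t h * g h) \<le> norm (kfar s t h * R')"
        using order_trans[OF g abs_ge_self] by (intro AE_I2) (simp add: abs_mult mult_left_mono)
    qed simp
    have wd: "\<bar>w a - w b\<bar> \<le> R" for a b using w(1,2)[of a] w(1,2)[of b] by linarith
    define A where "A = (\<integral>y. kfar s \<delta> (x - y) * (w x - w y) \<partial>lborel)"
    have A1: "A = (\<integral>h. kfar s \<delta> h * (w x - w (x - h)) \<partial>lborel)"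
      unfolding A_def using integral_reflect[of "\<lambda>y. kfar s \<delta> (x - y) * (w x - w y)" x] by simp
    have A2: "A = (\<integral>h. kfar s \<delta> h * (w x - w (x + h)) \<partial>lborel)"
      unfolding A1 using integral_reflect[of "\<lambda>h. kfar s \<delta> h * (w x - w (x - h))" 0] by simp
    have i1: "integrable lborel (\<lambda>h. kfar s t h * (w x - w (x - h)))" if "0 < t" for t
      by (rule kw[OF that _ wd]) measurable
    have i2: "integrable lborel (\<lambda>h. kfar s t h * (w x - w (x + h)))" if "0 < t" for t
      by (rule kw[OF that _ wd]) measurable
    define E where "E = (\<integral>h. kfar s \<eta> h * (w x - w (x - h)) \<partial>lborel)"
    have E2: "E = (\<integral>h. kfar s \<eta> h * (w x - w (x + h)) \<partial>lborel)"
      unfolding E_def using integral_reflect[of "\<lambda>h. kfar s \<eta> h * (w x - w (x - h))" 0] by simp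
    let ?n = "\<lambda>h. (norm h)\<^sup>2 * kern s h * indicator {h. norm h < \<eta>} h"
    \<comment> \<open>The substitution of \<open>- h\<close> for \<open>h\<close> gives two
      expressions for \<open>A\<close>; their sum contains the second difference of
      \<open>w\<close>, to which \<open>semi\<close> applies.\<close>
    have "2 * A = (\<integral>h. kfar s \<delta> h * (w x - w (x - h)) + kfar s \<delta> h * (w x - w (x + h)) \<partial>lborel)"
      using i1[OF \<delta>(1)] i2[OF \<delta>(1)] A1 A2 by simp
    also have "\<dots> \<le> (\<integral>h. 2 * ?n h + (kfar s \<eta> h * (w x - w (x - h)) + kfar s \<eta> h * (w x - w (x + h))) \<partial>lborel)"
    proof (rule integral_mono)
      show "integrable lborel (\<lambda>h. kfar s \<delta> h * (w x - w (x - h)) + kfar s \<delta> h * (w x - w (x + h)))"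
        using i1[OF \<delta>(1)] i2[OF \<delta>(1)] by (rule Bochner_Integration.integrable_add)
      show "integrable lborel (\<lambda>h. 2 * ?n h + (kfar s \<eta> h * (w x - w (x - h)) + kfar s \<eta> h * (w x - w (x + h))))"
        using i1[OF \<eta>(1)] i2[OF \<eta>(1)] T2i[OF \<eta>(1)] by (intro Bochner_Integration.integrable_add integrable_mult_right)
      fix h :: 'a
      have eq: "k * (w x - w (x - h)) + k * (w x - w (x + h)) = k * (2 * w x - w (x + h) - w (x - h))" for k
        by (simp add: algebra_simps)
      show "kfar s \<delta> h * (w x - w (x - h)) + kfar s \<delta> h * (w x - w (x + h))
        \<le> 2 * ?n h + (kfar s \<eta> h * (w x - w (x - h)) + kfar s \<eta> h * (w x - w (x + h)))"
      proof (cases "norm h < \<eta>")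
        case True
        have "kfar s \<delta> h * (2 * w x - w (x + h) - w (x - h)) \<le> kfar s \<delta> h * (2 * (norm h)\<^sup>2)"
          by (intro mult_left_mono semi) simp
        also have "\<dots> \<le> kern s h * (2 * (norm h)\<^sup>2)" by (intro mult_right_mono) (auto simp: kfar_def indicator_def)
        finally show ?thesis using True by (simp add: eq kfar_def[of s \<eta>] mult_ac)
      next
        case False
        then show ?thesis using \<delta> by (simp add: kfar_def)
      qed
    qed
    also have "\<dots> = 2 * (\<integral>h. ?n h \<partial>(lborel :: 'a measure)) + (E + E)"
    proof -
      have "(\<integral>h. kfar s \<eta> h * (w x - w (x - h)) + kfar s \<eta> h * (w x - w (x + h)) \<partial>lborel) = E + E"
        unfolding Bochner_Integration.integral_add[OF i1[OF \<eta>(1)] i2[OF \<eta>(1)]] using E_def E2 by simp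
      moreover have "integrable lborel (\<lambda>h. kfar s \<eta> h * (w x - w (x - h)) + kfar s \<eta> h * (w x - w (x + h)))"
        using i1[OF \<eta>(1)] i2[OF \<eta>(1)] by (rule Bochner_Integration.integrable_add)
      moreover have "integrable lborel (\<lambda>h::'a. 2 * ?n h)" using T2i[OF \<eta>(1)] by (intro integrable_mult_right)
      ultimately show ?thesis by (subst Bochner_Integration.integral_add) simp_all
    qed
    finally have AE: "A \<le> T2 * \<eta> powr (2 - 2 * s) + E" using T2b[OF \<eta>(1)] by linarith
    have iw: "integrable lborel (\<lambda>h. kfar s \<eta> h * w (x - h))"
    proof (rule kw[OF \<eta>(1)])
      show "\<bar>w (x - h)\<bar> \<le> R" for h using w(1,2)[of "x - h"] by simp
    qed measurable
    have "E = (\<integral>h. w x * kfar s \<eta> h \<partial>(lborel :: 'a measure)) - (\<integral>h. kfar s \<eta> h * w (x - h) \<partial>lborel)"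
      unfolding E_def right_diff_distrib
      by (subst Bochner_Integration.integral_diff) (use iw T1i[OF \<eta>(1)] in \<open>auto simp: mult.commute\<close>)
    also have "(\<integral>h. w x * kfar s \<eta> h \<partial>(lborel :: 'a measure)) = w x * (\<integral>h. kfar s \<eta> (h::'a) \<partial>lborel)" by simp
    also have "\<dots> \<le> w x * K" unfolding K_def using T1b[OF \<eta>(1)] w(1) by (rule mult_left_mono)
    finally have E: "E \<le> K * w x - (\<integral>h. kfar s \<eta> h * w (x - h) \<partial>lborel)" by (simp add: mult.commute)
    have "(\<integral>h. kfar s \<eta> h * w (x - h) \<partial>lborel) = (\<integral>y. kfar s \<eta> (x - y) * w y \<partial>lborel)"
      using integral_reflect[of "\<lambda>y. kfar s \<eta> (x - y) * w y" x] by simp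
    also have "\<dots> \<ge> (\<integral>y. c * w y - c * R * indicator (ball x \<eta>) y \<partial>lborel)"
    proof (rule integral_mono)
      show "integrable lborel (\<lambda>y. kfar s \<eta> (x - y) * w y)"
      proof -
        have "integrable (distr lborel borel (\<lambda>h. x - h)) (\<lambda>h. kfar s \<eta> h * w (x - h))"
          unfolding distr_reflect by (rule iw)
        from integrable_distr[OF _ this] show ?thesis by simp
      qed
      show "integrable lborel (\<lambda>y. c * w y - c * R * indicator (ball x \<eta>) y)"
        using wi emeasure_lborel_ball_finite[of x \<eta>] by (intro Bochner_Integration.integrable_diff integrable_mult_right) (auto simp: integrable_indicator_iff)
      show "c * w y - c * R * indicator (ball x \<eta>) y \<le> kfar s \<eta> (x - y) * w y" for y
      proof (cases "y \<in> \<Omega> \<and> \<eta> \<le> norm (x - y)")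
        case True
        then have "c * w y \<le> kern s (x - y) * w y" using x \<eta>(1) w(1) by (intro mult_right_mono kc) auto
        then show ?thesis using True by (simp add: kfar_def indicator_def dist_norm)
      next
        case False
        then consider "y \<notin> \<Omega>" | "norm (x - y) < \<eta>" by linarith
        then show ?thesis
        proof cases
          case 1 then show ?thesis using w(3) c R0 by (simp add: indicator_def)
        next
          case 2 
          then show ?thesis using w(2)[of y] c by (simp add: kfar_def indicator_def dist_norm)
        qed
      qed
    qed
    also have "(\<integral>y. c * w y - c * R * indicator (ball x \<eta>) y \<partial>lborel) = c * ?W - c * R * (?V * \<eta> ^ DIM('a))"
    proof -
      have "integrable lborel (indicator (ball x \<eta>) :: 'a \<Rightarrow> real)"
        using emeasure_lborel_ball_finite[of x \<eta>] by (auto simp: integrable_indicator_iff)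
      moreover have "measure lborel (ball x \<eta>) = ?V * \<eta> ^ DIM('a)"
        using \<eta>(1) unfolding measure_def by (subst emeasure_lborel_ball) auto
      ultimately show ?thesis using wi by simp
    qed
    finally show ?thesis using AE E \<eta>(2) unfolding A_def by linarith
  qed
  moreover have "0 < K" using T1 \<eta> by (simp add: K_def)
  moreover have "0 < c * ?W / 2" using c W by simp
  ultimately show ?thesis using \<eta>(1) by blast
qed

text \<open>Away from the diagonal the kernel is integrable, so \<open>\<phi> x - \<phi> y\<close>
  may be split and the two halves are equal by symmetry, whence the factor \<open>2\<close>. The
  pointwise bound is uniform in the truncation radius, and dominated convergence removes the
  truncation.\<close>

lemma form_le_of_pointwise_bound:
  assumes w: "w \<in> H" "\<And>x. 0 \<le> w x" "\<And>x. w x \<le> R" and \<phi>: "\<phi> \<in> H" "\<And>x. 0 \<le> \<phi> x" and \<eta>: "0 < \<eta>"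
    and bound: "\<And>x \<delta>. x \<in> \<Omega> \<Longrightarrow> 0 < \<delta> \<Longrightarrow> \<delta> \<le> \<eta> \<Longrightarrow> (\<integral>y. kfar s \<delta> (x - y) * (w x - w y) \<partial>lborel) \<le> g x"
    and gi: "integrable lborel (\<lambda>x. g x * \<phi> x)"
  shows "F w \<phi> \<le> 2 * (\<integral>x. g x * \<phi> x \<partial>lborel)"
proof -
  let ?P = "lborel \<Otimes>\<^sub>M lborel :: ('a \<times> 'a) measure"
  have [measurable]: "w \<in> borel_measurable borel" "\<phi> \<in> borel_measurable borel" using HsD(1) w \<phi> by auto
  have R0: "0 \<le> R" using w(2,3)[of 0] by linarith
  define e where "e n = \<eta> / real (Suc n)" for n
  have e: "0 < e n" "e n \<le> \<eta>" for n using \<eta> by (auto simp: e_def field_simps)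
  have e0: "e \<longlonglongrightarrow> 0" unfolding e_def[abs_def]
    by (rule real_tendsto_divide_at_top[OF tendsto_const filterlim_compose[OF filterlim_real_sequentially filterlim_Suc]])
  let ?D = "\<lambda>n. {z::'a \<times> 'a. e n \<le> norm (fst z - snd z)}"
  define E where "E n = (\<integral>z. indicator (?D n) z * (dq w z * dq \<phi> z) \<partial>kap s)" for n
  have "E \<longlonglongrightarrow> F w \<phi>"
    unfolding E_def[abs_def] form_def
  proof (rule integral_dominated_convergence)
    show "integrable (kap s) (\<lambda>z. \<bar>dq w z * dq \<phi> z\<bar>)" using Hs_integrable_mult[OF w(1) \<phi>(1)] by (rule integrable_abs)
    show "(\<lambda>z. dq w z * dq \<phi> z) \<in> borel_measurable (kap s)" by measurable
    show "(\<lambda>z. indicator (?D n) z * (dq w z * dq \<phi> z)) \<in> borel_measurable (kap s)" for n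
      unfolding measurable_kap by measurable
    show "AE z in kap s. (\<lambda>n. indicator (?D n) z * (dq w z * dq \<phi> z)) \<longlonglongrightarrow> dq w z * dq \<phi> z"
    proof (intro AE_I2)
      fix z :: "'a \<times> 'a"
      show "(\<lambda>n. indicator (?D n) z * (dq w z * dq \<phi> z)) \<longlonglongrightarrow> dq w z * dq \<phi> z"
      proof (cases "fst z = snd z")
        case False
        then have "\<forall>\<^sub>F n in sequentially. e n < norm (fst z - snd z)" using e0 by (intro order_tendstoD) auto
        then have "\<forall>\<^sub>F n in sequentially. indicator (?D n) z * (dq w z * dq \<phi> z) = dq w z * dq \<phi> z"
          by eventually_elim auto
        then show ?thesis by (rule tendsto_eventually)
      qed (simp add: dq_def)
    qed
    show "AE z in kap s. norm (indicator (?D n) z * (dq w z * dq \<phi> z)) \<le> \<bar>dq w z * dq \<phi> z\<bar>" for n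
      by (intro AE_I2) (auto simp: indicator_def)
  qed
  moreover have "E n \<le> 2 * (\<integral>x. g x * \<phi> x \<partial>lborel)" for n
  proof -
    define k where "k = (kfar s (e n) :: 'a \<Rightarrow> real)"
    have ki: "integrable lborel k" using kfar_integrable[OF s(1), where 'a='a] e(1)[of n] unfolding k_def by blast
    then have [measurable]: "k \<in> borel_measurable borel" by auto
    have k0: "0 \<le> k h" "k (- h) = k h" for h by (auto simp: k_def)
    have ks: "k (x - y) = k (y - x)" for x y using k0(2)[of "x - y"] by simp
    define f where "f z = k (fst z - snd z) * dq w z * \<phi> (fst z)" for z
    have fm [measurable]: "f \<in> borel_measurable ?P" unfolding f_def[abs_def] by measurable
    have fi: "integrable ?P f"
    proof (rule integrableI_bounded[OF fm])
      have kf: "(\<integral>\<^sup>+h. ennreal (k h) \<partial>lborel) < \<infinity>" "(\<integral>\<^sup>+x. ennreal (\<phi> x) \<partial>lborel) < \<infinity>"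
        using nn_integral_eq_integral[OF ki] nn_integral_eq_integral[OF Hs_L1[OF \<phi>(1)]] k0 \<phi>(2) by auto
      have "(\<integral>\<^sup>+z. ennreal (norm (f z)) \<partial>?P) \<le> (\<integral>\<^sup>+z. ennreal (k (fst z - snd z)) * ennreal (R * \<phi> (fst z)) \<partial>?P)"
      proof (intro nn_integral_mono)
        fix z
        have "\<bar>dq w z\<bar> \<le> R" unfolding dq_def using w(2,3)[of "fst z"] w(2,3)[of "snd z"] by linarith
        then have "norm (f z) \<le> k (fst z - snd z) * R * \<phi> (fst z)"
          unfolding f_def using k0 \<phi>(2) by (auto simp: abs_mult intro!: mult_right_mono mult_left_mono)
        then have "ennreal (norm (f z)) \<le> ennreal (k (fst z - snd z) * (R * \<phi> (fst z)))" by (intro ennreal_leI) (simp add: mult.assoc)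
        then show "ennreal (norm (f z)) \<le> ennreal (k (fst z - snd z)) * ennreal (R * \<phi> (fst z))"
          using k0 R0 \<phi>(2) by (simp add: ennreal_mult)
      qed
      also have "\<dots> = (\<integral>\<^sup>+x. \<integral>\<^sup>+y. ennreal (k (x - y)) * ennreal (R * \<phi> x) \<partial>lborel \<partial>lborel)"
        by (subst lborel.nn_integral_fst[symmetric]) auto
      also have "\<dots> = (\<integral>\<^sup>+x. (\<integral>\<^sup>+h. ennreal (k h) \<partial>lborel) * ennreal (R * \<phi> x) \<partial>lborel)"
        using nn_integral_reflect[of "\<lambda>h. ennreal (k h)"] by (simp add: nn_integral_multc)
      also have "\<dots> = (\<integral>\<^sup>+h. ennreal (k h) \<partial>lborel) * (ennreal R * (\<integral>\<^sup>+x. ennreal (\<phi> x) \<partial>lborel))"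
        using R0 \<phi>(2) by (simp add: nn_integral_cmult ennreal_mult)
      also have "\<dots> < \<infinity>" using kf by (simp add: ennreal_mult_less_top)
      finally show "(\<integral>\<^sup>+z. ennreal (norm (f z)) \<partial>?P) < \<infinity>" .
    qed
    have fi': "integrable ?P (\<lambda>z. f (snd z, fst z))"
      using lborel_pair.integrable_product_swap[OF fi] by (simp add: case_prod_beta')
    have fs: "(\<integral>z. f (snd z, fst z) \<partial>?P) = (\<integral>z. f z \<partial>?P)"
      using lborel_pair.integral_product_swap[OF fm] by (simp add: case_prod_beta')
    have "E n = (\<integral>z. kern s (fst z - snd z) *\<^sub>R (indicator (?D n) z * (dq w z * dq \<phi> z)) \<partial>?P)"
      unfolding E_def kap_def by (rule integral_density) auto
    also have "\<dots> = (\<integral>z. f z + f (snd z, fst z) \<partial>?P)"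
    proof (intro Bochner_Integration.integral_cong refl)
      fix z :: "'a \<times> 'a"
      have "kern s (fst z - snd z) *\<^sub>R (indicator (?D n) z * (dq w z * dq \<phi> z)) = k (fst z - snd z) * dq w z * dq \<phi> z"
        by (simp add: k_def kfar_def indicator_def)
      also have "\<dots> = f z + f (snd z, fst z)"
        unfolding f_def fst_conv snd_conv ks[of "snd z" "fst z"] by (simp add: dq_def algebra_simps)
      finally show "kern s (fst z - snd z) *\<^sub>R (indicator (?D n) z * (dq w z * dq \<phi> z)) = f z + f (snd z, fst z)" .
    qed
    also have "\<dots> = 2 * (\<integral>z. f z \<partial>?P)" using fi fi' fs by simp
    also have "(\<integral>z. f z \<partial>?P) = (\<integral>x. \<integral>y. f (x, y) \<partial>lborel \<partial>lborel)"
      by (rule lborel_pair.integral_fst'[OF fi, symmetric])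
    also have "\<dots> \<le> (\<integral>x. g x * \<phi> x \<partial>lborel)"
    proof (rule integral_mono[OF lborel_pair.integrable_fst'[OF fi] gi])
      fix x
      have "(\<integral>y. f (x, y) \<partial>lborel) = (\<integral>y. kfar s (e n) (x - y) * (w x - w y) \<partial>lborel) * \<phi> x"
        by (simp add: f_def k_def dq_def)
      also have "\<dots> \<le> g x * \<phi> x"
      proof (cases "x \<in> \<Omega>")
        case True
        then show ?thesis using e[of n] by (intro mult_right_mono bound \<phi>(2)) auto
      qed (simp add: Hs_outside[OF \<phi>(1)])
      finally show "(\<integral>y. f (x, y) \<partial>lborel) \<le> g x * \<phi> x" .
    qed
    finally show ?thesis by simp
  qed
  ultimately show ?thesis by (intro LIMSEQ_le_const2) auto
qed

text \<open>
  Up to scaling, the subsolution is the upper envelope of the paraboloids \<open>\<rho>\<^sup>2 - \<bar>x - a\<bar>\<^sup>2\<close> supported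
  in balls of radius \<open>\<rho>\<close> inside the domain; being a maximum of such functions makes its
  second differences bounded from below. Where it is small, its fractional Laplacian is negative.
\<close>

lemma subsolution_exists:
  assumes ball: "\<exists>\<rho>>0. \<forall>x\<in>\<Omega>. \<exists>a. x \<in> ball a \<rho> \<and> ball a \<rho> \<subseteq> \<Omega>" and q: "0 < q" "q < 1"
  shows "\<exists>lam>0. \<exists>w. weak_sub q lam w"
proof -
  obtain \<rho> where \<rho>: "0 < \<rho>" "\<forall>x\<in>\<Omega>. \<exists>a. x \<in> ball a \<rho> \<and> ball a \<rho> \<subseteq> \<Omega>" using ball by blast
  \<comment> \<open>The centres of all open balls of radius \<open>\<rho>\<close> in
    \<open>\<Omega>\<close>, described so that closedness is visible. Closedness makes the distance
    \<open>d\<close> to \<open>A\<close> attained, and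
    \<open>\<rho>\<^sup>2 - (min \<rho> d)\<^sup>2\<close> is the envelope of the
    paraboloids.\<close>
  define A where "A = {a. \<forall>y. y \<notin> \<Omega> \<longrightarrow> \<rho> \<le> dist a y}"
  define d where "d x = infdist x A" for x
  have inA: "a \<in> A" if "ball a \<rho> \<subseteq> \<Omega>" for a
  proof -
    have "\<rho> \<le> dist a y" if "y \<notin> \<Omega>" for y
    proof (rule ccontr)
      assume "\<not> \<rho> \<le> dist a y"
      then have "y \<in> ball a \<rho>" by simp
      then show False using that \<open>ball a \<rho> \<subseteq> \<Omega>\<close> by blast
    qed
    then show ?thesis by (simp add: A_def)
  qed
  have Ane: "A \<noteq> {}" using \<rho>(2) dom(3) inA by blast
  have clA: "closed A"
  proof -
    have "A = (\<Inter>y\<in>-\<Omega>. {a. \<rho> \<le> dist a y})" by (auto simp: A_def)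
    then show ?thesis by (auto intro!: closed_Collect_le continuous_intros)
  qed
  have d0: "0 \<le> d x" for x by (simp add: d_def infdist_nonneg)
  have d_in: "d x < \<rho>" if x: "x \<in> \<Omega>" for x
  proof -
    obtain a where a: "x \<in> ball a \<rho>" "ball a \<rho> \<subseteq> \<Omega>" using bspec[OF \<rho>(2) x] by blast
    have "d x \<le> dist x a" unfolding d_def by (rule infdist_le[OF inA[OF a(2)]])
    then show ?thesis using a(1) by (simp add: dist_commute)
  qed
  have att: "\<exists>a\<in>A. d x = dist x a" for x using infdist_attains_inf[OF clA Ane] unfolding d_def by blast
  have d_out: "\<rho> \<le> d x" if "x \<notin> \<Omega>" for x
    using att[of x] that by (auto simp: A_def dist_commute)
  define w where "w x = \<rho>\<^sup>2 - (min \<rho> (d x))\<^sup>2" for x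
  have wle: "w x \<le> \<rho>\<^sup>2" for x by (simp add: w_def)
  have w0: "0 \<le> w x" for x unfolding w_def using d0[of x] \<rho>(1) by (auto intro!: power_mono)
  have w_out: "w x = 0" if "x \<notin> \<Omega>" for x using d_out[OF that] by (simp add: w_def)
  have w_pos: "0 < w x" if "x \<in> \<Omega>" for x
  proof -
    have "(d x)\<^sup>2 < \<rho>\<^sup>2" using d_in[OF that] d0[of x] by (intro power_strict_mono) auto
    then show ?thesis using d_in[OF that] by (simp add: w_def)
  qed
  have lip: "\<bar>w x - w y\<bar> \<le> 2 * \<rho> * norm (x - y)" for x y
  proof -
    let ?a = "min \<rho> (d x)" let ?b = "min \<rho> (d y)"
    have "w x - w y = (?b + ?a) * (?b - ?a)" by (simp add: w_def power2_eq_square algebra_simps)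
    then have "\<bar>w x - w y\<bar> = (?b + ?a) * \<bar>?b - ?a\<bar>" using d0[of x] d0[of y] \<rho>(1) by (simp add: abs_mult)
    also have "\<dots> \<le> (2 * \<rho>) * norm (x - y)"
    proof (rule mult_mono)
      have "\<bar>d x - d y\<bar> \<le> norm (x - y)" unfolding d_def dist_norm[symmetric] by (rule infdist_triangle_abs)
      then show "\<bar>?b - ?a\<bar> \<le> norm (x - y)" by (auto simp: min_def)
    qed (use \<rho>(1) in auto)
    finally show ?thesis .
  qed
  have wH: "w \<in> H" by (rule lipschitz_in_Hs[OF lip w_out])
  have wm [measurable]: "w \<in> borel_measurable borel" by (rule HsD(1)[OF wH])
  have low: "\<rho>\<^sup>2 - (dist x a)\<^sup>2 \<le> w x" if "a \<in> A" for x a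
  proof -
    have "min \<rho> (d x) \<le> dist x a" using infdist_le[OF that, of x] unfolding d_def by (rule min.coboundedI2)
    then have "(min \<rho> (d x))\<^sup>2 \<le> (dist x a)\<^sup>2" using \<rho>(1) d0[of x] by (intro power_mono) auto
    then show ?thesis by (simp add: w_def)
  qed
  have semi: "2 * w x - w (x + h) - w (x - h) \<le> 2 * (norm h)\<^sup>2" for x h
  proof (cases "x \<in> \<Omega>")
    case True
    obtain a where a: "a \<in> A" "d x = dist x a" using att by blast
    have wx: "w x = \<rho>\<^sup>2 - (dist x a)\<^sup>2" using d_in[OF True] a by (simp add: w_def)
    have "(dist (x + h) a)\<^sup>2 + (dist (x - h) a)\<^sup>2 = 2 * (dist x a)\<^sup>2 + 2 * (norm h)\<^sup>2"
      unfolding dist_norm power2_norm_eq_inner by (simp add: inner_simps inner_commute algebra_simps)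
    then show ?thesis using low[OF a(1), of "x + h"] low[OF a(1), of "x - h"] wx by linarith
  next
    case False
    then show ?thesis using w_out w0[of "x + h"] w0[of "x - h"] zero_le_power2[of "norm h"] by (smt (verit))
  qed
  have W: "0 < (\<integral>x. w x \<partial>lborel)" by (rule integral_pos[OF Hs_L1[OF wH] w0 w_pos])
  obtain K m \<eta> where K: "0 < K" "0 < m" "0 < \<eta>"
    "\<forall>x\<in>\<Omega>. \<forall>\<delta>>0. \<delta> \<le> \<eta> \<longrightarrow> (\<integral>y. kfar s \<delta> (x - y) * (w x - w y) \<partial>lborel) \<le> K * w x - m"
    using fractional_laplacian_upper_bound[OF wm w0 wle w_out semi W] by blast
  \<comment> \<open>Chosen such that \<open>K * w \<le> m * (b * w) powr q\<close>, where
    \<open>w \<le> \<rho>\<^sup>2\<close> trades the factor \<open>w powr (1 - q)\<close> for a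
    constant. Multiplying \<open>w\<close> by \<open>b\<close> and doubling as in
    \<open>form_le_of_pointwise_bound\<close> then gives the parameter
    \<open>2 * b * m\<close>.\<close>
  define b where "b = (K * (\<rho>\<^sup>2) powr (1 - q) / m) powr (1 / q)"
  have b: "0 < b" using K \<rho>(1) by (simp add: b_def)
  have bq: "m * b powr q = K * (\<rho>\<^sup>2) powr (1 - q)" using K \<rho>(1) q by (simp add: b_def powr_powr)
  have key: "K * w x \<le> m * (b * w x) powr q" if "x \<in> \<Omega>" for x
  proof -
    have "w x = w x powr (1 - q) * w x powr q" using w_pos[OF that] by (simp flip: powr_add)
    also have "\<dots> \<le> (\<rho>\<^sup>2) powr (1 - q) * w x powr q" using w_pos[OF that] wle q by (intro mult_right_mono powr_mono2) auto
    finally have "K * w x \<le> K * (\<rho>\<^sup>2) powr (1 - q) * w x powr q" using K by (simp add: mult.assoc)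
    also have "\<dots> = m * (b * w x) powr q" using b w0 bq by (simp add: powr_mult)
    finally show ?thesis .
  qed
  let ?u = "\<lambda>x. b * w x"
  have uH: "?u \<in> H" by (rule Hs_cmult[OF wH])
  have "F ?u \<phi> \<le> 2 * b * m * (\<integral>x. (?u x powr q - 1) * \<phi> x \<partial>lborel)" if \<phi>: "\<phi> \<in> H" "\<forall>x. 0 \<le> \<phi> x" for \<phi>
  proof -
    have i1: "integrable lborel (\<lambda>x. (K * w x - m) * \<phi> x)"
      using Hs_mult_L1[OF wH \<phi>(1)] Hs_L1[OF \<phi>(1)] by (simp add: left_diff_distrib mult.assoc)
    have i2: "integrable lborel (\<lambda>x. (?u x powr q - 1) * \<phi> x)"
      using integrable_powr_weight[OF _ _ uH _ \<phi>(1), of q] Hs_L1[OF \<phi>(1)] q b w0 by (simp add: left_diff_distrib)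
    have "F w \<phi> \<le> 2 * (\<integral>x. (K * w x - m) * \<phi> x \<partial>lborel)"
      using K(4) \<phi>(2) by (intro form_le_of_pointwise_bound[OF wH w0 wle \<phi>(1) _ K(3) _ i1]) auto
    also have "(\<integral>x. (K * w x - m) * \<phi> x \<partial>lborel) \<le> (\<integral>x. m * ((?u x powr q - 1) * \<phi> x) \<partial>lborel)"
    proof (rule integral_mono[OF i1])
      show "integrable lborel (\<lambda>x. m * ((?u x powr q - 1) * \<phi> x))" using i2 by (intro integrable_mult_right)
      show "(K * w x - m) * \<phi> x \<le> m * ((?u x powr q - 1) * \<phi> x)" for x
      proof (cases "x \<in> \<Omega>")
        case True
        have "(K * w x - m) * \<phi> x \<le> (m * ?u x powr q - m) * \<phi> x" using key[OF True] \<phi>(2) by (intro mult_right_mono) auto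
        then show ?thesis by (simp add: algebra_simps)
      qed (simp add: Hs_outside[OF \<phi>(1)])
    qed
    finally have "b * F w \<phi> \<le> b * (2 * (m * (\<integral>x. (?u x powr q - 1) * \<phi> x \<partial>lborel)))"
      using b by (intro mult_left_mono) auto
    then show ?thesis by (simp add: form_cmult mult_ac)
  qed
  then have "weak_sub q (2 * b * m) ?u" unfolding weak_sub_def using uH b w_pos by auto
  moreover have "0 < 2 * b * m" using b K by simp
  ultimately show ?thesis by blast
qed

end

section \<open>Weak solutions\<close>

lemma lebesgue_transfer:
  fixes f g :: "'b::euclidean_space \<Rightarrow> real"
  assumes g: "g \<in> borel_measurable borel" and ae: "AE x in lborel. f x = g x"
  shows "f \<in> borel_measurable lebesgue" and "integrable lebesgue f \<longleftrightarrow> integrable lborel g"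
    and "(\<integral>x. f x \<partial>lebesgue) = (\<integral>x. g x \<partial>lborel)"
proof -
  have gm: "g \<in> borel_measurable lborel" using g by simp
  have gl: "g \<in> borel_measurable lebesgue" by (rule measurable_completion[OF gm])
  have ae': "AE x in lebesgue. f x = g x" by (rule AE_completion[OF ae])
  show fl: "f \<in> borel_measurable lebesgue"
    by (rule borel_measurable_AE[OF gl]) (use ae' in \<open>eventually_elim, simp\<close>)
  show "integrable lebesgue f \<longleftrightarrow> integrable lborel g"
    using integrable_cong_AE[OF fl gl ae'] integrable_completion[OF gm] by simp
  show "(\<integral>x. f x \<partial>lebesgue) = (\<integral>x. g x \<partial>lborel)"
    using integral_cong_AE[OF fl gl ae'] integral_completion[OF gm] by simp
qed

lemma kap_integral:
  fixes G :: "'a::euclidean_space \<times> 'a \<Rightarrow> real"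
  assumes [measurable]: "G \<in> borel_measurable (lborel \<Otimes>\<^sub>M lborel)"
  shows "integrable (kap s) G \<longleftrightarrow> integrable lborel (\<lambda>z. kern s (fst z - snd z) * G z)"
    and "(\<integral>z. G z \<partial>kap s) = (\<integral>z. kern s (fst z - snd z) * G z \<partial>lborel)"
  unfolding kap_def lborel_prod[symmetric]
  by (subst integrable_density, auto) (subst integral_density, auto)

lemma kern_eq_inverse: "kern s (h::'a::euclidean_space) = inverse (norm h powr (real DIM('a) + 2 * s))"
  by (simp only: kern_def powr_minus)

lemma C_const_pos: "0 < s \<Longrightarrow> s < 1 \<Longrightarrow> 0 < C_const TYPE('a::euclidean_space) s"
  unfolding C_const_def by (intro divide_pos_pos mult_pos_pos Gamma_real_pos) (auto intro: add_pos_pos)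

context fractional_domain begin

lemma gagliardo_transfer:
  fixes f :: "'a \<times> 'a \<Rightarrow> real"
  assumes v: "v \<in> borel_measurable borel" "\<And>x. x \<notin> \<Omega> \<Longrightarrow> v x = 0" and \<phi>: "\<phi> \<in> borel_measurable borel" "\<And>x. x \<notin> \<Omega> \<Longrightarrow> \<phi> x = 0"
    and f: "AE z in lborel \<Otimes>\<^sub>M lborel. f z = dq v z * dq \<phi> z / norm (fst z - snd z) powr (real DIM('a) + 2 * s)"
  shows "set_integrable lebesgue (Q_set \<Omega>) f \<longleftrightarrow> integrable (kap s) (\<lambda>z. dq v z * dq \<phi> z)"
    and "set_lebesgue_integral lebesgue (Q_set \<Omega>) f = F v \<phi>"
proof -
  have [measurable]: "v \<in> borel_measurable borel" "\<phi> \<in> borel_measurable borel" using v \<phi> by auto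
  let ?g = "\<lambda>z. kern s (fst z - snd z) * (dq v z * dq \<phi> z)"
  have "?g \<in> borel_measurable (lborel \<Otimes>\<^sub>M lborel)" by measurable
  then have gm: "?g \<in> borel_measurable borel" by (simp add: lborel_prod)
  have "AE z in lborel \<Otimes>\<^sub>M lborel. indicator (Q_set \<Omega>) z *\<^sub>R f z = ?g z"
    using f
  proof eventually_elim
    case (elim z)
    show ?case
    proof (cases "z \<in> Q_set \<Omega>")
      case True
      then show ?thesis using elim by (simp add: kern_eq_inverse divide_inverse mult.commute)
    next
      case False
      then have "fst z \<notin> \<Omega>" "snd z \<notin> \<Omega>" by (auto simp: Q_set_def mem_Times_iff)
      then show ?thesis using False v(2) by (simp add: dq_def)
    qed
  qed
  then have ae: "AE z in lborel. indicator (Q_set \<Omega>) z *\<^sub>R f z = ?g z" by (simp only: lborel_prod)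
  have "(\<lambda>z. dq v z * dq \<phi> z) \<in> borel_measurable (lborel \<Otimes>\<^sub>M lborel)" by measurable
  note k = kap_integral[OF this, of s]
  show "set_integrable lebesgue (Q_set \<Omega>) f \<longleftrightarrow> integrable (kap s) (\<lambda>z. dq v z * dq \<phi> z)"
    unfolding set_integrable_def lebesgue_transfer(2)[OF gm ae] k(1) ..
  show "set_lebesgue_integral lebesgue (Q_set \<Omega>) f = F v \<phi>"
    unfolding set_lebesgue_integral_def lebesgue_transfer(3)[OF gm ae] form_def k(2) ..
qed

lemma energy_form_eq:
  assumes v: "v \<in> H" and \<phi>: "\<phi> \<in> H" and uv: "AE x in lborel. u x = v x"
  shows "energy_form s \<Omega> u \<phi> = C_const TYPE('a) s * F v \<phi>"
proof -
  have "AE z in lborel \<Otimes>\<^sub>M lborel. (\<lambda>(x, y). (u x - u y) * (\<phi> x - \<phi> y) / norm (x - y) powr (real DIM('a) + 2 * s)) z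
      = dq v z * dq \<phi> z / norm (fst z - snd z) powr (real DIM('a) + 2 * s)"
    using AE_pairI[OF uv] by eventually_elim (auto simp: dq_def)
  from gagliardo_transfer(2)[OF HsD(1,2)[OF v] HsD(1,2)[OF \<phi>] this]
  show ?thesis unfolding energy_form_def by simp
qed

lemma Xs0_of_Hs:
  assumes v: "v \<in> H" and uv: "AE x in lborel. u x = v x"
  shows "u \<in> Xs0 s \<Omega>"
proof -
  have [measurable]: "v \<in> borel_measurable borel" by (rule HsD(1)[OF v])
  have "AE z in lborel \<Otimes>\<^sub>M lborel. (\<lambda>(x, y). \<bar>u x - u y\<bar>\<^sup>2 / norm (x - y) powr (real DIM('a) + 2 * s)) z
      = dq v z * dq v z / norm (fst z - snd z) powr (real DIM('a) + 2 * s)"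
    using AE_pairI[OF uv] by eventually_elim (auto simp: dq_def power2_eq_square)
  note g = gagliardo_transfer(1)[OF HsD(1,2)[OF v] HsD(1,2)[OF v] this]
  have "AE x in lborel. indicator \<Omega> x *\<^sub>R (u x)\<^sup>2 = (v x)\<^sup>2"
    using uv by eventually_elim (auto simp: indicator_def Hs_outside[OF v])
  then have "set_integrable lebesgue \<Omega> (\<lambda>x. (u x)\<^sup>2)"
    unfolding set_integrable_def by (subst lebesgue_transfer(2)) (use Hs_L2[OF v] in auto)
  moreover have "u \<in> borel_measurable lebesgue" by (rule lebesgue_transfer(1)[OF HsD(1)[OF v] uv])
  moreover have "AE x in lebesgue. x \<notin> \<Omega> \<longrightarrow> u x = 0"
    using AE_completion[OF uv] by eventually_elim (simp add: Hs_outside[OF v])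
  ultimately show ?thesis
    unfolding Xs0_def Xs_def using g HsD(3)[OF v] by (simp add: power2_eq_square)
qed

lemma Hs_of_Xs0:
  assumes u: "u \<in> Xs0 s \<Omega>" and pos: "\<forall>x\<in>\<Omega>. 0 < u x"
  shows "\<exists>v\<in>H. (\<forall>x\<in>\<Omega>. 0 < v x) \<and> (AE x in lborel. u x = v x)"
proof -
  have um: "u \<in> borel_measurable lebesgue" and uz: "AE x in lebesgue. x \<notin> \<Omega> \<longrightarrow> u x = 0"
    and ui: "set_integrable lebesgue (Q_set \<Omega>) (\<lambda>(x, y). \<bar>u x - u y\<bar>\<^sup>2 / norm (x - y) powr (real DIM('a) + 2 * s))"
    using u by (auto simp: Xs0_def Xs_def)
  obtain g where g [measurable]: "g \<in> borel_measurable borel" "AE x in lborel. u x = g x"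
    using completion_ex_borel_measurable_real[OF um] by auto
  \<comment> \<open>The value \<open>1\<close> is an arbitrary positive one: it fills the null set
    of points of \<open>\<Omega>\<close> where the Borel representative fails to be
    positive.\<close>
  define v where "v x = (if x \<in> \<Omega> then if 0 < g x then g x else 1 else 0)" for x
  have vm [measurable]: "v \<in> borel_measurable borel" unfolding v_def[abs_def] by measurable
  have v0: "v x = 0" if "x \<notin> \<Omega>" for x using that by (simp add: v_def)
  have "AE x in lborel. x \<notin> \<Omega> \<longrightarrow> u x = 0" using uz by (simp add: AE_completion_iff)
  with g(2) have uv: "AE x in lborel. u x = v x"
    by eventually_elim (use pos in \<open>auto simp: v_def\<close>)
  have "AE z in lborel \<Otimes>\<^sub>M lborel. (\<lambda>(x, y). \<bar>u x - u y\<bar>\<^sup>2 / norm (x - y) powr (real DIM('a) + 2 * s)) z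
      = dq v z * dq v z / norm (fst z - snd z) powr (real DIM('a) + 2 * s)"
    using AE_pairI[OF uv] by eventually_elim (auto simp: dq_def power2_eq_square)
  from gagliardo_transfer(1)[OF vm v0 vm v0 this] ui
  have "v \<in> H" using vm v0 by (simp add: Hs_def power2_eq_square)
  moreover have "\<forall>x\<in>\<Omega>. 0 < v x" by (simp add: v_def)
  ultimately show ?thesis using uv by blast
qed

lemma reaction_integral_eq:
  fixes f :: "real \<Rightarrow> real"
  assumes v: "v \<in> H" and \<phi>: "\<phi> \<in> H" and uv: "AE x in lborel. u x = v x" and [measurable]: "f \<in> borel_measurable borel"
  shows "(LINT x:\<Omega>|lebesgue. f (u x) * \<phi> x) = (\<integral>x. f (v x) * \<phi> x \<partial>lborel)"
proof -
  have [measurable]: "v \<in> borel_measurable borel" "\<phi> \<in> borel_measurable borel" using HsD(1) v \<phi> by auto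
  have "AE x in lborel. indicator \<Omega> x *\<^sub>R (f (u x) * \<phi> x) = f (v x) * \<phi> x"
    using uv by eventually_elim (auto simp: indicator_def Hs_outside[OF \<phi>])
  then show ?thesis unfolding set_lebesgue_integral_def by (intro lebesgue_transfer(3)) auto
qed

lemma weak_solution_of_solves:
  assumes v: "solves q r (lam / C_const TYPE('a) s) (\<mu> / C_const TYPE('a) s) v"
    and w: "\<forall>x\<in>\<Omega>. 0 < w x" "AE x in lborel. w x \<le> v x"
  shows "\<exists>u. weak_solution s q r \<Omega> lam \<mu> u \<and> (AE x in lborel. u x = v x)"
proof -
  let ?C = "C_const TYPE('a) s"
  have C: "0 < ?C" using s by (rule C_const_pos)
  have vH: "v \<in> H" and eq: "\<forall>\<phi>\<in>H. F v \<phi> = lam / ?C * (\<integral>x. (v x powr q - 1) * \<phi> x \<partial>lborel) + \<mu> / ?C * (\<integral>x. v x powr r * \<phi> x \<partial>lborel)"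
    using v by (auto simp: solves_def)
  \<comment> \<open>\<open>v\<close> lies above \<open>w\<close> only almost everywhere, but
    positivity is required at every point of \<open>\<Omega>\<close>; the maximum with
    \<open>w\<close> repairs this on a null set.\<close>
  define u where "u x = (if x \<in> \<Omega> then max (v x) (w x) else 0)" for x
  have uv: "AE x in lborel. u x = v x"
    using w(2) by eventually_elim (auto simp: u_def Hs_outside[OF vH])
  have "energy_form s \<Omega> u \<phi> = lam * (LINT x:\<Omega>|lebesgue. (u x powr q - 1) * \<phi> x) + \<mu> * (LINT x:\<Omega>|lebesgue. u x powr r * \<phi> x)"
    if "test_function \<Omega> \<phi>" for \<phi>
  proof -
    have \<phi>: "\<phi> \<in> H" by (rule test_function_in_Hs[OF that])
    show ?thesis
      unfolding energy_form_eq[OF vH \<phi> uv] reaction_integral_eq[OF vH \<phi> uv, of "\<lambda>t. t powr q - 1", simplified]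
        reaction_integral_eq[OF vH \<phi> uv, of "\<lambda>t. t powr r", simplified]
      using eq \<phi> C by (simp add: field_simps)
  qed
  moreover have "\<forall>x\<in>\<Omega>. 0 < u x" using w(1) by (auto simp: u_def less_max_iff_disj)
  ultimately have "weak_solution s q r \<Omega> lam \<mu> u"
    unfolding weak_solution_def using Xs0_of_Hs[OF vH uv] by blast
  then show ?thesis using uv by blast
qed

text \<open>Each function is the limit almost everywhere of the constant sequence of the other, so
  lower semicontinuity gives both inequalities.\<close>

lemma form_cong_AE:
  assumes u: "u \<in> H" and v: "v \<in> H" and uv: "AE x in lborel. u x = v x"
  shows "F u u = F v v"
proof -
  have "AE x in lborel. (\<lambda>n::nat. u x) \<longlonglongrightarrow> v x" "AE x in lborel. (\<lambda>n::nat. v x) \<longlonglongrightarrow> u x"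
    using uv by (auto elim!: eventually_mono)
  then show ?thesis
    using Hs_limit(2)[of "\<lambda>_. u" s \<Omega> "F u u" v, OF u order_refl _ HsD(1,2)[OF v]]
      Hs_limit(2)[of "\<lambda>_. v" s \<Omega> "F v v" u, OF v order_refl _ HsD(1,2)[OF u]] by fastforce
qed

end

section \<open>The problem without superlinear term, tested with functions of finite energy\<close>

context hardy_domain begin

text \<open>The difference of the two sides is continuous along sequences of bounded energy that
  converge almost everywhere, and it vanishes on test functions; \<open>density\<close> extends this
  to \<open>H\<close>.\<close>

lemma weak_solution_0_equation:
  assumes u: "weak_solution_0 s q \<Omega> lam u" and q: "0 < q" "q < 1"
  shows "\<exists>v\<in>H. (\<forall>x\<in>\<Omega>. 0 < v x) \<and> (\<forall>\<phi>\<in>H. F v \<phi> = lam / C_const TYPE('a) s * (\<integral>x. (v x powr q - 1) * \<phi> x \<partial>lborel))"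
proof -
  let ?C = "C_const TYPE('a) s"
  have C: "0 < ?C" using s by (rule C_const_pos)
  have uX: "u \<in> Xs0 s \<Omega>" "\<forall>x\<in>\<Omega>. 0 < u x"
    and eq: "\<And>\<phi>. test_function \<Omega> \<phi> \<Longrightarrow> energy_form s \<Omega> u \<phi> = lam * (LINT x:\<Omega>|lebesgue. (u x powr q - 1) * \<phi> x)"
    using u by (auto simp: weak_solution_0_def)
  obtain v where v: "v \<in> H" "\<forall>x\<in>\<Omega>. 0 < v x" "AE x in lborel. u x = v x" using Hs_of_Xs0[OF uX] by blast
  have vm [measurable]: "v \<in> borel_measurable borel" by (rule HsD(1)[OF v(1)])
  \<comment> \<open>Off \<open>\<Omega>\<close> the factor \<open>v powr q - 1\<close> is
    \<open>-1\<close>; the indicator removes it, so that \<open>h\<close> is integrable. Inside, the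
    product with \<open>t\<close> is bounded by a sum of squares, and the growth exponent
    \<open>2\<close> is below the critical one.\<close>
  define g where "g x t = indicator \<Omega> x * ((v x powr q - 1) * t)" for x and t :: real
  define h where "h x = 2 * indicator \<Omega> x + 2 * (v x)\<^sup>2" for x
  have v0: "0 \<le> v x" for x using v(2) Hs_outside[OF v(1), of x] by (cases "x \<in> \<Omega>") (auto intro: less_imp_le)
  have bound: "\<bar>g x t\<bar> \<le> 1 * \<bar>t\<bar> powr 2 + h x" for x t
  proof (cases "x \<in> \<Omega>")
    case True
    let ?a = "v x powr q - 1"
    have "v x powr q \<le> 1 + v x" using v0[of x] q by (intro powr_le_1_plus) auto
    moreover have "0 \<le> v x powr q" by simp
    ultimately have "\<bar>?a\<bar> \<le> 1 + v x" using v0[of x] by linarith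
    then have "?a\<^sup>2 \<le> (1 + v x)\<^sup>2" using v0[of x] by (intro abs_le_square_iff[THEN iffD1]) auto
    also have "\<dots> \<le> 2 + 2 * (v x)\<^sup>2" using zero_le_power2[of "1 - v x"] by (simp add: power2_eq_square algebra_simps)
    finally have "?a\<^sup>2 \<le> h x" using True by (simp add: h_def)
    moreover have "\<bar>?a * t\<bar> \<le> t\<^sup>2 + ?a\<^sup>2"
    proof -
      have "2 * (\<bar>?a\<bar> * \<bar>t\<bar>) \<le> ?a\<^sup>2 + t\<^sup>2" using sum_squares_bound[of "\<bar>?a\<bar>" "\<bar>t\<bar>"] by (simp add: mult.assoc)
      moreover have "0 \<le> \<bar>?a\<bar> * \<bar>t\<bar>" by simp
      ultimately show ?thesis unfolding abs_mult by linarith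
    qed
    moreover have "\<bar>t\<bar> powr 2 = t\<^sup>2" by (cases "t = 0") auto
    ultimately show ?thesis using True by (simp add: g_def)
  qed (simp add: g_def h_def)
  have geq: "(\<integral>x. g x (\<phi> x) \<partial>lborel) = (\<integral>x. (v x powr q - 1) * \<phi> x \<partial>lborel)" if "\<phi> \<in> H" for \<phi>
    using Hs_outside[OF that] by (intro Bochner_Integration.integral_cong) (auto simp: g_def indicator_def)
  have hi: "integrable lborel h"
    unfolding h_def[abs_def] using integrable_indicator_dom Hs_L2[OF v(1)] by auto
  define \<Psi> where "\<Psi> \<phi> = F v \<phi> - lam / ?C * (\<integral>x. g x (\<phi> x) \<partial>lborel)" for \<phi>
  have "\<Psi> \<phi> = 0" if \<phi>: "\<phi> \<in> H" for \<phi>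
  proof (rule density[OF _ _ \<phi>])
    fix \<phi> assume \<phi>: "\<phi> \<in> H" and t: "test_function \<Omega> \<phi>"
    have "?C * F v \<phi> = lam * (\<integral>x. (v x powr q - 1) * \<phi> x \<partial>lborel)"
      using eq[OF t] unfolding energy_form_eq[OF v(1) \<phi> v(3)]
        reaction_integral_eq[OF v(1) \<phi> v(3), of "\<lambda>t. t powr q - 1", simplified] .
    then show "\<Psi> \<phi> = 0" using C by (simp add: \<Psi>_def geq[OF \<phi>] field_simps)
  next
    fix f u B assume f: "\<And>n. f n \<in> H" "\<And>n. F (f n) (f n) \<le> B" "AE x in lborel. (\<lambda>n. f n x) \<longlonglongrightarrow> u x" "u \<in> H"
    have "(\<lambda>n. F v (f n)) \<longlonglongrightarrow> F v u" by (rule form_tendsto[OF f v(1)])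
    moreover have "(\<lambda>n. \<integral>x. g x (f n x) \<partial>lborel) \<longlonglongrightarrow> (\<integral>x. g x (u x) \<partial>lborel)"
    proof (rule nemytskii_tendsto[OF _ crit_gt_2 _ hi _ _ bound f])
      show "(\<lambda>x. g x (u x)) \<in> borel_measurable borel" if [measurable]: "u \<in> borel_measurable borel" for u
        unfolding g_def by measurable
      show "isCont (g x) t" for x t unfolding g_def[abs_def] by (intro continuous_intros)
    qed auto
    ultimately show "(\<lambda>n. \<Psi> (f n)) \<longlonglongrightarrow> \<Psi> u" unfolding \<Psi>_def by (intro tendsto_intros)
  qed
  then have "\<forall>\<phi>\<in>H. F v \<phi> = lam / ?C * (\<integral>x. (v x powr q - 1) * \<phi> x \<partial>lborel)"
    by (simp add: \<Psi>_def geq)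
  then show ?thesis using v by blast
qed

lemma weak_solution_0_parameter_bound:
  assumes q: "0 < q" "q < 1"
  shows "\<exists>c>0. \<forall>lam u. 0 < lam \<longrightarrow> weak_solution_0 s q \<Omega> lam u \<longrightarrow> c \<le> lam"
proof -
  let ?C = "C_const TYPE('a) s"
  have C: "0 < ?C" using s by (rule C_const_pos)
  obtain c where c: "0 < c" "\<forall>u\<in>H. c * (\<integral>x. (u x)\<^sup>2 \<partial>lborel) \<le> F u u" using poincare by blast
  have "c * ?C \<le> lam" if lam: "0 < lam" and u: "weak_solution_0 s q \<Omega> lam u" for lam u
  proof -
    obtain v where v: "v \<in> H" "\<forall>x\<in>\<Omega>. 0 < v x" "\<forall>\<phi>\<in>H. F v \<phi> = lam / ?C * (\<integral>x. (v x powr q - 1) * \<phi> x \<partial>lborel)"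
      using weak_solution_0_equation[OF u q] by blast
    have v0: "0 \<le> v x" for x using v(2) Hs_outside[OF v(1), of x] by (cases "x \<in> \<Omega>") (auto intro: less_imp_le)
    let ?I = "\<integral>x. (v x)\<^sup>2 \<partial>lborel"
    have i: "integrable lborel (\<lambda>x. (v x powr q - 1) * v x)"
      using integrable_powr_weight[OF _ _ v(1) v0 v(1), of q] Hs_L1[OF v(1)] q by (simp add: left_diff_distrib)
    have "(\<integral>x. (v x powr q - 1) * v x \<partial>lborel) \<le> ?I"
    proof (rule integral_mono[OF i Hs_L2[OF v(1)]])
      fix x
      have "v x powr q - 1 \<le> v x" using powr_le_1_plus[of "v x" q] v0[of x] q by simp
      then show "(v x powr q - 1) * v x \<le> (v x)\<^sup>2" unfolding power2_eq_square using v0 by (rule mult_right_mono)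
    qed
    then have "lam / ?C * (\<integral>x. (v x powr q - 1) * v x \<partial>lborel) \<le> lam / ?C * ?I"
      using lam C by (intro mult_left_mono) auto
    then have le: "c * ?I \<le> lam / ?C * ?I" using c(2) v(1,3) by fastforce
    have "0 < ?I" by (rule integral_pos[OF Hs_L2[OF v(1)]]) (use v(2) in force)+
    then have "c \<le> lam / ?C" using le by (simp only: mult_le_cancel_right_pos)
    then show ?thesis using C by (simp add: field_simps)
  qed
  then show ?thesis using c C by (intro exI[of _ "c * ?C"]) auto
qed

text \<open>Multiplication by \<open>t = lam' / lam\<close> turns the factor \<open>lam\<close> into
  \<open>lam'\<close>, while \<open>t > 1\<close> only increases the power on the right-hand
  side.\<close>

lemma weak_sub_of_weak_solution_0:
  assumes u: "weak_solution_0 s q \<Omega> lam u" and q: "0 < q" "q < 1" and lam: "0 < lam" "lam < lam'"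
  shows "\<exists>w. weak_sub q (lam' / C_const TYPE('a) s) w"
proof -
  let ?C = "C_const TYPE('a) s"
  have C: "0 < ?C" using s by (rule C_const_pos)
  obtain v where v: "v \<in> H" "\<forall>x\<in>\<Omega>. 0 < v x" "\<forall>\<phi>\<in>H. F v \<phi> = lam / ?C * (\<integral>x. (v x powr q - 1) * \<phi> x \<partial>lborel)"
    using weak_solution_0_equation[OF u q] by blast
  have v0: "0 \<le> v x" for x using v(2) Hs_outside[OF v(1), of x] by (cases "x \<in> \<Omega>") (auto intro: less_imp_le)
  define t where "t = lam' / lam"
  have t: "1 < t" "t * lam = lam'" using lam by (auto simp: t_def)
  let ?w = "\<lambda>x. t * v x"
  have wH: "?w \<in> H" by (rule Hs_cmult[OF v(1)])
  have "F ?w \<phi> \<le> lam' / ?C * (\<integral>x. (?w x powr q - 1) * \<phi> x \<partial>lborel)" if \<phi>: "\<phi> \<in> H" "\<forall>x. 0 \<le> \<phi> x" for \<phi>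
  proof -
    have "F ?w \<phi> = lam' / ?C * (\<integral>x. (v x powr q - 1) * \<phi> x \<partial>lborel)"
      using v(3) \<phi>(1) t(2) by (simp add: form_cmult flip: mult.assoc times_divide_eq_right)
    also have "\<dots> \<le> lam' / ?C * (\<integral>x. (?w x powr q - 1) * \<phi> x \<partial>lborel)"
    proof (intro mult_left_mono integral_mono)
      show "integrable lborel (\<lambda>x. (v x powr q - 1) * \<phi> x)"
        using integrable_powr_weight[OF _ _ v(1) v0 \<phi>(1), of q] Hs_L1[OF \<phi>(1)] q by (simp add: left_diff_distrib)
      show "integrable lborel (\<lambda>x. (?w x powr q - 1) * \<phi> x)"
        using integrable_powr_weight[OF _ _ wH _ \<phi>(1), of q] Hs_L1[OF \<phi>(1)] q t v0 by (simp add: left_diff_distrib)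
      show "(v x powr q - 1) * \<phi> x \<le> (?w x powr q - 1) * \<phi> x" for x
      proof -
        have "v x \<le> t * v x" using mult_right_mono[of 1 t "v x"] t v0[of x] by simp
        then have "v x powr q \<le> (t * v x) powr q" using q v0 by (intro powr_mono2) auto
        then show ?thesis using \<phi>(2) by (intro mult_right_mono) auto
      qed
      show "0 \<le> lam' / ?C" using lam C by simp
    qed
    finally show ?thesis .
  qed
  then have "weak_sub q (lam' / ?C) ?w" unfolding weak_sub_def using wH v(2) t by auto
  then show ?thesis by blast
qed

end

theorem theorem1p2:
  fixes s q :: real and \<Omega> :: "(real ^ 'n) set"
  assumes "0 < s" and "s < 1"
    and "real CARD('n) > 2 * s"
    and "0 < q" and "q < 1"
    and "open \<Omega>" and "connected \<Omega>" and "\<Omega> \<noteq> {}"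
    and "bounded \<Omega>"
    and "C11_boundary \<Omega>"
  shows "0 < lambda0 s q \<Omega> \<and> lambda0 s q \<Omega> < \<infinity> \<and>
    (\<forall>r lam :: real.
       1 < r \<and> r \<le> (real CARD('n) + 2 * s) / (real CARD('n) - 2 * s) \<and> lambda0 s q \<Omega> < ereal lam \<longrightarrow>
       (\<exists>\<mu>0>0. \<forall>\<mu>. 0 < \<mu> \<and> \<mu> < \<mu>0 \<longrightarrow>
          (\<exists>u. weak_solution s q r \<Omega> lam \<mu> u \<and>
             (r < (real CARD('n) + 2 * s) / (real CARD('n) - 2 * s) \<longrightarrow>
               (\<exists>v. weak_solution s q r \<Omega> lam \<mu> v \<and> \<not> (AE x in lebesgue. u x = v x))))))"
proof -
  have q: "0 < q" "q < 1" using assms by auto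
  have N: "real DIM(real ^ 'n) = real CARD('n)" by simp
  interpret hardy_domain s \<Omega>
    using assms exterior_ball_condition[of \<Omega>] by unfold_locales auto
  let ?C = "C_const TYPE(real ^ 'n) s"
  let ?S = "{ereal lam | lam. lam > 0 \<and> (\<exists>u. weak_solution_0 s q \<Omega> lam u)}"
  have C: "0 < ?C" using s by (rule C_const_pos)
  have low: "0 < lambda0 s q \<Omega>"
  proof -
    obtain c where c: "0 < c" "\<forall>lam u. 0 < lam \<longrightarrow> weak_solution_0 s q \<Omega> lam u \<longrightarrow> c \<le> lam"
      using weak_solution_0_parameter_bound[OF q] by blast
    have "ereal c \<le> lambda0 s q \<Omega>"
      unfolding lambda0_def by (rule Inf_greatest) (use c in auto)
    with c(1) show ?thesis by (simp add: less_le_trans[of 0 "ereal c"])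
  qed
  have fin: "lambda0 s q \<Omega> < \<infinity>"
  proof -
    from subsolution_exists[OF interior_ball_condition[OF assms(10,6,9)] q] obtain lam w where w: "0 < lam" "weak_sub q lam w"
      by (elim exE conjE) (rule that)
    \<comment> \<open>The solution is used at \<open>\<mu> = 0\<close>, which switches the
      additional power off; the exponent \<open>1\<close> is a placeholder.\<close>
    obtain \<mu>0 B where \<mu>0: "0 < \<mu>0" "\<forall>w \<mu>. weak_sub q lam w \<longrightarrow> 0 \<le> \<mu> \<longrightarrow> \<mu> < \<mu>0 \<longrightarrow>
        (\<exists>u. solves q 1 lam \<mu> u \<and> (AE x in lborel. w x \<le> u x) \<and> F u u \<le> B)"
      using first_solution[OF q w(1) zero_less_one] by (elim exE conjE) (rule that)
    then obtain v where v: "solves q 1 lam 0 v" "AE x in lborel. w x \<le> v x" using w(2) by blast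
    have "\<exists>u. weak_solution s q 1 \<Omega> (?C * lam) 0 u \<and> (AE x in lborel. u x = v x)"
      by (rule weak_solution_of_solves) (use v weak_subD(2)[OF w(2)] C in auto)
    then have "ereal (?C * lam) \<in> ?S" using C w(1) by (auto simp: weak_solution_mu_0)
    then have "lambda0 s q \<Omega> \<le> ereal (?C * lam)" unfolding lambda0_def by (rule Inf_lower)
    then show ?thesis by (rule le_less_trans) simp
  qed
  have main: "\<exists>\<mu>0>0. \<forall>\<mu>. 0 < \<mu> \<and> \<mu> < \<mu>0 \<longrightarrow>
          (\<exists>u. weak_solution s q r \<Omega> lam \<mu> u \<and>
             (r < (real CARD('n) + 2 * s) / (real CARD('n) - 2 * s) \<longrightarrow>
               (\<exists>v. weak_solution s q r \<Omega> lam \<mu> v \<and> \<not> (AE x in lebesgue. u x = v x))))"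
    if r: "1 < r" and lam: "lambda0 s q \<Omega> < ereal lam" for r lam
  proof -
    obtain lam1 u1 where u1: "0 < lam1" "lam1 < lam" "weak_solution_0 s q \<Omega> lam1 u1"
      using lam unfolding lambda0_def Inf_less_iff by auto
    obtain w where w: "weak_sub q (lam / ?C) w"
      using weak_sub_of_weak_solution_0[OF u1(3) q u1(1,2)] by blast
    have lC: "0 < lam / ?C" using u1 C by simp
    have r0: "0 < r" using r by simp
    have wpos: "\<forall>x\<in>\<Omega>. 0 < w x" using weak_subD(2)[OF w] by blast
    obtain \<mu>1 B where \<mu>1: "0 < \<mu>1" "\<forall>w \<mu>. weak_sub q (lam / ?C) w \<longrightarrow> 0 \<le> \<mu> \<longrightarrow> \<mu> < \<mu>1 \<longrightarrow>
        (\<exists>u. solves q r (lam / ?C) \<mu> u \<and> (AE x in lborel. w x \<le> u x) \<and> F u u \<le> B)"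
      using first_solution[OF q lC r0] by (elim exE conjE) (rule that)
    \<comment> \<open>\<open>B\<close> bounds the first solutions uniformly in \<open>\<mu>\<close>,
      so it can be prescribed as a lower energy bound for the second solution before
      \<open>\<mu>\<close> is chosen.\<close>
    have "\<exists>\<mu>2>0. r < (real CARD('n) + 2 * s) / (real CARD('n) - 2 * s) \<longrightarrow>
        (\<forall>\<mu>. 0 < \<mu> \<longrightarrow> \<mu> < \<mu>2 \<longrightarrow> (\<exists>v. solves q r (lam / ?C) \<mu> v \<and> (AE x in lborel. w x \<le> v x) \<and> B < F v v))"
    proof (cases "r < (real CARD('n) + 2 * s) / (real CARD('n) - 2 * s)")
      case True
      have "r + 1 < 2 * real DIM(real ^ 'n) / (real DIM(real ^ 'n) - 2 * s)"
        unfolding N using True assms(3) by (simp add: field_simps)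
      from second_solution[OF q lC r this w, of B] show ?thesis by blast
    qed (auto intro: exI[of _ 1])
    then obtain \<mu>2 where \<mu>2: "0 < \<mu>2" "r < (real CARD('n) + 2 * s) / (real CARD('n) - 2 * s) \<Longrightarrow>
        \<forall>\<mu>. 0 < \<mu> \<longrightarrow> \<mu> < \<mu>2 \<longrightarrow> (\<exists>v. solves q r (lam / ?C) \<mu> v \<and> (AE x in lborel. w x \<le> v x) \<and> B < F v v)"
      by blast
    \<comment> \<open>Both thresholds were obtained for the equation without the normalizing
      constant, hence the factor \<open>?C\<close> in the bound for \<open>\<mu>\<close>.\<close>
    have "\<exists>u. weak_solution s q r \<Omega> lam \<mu> u \<and>
             (r < (real CARD('n) + 2 * s) / (real CARD('n) - 2 * s) \<longrightarrow>
               (\<exists>v. weak_solution s q r \<Omega> lam \<mu> v \<and> \<not> (AE x in lebesgue. u x = v x)))"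
      if \<mu>: "0 < \<mu>" "\<mu> < ?C * min \<mu>1 \<mu>2" for \<mu>
    proof -
      have \<mu>C: "0 < \<mu> / ?C" "\<mu> / ?C < \<mu>1" "\<mu> / ?C < \<mu>2"
      proof -
        have "\<mu> / ?C < min \<mu>1 \<mu>2" using \<mu> C by (simp add: divide_less_eq mult.commute del: min_less_iff_conj)
        then show "0 < \<mu> / ?C" "\<mu> / ?C < \<mu>1" "\<mu> / ?C < \<mu>2" using \<mu> C by simp_all
      qed
      obtain u where u: "solves q r (lam / ?C) (\<mu> / ?C) u" "AE x in lborel. w x \<le> u x" "F u u \<le> B"
        using \<mu>1(2) w \<mu>C by (meson less_imp_le)
      obtain u' where u': "weak_solution s q r \<Omega> lam \<mu> u'" "AE x in lborel. u' x = u x"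
        using weak_solution_of_solves[OF u(1) wpos u(2)] by blast
      have "\<exists>v. weak_solution s q r \<Omega> lam \<mu> v \<and> \<not> (AE x in lebesgue. u' x = v x)"
        if sub: "r < (real CARD('n) + 2 * s) / (real CARD('n) - 2 * s)"
      proof -
        obtain v where v: "solves q r (lam / ?C) (\<mu> / ?C) v" "AE x in lborel. w x \<le> v x" "B < F v v"
          using \<mu>2(2)[OF sub] \<mu>C by blast
        obtain v' where v': "weak_solution s q r \<Omega> lam \<mu> v'" "AE x in lborel. v' x = v x"
          using weak_solution_of_solves[OF v(1) wpos v(2)] by blast
        have "\<not> (AE x in lebesgue. u' x = v' x)"
        proof
          assume "AE x in lebesgue. u' x = v' x"
          then have "AE x in lborel. u' x = v' x" by (simp add: AE_completion_iff)
          with u'(2) v'(2) have "AE x in lborel. u x = v x" by eventually_elim simp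
          then have "F u u = F v v" using u(1) v(1) by (intro form_cong_AE) (auto simp: solves_def)
          then show False using u(3) v(3) by simp
        qed
        then show ?thesis using v'(1) by blast
      qed
      then show ?thesis using u'(1) by blast
    qed
    moreover have "0 < ?C * min \<mu>1 \<mu>2" using C \<mu>1 \<mu>2 by simp
    ultimately show ?thesis by blast
  qed
  show ?thesis using low fin main by blast
qed

end
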